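(* Let $(\mathbf{C},\mathcal{M}_{\mathbf{C}})$ be a small geometric $\mathcal{M}$-category and let $(\mathbf{D},\mathcal{M}_{\mathbf{D}})$ be a cocomplete geometric $\mathcal{M}$-category. Then precomposition with $\mathbf{a}\mathbf{y}\colon(\mathbf{C},\mathcal{M}_{\mathbf{C}})\to\mathsf{Sh}_{\mathcal{M}}(\mathbf{C})$, $$(-)\circ\mathbf{a}\mathbf{y}\colon \mathbf{g}\mathcal{M}\mathbf{Cocomp}\big(\mathsf{Sh}_{\mathcal{M}}(\mathbf{C}),(\mathbf{D},\mathcal{M}_{\mathbf{D}})\big)\to\mathbf{g}\mathcal{M}\mathbf{Cat}\big((\mathbf{C},\mathcal{M}_{\mathbf{C}}),(\mathbf{D},\mathcal{M}_{\mathbf{D}})\big),$$ is an equivalence of categories.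
   Context: All categories are locally small unless stated otherwise; families are indexed by sets. Restriction categories. A restriction category is a category $\mathbf{X}$ with an assignment $f\mapsto \bar f$, $\mathbf{X}(A,B)\to\mathbf{X}(A,A)$, satisfying, for suitable maps, (R1) $f\bar f=f$; (R2) $\bar g\bar f=\bar f\bar g$; (R3) $\overline{g\bar f}=\bar g\bar f$; (R4) $\bar h f=f\,\overline{hf}$. Hom-sets are partially ordered by $f\le g$ iff $f=g\bar f$. Maps $f,g\in\mathbf{X}(A,B)$ are compatible if $f\bar g=g\bar f$; a set of parallel maps is compatible if its elements are pairwise compatible. A join restriction category is a restriction category in which every compatible set $S\subset\mathbf{X}(A,B)$ has a join $\bigvee_{s\in S}s$ in the poset $\mathbf{X}(A,B)$ satisfying (J1) $\overline{\bigvee_{s\in S}s}=\bigvee_{s\in S}\bar s$ and (J2) $(\bigvee_{s\in S}s)\circ g=\bigvee_{s\in S}(s\circ g)$. A restriction functor is a functor preserving $f\mapsto\bar f$; a join restriction functor is one that also preserves joins of compatible sets. $\mathcal{M}$-categories. An $\mathcal{M}$-category $(\mathbf{C},\mathcal{M})$ is a category $\mathbf{C}$ with a family $\mathcal{M}$ of monics containing all isomorphisms, closed under composition, and such that the pullback of any $m\in\mathcal{M}$ along any map exists and is in $\mathcal{M}$; it is assumed that the $\mathcal{M}$-subobjects of each object form a small poset $\mathsf{Sub}_{\mathcal{M}}(C)$. It is small if $\mathbf{C}$ is small. An $\mathcal{M}$-functor is a functor sending $\mathcal{M}$-maps to $\mathcal{M}$-maps and preserving pullbacks of $\mathcal{M}$-maps.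 A natural transformation between $\mathcal{M}$-functors is $\mathcal{M}$-cartesian if its naturality squares at maps in $\mathcal{M}$ are pullbacks. $\mathsf{Par}(\mathbf{C},\mathcal{M})$ has the objects of $\mathbf{C}$; its morphisms $A\to B$ are isomorphism classes of spans $(m,f)$ with $m\colon C\to A$ in $\mathcal{M}$ and $f\colon C\to B$, composed by pullback; it is a restriction category with $\overline{(m,f)}=(m,m)$. An $\mathcal{M}$-functor $F$ induces a restriction functor $\mathsf{Par}(F)\colon (m,f)\mapsto(Fm,Ff)$. $(\mathbf{C},\mathcal{M})$ is geometric if $\mathsf{Par}(\mathbf{C},\mathcal{M})$ is a join restriction category; an $\mathcal{M}$-functor $F$ between geometric $\mathcal{M}$-categories is geometric if $\mathsf{Par}(F)$ is a join restriction functor. $\mathbf{g}\mathcal{M}\mathbf{Cat}$ is the 2-category of geometric $\mathcal{M}$-categories, geometric $\mathcal{M}$-functors and $\mathcal{M}$-cartesian natural transformations. Cocompleteness. $(\mathbf{D},\mathcal{M})$ is cocomplete if $\mathbf{D}$ is cocomplete and the inclusion $\mathbf{D}\hookrightarrow\mathsf{Par}(\mathbf{D},\mathcal{M})$, $f\mapsto(1,f)$, preserves colimits. An $\mathcal{M}$-functor is cocontinuous if its underlying functor is. $\mathbf{g}\mathcal{M}\mathbf{Cocomp}$ is the 2-category of $\mathcal{M}$-categories that are both cocomplete and geometric, cocontinuous $\mathcal{M}$-functors and $\mathcal{M}$-cartesian natural transformations. Sheaves. For a small geometric $(\mathbf{C},\mathcal{M})$, the poset $\mathsf{Sub}_{\mathcal{M}}(C)$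 has all joins, and $\mathbf{C}$ carries the Grothendieck topology $J$ whose basic covers of $C$ are the families $\{a_i\colon C_i\to C\}_{i\in I}$ with $a_i\in\mathcal{M}$ and $\bigvee_{i\in I}a_i=1$ in $\mathsf{Sub}_{\mathcal{M}}(C)$. $\mathsf{Sh}(\mathbf{C})$ is the category of sheaves on $(\mathbf{C},J)$, $\mathbf{y}\colon\mathbf{C}\to\mathsf{PSh}(\mathbf{C})$ is the Yoneda embedding and $\mathbf{a}\colon\mathsf{PSh}(\mathbf{C})\to\mathsf{Sh}(\mathbf{C})$ the associated sheaf functor. $\mathsf{Sh}_{\mathcal{M}}(\mathbf{C})=(\mathsf{Sh}(\mathbf{C}),\mathcal{M}_{\mathsf{Sh}(\mathbf{C})})$ is the $\mathcal{M}$-category in which $\mu\colon P\to Q$ is in $\mathcal{M}_{\mathsf{Sh}(\mathbf{C})}$ iff for every $\alpha\colon\mathbf{a}\mathbf{y}D\to Q$ there is $m\colon C\to D$ in $\mathcal{M}$ such that $\mathbf{a}\mathbf{y}m\colon\mathbf{a}\mathbf{y}C\to\mathbf{a}\mathbf{y}D$ is a pullback of $\mu$ along $\alpha$. *)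

theory Defs
  imports Main "HOL-Library.FuncSet" "HOL-Library.Equipollence"
begin

section \<open>Size\<close>

text \<open>
  The type \<open>'u\<close> plays the role of the universe of sets: a collection of any type is
  a (small) set iff it has strictly smaller cardinality than \<open>'u\<close>. A universe is closed
  under power sets and under unions of set-indexed families of sets, that is, its
  cardinality is a regular strong limit cardinal. Countable \<open>'u\<close> is not excluded; the sets
  are then the finite ones. Types of larger cardinality hold the proper
  classes.
\<close>

definition small :: "'u itself \<Rightarrow> 'a set \<Rightarrow> bool" where
  "small _ X \<longleftrightarrow> X \<prec> (UNIV :: 'u set)"

definition universe :: "'u itself \<Rightarrow> bool" where
  "universe U \<longleftrightarrow>
     infinite (UNIV :: 'u set) \<and>
     (\<forall>X :: 'u set. small U X \<longrightarrow> small U (Pow X)) \<and>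
     (\<forall>(X :: 'u set) (Y :: 'u \<Rightarrow> 'u set).
        small U X \<and> (\<forall>x\<in>X. small U (Y x)) \<longrightarrow> small U (\<Union>x\<in>X. Y x))"


section \<open>Categories, functors, natural transformations\<close>

record ('o, 'a) cat =
  Ob :: "'o set"
  Ar :: "'a set"
  Dom :: "'a \<Rightarrow> 'o"
  Cod :: "'a \<Rightarrow> 'o"
  Idt :: "'o \<Rightarrow> 'a"
  Cmp :: "'a \<Rightarrow> 'a \<Rightarrow> 'a" (infixl "\<cdot>\<index>" 70)

definition Hom :: "('o, 'a) cat \<Rightarrow> 'o \<Rightarrow> 'o \<Rightarrow> 'a set" where
  "Hom C A B = {f \<in> Ar C. Dom C f = A \<and> Cod C f = B}"

locale category =
  fixes C :: "('o, 'a) cat" (structure)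
  assumes Dom_Ob: "f \<in> Ar C \<Longrightarrow> Dom C f \<in> Ob C"
    and Cod_Ob: "f \<in> Ar C \<Longrightarrow> Cod C f \<in> Ob C"
    and Idt_Hom: "A \<in> Ob C \<Longrightarrow> Idt C A \<in> Hom C A A"
    and Cmp_Hom: "f \<in> Hom C A B \<Longrightarrow> g \<in> Hom C B D \<Longrightarrow> g \<cdot> f \<in> Hom C A D"
    and Cmp_Idt: "f \<in> Ar C \<Longrightarrow> f \<cdot> Idt C (Dom C f) = f"
    and Idt_Cmp: "f \<in> Ar C \<Longrightarrow> Idt C (Cod C f) \<cdot> f = f"
    and Cmp_assoc: "f \<in> Hom C A B \<Longrightarrow> g \<in> Hom C B D \<Longrightarrow> h \<in> Hom C D E \<Longrightarrow>
                      h \<cdot> (g \<cdot> f) = (h \<cdot> g) \<cdot> f"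

definition locally_small :: "'u itself \<Rightarrow> ('o, 'a) cat \<Rightarrow> bool" where
  "locally_small U C \<longleftrightarrow> (\<forall>A\<in>Ob C. \<forall>B\<in>Ob C. small U (Hom C A B))"

definition small_category :: "'u itself \<Rightarrow> ('o, 'a) cat \<Rightarrow> bool" where
  "small_category U C \<longleftrightarrow> category C \<and> small U (Ob C) \<and> small U (Ar C)"

definition op_cat :: "('o, 'a) cat \<Rightarrow> ('o, 'a) cat" where
  "op_cat C = \<lparr>Ob = Ob C, Ar = Ar C, Dom = Cod C, Cod = Dom C, Idt = Idt C,
               Cmp = (\<lambda>g f. f \<cdot>\<^bsub>C\<^esub> g)\<rparr>"

definition is_mono :: "('o, 'a) cat \<Rightarrow> 'a \<Rightarrow> bool" where
  "is_mono C m \<longleftrightarrow> m \<in> Ar C \<and>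
     (\<forall>f\<in>Ar C. \<forall>g\<in>Ar C. Dom C f = Dom C g \<and> Cod C f = Dom C m \<and> Cod C g = Dom C m \<and>
        m \<cdot>\<^bsub>C\<^esub> f = m \<cdot>\<^bsub>C\<^esub> g \<longrightarrow> f = g)"

definition is_iso :: "('o, 'a) cat \<Rightarrow> 'a \<Rightarrow> bool" where
  "is_iso C f \<longleftrightarrow> f \<in> Ar C \<and>
     (\<exists>g\<in>Hom C (Cod C f) (Dom C f).
        g \<cdot>\<^bsub>C\<^esub> f = Idt C (Dom C f) \<and> f \<cdot>\<^bsub>C\<^esub> g = Idt C (Cod C f))"

text \<open>\<open>pullback C f g p q\<close>: the span \<open>(p, q)\<close> is a pullback of the cospan \<open>(f, g)\<close>,
  where \<open>p\<close> lies over the domain of \<open>f\<close> and \<open>q\<close> over the domain of \<open>g\<close>;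
  thus \<open>q\<close> is a pullback of \<open>f\<close> along \<open>g\<close>.\<close>

definition pullback :: "('o, 'a) cat \<Rightarrow> 'a \<Rightarrow> 'a \<Rightarrow> 'a \<Rightarrow> 'a \<Rightarrow> bool" where
  "pullback C f g p q \<longleftrightarrow>
     f \<in> Ar C \<and> g \<in> Ar C \<and> p \<in> Ar C \<and> q \<in> Ar C \<and>
     Cod C f = Cod C g \<and> Dom C p = Dom C q \<and> Cod C p = Dom C f \<and> Cod C q = Dom C g \<and>
     f \<cdot>\<^bsub>C\<^esub> p = g \<cdot>\<^bsub>C\<^esub> q \<and>
     (\<forall>h\<in>Ar C. \<forall>k\<in>Ar C.
        Dom C h = Dom C k \<and> Cod C h = Dom C f \<and> Cod C k = Dom C g \<and>
        f \<cdot>\<^bsub>C\<^esub> h = g \<cdot>\<^bsub>C\<^esub> k \<longrightarrow>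
        (\<exists>!u. u \<in> Hom C (Dom C h) (Dom C p) \<and> p \<cdot>\<^bsub>C\<^esub> u = h \<and> q \<cdot>\<^bsub>C\<^esub> u = k))"

text \<open>Functors and transformations are extensional (undefined outside the objects and arrows
  of their source), so that equality of functors is equality in HOL.\<close>

record ('o, 'a, 'p, 'b) ftor =
  FO :: "'o \<Rightarrow> 'p"
  FA :: "'a \<Rightarrow> 'b"

locale cat_functor = src: category C + tgt: category D
  for C :: "('o, 'a) cat" and D :: "('p, 'b) cat" +
  fixes F :: "('o, 'a, 'p, 'b) ftor"
  assumes FO_Ob: "FO F \<in> Ob C \<rightarrow>\<^sub>E Ob D"
    and FA_Ar: "FA F \<in> Ar C \<rightarrow>\<^sub>E Ar D"
    and FA_Dom: "f \<in> Ar C \<Longrightarrow> Dom D (FA F f) = FO F (Dom C f)"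
    and FA_Cod: "f \<in> Ar C \<Longrightarrow> Cod D (FA F f) = FO F (Cod C f)"
    and FA_Idt: "A \<in> Ob C \<Longrightarrow> FA F (Idt C A) = Idt D (FO F A)"
    and FA_Cmp: "f \<in> Ar C \<Longrightarrow> g \<in> Ar C \<Longrightarrow> Cod C f = Dom C g \<Longrightarrow>
                   FA F (g \<cdot>\<^bsub>C\<^esub> f) = FA F g \<cdot>\<^bsub>D\<^esub> FA F f"

definition id_functor :: "('o, 'a) cat \<Rightarrow> ('o, 'a, 'o, 'a) ftor" where
  "id_functor C = \<lparr>FO = (\<lambda>A\<in>Ob C. A), FA = (\<lambda>f\<in>Ar C. f)\<rparr>"

text \<open>\<open>comp_functor C G F\<close> is \<open>G \<circ> F\<close>, where \<open>C\<close> is the source category of \<open>F\<close>.\<close>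

definition comp_functor ::
  "('o, 'a) cat \<Rightarrow> ('p, 'b, 'q, 'c) ftor \<Rightarrow> ('o, 'a, 'p, 'b) ftor \<Rightarrow> ('o, 'a, 'q, 'c) ftor" where
  "comp_functor C G F =
     \<lparr>FO = (\<lambda>A\<in>Ob C. FO G (FO F A)), FA = (\<lambda>f\<in>Ar C. FA G (FA F f))\<rparr>"

record ('o, 'a, 'p, 'b) ntrans =
  Src :: "('o, 'a, 'p, 'b) ftor"
  Tgt :: "('o, 'a, 'p, 'b) ftor"
  component :: "'o \<Rightarrow> 'b"

definition nat_trans ::
  "('o, 'a) cat \<Rightarrow> ('p, 'b) cat \<Rightarrow> ('o, 'a, 'p, 'b) ntrans \<Rightarrow> bool" where
  "nat_trans C D t \<longleftrightarrow>
     cat_functor C D (Src t) \<and> cat_functor C D (Tgt t) \<and> component t \<in> extensional (Ob C) \<and>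
     (\<forall>A\<in>Ob C. component t A \<in> Hom D (FO (Src t) A) (FO (Tgt t) A)) \<and>
     (\<forall>f\<in>Ar C. component t (Cod C f) \<cdot>\<^bsub>D\<^esub> FA (Src t) f = FA (Tgt t) f \<cdot>\<^bsub>D\<^esub> component t (Dom C f))"

definition functor_cat ::
  "('o, 'a) cat \<Rightarrow> ('p, 'b) cat \<Rightarrow> (('o, 'a, 'p, 'b) ftor, ('o, 'a, 'p, 'b) ntrans) cat" where
  "functor_cat C D =
     \<lparr>Ob = {F. cat_functor C D F},
      Ar = {t. nat_trans C D t},
      Dom = Src,
      Cod = Tgt,
      Idt = (\<lambda>F. \<lparr>Src = F, Tgt = F, component = (\<lambda>A\<in>Ob C. Idt D (FO F A))\<rparr>),
      Cmp = (\<lambda>t s. \<lparr>Src = Src s, Tgt = Tgt t, component = (\<lambda>A\<in>Ob C. component t A \<cdot>\<^bsub>D\<^esub> component s A)\<rparr>)\<rparr>"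

definition subcategory :: "('o, 'a) cat \<Rightarrow> ('o \<Rightarrow> bool) \<Rightarrow> ('a \<Rightarrow> bool) \<Rightarrow> ('o, 'a) cat" where
  "subcategory C P Q =
     C\<lparr>Ob := {A \<in> Ob C. P A},
       Ar := {f \<in> Ar C. P (Dom C f) \<and> P (Cod C f) \<and> Q f}\<rparr>"

definition naturally_isomorphic ::
  "('o, 'a) cat \<Rightarrow> ('p, 'b) cat \<Rightarrow> ('o, 'a, 'p, 'b) ftor \<Rightarrow> ('o, 'a, 'p, 'b) ftor \<Rightarrow> bool" where
  "naturally_isomorphic C D F G \<longleftrightarrow>
     (\<exists>t. nat_trans C D t \<and> Src t = F \<and> Tgt t = G \<and> (\<forall>A\<in>Ob C. is_iso D (component t A)))"

definition equivalence_of_categories ::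
  "('o, 'a) cat \<Rightarrow> ('p, 'b) cat \<Rightarrow> ('o, 'a, 'p, 'b) ftor \<Rightarrow> bool" where
  "equivalence_of_categories C D F \<longleftrightarrow>
     cat_functor C D F \<and>
     (\<exists>G. cat_functor D C G \<and>
          naturally_isomorphic C C (id_functor C) (comp_functor C G F) \<and>
          naturally_isomorphic D D (comp_functor D F G) (id_functor D))"

definition left_adjoint ::
  "('o, 'a) cat \<Rightarrow> ('p, 'b) cat \<Rightarrow> ('o, 'a, 'p, 'b) ftor \<Rightarrow> ('p, 'b, 'o, 'a) ftor \<Rightarrow> bool" where
  "left_adjoint C D L R \<longleftrightarrow>
     cat_functor C D L \<and> cat_functor D C R \<and>
     (\<exists>e. nat_trans C C e \<and> Src e = id_functor C \<and> Tgt e = comp_functor C R L \<and>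
        (\<forall>A\<in>Ob C. \<forall>B\<in>Ob D. \<forall>f\<in>Hom C A (FO R B).
           \<exists>!g. g \<in> Hom D (FO L A) B \<and> FA R g \<cdot>\<^bsub>C\<^esub> component e A = f))"


section \<open>Colimits\<close>

definition cocone ::
  "('j, 'k) cat \<Rightarrow> ('o, 'a) cat \<Rightarrow> ('j, 'k, 'o, 'a) ftor \<Rightarrow> 'o \<Rightarrow> ('j \<Rightarrow> 'a) \<Rightarrow> bool" where
  "cocone J C F X c \<longleftrightarrow>
     X \<in> Ob C \<and> (\<forall>j\<in>Ob J. c j \<in> Hom C (FO F j) X) \<and>
     (\<forall>f\<in>Ar J. c (Cod J f) \<cdot>\<^bsub>C\<^esub> FA F f = c (Dom J f))"

definition colimit ::
  "('j, 'k) cat \<Rightarrow> ('o, 'a) cat \<Rightarrow> ('j, 'k, 'o, 'a) ftor \<Rightarrow> 'o \<Rightarrow> ('j \<Rightarrow> 'a) \<Rightarrow> bool" where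
  "colimit J C F X c \<longleftrightarrow>
     cocone J C F X c \<and>
     (\<forall>Y d. cocone J C F Y d \<longrightarrow> (\<exists>!u. u \<in> Hom C X Y \<and> (\<forall>j\<in>Ob J. u \<cdot>\<^bsub>C\<^esub> c j = d j)))"

text \<open>Every small category is isomorphic to one whose objects and arrows are elements of
  \<open>'u\<close>, so it suffices to consider index categories of this type.\<close>

definition cocomplete :: "'u itself \<Rightarrow> ('o, 'a) cat \<Rightarrow> bool" where
  "cocomplete U C \<longleftrightarrow>
     category C \<and>
     (\<forall>(J :: ('u, 'u) cat) F. small_category U J \<and> cat_functor J C F \<longrightarrow>
        (\<exists>X c. colimit J C F X c))"

definition preserves_colimits ::
  "'u itself \<Rightarrow> ('o, 'a) cat \<Rightarrow> ('p, 'b) cat \<Rightarrow> ('o, 'a, 'p, 'b) ftor \<Rightarrow> bool" where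
  "preserves_colimits U C D G \<longleftrightarrow>
     (\<forall>(J :: ('u, 'u) cat) F X c.
        small_category U J \<and> cat_functor J C F \<and> colimit J C F X c \<longrightarrow>
        colimit J D (comp_functor J G F) (FO G X) (\<lambda>j. FA G (c j)))"


section \<open>Restriction categories\<close>

locale restriction_category = category X for X :: "('o, 'a) cat" (structure) +
  fixes r :: "'a \<Rightarrow> 'a"
  assumes restr_Hom: "f \<in> Hom X A B \<Longrightarrow> r f \<in> Hom X A A"
    and R1: "f \<in> Ar X \<Longrightarrow> f \<cdot> r f = f"
    and R2: "f \<in> Ar X \<Longrightarrow> g \<in> Ar X \<Longrightarrow> Dom X f = Dom X g \<Longrightarrow> r g \<cdot> r f = r f \<cdot> r g"
    and R3: "f \<in> Ar X \<Longrightarrow> g \<in> Ar X \<Longrightarrow> Dom X f = Dom X g \<Longrightarrow> r (g \<cdot> r f) = r g \<cdot> r f"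
    and R4: "f \<in> Ar X \<Longrightarrow> h \<in> Ar X \<Longrightarrow> Cod X f = Dom X h \<Longrightarrow> r h \<cdot> f = f \<cdot> r (h \<cdot> f)"

definition restr_le :: "('o, 'a) cat \<Rightarrow> ('a \<Rightarrow> 'a) \<Rightarrow> 'a \<Rightarrow> 'a \<Rightarrow> bool" where
  "restr_le X r f g \<longleftrightarrow> f = g \<cdot>\<^bsub>X\<^esub> r f"

definition compatible_set ::
  "('o, 'a) cat \<Rightarrow> ('a \<Rightarrow> 'a) \<Rightarrow> 'o \<Rightarrow> 'o \<Rightarrow> 'a set \<Rightarrow> bool" where
  "compatible_set X r A B S \<longleftrightarrow>
     A \<in> Ob X \<and> B \<in> Ob X \<and> S \<subseteq> Hom X A B \<and> (\<forall>f\<in>S. \<forall>g\<in>S. f \<cdot>\<^bsub>X\<^esub> r g = g \<cdot>\<^bsub>X\<^esub> r f)"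

definition is_join ::
  "('o, 'a) cat \<Rightarrow> ('a \<Rightarrow> 'a) \<Rightarrow> 'o \<Rightarrow> 'o \<Rightarrow> 'a set \<Rightarrow> 'a \<Rightarrow> bool" where
  "is_join X r A B S j \<longleftrightarrow>
     j \<in> Hom X A B \<and> (\<forall>s\<in>S. restr_le X r s j) \<and>
     (\<forall>k\<in>Hom X A B. (\<forall>s\<in>S. restr_le X r s k) \<longrightarrow> restr_le X r j k)"

locale join_restriction_category = restriction_category +
  assumes join_exists: "compatible_set X r A B S \<Longrightarrow> \<exists>j. is_join X r A B S j"
    and J1: "compatible_set X r A B S \<Longrightarrow> is_join X r A B S j \<Longrightarrow> is_join X r A A (r ` S) (r j)"
    and J2: "compatible_set X r A B S \<Longrightarrow> is_join X r A B S j \<Longrightarrow> g \<in> Hom X D A \<Longrightarrow>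
               is_join X r D B ((\<lambda>s. s \<cdot> g) ` S) (j \<cdot> g)"

definition restriction_functor ::
  "('o, 'a) cat \<Rightarrow> ('a \<Rightarrow> 'a) \<Rightarrow> ('p, 'b) cat \<Rightarrow> ('b \<Rightarrow> 'b) \<Rightarrow> ('o, 'a, 'p, 'b) ftor \<Rightarrow> bool" where
  "restriction_functor X r Y s F \<longleftrightarrow>
     cat_functor X Y F \<and> (\<forall>f\<in>Ar X. FA F (r f) = s (FA F f))"

definition join_restriction_functor ::
  "('o, 'a) cat \<Rightarrow> ('a \<Rightarrow> 'a) \<Rightarrow> ('p, 'b) cat \<Rightarrow> ('b \<Rightarrow> 'b) \<Rightarrow> ('o, 'a, 'p, 'b) ftor \<Rightarrow> bool" where
  "join_restriction_functor X r Y s F \<longleftrightarrow>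
     restriction_functor X r Y s F \<and>
     (\<forall>A B S j. compatible_set X r A B S \<and> is_join X r A B S j \<longrightarrow>
        is_join Y s (FO F A) (FO F B) (FA F ` S) (FA F j))"


section \<open>M-categories\<close>

definition subobj_le :: "('o, 'a) cat \<Rightarrow> 'a \<Rightarrow> 'a \<Rightarrow> bool" where
  "subobj_le C m n \<longleftrightarrow> (\<exists>u\<in>Hom C (Dom C m) (Dom C n). n \<cdot>\<^bsub>C\<^esub> u = m)"

definition subobj_equiv :: "('o, 'a) cat \<Rightarrow> 'a set \<Rightarrow> 'o \<Rightarrow> ('a \<times> 'a) set" where
  "subobj_equiv C M A =
     {(m, n). m \<in> M \<and> n \<in> M \<and> Cod C m = A \<and> Cod C n = A \<and>
        (\<exists>u\<in>Hom C (Dom C m) (Dom C n). is_iso C u \<and> n \<cdot>\<^bsub>C\<^esub> u = m)}"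

definition mcategory :: "'u itself \<Rightarrow> ('o, 'a) cat \<Rightarrow> 'a set \<Rightarrow> bool" where
  "mcategory U C M \<longleftrightarrow>
     category C \<and> locally_small U C \<and>
     (\<forall>m\<in>M. is_mono C m) \<and>
     (\<forall>f. is_iso C f \<longrightarrow> f \<in> M) \<and>
     (\<forall>m\<in>M. \<forall>n\<in>M. Cod C m = Dom C n \<longrightarrow> n \<cdot>\<^bsub>C\<^esub> m \<in> M) \<and>
     (\<forall>m\<in>M. \<forall>f\<in>Ar C. Cod C f = Cod C m \<longrightarrow>
        (\<exists>p q. pullback C m f p q) \<and> (\<forall>p q. pullback C m f p q \<longrightarrow> q \<in> M)) \<and>
     (\<forall>A\<in>Ob C. small U ({m \<in> M. Cod C m = A} // subobj_equiv C M A))"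

definition mfunctor ::
  "('o, 'a) cat \<Rightarrow> 'a set \<Rightarrow> ('p, 'b) cat \<Rightarrow> 'b set \<Rightarrow> ('o, 'a, 'p, 'b) ftor \<Rightarrow> bool" where
  "mfunctor C M D N F \<longleftrightarrow>
     cat_functor C D F \<and> (\<forall>m\<in>M. FA F m \<in> N) \<and>
     (\<forall>m\<in>M. \<forall>f p q. pullback C m f p q \<longrightarrow> pullback D (FA F m) (FA F f) (FA F p) (FA F q))"

definition mcartesian ::
  "('o, 'a) cat \<Rightarrow> 'a set \<Rightarrow> ('p, 'b) cat \<Rightarrow> ('o, 'a, 'p, 'b) ntrans \<Rightarrow> bool" where
  "mcartesian C M D t \<longleftrightarrow>
     (\<forall>m\<in>M. pullback D (component t (Cod C m)) (FA (Tgt t) m) (FA (Src t) m) (component t (Dom C m)))"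


subsection \<open>Partial maps\<close>

definition spans :: "('o, 'a) cat \<Rightarrow> 'a set \<Rightarrow> ('a \<times> 'a) set" where
  "spans C M = {(m, f). m \<in> M \<and> f \<in> Ar C \<and> Dom C m = Dom C f}"

definition span_equiv :: "('o, 'a) cat \<Rightarrow> 'a set \<Rightarrow> (('a \<times> 'a) \<times> ('a \<times> 'a)) set" where
  "span_equiv C M =
     {((m, f), (n, g)). (m, f) \<in> spans C M \<and> (n, g) \<in> spans C M \<and>
        (\<exists>u\<in>Hom C (Dom C m) (Dom C n). is_iso C u \<and> n \<cdot>\<^bsub>C\<^esub> u = m \<and> g \<cdot>\<^bsub>C\<^esub> u = f)}"

text \<open>A partial map is an isomorphism class of spans. As pullbacks are determined only up to
  isomorphism, the set of all composites of representatives of \<open>S\<close> and \<open>T\<close>, formed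
  with all possible pullbacks, is already a full isomorphism class. Likewise, the set of all
  \<open>(m, m)\<close> with \<open>(m, f) \<in> S\<close> is a full isomorphism class.\<close>

definition Par :: "('o, 'a) cat \<Rightarrow> 'a set \<Rightarrow> ('o, ('a \<times> 'a) set) cat" where
  "Par C M =
     \<lparr>Ob = Ob C,
      Ar = spans C M // span_equiv C M,
      Dom = (\<lambda>S. THE A. \<exists>(m, f)\<in>S. A = Cod C m),
      Cod = (\<lambda>S. THE B. \<exists>(m, f)\<in>S. B = Cod C f),
      Idt = (\<lambda>A. span_equiv C M `` {(Idt C A, Idt C A)}),
      Cmp = (\<lambda>T S. {(m \<cdot>\<^bsub>C\<^esub> p, g \<cdot>\<^bsub>C\<^esub> q) | m f n g p q.
                      (m, f) \<in> S \<and> (n, g) \<in> T \<and> pullback C f n p q})\<rparr>"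

definition Par_restr :: "('a \<times> 'a) set \<Rightarrow> ('a \<times> 'a) set" where
  "Par_restr S = (\<lambda>(m, f). (m, m)) ` S"

definition Par_functor ::
  "('o, 'a) cat \<Rightarrow> 'a set \<Rightarrow> ('p, 'b) cat \<Rightarrow> 'b set \<Rightarrow> ('o, 'a, 'p, 'b) ftor \<Rightarrow>
     ('o, ('a \<times> 'a) set, 'p, ('b \<times> 'b) set) ftor" where
  "Par_functor C M D N F =
     \<lparr>FO = FO F,
      FA = (\<lambda>S\<in>Ar (Par C M). span_equiv D N `` ((\<lambda>(m, f). (FA F m, FA F f)) ` S))\<rparr>"

definition Par_inclusion ::
  "('o, 'a) cat \<Rightarrow> 'a set \<Rightarrow> ('o, 'a, 'o, ('a \<times> 'a) set) ftor" where
  "Par_inclusion C M =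
     \<lparr>FO = (\<lambda>A\<in>Ob C. A), FA = (\<lambda>f\<in>Ar C. span_equiv C M `` {(Idt C (Dom C f), f)})\<rparr>"

definition geometric :: "'u itself \<Rightarrow> ('o, 'a) cat \<Rightarrow> 'a set \<Rightarrow> bool" where
  "geometric U C M \<longleftrightarrow> mcategory U C M \<and> join_restriction_category (Par C M) Par_restr"

definition cocomplete_mcategory :: "'u itself \<Rightarrow> ('o, 'a) cat \<Rightarrow> 'a set \<Rightarrow> bool" where
  "cocomplete_mcategory U C M \<longleftrightarrow>
     mcategory U C M \<and> cocomplete U C \<and> preserves_colimits U C (Par C M) (Par_inclusion C M)"


subsection \<open>Hom-categories of the 2-categories of geometric M-categories\<close>

definition gMCat_1cell ::
  "'u itself \<Rightarrow> ('o, 'a) cat \<Rightarrow> 'a set \<Rightarrow> ('p, 'b) cat \<Rightarrow> 'b set \<Rightarrow> ('o, 'a, 'p, 'b) ftor \<Rightarrow> bool"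
  where
  "gMCat_1cell U C M D N F \<longleftrightarrow>
     geometric U C M \<and> geometric U D N \<and> mfunctor C M D N F \<and>
     join_restriction_functor (Par C M) Par_restr (Par D N) Par_restr (Par_functor C M D N F)"

definition gMCat_hom ::
  "'u itself \<Rightarrow> ('o, 'a) cat \<Rightarrow> 'a set \<Rightarrow> ('p, 'b) cat \<Rightarrow> 'b set \<Rightarrow>
     (('o, 'a, 'p, 'b) ftor, ('o, 'a, 'p, 'b) ntrans) cat" where
  "gMCat_hom U C M D N =
     subcategory (functor_cat C D) (gMCat_1cell U C M D N) (mcartesian C M D)"

definition gMCocomp_1cell ::
  "'u itself \<Rightarrow> ('o, 'a) cat \<Rightarrow> 'a set \<Rightarrow> ('p, 'b) cat \<Rightarrow> 'b set \<Rightarrow> ('o, 'a, 'p, 'b) ftor \<Rightarrow> bool"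
  where
  "gMCocomp_1cell U C M D N F \<longleftrightarrow>
     geometric U C M \<and> cocomplete_mcategory U C M \<and>
     geometric U D N \<and> cocomplete_mcategory U D N \<and>
     mfunctor C M D N F \<and> preserves_colimits U C D F"

definition gMCocomp_hom ::
  "'u itself \<Rightarrow> ('o, 'a) cat \<Rightarrow> 'a set \<Rightarrow> ('p, 'b) cat \<Rightarrow> 'b set \<Rightarrow>
     (('o, 'a, 'p, 'b) ftor, ('o, 'a, 'p, 'b) ntrans) cat" where
  "gMCocomp_hom U C M D N =
     subcategory (functor_cat C D) (gMCocomp_1cell U C M D N) (mcartesian C M D)"

text \<open>Precomposition with a functor \<open>H\<close> with source \<open>C\<close>, as a functor defined on a
  category \<open>X\<close> of functors out of the target of \<open>H\<close>; it acts on transformations by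
  whiskering.\<close>

definition precomposition ::
  "('o, 'a) cat \<Rightarrow> ('o, 'a, 'p, 'b) ftor \<Rightarrow>
     (('p, 'b, 'q, 'c) ftor, ('p, 'b, 'q, 'c) ntrans) cat \<Rightarrow>
     (('p, 'b, 'q, 'c) ftor, ('p, 'b, 'q, 'c) ntrans,
      ('o, 'a, 'q, 'c) ftor, ('o, 'a, 'q, 'c) ntrans) ftor" where
  "precomposition C H X =
     \<lparr>FO = (\<lambda>F\<in>Ob X. comp_functor C F H),
      FA = (\<lambda>t\<in>Ar X. \<lparr>Src = comp_functor C (Src t) H, Tgt = comp_functor C (Tgt t) H,
                      component = (\<lambda>A\<in>Ob C. component t (FO H A))\<rparr>)\<rparr>"


section \<open>Presheaves and sheaves\<close>

type_synonym 'u set_arrow = "'u set \<times> 'u set \<times> ('u \<Rightarrow> 'u)"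

definition Set_cat :: "('u set, 'u set_arrow) cat" where
  "Set_cat =
     \<lparr>Ob = {X. small TYPE('u) X},
      Ar = {(X, Y, f). small TYPE('u) X \<and> small TYPE('u) Y \<and> f \<in> X \<rightarrow>\<^sub>E Y},
      Dom = (\<lambda>(X, Y, f). X),
      Cod = (\<lambda>(X, Y, f). Y),
      Idt = (\<lambda>X. (X, X, \<lambda>x\<in>X. x)),
      Cmp = (\<lambda>(Y', Z, g) (X, Y, f). (X, Z, \<lambda>x\<in>X. g (f x)))\<rparr>"

type_synonym ('o, 'u) presheaf = "('o, 'u, 'u set, 'u set_arrow) ftor"
type_synonym ('o, 'u) presheaf_map = "('o, 'u, 'u set, 'u set_arrow) ntrans"

definition PSh :: "('o, 'u) cat \<Rightarrow> (('o, 'u) presheaf, ('o, 'u) presheaf_map) cat" where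
  "PSh C = functor_cat (op_cat C) Set_cat"

definition representable :: "('o, 'u) cat \<Rightarrow> 'o \<Rightarrow> ('o, 'u) presheaf" where
  "representable C A =
     \<lparr>FO = (\<lambda>B\<in>Ob C. Hom C B A),
      FA = (\<lambda>f\<in>Ar C. (Hom C (Cod C f) A, Hom C (Dom C f) A, \<lambda>h\<in>Hom C (Cod C f) A. h \<cdot>\<^bsub>C\<^esub> f))\<rparr>"

definition yoneda :: "('o, 'u) cat \<Rightarrow> ('o, 'u, ('o, 'u) presheaf, ('o, 'u) presheaf_map) ftor" where
  "yoneda C =
     \<lparr>FO = (\<lambda>A\<in>Ob C. representable C A),
      FA = (\<lambda>g\<in>Ar C. \<lparr>Src = representable C (Dom C g), Tgt = representable C (Cod C g),
              component = (\<lambda>B\<in>Ob C. (Hom C B (Dom C g), Hom C B (Cod C g),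
                                \<lambda>h\<in>Hom C B (Dom C g). g \<cdot>\<^bsub>C\<^esub> h))\<rparr>)\<rparr>"

definition restrict_along :: "('o, 'u) presheaf \<Rightarrow> 'u \<Rightarrow> 'u \<Rightarrow> 'u" where
  "restrict_along P f = snd (snd (FA P f))"

definition is_subobj_join :: "('o, 'a) cat \<Rightarrow> 'a set \<Rightarrow> 'o \<Rightarrow> 'a set \<Rightarrow> 'a \<Rightarrow> bool" where
  "is_subobj_join C M A R j \<longleftrightarrow>
     j \<in> M \<and> Cod C j = A \<and> (\<forall>a\<in>R. subobj_le C a j) \<and>
     (\<forall>n\<in>M. Cod C n = A \<and> (\<forall>a\<in>R. subobj_le C a n) \<longrightarrow> subobj_le C j n)"

definition basic_cover :: "('o, 'a) cat \<Rightarrow> 'a set \<Rightarrow> 'o \<Rightarrow> 'a set \<Rightarrow> bool" where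
  "basic_cover C M A R \<longleftrightarrow>
     R \<subseteq> {a \<in> M. Cod C a = A} \<and> is_subobj_join C M A R (Idt C A)"

definition sieve :: "('o, 'a) cat \<Rightarrow> 'o \<Rightarrow> 'a set \<Rightarrow> bool" where
  "sieve C A S \<longleftrightarrow>
     S \<subseteq> {f \<in> Ar C. Cod C f = A} \<and>
     (\<forall>f\<in>S. \<forall>g\<in>Ar C. Cod C g = Dom C f \<longrightarrow> f \<cdot>\<^bsub>C\<^esub> g \<in> S)"

definition covering_sieve :: "('o, 'a) cat \<Rightarrow> 'a set \<Rightarrow> 'o \<Rightarrow> 'a set \<Rightarrow> bool" where
  "covering_sieve C M A S \<longleftrightarrow> sieve C A S \<and> (\<exists>R. basic_cover C M A R \<and> R \<subseteq> S)"

definition matching_family ::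
  "('o, 'u) cat \<Rightarrow> ('o, 'u) presheaf \<Rightarrow> 'u set \<Rightarrow> ('u \<Rightarrow> 'u) \<Rightarrow> bool" where
  "matching_family C P S x \<longleftrightarrow>
     (\<forall>f\<in>S. x f \<in> FO P (Dom C f)) \<and>
     (\<forall>f\<in>S. \<forall>g\<in>Ar C. Cod C g = Dom C f \<longrightarrow> x (f \<cdot>\<^bsub>C\<^esub> g) = restrict_along P g (x f))"

definition is_sheaf :: "('o, 'u) cat \<Rightarrow> 'u set \<Rightarrow> ('o, 'u) presheaf \<Rightarrow> bool" where
  "is_sheaf C M P \<longleftrightarrow>
     P \<in> Ob (PSh C) \<and>
     (\<forall>A\<in>Ob C. \<forall>S x. covering_sieve C M A S \<and> matching_family C P S x \<longrightarrow>
        (\<exists>!a. a \<in> FO P A \<and> (\<forall>f\<in>S. restrict_along P f a = x f)))"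

definition Sh ::
  "('o, 'u) cat \<Rightarrow> 'u set \<Rightarrow> (('o, 'u) presheaf, ('o, 'u) presheaf_map) cat" where
  "Sh C M = subcategory (PSh C) (is_sheaf C M) (\<lambda>_. True)"

text \<open>The associated sheaf functor is some left adjoint of the inclusion of sheaves into
  presheaves, which is given by the identity on sheaves and their maps.\<close>

definition associated_sheaf ::
  "('o, 'u) cat \<Rightarrow> 'u set \<Rightarrow>
     (('o, 'u) presheaf, ('o, 'u) presheaf_map, ('o, 'u) presheaf, ('o, 'u) presheaf_map) ftor" where
  "associated_sheaf C M =
     (SOME L. left_adjoint (PSh C) (Sh C M) L (id_functor (Sh C M)))"

definition ay ::
  "('o, 'u) cat \<Rightarrow> 'u set \<Rightarrow> ('o, 'u, ('o, 'u) presheaf, ('o, 'u) presheaf_map) ftor" where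
  "ay C M = comp_functor C (associated_sheaf C M) (yoneda C)"

definition M_Sh :: "('o, 'u) cat \<Rightarrow> 'u set \<Rightarrow> ('o, 'u) presheaf_map set" where
  "M_Sh C M =
     {\<mu> \<in> Ar (Sh C M).
        \<forall>D\<in>Ob C. \<forall>\<alpha>\<in>Hom (Sh C M) (FO (ay C M) D) (Cod (Sh C M) \<mu>).
          \<exists>m\<in>M. Cod C m = D \<and> (\<exists>\<beta>. pullback (Sh C M) \<mu> \<alpha> \<beta> (FA (ay C M) m))}"

end

(*
 A geometric M-functor F : C -> D extends along ay to L, where L Q is the colimit of F over the
 category of elements of the sheaf Q; gluing makes F A, with the cocone F(m), a colimit over any
 covering family, so L is left adjoint to Y |-> D(F -, Y) and hence cocontinuous.  Every sheaf is
 the colimit of its points, so cocontinuous functors and transformations are determined by their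
 restriction along ay; this gives fullness, faithfulness and L . ay = F.

 A map of sheaves lies in M iff its pullback along each point of the codomain is represented by
 an M-subobject.  Partial maps into a sheaf Y are classified by the sheaf of partial sections
 of Y, so the inclusion of sheaves into their partial maps preserves colimits.  In D the
 same preservation lets one glue partial maps out of a colimit: the spans (F m, i p), one for
 each point of Q with pullback m of mu, glue to a partial map from L Q to L P, which shows
 that L mu is an M-map and that L preserves the pullbacks of mu along points.
*)
theory Submission
 imports Defs
begin

section \<open>Closure of the small sets under subsets, power sets and small sums\<close>

section \<open>Small sets\<close>

text \<open>Join preservation is reduced to covers: the join \<open>(j, h)\<close> of compatible
  spans is an upper bound whose domain is covered by the family, so an M-functor is geometric as
  soon as it sends basic covers to basic covers. This matters because a 1-cell between cocomplete
  M-categories is only asked to be cocontinuous; that its restriction preserves joins is derived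
  from \<open>ay A\<close> being a colimit over each covering sieve. The associated sheaf functor is
  an arbitrary left adjoint, so \<open>ay A\<close> is merely isomorphic to a representable and is
  used through a universal element \<open>ue A\<close>. The obstacle is that L, a left adjoint with
  no exactness known beforehand, need not obviously send \<open>\<mu>\<close> even to a monic.
  Gluing supplies only a span \<open>(n, h)\<close> with \<open>n\<close> in M; a section
  \<open>v\<close> of \<open>h\<close> is built from the points lying in the image of
  \<open>\<mu>\<close>, and \<open>n v = L \<mu>\<close> together with \<open>L \<mu> h = n\<close>
  makes \<open>h\<close> invertible. Sheafification and colimits of sheaves come from one
  construction, the free sheaf on a presheaf subject to identifications.\<close>

lemma small_lepoll: "Y \<lesssim> X ==> small U X ==> small U Y"
 unfolding small_def using lesspoll_trans1 by blast

lemma small_subset: "small U X ==> Y \<subseteq> X ==> small U Y"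
 using small_lepoll subset_imp_lepoll by blast

lemma small_image: "small U X ==> small U (f ` X)"
 using small_lepoll image_lepoll by blast

lemma small_inj_on: "inj_on f Y ==> f ` Y \<subseteq> X ==> small U X ==> small U Y"
 by (rule small_lepoll[of _ X]) (auto simp: lepoll_def)

text \<open>The universe axioms speak only of subsets of \<open>'u\<close>; this embedding
  transports them to small sets of any type.\<close>

lemma small_encoding:
 fixes X :: "'a set"
 assumes "small TYPE('u) X"
 shows "\<exists>f :: 'a \<Rightarrow> 'u. inj_on f X"
 using lesspoll_imp_lepoll[OF assms[unfolded small_def]] by (auto simp: lepoll_def)

context
 fixes U :: "'u itself"
 assumes univ: "universe U"
begin

lemma small_Pow:
 fixes X :: "'a set"
 assumes "small U X"
 shows "small U (Pow X)"
proof -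
 obtain f :: "'a \<Rightarrow> 'u" where f: "inj_on f X"
  using assms small_encoding small_def by metis
 have "small U (Pow (f ` X))"
  using univ small_image[OF assms, of f] unfolding universe_def by blast
 moreover have "inj_on ((`) f) (Pow X)" "(`) f ` Pow X \<subseteq> Pow (f ` X)"
  using inj_on_image_Pow[OF f] by auto
 ultimately show ?thesis by (rule small_inj_on[rotated 2])
qed

text \<open>Embedding the base and the fibres into \<open>'u\<close> and pairing by an injection
  turns the sum into part of a union of small sets indexed by a small subset of \<open>'u\<close>,
  which is the regularity axiom.\<close>

lemma small_Sigma:
 fixes X :: "'a set" and Y :: "'a \<Rightarrow> 'b set"
 assumes X: "small U X" and Y: "\<And>x. x \<in> X ==> small U (Y x)"
 shows "small U (Sigma X Y)"
proof -
 obtain f :: "'a \<Rightarrow> 'u" where f: "inj_on f X"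
  using X small_encoding small_def by metis
 have "\<exists>g :: 'b \<Rightarrow> 'u. inj_on g (Y x)" if "x \<in> X" for x
  using Y[OF that] small_encoding small_def by metis
 then obtain g :: "'a \<Rightarrow> 'b \<Rightarrow> 'u" where g: "\<And>x. x \<in> X ==> inj_on (g x) (Y x)"
  by metis
 have "infinite (UNIV :: 'u set)" using univ unfolding universe_def by simp
 then obtain p :: "'u \<times> 'u \<Rightarrow> 'u" where p: "inj p"
  using card_of_Times_same_infinite[of "UNIV :: 'u set"]
  by (metis UNIV_Times_UNIV bij_betw_imp_inj_on card_of_ordIso)
 \<comment> \<open>\<open>Z x'\<close> is the coded fibre over the point whose code is
   \<open>x'\<close>, so that the union is indexed by elements of \<open>'u\<close>.\<close>
 define Z where "Z x' = (\<lambda>y. p (x', g (inv_into X f x') y)) ` Y (inv_into X f x')" for x'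
 have "small U (f ` X)" using X small_image by blast
 moreover have "small U (Z x')" if "x' \<in> f ` X" for x'
  unfolding Z_def using Y small_image inv_into_into[OF that] by blast
 ultimately have "small U (\<Union>x'\<in>f ` X. Z x')"
  using univ unfolding universe_def by blast
 moreover have "inj_on (\<lambda>(x, y). p (f x, g x y)) (Sigma X Y)"
 proof (rule inj_onI)
  fix z z' assume z: "z \<in> Sigma X Y" "z' \<in> Sigma X Y"
   and eq: "(\<lambda>(x, y). p (f x, g x y)) z = (\<lambda>(x, y). p (f x, g x y)) z'"
  have "f (fst z) = f (fst z')" and snd: "g (fst z) (snd z) = g (fst z') (snd z')"
   using eq by (simp_all add: inj_eq[OF p] case_prod_unfold)
  hence "fst z = fst z'" using inj_onD[OF f] z by (metis mem_Sigma_iff prod.collapse)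
  moreover from this have "snd z = snd z'"
   using inj_onD[OF g] z snd by (metis mem_Sigma_iff prod.collapse)
  ultimately show "z = z'" by (simp add: prod_eq_iff)
 qed
 moreover have "(\<lambda>(x, y). p (f x, g x y)) ` Sigma X Y \<subseteq> (\<Union>x'\<in>f ` X. Z x')"
  using f by (auto simp: Z_def)
 ultimately show ?thesis by (rule small_inj_on[rotated 2])
qed

end

section \<open>Arrows, isomorphisms and monics\<close>

section \<open>Categories\<close>

abbreviation (input) Cmp_in ("_ \<cdot>[_] _" [70, 0, 71] 70) where "g \<cdot>[C] f \<equiv> Cmp C g f"

lemma Hom_iff: "f \<in> Hom C A B \<longleftrightarrow> f \<in> Ar C \<and> Dom C f = A \<and> Cod C f = B"
 by (simp add: Hom_def)

context category
begin

abbreviation dom :: "'a \<Rightarrow> 'o" where "dom \<equiv> Dom C"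
abbreviation cod :: "'a \<Rightarrow> 'o" where "cod \<equiv> Cod C"

lemma Dom_in [simp]: "f \<in> Ar C ==> dom f \<in> Ob C"
 and Cod_in [simp]: "f \<in> Ar C ==> cod f \<in> Ob C"
 by (simp_all add: Dom_Ob Cod_Ob)

lemma Idt_simps [simp]:
 assumes "A \<in> Ob C"
 shows "Idt C A \<in> Ar C" "dom (Idt C A) = A" "cod (Idt C A) = A"
 using Idt_Hom[OF assms] by (auto simp: Hom_iff)

lemma comp_simps [simp]:
 assumes "f \<in> Ar C" "g \<in> Ar C" "cod f = dom g"
 shows "g \<cdot> f \<in> Ar C" "dom (g \<cdot> f) = dom f" "cod (g \<cdot> f) = cod g"
 using Cmp_Hom[of f "dom f" "cod f" g "cod g"] assms by (auto simp: Hom_iff)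

lemma comp_assoc [simp]:
 assumes "f \<in> Ar C" "g \<in> Ar C" "h \<in> Ar C" "cod f = dom g" "cod g = dom h"
 shows "(h \<cdot> g) \<cdot> f = h \<cdot> (g \<cdot> f)"
 using Cmp_assoc[of f "dom f" "cod f" g "cod g" h "cod h"] assms by (auto simp: Hom_iff)

lemma comp_id [simp]: "f \<in> Ar C ==> dom f = A ==> f \<cdot> Idt C A = f"
 and id_comp [simp]: "f \<in> Ar C ==> cod f = B ==> Idt C B \<cdot> f = f"
 using Cmp_Idt Idt_Cmp by auto

text \<open>Simplification associates to the right, so an equation \<open>g f = k\<close> no longer
  matches inside \<open>g (f e)\<close>; this form makes it usable there.\<close>

lemma comp_reassoc:
 assumes "g \<cdot> f = k" "f \<in> Ar C" "g \<in> Ar C" "e \<in> Ar C" "cod f = dom g" "cod e = dom f"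
 shows "g \<cdot> (f \<cdot> e) = k \<cdot> e"
 using assms comp_assoc[of e f g] by auto

lemma mono_Ar [simp]: "is_mono C m ==> m \<in> Ar C"
 by (simp add: is_mono_def)

lemma mono_cancel:
 assumes "is_mono C m" "m \<cdot> f = m \<cdot> g" "f \<in> Ar C" "g \<in> Ar C" "dom f = dom g"
  "cod f = dom m" "cod g = dom m"
 shows "f = g"
 using assms unfolding is_mono_def by blast

lemma monoI:
 assumes "m \<in> Ar C"
  "\<And>f g. [|f \<in> Ar C; g \<in> Ar C; dom f = dom g; cod f = dom m; cod g = dom m;
       m \<cdot> f = m \<cdot> g|] ==> f = g"
 shows "is_mono C m"
 using assms unfolding is_mono_def by blast

lemma isoE:
 assumes "is_iso C f"
 obtains g where "f \<in> Ar C" "g \<in> Ar C" "dom g = cod f" "cod g = dom f"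
  "g \<cdot> f = Idt C (dom f)" "f \<cdot> g = Idt C (cod f)" "is_iso C g"
proof -
 obtain g where g: "f \<in> Ar C" "g \<in> Ar C" "dom g = cod f" "cod g = dom f"
  "g \<cdot> f = Idt C (dom f)" "f \<cdot> g = Idt C (cod f)"
  using assms by (auto simp: is_iso_def Hom_iff)
 moreover have "is_iso C g" using g by (auto simp: is_iso_def Hom_iff intro!: bexI[of _ f])
 ultimately show thesis using that by blast
qed

lemma isoI:
 assumes "f \<in> Ar C" "g \<in> Ar C" "dom g = cod f" "cod g = dom f"
  "g \<cdot> f = Idt C (dom f)" "f \<cdot> g = Idt C (cod f)"
 shows "is_iso C f"
 using assms by (auto simp: is_iso_def Hom_iff intro!: bexI[of _ g])

lemma iso_Ar [simp]: "is_iso C f ==> f \<in> Ar C"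
 by (simp add: is_iso_def)

lemma iso_id [simp]: "A \<in> Ob C ==> is_iso C (Idt C A)"
 by (rule isoI[of _ "Idt C A"]) auto

lemma iso_comp:
 assumes "is_iso C f" "is_iso C g" "cod f = dom g"
 shows "is_iso C (g \<cdot> f)"
proof -
 obtain f' where f': "f \<in> Ar C" "f' \<in> Ar C" "dom f' = cod f" "cod f' = dom f"
  "f' \<cdot> f = Idt C (dom f)" "f \<cdot> f' = Idt C (cod f)" using isoE[OF assms(1)] by metis
 obtain g' where g': "g \<in> Ar C" "g' \<in> Ar C" "dom g' = cod g" "cod g' = dom g"
  "g' \<cdot> g = Idt C (dom g)" "g \<cdot> g' = Idt C (cod g)" using isoE[OF assms(2)] by metis
 show ?thesis
  using f' g' assms(3) comp_reassoc[OF g'(5), of f] comp_reassoc[OF f'(6), of g']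
  by (intro isoI[of _ "f' \<cdot> g'"]) auto
qed

lemma iso_mono: "is_iso C f ==> is_mono C f"
proof (rule monoI)
 fix a b assume f: "is_iso C f" and ab: "a \<in> Ar C" "b \<in> Ar C" "dom a = dom b"
  "cod a = dom f" "cod b = dom f" "f \<cdot> a = f \<cdot> b"
 obtain g where g: "f \<in> Ar C" "g \<in> Ar C" "dom g = cod f" "cod g = dom f"
  "g \<cdot> f = Idt C (dom f)" using isoE[OF f] by metis
 have "a = (g \<cdot> f) \<cdot> a" using g(5) ab by simp
 also have "\<dots> = g \<cdot> (f \<cdot> b)" using g(1-4) ab by (subst comp_assoc) auto
 also have "\<dots> = (g \<cdot> f) \<cdot> b" using g(1-4) ab by (subst comp_assoc) auto
 also have "\<dots> = b" using g(5) ab by simp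
 finally show "a = b" .
qed auto

lemma split_mono_iso:
 assumes "is_mono C m" "s \<in> Ar C" "dom s = cod m" "cod s = dom m"
  "m \<cdot> s = Idt C (cod m)"
 shows "is_iso C m"
proof -
 have "s \<cdot> m = Idt C (dom m)"
  by (rule mono_cancel[OF assms(1)])
   (use assms comp_reassoc[OF assms(5), of m] in \<open>auto\<close>)
 thus ?thesis using assms by (intro isoI[of _ s]) auto
qed

lemma mono_cancel_right:
 assumes "is_mono C (n \<cdot> m)" "m \<in> Ar C" "n \<in> Ar C" "cod m = dom n"
 shows "is_mono C m"
proof (rule monoI)
 fix f g assume fg: "f \<in> Ar C" "g \<in> Ar C" "dom f = dom g" "cod f = dom m"
  "cod g = dom m" "m \<cdot> f = m \<cdot> g"
 show "f = g" by (rule mono_cancel[OF assms(1)]) (use fg assms in auto)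
qed fact

lemma mono_le_antisym:
 assumes "is_mono C m" "is_mono C n" "subobj_le C m n" "subobj_le C n m" "cod m = cod n"
 obtains u where "is_iso C u" "dom u = dom m" "cod u = dom n" "n \<cdot> u = m"
proof -
 obtain u where u: "u \<in> Ar C" "dom u = dom m" "cod u = dom n" "n \<cdot> u = m"
  using assms(3) by (auto simp: subobj_le_def Hom_iff)
 obtain v where v: "v \<in> Ar C" "dom v = dom n" "cod v = dom m" "m \<cdot> v = n"
  using assms(4) by (auto simp: subobj_le_def Hom_iff)
 have "u \<cdot> v = Idt C (cod u)"
  by (rule mono_cancel[OF assms(2)])
   (use u v assms in \<open>auto simp: comp_reassoc[OF u(4)]\<close>)
 moreover have "is_mono C u" using mono_cancel_right[of n u] u assms by auto
 ultimately have "is_iso C u" using u v by (intro split_mono_iso[of u v]) auto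
 thus thesis using that u by blast
qed

lemma subobj_equiv_iff:
 assumes "\<And>m. m \<in> M ==> is_mono C m"
 shows "(m, n) \<in> subobj_equiv C M A \<longleftrightarrow>
  m \<in> M \<and> n \<in> M \<and> cod m = A \<and> cod n = A \<and> subobj_le C m n \<and> subobj_le C n m"
proof
 assume e: "(m, n) \<in> subobj_equiv C M A"
 then obtain u where u: "is_iso C u" "dom u = dom m" "cod u = dom n" "n \<cdot> u = m"
  by (auto simp: subobj_equiv_def Hom_iff)
 obtain v where v: "u \<in> Ar C" "v \<in> Ar C" "dom v = cod u" "cod v = dom u" "u \<cdot> v = Idt C (cod u)"
  using isoE[OF u(1)] by metis
 have "m \<cdot> v = n" using v u comp_assoc[of v u n] e mono_Ar[OF assms, of n] by (auto simp: subobj_equiv_def)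
 thus "m \<in> M \<and> n \<in> M \<and> cod m = A \<and> cod n = A \<and> subobj_le C m n \<and> subobj_le C n m"
  using e u v unfolding subobj_equiv_def subobj_le_def by (auto simp: Hom_iff)
next
 assume m: "m \<in> M \<and> n \<in> M \<and> cod m = A \<and> cod n = A \<and> subobj_le C m n \<and> subobj_le C n m"
 then obtain u where "is_iso C u" "dom u = dom m" "cod u = dom n" "n \<cdot> u = m"
  using mono_le_antisym[of m n] assms by metis
 thus "(m, n) \<in> subobj_equiv C M A" using m by (auto simp: subobj_equiv_def Hom_iff)
qed

section \<open>Pasting of pullbacks and their behaviour under isomorphisms\<close>

subsection \<open>Pullbacks\<close>

lemma pullbackD:
 assumes "pullback C f g p q"
 shows "f \<in> Ar C" "g \<in> Ar C" "p \<in> Ar C" "q \<in> Ar C" "cod f = cod g" "dom p = dom q"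
  "cod p = dom f" "cod q = dom g" "f \<cdot> p = g \<cdot> q"
 using assms unfolding pullback_def by blast+

lemma pullback_lift:
 assumes "pullback C f g p q" "h \<in> Ar C" "k \<in> Ar C" "dom h = dom k" "cod h = dom f"
  "cod k = dom g" "f \<cdot> h = g \<cdot> k"
 obtains u where "u \<in> Ar C" "dom u = dom h" "cod u = dom p" "p \<cdot> u = h" "q \<cdot> u = k"
 using assms unfolding pullback_def Hom_iff by metis

lemma pullback_unique:
 assumes "pullback C f g p q" "p \<cdot> u = p \<cdot> v" "q \<cdot> u = q \<cdot> v" "u \<in> Ar C" "v \<in> Ar C"
  "dom u = dom v" "cod u = dom p" "cod v = dom p"
 shows "u = v"
proof -
 note D = pullbackD[OF assms(1)]
 have "f \<cdot> (p \<cdot> u) = g \<cdot> (q \<cdot> u)" using D assms comp_reassoc[OF D(9), of u] by auto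
 hence "\<exists>!w. w \<in> Hom C (dom (p \<cdot> u)) (dom p) \<and> p \<cdot> w = p \<cdot> u \<and> q \<cdot> w = q \<cdot> u"
 proof -
  have "\<forall>h\<in>Ar C. \<forall>k\<in>Ar C.
    dom h = dom k \<and> cod h = dom f \<and> cod k = dom g \<and> f \<cdot> h = g \<cdot> k \<longrightarrow>
    (\<exists>!u. u \<in> Hom C (dom h) (dom p) \<and> p \<cdot> u = h \<and> q \<cdot> u = k)"
   using assms(1) unfolding pullback_def by blast
  from this[rule_format, of "p \<cdot> u" "q \<cdot> u"] show ?thesis
   using D assms(4-) \<open>f \<cdot> (p \<cdot> u) = g \<cdot> (q \<cdot> u)\<close> by simp
 qed
 then obtain w where "\<And>y. y \<in> Hom C (dom (p \<cdot> u)) (dom p) \<and> p \<cdot> y = p \<cdot> u \<and> q \<cdot> y = q \<cdot> u ==> y = w"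
  by (elim ex1E) blast
 from this[of u] this[of v] show ?thesis using assms D by (simp add: Hom_iff)
qed

lemma pullbackI:
 assumes "f \<in> Ar C" "g \<in> Ar C" "p \<in> Ar C" "q \<in> Ar C" "cod f = cod g" "dom p = dom q"
  "cod p = dom f" "cod q = dom g" "f \<cdot> p = g \<cdot> q"
  "\<And>h k. [|h \<in> Ar C; k \<in> Ar C; dom h = dom k; cod h = dom f; cod k = dom g;
    f \<cdot> h = g \<cdot> k|] ==> \<exists>u\<in>Ar C. dom u = dom h \<and> cod u = dom p \<and> p \<cdot> u = h \<and> q \<cdot> u = k"
  "\<And>u v. [|u \<in> Ar C; v \<in> Ar C; dom u = dom v; cod u = dom p; cod v = dom p;
    p \<cdot> u = p \<cdot> v; q \<cdot> u = q \<cdot> v|] ==> u = v"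
 shows "pullback C f g p q"
 unfolding pullback_def
proof (intro conjI ballI impI)
 fix h k assume "h \<in> Ar C" "k \<in> Ar C"
  "dom h = dom k \<and> cod h = dom f \<and> cod k = dom g \<and> f \<cdot> h = g \<cdot> k"
 with assms(10)[of h k] obtain u where u: "u \<in> Ar C" "dom u = dom h" "cod u = dom p"
  "p \<cdot> u = h" "q \<cdot> u = k" by blast
 show "\<exists>!u. u \<in> Hom C (dom h) (dom p) \<and> p \<cdot> u = h \<and> q \<cdot> u = k"
 proof (rule ex1I[of _ u])
  fix v assume v: "v \<in> Hom C (dom h) (dom p) \<and> p \<cdot> v = h \<and> q \<cdot> v = k"
  show "v = u" by (rule assms(11)) (use u v in \<open>simp_all add: Hom_iff\<close>)
 qed (use u in \<open>auto simp: Hom_iff\<close>)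
qed (use assms in auto)

lemma pullbackI_mono:
 assumes "f \<in> Ar C" "g \<in> Ar C" "p \<in> Ar C" "is_mono C q" "cod f = cod g" "dom p = dom q"
  "cod p = dom f" "cod q = dom g" "f \<cdot> p = g \<cdot> q"
  "\<And>h k. [|h \<in> Ar C; k \<in> Ar C; dom h = dom k; cod h = dom f; cod k = dom g;
    f \<cdot> h = g \<cdot> k|] ==> \<exists>u\<in>Ar C. dom u = dom h \<and> cod u = dom p \<and> p \<cdot> u = h \<and> q \<cdot> u = k"
 shows "pullback C f g p q"
proof (rule pullbackI)
 fix u v assume uv: "u \<in> Ar C" "v \<in> Ar C" "dom u = dom v" "cod u = dom p"
  "cod v = dom p" "q \<cdot> u = q \<cdot> v"
 show "u = v" by (rule mono_cancel[OF assms(4)]) (use uv assms(1-9) in auto)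
qed (insert assms(1-9) mono_Ar[OF assms(4)], (assumption | (rule assms(10); assumption))+)

lemma pullback_sym: "pullback C f g p q ==> pullback C g f q p"
 unfolding pullback_def by (metis (no_types, lifting))

lemma pullback_iso_unique:
 assumes "pullback C f g p q" "pullback C f g p' q'"
 obtains u where "is_iso C u" "dom u = dom p'" "cod u = dom p" "p \<cdot> u = p'" "q \<cdot> u = q'"
proof -
 note D = pullbackD[OF assms(1)] and D' = pullbackD[OF assms(2)]
 obtain u where u: "u \<in> Ar C" "dom u = dom p'" "cod u = dom p" "p \<cdot> u = p'" "q \<cdot> u = q'"
  using pullback_lift[OF assms(1) D'(3,4)] D D' by metis
 obtain v where v: "v \<in> Ar C" "dom v = dom p" "cod v = dom p'" "p' \<cdot> v = p" "q' \<cdot> v = q"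
  using pullback_lift[OF assms(2) D(3,4)] D D' by metis
 have "u \<cdot> v = Idt C (cod u)"
  by (rule pullback_unique[OF assms(1)])
   (use u v D comp_reassoc[OF u(4), of v] comp_reassoc[OF u(5), of v] in simp_all)
 moreover have "v \<cdot> u = Idt C (dom u)"
  by (rule pullback_unique[OF assms(2)])
   (use u v D D' comp_reassoc[OF v(4), of u] comp_reassoc[OF v(5), of u] in simp_all)
 ultimately have "is_iso C u" using u v by (intro isoI[of _ v]) auto
 thus thesis using that u by blast
qed

lemma pullback_paste:
 assumes "pullback C m f p q" "pullback C q g r s"
 shows "pullback C m (f \<cdot> g) (p \<cdot> r) s"
proof -
 note D = pullbackD[OF assms(1)] and D' = pullbackD[OF assms(2)]
 show ?thesis
 proof (rule pullbackI)
  show "m \<cdot> (p \<cdot> r) = f \<cdot> g \<cdot> s" using D D' comp_reassoc[OF D(9), of r] by auto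
  fix h k assume hk: "h \<in> Ar C" "k \<in> Ar C" "dom h = dom k" "cod h = dom m"
   "cod k = dom (f \<cdot> g)" "m \<cdot> h = f \<cdot> g \<cdot> k"
  hence "m \<cdot> h = f \<cdot> (g \<cdot> k)" using D D' by auto
  then obtain u where u: "u \<in> Ar C" "dom u = dom h" "cod u = dom p" "p \<cdot> u = h"
   "q \<cdot> u = g \<cdot> k" using pullback_lift[OF assms(1), of h "g \<cdot> k"] hk D D' by auto
  obtain v where v: "v \<in> Ar C" "dom v = dom u" "cod v = dom r" "r \<cdot> v = u" "s \<cdot> v = k"
   using pullback_lift[OF assms(2), of u k] u hk D D' by auto
  show "\<exists>v\<in>Ar C. dom v = dom h \<and> cod v = dom (p \<cdot> r) \<and> p \<cdot> r \<cdot> v = h \<and> s \<cdot> v = k"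
   using u v D D' by (intro bexI[of _ v]) auto
 next
  fix a b assume ab: "a \<in> Ar C" "b \<in> Ar C" "dom a = dom b" "cod a = dom (p \<cdot> r)"
   "cod b = dom (p \<cdot> r)" "p \<cdot> r \<cdot> a = p \<cdot> r \<cdot> b" "s \<cdot> a = s \<cdot> b"
  have "r \<cdot> a = r \<cdot> b"
   by (rule pullback_unique[OF assms(1)])
   (use ab D D' comp_reassoc[OF D'(9), of a] comp_reassoc[OF D'(9), of b] in \<open>auto\<close>)
  thus "a = b" by (rule pullback_unique[OF assms(2)])
   (use ab D D' in \<open>auto\<close>)
 qed (use D D' in auto)
qed

text \<open>The cancelling half of the pasting lemma. The connecting map \<open>r\<close> is not
  given but induced by the first square, so its equation with \<open>t\<close> is returned along
  with it.\<close>

lemma pullback_cancel: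
 assumes "pullback C m f p q" "pullback C m (f \<cdot> g) t s" "g \<in> Ar C" "cod g = dom f"
 obtains r where "pullback C q g r s" "p \<cdot> r = t"
proof -
 note D = pullbackD[OF assms(1)] and D' = pullbackD[OF assms(2)]
 obtain r where r: "r \<in> Ar C" "dom r = dom t" "cod r = dom p" "p \<cdot> r = t" "q \<cdot> r = g \<cdot> s"
  using pullback_lift[OF assms(1), of t "g \<cdot> s"] D D' assms by auto
 have "pullback C q g r s"
 proof (rule pullbackI)
  fix h k assume hk: "h \<in> Ar C" "k \<in> Ar C" "dom h = dom k" "cod h = dom q"
   "cod k = dom g" "q \<cdot> h = g \<cdot> k"
  have "m \<cdot> (p \<cdot> h) = f \<cdot> g \<cdot> k" using hk D D' assms(3,4) comp_reassoc[OF D(9), of h] by auto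
  then obtain u where u: "u \<in> Ar C" "dom u = dom h" "cod u = dom t" "t \<cdot> u = p \<cdot> h"
   "s \<cdot> u = k" using pullback_lift[OF assms(2), of "p \<cdot> h" k] hk D D' assms(3,4) by auto
  have "r \<cdot> u = h"
   by (rule pullback_unique[OF assms(1)])
   (use u r hk D D' assms(3,4) comp_reassoc[OF r(4), of u] comp_reassoc[OF r(5), of u] in \<open>auto\<close>)
  thus "\<exists>u\<in>Ar C. dom u = dom h \<and> cod u = dom r \<and> r \<cdot> u = h \<and> s \<cdot> u = k"
   using u r by (intro bexI[of _ u]) auto
 next
  fix a b assume ab: "a \<in> Ar C" "b \<in> Ar C" "dom a = dom b" "cod a = dom r"
   "cod b = dom r" "r \<cdot> a = r \<cdot> b" "s \<cdot> a = s \<cdot> b"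
  show "a = b"
   by (rule pullback_unique[OF assms(2)])
   (use ab r D D' comp_reassoc[OF r(4), of a] comp_reassoc[OF r(4), of b] in \<open>auto\<close>)
 qed (use D D' r assms in auto)
 thus thesis using that r by blast
qed

lemma pullback_id_right:
 "f \<in> Ar C ==> cod f = B ==> dom f = A ==> pullback C f (Idt C B) (Idt C A) f"
 by (rule pullbackI) auto

lemma pullback_id_left:
 "f \<in> Ar C ==> cod f = B ==> dom f = A ==> pullback C (Idt C B) f f (Idt C A)"
 by (rule pullbackI) auto

text \<open>A monic pulled back along a map that factors through it becomes an identity. In this
  form an inequality between subobjects or spans is turned into a pullback that can be used for
  composing partial maps.\<close>

lemma pullback_mono_factor:
 "is_mono C m ==> n \<in> Ar C ==> cod n = dom m ==> pullback C m (m \<cdot> n) n (Idt C (dom n))"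
proof (rule pullbackI)
 fix h k assume m: "is_mono C m" "n \<in> Ar C" "cod n = dom m" and
  "h \<in> Ar C" "k \<in> Ar C" "dom h = dom k" "cod h = dom m"
  "cod k = dom (m \<cdot> n)" "m \<cdot> h = m \<cdot> n \<cdot> k"
 hence "h = n \<cdot> k" and "cod k = dom n" by (auto intro: mono_cancel[OF m(1)])
 thus "\<exists>u\<in>Ar C. dom u = dom h \<and> cod u = dom n \<and> n \<cdot> u = h \<and> Idt C (dom n) \<cdot> u = k"
  using m \<open>k \<in> Ar C\<close> by (intro bexI[of _ k]) auto
qed auto

lemma pullback_mono_self: "is_mono C m ==> pullback C m m (Idt C (dom m)) (Idt C (dom m))"
 using pullback_mono_factor[of m "Idt C (dom m)"] by auto

lemma pullback_isos:
 assumes "is_iso C f" "is_iso C q" "g \<in> Ar C" "p \<in> Ar C" "cod f = cod g" "dom p = dom q"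
  "cod p = dom f" "cod q = dom g" "f \<cdot> p = g \<cdot> q"
 shows "pullback C f g p q"
proof (rule pullbackI_mono)
 show "is_mono C q" using assms iso_mono by blast
 obtain r where r: "q \<in> Ar C" "r \<in> Ar C" "dom r = cod q" "cod r = dom q"
  "r \<cdot> q = Idt C (dom q)" "q \<cdot> r = Idt C (cod q)" using isoE[OF assms(2)] by metis
 fix h k assume hk: "h \<in> Ar C" "k \<in> Ar C" "dom h = dom k" "cod h = dom f"
   "cod k = dom g" "f \<cdot> h = g \<cdot> k"
 have "f \<cdot> (p \<cdot> (r \<cdot> k)) = g \<cdot> k"
  using comp_reassoc[OF assms(9), of "r \<cdot> k"] comp_reassoc[OF r(6), of k] hk r assms by auto
 hence "p \<cdot> (r \<cdot> k) = h"
  using mono_cancel[OF iso_mono[OF assms(1)], of "p \<cdot> (r \<cdot> k)" h] hk r assms by auto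
 thus "\<exists>u\<in>Ar C. dom u = dom h \<and> cod u = dom p \<and> p \<cdot> u = h \<and> q \<cdot> u = k"
  using hk r assms comp_reassoc[OF r(6), of k] by (intro bexI[of _ "r \<cdot> k"]) auto
qed (use assms in auto)

lemma pullback_iso_comp:
 assumes "pullback C f g p q" "is_iso C u" "cod u = dom p"
 shows "pullback C f g (p \<cdot> u) (q \<cdot> u)"
proof -
 note D = pullbackD[OF assms(1)]
 have "pullback C (Idt C (cod q)) q (q \<cdot> u) u" by (rule pullback_isos) (use D assms(2,3) in auto)
 from pullback_paste[OF assms(1) pullback_sym[OF this]] show ?thesis using D by simp
qed

text \<open>Moves an isomorphism from the cospan into the projection. It compares representatives of
  a partial map, and it finally replaces the glued M-map \<open>n\<close> by \<open>L \<mu>\<close>,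
  where \<open>n = L \<mu> h\<close> with \<open>h\<close> invertible.\<close>

lemma pullback_iso_change:
 assumes "pullback C (f \<cdot> u) g p q" "is_iso C u" "f \<in> Ar C" "cod u = dom f"
 shows "pullback C f g (u \<cdot> p) q"
proof -
 note D = pullbackD[OF assms(1)]
 obtain v where v: "v \<in> Ar C" "dom v = cod u" "cod v = dom u" "v \<cdot> u = Idt C (dom u)" "u \<cdot> v = Idt C (cod u)" "is_iso C v"
  using isoE[OF assms(2)] by metis
 have "pullback C v p (u \<cdot> p) (Idt C (dom p))"
  by (rule pullback_isos) (use D v assms(2-4) comp_reassoc[OF v(4), of p] in auto)
 from pullback_paste[OF pullback_sym[OF assms(1)] pullback_sym[OF this]] show ?thesis
  using D v assms(2-4) by (simp add: pullback_sym)
qed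

end

subsection \<open>Functors and natural transformations\<close>

context cat_functor
begin

lemma FO_in [simp]: "A \<in> Ob C ==> FO F A \<in> Ob D"
 and FA_in [simp]: "f \<in> Ar C ==> FA F f \<in> Ar D"
 using FO_Ob FA_Ar by auto

lemma FA_simps [simp]:
 "f \<in> Ar C ==> Dom D (FA F f) = FO F (Dom C f)"
 "f \<in> Ar C ==> Cod D (FA F f) = FO F (Cod C f)"
 "A \<in> Ob C ==> FA F (Idt C A) = Idt D (FO F A)"
 by (simp_all add: FA_Dom FA_Cod FA_Idt)

lemma FA_comp: "f \<in> Ar C ==> g \<in> Ar C ==> Cod C f = Dom C g ==>
  FA F (g \<cdot>[C] f) = FA F g \<cdot>[D] FA F f"
 by (rule FA_Cmp)

lemma FA_iso:
 assumes "is_iso C f" shows "is_iso D (FA F f)"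
proof -
 obtain g where g: "f \<in> Ar C" "g \<in> Ar C" "Dom C g = Cod C f" "Cod C g = Dom C f"
  "g \<cdot>[C] f = Idt C (Dom C f)" "f \<cdot>[C] g = Idt C (Cod C f)"
  using src.isoE[OF assms] by metis
 have "FA F g \<cdot>[D] FA F f = FA F (g \<cdot>[C] f)" "FA F f \<cdot>[D] FA F g = FA F (f \<cdot>[C] g)"
  using g by (auto simp: FA_comp[symmetric])
 thus ?thesis using g by (intro tgt.isoI[of _ "FA F g"]) auto
qed

end

lemma cat_functorI:
 assumes "category C" "category D"
  "\<And>A. A \<in> Ob C ==> FO F A \<in> Ob D" "FO F \<in> extensional (Ob C)"
  "\<And>f. f \<in> Ar C ==> FA F f \<in> Ar D" "FA F \<in> extensional (Ar C)"
  "\<And>f. f \<in> Ar C ==> Dom D (FA F f) = FO F (Dom C f)"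
  "\<And>f. f \<in> Ar C ==> Cod D (FA F f) = FO F (Cod C f)"
  "\<And>A. A \<in> Ob C ==> FA F (Idt C A) = Idt D (FO F A)"
  "\<And>f g. f \<in> Ar C ==> g \<in> Ar C ==> Cod C f = Dom C g ==>
    FA F (g \<cdot>[C] f) = FA F g \<cdot>[D] FA F f"
 shows "cat_functor C D F"
 using assms by (auto simp: cat_functor_def cat_functor_axioms_def PiE_def)

lemma id_functor_simps [simp]:
 "A \<in> Ob C ==> FO (id_functor C) A = A" "f \<in> Ar C ==> FA (id_functor C) f = f"
 by (simp_all add: id_functor_def)

lemma comp_functor_simps [simp]:
 "A \<in> Ob C ==> FO (comp_functor C G F) A = FO G (FO F A)"
 "f \<in> Ar C ==> FA (comp_functor C G F) f = FA G (FA F f)"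
 by (simp_all add: comp_functor_def)

lemma comp_functor_ext [simp]:
 "FO (comp_functor C G F) \<in> extensional (Ob C)" "FA (comp_functor C G F) \<in> extensional (Ar C)"
 by (simp_all add: comp_functor_def)

lemma cat_functor_id: "category C ==> cat_functor C C (id_functor C)"
 using category.comp_simps[of C] category.Idt_simps[of C]
  category.Dom_in[of C] category.Cod_in[of C]
 by (intro cat_functorI) (auto simp: id_functor_def)

lemma cat_functor_comp:
 assumes "cat_functor C D F" "cat_functor D E G"
 shows "cat_functor C E (comp_functor C G F)"
proof -
 interpret F: cat_functor C D F by fact
 interpret G: cat_functor D E G by fact
 show ?thesis by (rule cat_functorI) (auto simp: F.FA_comp G.FA_comp F.src.category_axioms G.tgt.category_axioms)
qed

lemma nat_transI:
 assumes "cat_functor C D (Src t)" "cat_functor C D (Tgt t)" "component t \<in> extensional (Ob C)"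
  "\<And>A. A \<in> Ob C ==> component t A \<in> Ar D"
  "\<And>A. A \<in> Ob C ==> Dom D (component t A) = FO (Src t) A"
  "\<And>A. A \<in> Ob C ==> Cod D (component t A) = FO (Tgt t) A"
  "\<And>f. f \<in> Ar C ==>
   component t (Cod C f) \<cdot>[D] FA (Src t) f = FA (Tgt t) f \<cdot>[D] component t (Dom C f)"
 shows "nat_trans C D t"
 using assms unfolding nat_trans_def Hom_iff by blast

lemma nat_transD:
 assumes "nat_trans C D t"
 shows "cat_functor C D (Src t)" "cat_functor C D (Tgt t)" "component t \<in> extensional (Ob C)"
  "\<And>A. A \<in> Ob C ==> component t A \<in> Ar D"
  "\<And>A. A \<in> Ob C ==> Dom D (component t A) = FO (Src t) A"
  "\<And>A. A \<in> Ob C ==> Cod D (component t A) = FO (Tgt t) A"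
  "\<And>f. f \<in> Ar C ==>
   component t (Cod C f) \<cdot>[D] FA (Src t) f = FA (Tgt t) f \<cdot>[D] component t (Dom C f)"
 using assms unfolding nat_trans_def Hom_iff by blast+

lemma nat_trans_eqI:
 assumes "nat_trans C D s" "nat_trans C D t" "Src s = Src t" "Tgt s = Tgt t"
  "\<And>A. A \<in> Ob C ==> component s A = component t A"
 shows "s = t"
proof -
 have "component s = component t"
  using extensionalityI nat_transD(3)[OF assms(1)] nat_transD(3)[OF assms(2)] assms(5) by blast
 thus ?thesis using assms by simp
qed

lemma nat_trans_comp:
 assumes "nat_trans C D s" "nat_trans C D t" "Tgt s = Src t"
 shows "nat_trans C D \<lparr>Src = Src s, Tgt = Tgt t,
      component = (\<lambda>A\<in>Ob C. component t A \<cdot>[D] component s A)\<rparr>"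
proof -
 note S = nat_transD[OF assms(1)] and T = nat_transD[OF assms(2)]
 interpret F: cat_functor C D "Src s" by (rule S)
 interpret G: cat_functor C D "Src t" by (rule T)
 interpret H: cat_functor C D "Tgt t" by (rule T)
 show ?thesis
 proof (rule nat_transI, goal_cases)
  case (7 f)
  have "(component t (Cod C f) \<cdot>[D] component s (Cod C f)) \<cdot>[D] FA (Src s) f
    = component t (Cod C f) \<cdot>[D] (FA (Src t) f \<cdot>[D] component s (Dom C f))"
   using 7 S(4-6) T(4-6) S(7)[of f] assms(3) by auto
  also have "\<dots> = (FA (Tgt t) f \<cdot>[D] component t (Dom C f)) \<cdot>[D] component s (Dom C f)"
   using 7 S(4-6) T(4-6) assms(3) F.tgt.comp_reassoc[OF T(7)[of f]] by auto
  also have "\<dots> = FA (Tgt t) f \<cdot>[D] (component t (Dom C f) \<cdot>[D] component s (Dom C f))"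
   using 7 S(4-6) T(4-6) assms(3) by auto
  finally show ?case using 7 by simp
 qed (use S(1-6) T(1-6) assms(3) in auto)
qed

lemma nat_trans_id:
 assumes "cat_functor C D F"
 shows "nat_trans C D \<lparr>Src = F, Tgt = F, component = (\<lambda>A\<in>Ob C. Idt D (FO F A))\<rparr>"
proof -
 interpret F: cat_functor C D F by fact
 show ?thesis by (rule nat_transI) (auto simp: assms)
qed

lemma category_functor_cat:
 assumes "category D"
 shows "category (functor_cat C D)"
proof -
 interpret D: category D by fact
 show ?thesis
 proof (unfold_locales, goal_cases)
  case (5 t)
  hence t: "nat_trans C D t" by (simp add: functor_cat_def)
  note i = nat_trans_id[OF nat_transD(1)[OF t]]
  have "nat_trans C D \<lparr>Src = Src t, Tgt = Tgt t,
    component = (\<lambda>A\<in>Ob C. component t A \<cdot>[D] (\<lambda>A\<in>Ob C. Idt D (FO (Src t) A)) A)\<rparr>"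
   using nat_trans_comp[OF i t] by (simp cong: restrict_cong)
  hence "\<lparr>Src = Src t, Tgt = Tgt t,
    component = (\<lambda>A\<in>Ob C. component t A \<cdot>[D] (\<lambda>A\<in>Ob C. Idt D (FO (Src t) A)) A)\<rparr> = t"
   by (rule nat_trans_eqI) (use t nat_transD(4,5)[OF t] in simp_all)
  thus ?case by (simp add: functor_cat_def cong: restrict_cong)
 next
  case (6 t)
  hence t: "nat_trans C D t" by (simp add: functor_cat_def)
  note i = nat_trans_id[OF nat_transD(2)[OF t]]
  have "nat_trans C D \<lparr>Src = Src t, Tgt = Tgt t,
    component = (\<lambda>A\<in>Ob C. (\<lambda>A\<in>Ob C. Idt D (FO (Tgt t) A)) A \<cdot>[D] component t A)\<rparr>"
   using nat_trans_comp[OF t i] by (simp cong: restrict_cong)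
  hence "\<lparr>Src = Src t, Tgt = Tgt t,
    component = (\<lambda>A\<in>Ob C. (\<lambda>A\<in>Ob C. Idt D (FO (Tgt t) A)) A \<cdot>[D] component t A)\<rparr> = t"
   by (rule nat_trans_eqI) (use t nat_transD(4,6)[OF t] in simp_all)
  thus ?case by (simp add: functor_cat_def cong: restrict_cong)
 next
  case (7 s A B t D' r E)
  hence st: "nat_trans C D s" "nat_trans C D t" "nat_trans C D r"
   "Tgt s = Src t" "Tgt t = Src r" by (auto simp: Hom_iff functor_cat_def)
  note S = nat_transD[OF st(1)] and T = nat_transD[OF st(2)] and R = nat_transD[OF st(3)]
  have "component r A \<cdot>[D] (component t A \<cdot>[D] component s A)
    = (component r A \<cdot>[D] component t A) \<cdot>[D] component s A" if "A \<in> Ob C" for A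
   using that S(4-6) T(4-6) R(4-6) st(4,5) D.comp_assoc by auto
  thus ?case using st by (auto simp: functor_cat_def cong: restrict_cong)
 qed (auto simp: Hom_iff functor_cat_def nat_transD nat_trans_comp nat_trans_id)
qed

lemma category_subcategory:
 assumes "category C"
  and "\<And>A. A \<in> Ob C ==> P A ==> Q (Idt C A)"
  and "\<And>f g. [|f \<in> Ar C; g \<in> Ar C; Cod C f = Dom C g; P (Dom C f); P (Cod C f); P (Cod C g);
      Q f; Q g|] ==> Q (g \<cdot>[C] f)"
 shows "category (subcategory C P Q)"
proof -
 interpret category C by fact
 show ?thesis using assms(2,3)
  by unfold_locales (auto simp: Hom_iff subcategory_def)
qed

lemma subcategory_simps [simp]:
 "Ob (subcategory C P Q) = {A \<in> Ob C. P A}"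
 "f \<in> Ar (subcategory C P Q) \<longleftrightarrow> f \<in> Ar C \<and> P (Dom C f) \<and> P (Cod C f) \<and> Q f"
 "Dom (subcategory C P Q) = Dom C" "Cod (subcategory C P Q) = Cod C"
 "Idt (subcategory C P Q) = Idt C" "Cmp (subcategory C P Q) = Cmp C"
 by (auto simp: subcategory_def)

lemma functor_cat_simps [simp]:
 "F \<in> Ob (functor_cat C D) \<longleftrightarrow> cat_functor C D F"
 "t \<in> Ar (functor_cat C D) \<longleftrightarrow> nat_trans C D t"
 "Dom (functor_cat C D) = Src" "Cod (functor_cat C D) = Tgt"
 "component (Idt (functor_cat C D) F) = (\<lambda>A\<in>Ob C. Idt D (FO F A))"
 "component (t \<cdot>[functor_cat C D] s) = (\<lambda>A\<in>Ob C. component t A \<cdot>[D] component s A)"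
 "Src (Idt (functor_cat C D) F) = F" "Tgt (Idt (functor_cat C D) F) = F"
 "Src (t \<cdot>[functor_cat C D] s) = Src s" "Tgt (t \<cdot>[functor_cat C D] s) = Tgt t"
 by (auto simp: functor_cat_def)

subsection \<open>Equivalences\<close>

text \<open>The inverse sends \<open>g\<close> to the unique lift of its conjugate
  \<open>i g e\<close> through the bijections on hom-sets. Every law for it is verified after
  applying \<open>F\<close>, which is faithful.\<close>

lemma equivalenceI:
 assumes F: "cat_functor C D F"
  and ff: "\<And>A B g. A \<in> Ob C ==> B \<in> Ob C ==> g \<in> Hom D (FO F A) (FO F B) ==>
   \<exists>!f. f \<in> Hom C A B \<and> FA F f = g"
  and eso: "\<And>B. B \<in> Ob D ==> \<exists>A\<in>Ob C. \<exists>i\<in>Hom D (FO F A) B. is_iso D i"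
 shows "equivalence_of_categories C D F"
proof -
 interpret F: cat_functor C D F by fact
 have "\<forall>B\<in>Ob D. \<exists>A i. A \<in> Ob C \<and> i \<in> Hom D (FO F A) B \<and> is_iso D i" using eso by blast
 then obtain G0 e where G0: "\<And>B. B \<in> Ob D ==> G0 B \<in> Ob C"
  and e0: "\<And>B. B \<in> Ob D ==> e B \<in> Hom D (FO F (G0 B)) B \<and> is_iso D (e B)"
  by metis
 have e: "e B \<in> Ar D" "Dom D (e B) = FO F (G0 B)" "Cod D (e B) = B" if "B \<in> Ob D" for B
  using e0[OF that] by (auto simp: Hom_iff)
 have "\<forall>B\<in>Ob D. \<exists>i. i \<in> Ar D \<and> Dom D i = B \<and> Cod D i = FO F (G0 B) \<and>
   i \<cdot>[D] e B = Idt D (FO F (G0 B)) \<and> e B \<cdot>[D] i = Idt D B \<and> is_iso D i"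
  using F.tgt.isoE e e0 by metis
 then obtain i where "\<forall>B\<in>Ob D. i B \<in> Ar D \<and> Dom D (i B) = B \<and> Cod D (i B) = FO F (G0 B) \<and>
   i B \<cdot>[D] e B = Idt D (FO F (G0 B)) \<and> e B \<cdot>[D] i B = Idt D B \<and> is_iso D (i B)"
  by (auto dest!: bchoice)
 hence i: "\<And>B. B \<in> Ob D ==> i B \<in> Ar D" "\<And>B. B \<in> Ob D ==> Dom D (i B) = B"
   "\<And>B. B \<in> Ob D ==> Cod D (i B) = FO F (G0 B)"
   "\<And>B. B \<in> Ob D ==> i B \<cdot>[D] e B = Idt D (FO F (G0 B))"
   "\<And>B. B \<in> Ob D ==> e B \<cdot>[D] i B = Idt D B" "\<And>B. B \<in> Ob D ==> is_iso D (i B)"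
  by blast+
 define lift where "lift A B g = (THE f. f \<in> Hom C A B \<and> FA F f = g)" for A B g
 have lift: "lift A B g \<in> Hom C A B \<and> FA F (lift A B g) = g"
  if "A \<in> Ob C" "B \<in> Ob C" "g \<in> Ar D" "Dom D g = FO F A" "Cod D g = FO F B" for A B g
  unfolding lift_def by (rule theI') (use ff[of A B g] that in \<open>auto simp: Hom_iff\<close>)
 have faithful: "f = g" if "f \<in> Ar C" "g \<in> Ar C" "Dom C f = Dom C g" "Cod C f = Cod C g"
  "FA F f = FA F g" for f g
  using ff[of "Dom C f" "Cod C f" "FA F f"] that by (auto simp: Hom_iff)
 define G where "G = \<lparr>FO = (\<lambda>B\<in>Ob D. G0 B),
   FA = (\<lambda>g\<in>Ar D. lift (G0 (Dom D g)) (G0 (Cod D g)) (i (Cod D g) \<cdot>[D] (g \<cdot>[D] e (Dom D g))))\<rparr>"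
 have Gob: "FO G B = G0 B" if "B \<in> Ob D" for B using that by (simp add: G_def)
 have Gar: "FA G g \<in> Ar C" "Dom C (FA G g) = G0 (Dom D g)" "Cod C (FA G g) = G0 (Cod D g)"
  "FA F (FA G g) = i (Cod D g) \<cdot>[D] (g \<cdot>[D] e (Dom D g))" if "g \<in> Ar D" for g
  using lift[of "G0 (Dom D g)" "G0 (Cod D g)" "i (Cod D g) \<cdot>[D] (g \<cdot>[D] e (Dom D g))"] that G0 e i
  by (auto simp: G_def Hom_iff)
 have G: "cat_functor D C G"
 proof (rule cat_functorI, goal_cases)
  case (9 B)
  show ?case by (rule faithful)
   (use 9 Gar[of "Idt D B"] i e G0 Gob in \<open>auto\<close>)
 next
  case (10 f g)
  have "FA F (FA G g) \<cdot>[D] FA F (FA G f) = i (Cod D g) \<cdot>[D] (g \<cdot>[D] ((e (Dom D g) \<cdot>[D] i (Cod D f)) \<cdot>[D] (f \<cdot>[D] e (Dom D f))))"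
   using 10 Gar(4)[of f] Gar(4)[of g] i(1-3) e G0 by simp
  also have "\<dots> = FA F (FA G (g \<cdot>[D] f))"
   using 10 Gar(4)[of "g \<cdot>[D] f"] i e G0 by simp
  finally have eq: "FA F (FA G g) \<cdot>[D] FA F (FA G f) = FA F (FA G (g \<cdot>[D] f))" .
  show ?case by (rule faithful)
   (use 10 eq Gar(1-3)[of "g \<cdot>[D] f"] Gar(1-3)[of g] Gar(1-3)[of f] in \<open>auto simp: F.FA_comp\<close>)
 qed (use F.src.category_axioms F.tgt.category_axioms G0 Gob Gar in \<open>auto simp: G_def\<close>)
 interpret G: cat_functor D C G by fact
 define n where "n A = lift A (G0 (FO F A)) (i (FO F A))" for A
 have n: "n A \<in> Ar C" "Dom C (n A) = A" "Cod C (n A) = G0 (FO F A)" "FA F (n A) = i (FO F A)"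
  if "A \<in> Ob C" for A
  using lift[of A "G0 (FO F A)" "i (FO F A)"] that i G0 by (auto simp: n_def Hom_iff)
 have niso: "is_iso C (n A)" if A: "A \<in> Ob C" for A
 proof -
  define k where "k = lift (G0 (FO F A)) A (e (FO F A))"
  have k: "k \<in> Ar C" "Dom C k = G0 (FO F A)" "Cod C k = A" "FA F k = e (FO F A)"
   using lift[of "G0 (FO F A)" A "e (FO F A)"] A e G0 by (auto simp: k_def Hom_iff)
  show ?thesis
  proof (rule F.src.isoI[of _ k])
   show "k \<cdot>[C] n A = Idt C (Dom C (n A))"
    by (rule faithful) (use k n[OF A] A i e G0 in \<open>auto simp: F.FA_comp\<close>)
   show "n A \<cdot>[C] k = Idt C (Cod C (n A))"
    by (rule faithful) (use k n[OF A] A i e G0 in \<open>auto simp: F.FA_comp\<close>)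
  qed (use k n[OF A] in auto)
 qed
 have "naturally_isomorphic C C (id_functor C) (comp_functor C G F)"
  unfolding naturally_isomorphic_def
 proof (intro exI conjI)
  show "nat_trans C C \<lparr>Src = id_functor C, Tgt = comp_functor C G F, component = (\<lambda>A\<in>Ob C. n A)\<rparr>"
  proof (rule nat_transI, goal_cases)
   case (7 f)
   have eq: "FA F (n (Cod C f) \<cdot>[C] f) = FA F (FA G (FA F f) \<cdot>[C] n (Dom C f))"
    using 7 n i e G0 Gar[of "FA F f"] by (simp add: F.FA_comp)
   have "n (Cod C f) \<cdot>[C] f = FA G (FA F f) \<cdot>[C] n (Dom C f)"
    by (rule faithful)
   (use 7 eq n Gar[of "FA F f"] in \<open>auto\<close>)
   thus ?case using 7 by simp
  qed (use n F G Gob in \<open>auto intro: cat_functor_id cat_functor_comp F.src.category_axioms\<close>)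
 qed (use niso in auto)
 moreover have "naturally_isomorphic D D (comp_functor D F G) (id_functor D)"
  unfolding naturally_isomorphic_def
 proof (intro exI conjI)
  show "nat_trans D D \<lparr>Src = comp_functor D F G, Tgt = id_functor D, component = (\<lambda>B\<in>Ob D. e B)\<rparr>"
  proof (rule nat_transI, goal_cases)
   case (7 g)
   have "e (Cod D g) \<cdot>[D] (i (Cod D g) \<cdot>[D] (g \<cdot>[D] e (Dom D g))) = g \<cdot>[D] e (Dom D g)"
    using 7 e i by (simp add: F.tgt.comp_reassoc[OF i(5)])
   thus ?case using 7 Gar[of g] by simp
  qed (use e F G Gob in \<open>auto intro: cat_functor_id cat_functor_comp F.tgt.category_axioms\<close>)
 qed (use e0 in auto)
 ultimately show ?thesis
  unfolding equivalence_of_categories_def using F G by blast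
qed

section \<open>The restriction category of partial maps, computed on representing spans\<close>

section \<open>Partial maps\<close>

lemma span_equiv_iff:
 "((m, f), (n, g)) \<in> span_equiv C M \<longleftrightarrow> (m, f) \<in> spans C M \<and> (n, g) \<in> spans C M \<and>
   (\<exists>u. is_iso C u \<and> u \<in> Ar C \<and> Dom C u = Dom C m \<and> Cod C u = Dom C n \<and>
     n \<cdot>[C] u = m \<and> g \<cdot>[C] u = f)"
 by (auto simp: span_equiv_def Hom_iff)

lemma spans_iff: "(m, f) \<in> spans C M \<longleftrightarrow> m \<in> M \<and> f \<in> Ar C \<and> Dom C m = Dom C f"
 by (simp add: spans_def)

text \<open>The restriction order of partial maps, read on representatives
  (\<open>restr_le_iff\<close>).\<close>

definition span_le :: "('o, 'a) cat \<Rightarrow> 'a \<times> 'a \<Rightarrow> 'a \<times> 'a \<Rightarrow> bool" where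
 "span_le C s t \<longleftrightarrow> (\<exists>u\<in>Ar C. Dom C u = Dom C (fst s) \<and> Cod C u = Dom C (fst t) \<and>
   fst t \<cdot>[C] u = fst s \<and> snd t \<cdot>[C] u = snd s)"

definition hom_spans :: "('o, 'a) cat \<Rightarrow> 'a set \<Rightarrow> 'o \<Rightarrow> 'o \<Rightarrow> ('a \<times> 'a) set" where
 "hom_spans C M A B = {s \<in> spans C M. Cod C (fst s) = A \<and> Cod C (snd s) = B}"

text \<open>Compatibility of partial maps read on representatives: agreement on the intersection of
  the domains. All pullbacks are quantified over, so none has to be chosen.\<close>

definition span_compat :: "('o, 'a) cat \<Rightarrow> ('a \<times> 'a) set \<Rightarrow> bool" where
 "span_compat C G \<longleftrightarrow> (\<forall>m f n g p q. (m, f) \<in> G \<longrightarrow> (n, g) \<in> G \<longrightarrow> pullback C m n p q \<longrightarrow>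
   f \<cdot>[C] p = g \<cdot>[C] q)"

definition span_join ::
 "('o, 'a) cat \<Rightarrow> 'a set \<Rightarrow> 'o \<Rightarrow> 'o \<Rightarrow> ('a \<times> 'a) set \<Rightarrow> 'a \<times> 'a \<Rightarrow> bool" where
 "span_join C M A B G j \<longleftrightarrow> j \<in> hom_spans C M A B \<and> (\<forall>s\<in>G. span_le C s j) \<and>
   (\<forall>t\<in>hom_spans C M A B. (\<forall>s\<in>G. span_le C s t) \<longrightarrow> span_le C j t)"

definition partial_map :: "('o, 'a) cat \<Rightarrow> 'a set \<Rightarrow> 'a \<times> 'a \<Rightarrow> ('a \<times> 'a) set" where
 "partial_map C M s = span_equiv C M `` {s}"

lemma hom_spans_iff: "(m, f) \<in> hom_spans C M A B \<longleftrightarrow>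
  m \<in> M \<and> f \<in> Ar C \<and> Dom C m = Dom C f \<and> Cod C m = A \<and> Cod C f = B"
 by (auto simp: hom_spans_def spans_iff)

locale mcat = category C for C :: "('o, 'a) cat" (structure) +
 fixes U :: "'u itself" and M :: "'a set"
 assumes mcat: "mcategory U C M"
begin

abbreviation "\<S> \<equiv> hom_spans C M"
abbreviation "pm m f \<equiv> partial_map C M (m, f)"
abbreviation "\<P> \<equiv> Par C M"

lemma mcatD:
 "locally_small U C" "\<forall>m\<in>M. is_mono C m" "\<forall>f. is_iso C f \<longrightarrow> f \<in> M"
 "\<forall>m\<in>M. \<forall>n\<in>M. cod m = dom n \<longrightarrow> n \<cdot> m \<in> M"
 "\<forall>m\<in>M. \<forall>f\<in>Ar C. cod f = cod m \<longrightarrow>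
    (\<exists>p q. pullback C m f p q) \<and> (\<forall>p q. pullback C m f p q \<longrightarrow> q \<in> M)"
 "\<forall>A\<in>Ob C. small U ({m \<in> M. cod m = A} // subobj_equiv C M A)"
 by (insert mcat, unfold mcategory_def, (elim conjE, assumption)+)

lemma M_mono [simp]: "m \<in> M ==> is_mono C m"
 using mcatD(2) by blast

lemma M_Ar [simp]: "m \<in> M ==> m \<in> Ar C"
 by simp

lemma iso_M: "is_iso C f ==> f \<in> M"
 using mcatD(3) by blast

lemma Idt_M [simp]: "A \<in> Ob C ==> Idt C A \<in> M"
 by (simp add: iso_M)

lemma M_comp [simp]: "m \<in> M ==> n \<in> M ==> cod m = dom n ==> n \<cdot> m \<in> M"
 using mcatD(4) by blast

lemma mcat_pullback:
 assumes "m \<in> M" "f \<in> Ar C" "cod f = cod m"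
 shows "\<exists>p q. pullback C m f p q" "pullback C m f p q ==> q \<in> M"
 using mcatD(5) assms by blast+

lemma M_pullback:
 assumes "pullback C m f p q" "m \<in> M" shows "q \<in> M"
 using mcat_pullback(2)[OF assms(2) _ _ assms(1)] pullbackD[OF assms(1)] by simp

lemma pullback_exists:
 assumes "m \<in> M" "f \<in> Ar C" "cod f = cod m"
 obtains p q where "pullback C m f p q" "q \<in> M" "p \<in> Ar C" "dom p = dom q" "cod p = dom m"
  "cod q = dom f" "m \<cdot> p = f \<cdot> q"
proof -
 obtain p q where "pullback C m f p q" using mcat_pullback(1)[OF assms] by blast
 thus thesis using that[of p q] M_pullback assms(1) pullbackD[of m f p q] by auto
qed

lemma equiv_span: "equiv (spans C M) (span_equiv C M)"
proof (rule equivI)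
 show "span_equiv C M \<subseteq> spans C M \<times> spans C M" by (auto simp: span_equiv_iff)
 show "refl_on (spans C M) (span_equiv C M)"
 proof (rule refl_onI)
  fix s assume "s \<in> spans C M"
  thus "(s, s) \<in> span_equiv C M"
   by (cases s) (auto simp: span_equiv_iff spans_iff intro!: exI[of _ "Idt C (dom (fst s))"])
 qed
 show "sym (span_equiv C M)"
 proof (rule symI)
  fix s t assume "(s, t) \<in> span_equiv C M"
  then obtain m f n g u where s: "s = (m, f)" "t = (n, g)" "(m, f) \<in> spans C M" "(n, g) \<in> spans C M"
   and u: "is_iso C u" "dom u = dom m" "cod u = dom n" "n \<cdot> u = m" "g \<cdot> u = f"
   by (cases s; cases t) (auto simp: span_equiv_iff)
  obtain v where v: "u \<in> Ar C" "v \<in> Ar C" "dom v = cod u" "cod v = dom u"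
   "v \<cdot> u = Idt C (dom u)" "u \<cdot> v = Idt C (cod u)" "is_iso C v" using isoE[OF u(1)] by metis
  have "m \<cdot> v = n" "f \<cdot> v = g" using s u v unfolding u(4,5)[symmetric] by (auto simp: spans_iff)
  thus "(t, s) \<in> span_equiv C M" using s u v by (auto simp: span_equiv_iff intro!: exI[of _ v])
 qed
 show "trans (span_equiv C M)"
 proof (rule transI)
  fix s t r assume "(s, t) \<in> span_equiv C M" "(t, r) \<in> span_equiv C M"
  then obtain m f n g k h u v where s: "s = (m, f)" "t = (n, g)" "r = (k, h)"
   "(m, f) \<in> spans C M" "(n, g) \<in> spans C M" "(k, h) \<in> spans C M"
   and u: "is_iso C u" "dom u = dom m" "cod u = dom n" "n \<cdot> u = m" "g \<cdot> u = f"
   and v: "is_iso C v" "dom v = dom n" "cod v = dom k" "k \<cdot> v = n" "h \<cdot> v = g"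
   by (cases s; cases t; cases r) (auto simp: span_equiv_iff)
  have "k \<cdot> (v \<cdot> u) = m" "h \<cdot> (v \<cdot> u) = f"
   using s u v comp_reassoc[OF v(4), of u] comp_reassoc[OF v(5), of u] by (auto simp: spans_iff)
  thus "(s, r) \<in> span_equiv C M"
   using s u v iso_comp[OF u(1) v(1)] by (auto simp: span_equiv_iff intro!: exI[of _ "v \<cdot> u"])
 qed
qed

lemma partial_map_eq_iff:
 assumes "(m, f) \<in> spans C M" "(n, g) \<in> spans C M"
 shows "pm m f = pm n g \<longleftrightarrow> (\<exists>u. is_iso C u \<and> dom u = dom m \<and> cod u = dom n \<and>
  n \<cdot> u = m \<and> g \<cdot> u = f)"
 unfolding partial_map_def
 using eq_equiv_class_iff[OF equiv_span assms] assms by (auto simp: span_equiv_iff)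

lemma partial_map_mem:
 assumes "(m, f) \<in> spans C M"
 shows "(n, g) \<in> pm m f \<longleftrightarrow> (\<exists>u. is_iso C u \<and> dom u = dom n \<and> cod u = dom m \<and>
  m \<cdot> u = n \<and> f \<cdot> u = g)"
proof -
 have "(n, g) \<in> pm m f \<longleftrightarrow> ((n, g), (m, f)) \<in> span_equiv C M"
  unfolding partial_map_def using equiv_span by (metis Image_singleton_iff equivE symE)
 also have "\<dots> \<longleftrightarrow> (\<exists>u. is_iso C u \<and> dom u = dom n \<and> cod u = dom m \<and>
  m \<cdot> u = n \<and> f \<cdot> u = g)"
  using assms by (auto simp: span_equiv_iff spans_iff iso_M)
 finally show ?thesis .
qed

lemma partial_map_self: "(m, f) \<in> spans C M ==> (m, f) \<in> pm m f"
 unfolding partial_map_def using equiv_class_self[OF equiv_span] by blast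

lemma Par_Ar_iff: "S \<in> Ar \<P> \<longleftrightarrow> (\<exists>m f. (m, f) \<in> spans C M \<and> S = pm m f)"
 by (auto simp: Par_def quotient_def partial_map_def)

lemma Par_Ar: "(m, f) \<in> spans C M ==> pm m f \<in> Ar \<P>"
 by (auto simp: Par_Ar_iff)

lemma Par_Ob [simp]: "Ob \<P> = Ob C"
 by (simp add: Par_def)

lemma Par_Dom: "(m, f) \<in> spans C M ==> Dom \<P> (pm m f) = cod m"
 unfolding Par_def
 by (auto intro!: the_equality bexI[OF _ partial_map_self] simp: partial_map_mem spans_iff)

lemma Par_Cod: "(m, f) \<in> spans C M ==> Cod \<P> (pm m f) = cod f"
 unfolding Par_def
 by (auto intro!: the_equality bexI[OF _ partial_map_self] simp: partial_map_mem spans_iff)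

lemma Par_Hom: "pm m f \<in> Hom \<P> A B" if "(m, f) \<in> \<S> A B"
 using that by (auto simp: Hom_iff hom_spans_def Par_Ar Par_Dom Par_Cod)

lemma Par_HomE:
 assumes "S \<in> Hom \<P> A B"
 obtains m f where "S = pm m f" "(m, f) \<in> \<S> A B"
 using assms by (auto simp: Hom_iff Par_Ar_iff hom_spans_def Par_Dom Par_Cod)

lemma Par_Idt: "Idt \<P> A = pm (Idt C A) (Idt C A)"
 by (simp add: Par_def partial_map_def)

lemma Par_restr: "(m, f) \<in> spans C M ==> Par_restr (pm m f) = pm m m"
proof -
 assume mf: "(m, f) \<in> spans C M"
 hence mm: "(m, m) \<in> spans C M" by (auto simp: spans_iff)
 show ?thesis
 proof (intro set_eqI iffI)
  fix x assume "x \<in> Par_restr (pm m f)"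
  thus "x \<in> pm m m" using mf mm by (auto simp: Par_restr_def partial_map_mem)
 next
  fix x assume "x \<in> pm m m"
  then obtain u where u: "is_iso C u" "cod u = dom m" "x = (m \<cdot> u, m \<cdot> u)"
   using mm by (cases x) (auto simp: partial_map_mem)
  hence "(m \<cdot> u, f \<cdot> u) \<in> pm m f" using mf by (auto simp: partial_map_mem spans_iff)
  thus "x \<in> Par_restr (pm m f)" using u unfolding Par_restr_def by force
 qed
qed

text \<open>Composites along different representatives and pullbacks are isomorphic because
  pullbacks are unique; conversely, a span isomorphic to one composite is itself a composite, along
  the pullback moved by that isomorphism.\<close>

lemma Par_comp:
 assumes s: "(m, f) \<in> spans C M" and t: "(n, g) \<in> spans C M" and pb: "pullback C f n p q"
 shows "pm n g \<cdot>[\<P>] pm m f = pm (m \<cdot> p) (g \<cdot> q)"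
proof -
 note D = pullbackD[OF pb]
 have "p \<in> M" using M_pullback[OF pullback_sym[OF pb]] t by (simp add: spans_iff)
 hence mp: "(m \<cdot> p, g \<cdot> q) \<in> spans C M" using s t D by (auto simp: spans_iff)
 show ?thesis
 proof (intro set_eqI iffI)
  fix x assume "x \<in> pm n g \<cdot>[\<P>] pm m f"
  then obtain m' f' n' g' p' q' where x: "x = (m' \<cdot> p', g' \<cdot> q')" "(m', f') \<in> pm m f"
   "(n', g') \<in> pm n g" and pb': "pullback C f' n' p' q'"
   by (auto simp: Par_def)
  obtain u where u: "is_iso C u" "cod u = dom m" "m \<cdot> u = m'" "f \<cdot> u = f'"
   using x(2) s by (auto simp: partial_map_mem)
  obtain v where v: "is_iso C v" "cod v = dom n" "n \<cdot> v = n'" "g \<cdot> v = g'"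
   using x(3) t by (auto simp: partial_map_mem)
  have "pullback C f n' (u \<cdot> p') q'" using pb' u s by (intro pullback_iso_change) (auto simp: spans_iff)
  hence "pullback C f n (u \<cdot> p') (v \<cdot> q')"
   using v t by (intro pullback_sym[OF pullback_iso_change[OF pullback_sym]]) (auto simp: spans_iff)
  from pullback_iso_unique[OF pb this] obtain w where
   w: "is_iso C w" "cod w = dom p" "p \<cdot> w = u \<cdot> p'" "q \<cdot> w = v \<cdot> q'" by metis
  have D': "p' \<in> Ar C" "q' \<in> Ar C" "cod p' = dom f'" "cod q' = dom n'" using pullbackD[OF pb'] by auto
  have "(m \<cdot> p) \<cdot> w = m' \<cdot> p'" "(g \<cdot> q) \<cdot> w = g' \<cdot> q'"
   using w D D' s t u(1,2) v(1,2) unfolding u(3,4)[symmetric] v(3,4)[symmetric]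
   by (auto simp: spans_iff)
  moreover have "dom w = dom p'"
   using w(1,2) D D' pullbackD(6)[OF pb'] u v s arg_cong[OF w(3), of "dom"] by (auto simp: spans_iff)
  moreover have "dom (m' \<cdot> p') = dom p'" using u D' s by (auto simp: spans_iff)
  ultimately show "x \<in> pm (m \<cdot> p) (g \<cdot> q)"
   using w(1,2) mp D s unfolding x(1) partial_map_mem[OF mp]
   by (intro exI[of _ w]) (simp add: spans_iff)
 next
  fix x assume "x \<in> pm (m \<cdot> p) (g \<cdot> q)"
  then obtain w where w: "is_iso C w" "cod w = dom (m \<cdot> p)" "x = ((m \<cdot> p) \<cdot> w, (g \<cdot> q) \<cdot> w)"
   using mp by (cases x) (auto simp: partial_map_mem)
  have "pullback C f n (p \<cdot> w) (q \<cdot> w)" using w D s by (intro pullback_iso_comp[OF pb]) (auto simp: spans_iff)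
  moreover have "x = (m \<cdot> (p \<cdot> w), g \<cdot> (q \<cdot> w))" using w D s t by (auto simp: spans_iff)
  ultimately show "x \<in> pm n g \<cdot>[\<P>] pm m f"
   using partial_map_self[OF s] partial_map_self[OF t] unfolding Par_def by fastforce
 qed
qed

lemma pullback_span:
 assumes "(m, f) \<in> spans C M" "(n, g) \<in> spans C M" "cod f = cod n"
 obtains p q where "pullback C f n p q" "(m \<cdot> p, g \<cdot> q) \<in> spans C M"
  "p \<in> M" "q \<in> Ar C" "cod p = dom f" "cod q = dom n" "dom p = dom q" "f \<cdot> p = n \<cdot> q"
proof -
 obtain q p where "pullback C n f q p" "p \<in> M" using pullback_exists[of n f] assms
  by (metis spans_iff)
 thus thesis using that[of p q] assms pullbackD[of n f q p] pullback_sym by (auto simp: spans_iff)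
qed

lemma category_Par: "category \<P>"
proof (unfold_locales, goal_cases)
 case (1 S) thus ?case by (auto simp: Par_Ar_iff Par_Dom spans_iff)
next
 case (2 S) thus ?case by (auto simp: Par_Ar_iff Par_Cod spans_iff)
next
 case (3 A) thus ?case unfolding Par_Idt by (intro Par_Hom) (auto simp: hom_spans_iff)
next
 case (4 S A B T E)
 then obtain m f n g where st: "S = pm m f" "(m, f) \<in> \<S> A B" "T = pm n g"
  "(n, g) \<in> \<S> B E" by (metis Par_HomE)
 hence "(m, f) \<in> spans C M" "(n, g) \<in> spans C M" "cod f = cod n" by (auto simp: hom_spans_def)
 then obtain p q where pq: "pullback C f n p q" "(m \<cdot> p, g \<cdot> q) \<in> spans C M"
  using pullback_span[of m f n g] by metis
 have "(m \<cdot> p, g \<cdot> q) \<in> \<S> A E"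
  using st pq pullbackD[OF pq(1)] by (auto simp: hom_spans_def spans_iff)
 thus ?case using Par_comp[OF _ _ pq(1)] Par_Hom st by (auto simp: hom_spans_def)
next
 case (5 S)
 then obtain m f where st: "S = pm m f" "(m, f) \<in> spans C M" by (auto simp: Par_Ar_iff)
 have "pullback C (Idt C (cod m)) m m (Idt C (dom m))"
  using st by (intro pullback_id_left) (auto simp: spans_iff)
 from Par_comp[OF _ st(2) this] show ?case
  using st by (auto simp: Par_Dom Par_Idt spans_iff)
next
 case (6 S)
 then obtain m f where st: "S = pm m f" "(m, f) \<in> spans C M" by (auto simp: Par_Ar_iff)
 have "pullback C f (Idt C (cod f)) (Idt C (dom f)) f"
  using st by (intro pullback_id_right) (auto simp: spans_iff)
 from Par_comp[OF st(2) _ this, of "Idt C (cod f)"] show ?case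
  using st by (simp add: Par_Cod Par_Idt spans_iff)
next
 case (7 S A B T E R H)
 then obtain m f n g k h where st: "S = pm m f" "(m, f) \<in> \<S> A B" "T = pm n g"
  "(n, g) \<in> \<S> B E" "R = pm k h" "(k, h) \<in> \<S> E H" by (metis Par_HomE)
 hence sp: "(m, f) \<in> spans C M" "(n, g) \<in> spans C M" "(k, h) \<in> spans C M"
  "cod f = cod n" "cod g = cod k" by (auto simp: hom_spans_def)
 obtain p q where pq: "pullback C f n p q" "(m \<cdot> p, g \<cdot> q) \<in> spans C M" "p \<in> M" "q \<in> Ar C"
  "cod q = dom n" "dom p = dom q" "cod p = dom f"
  using pullback_span[of m f n g] sp by metis
 obtain r s where rs: "pullback C g k r s" "(n \<cdot> r, h \<cdot> s) \<in> spans C M" "r \<in> M" "s \<in> Ar C"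
  "cod r = dom g" "dom r = dom s" "cod s = dom k"
  using pullback_span[of n g k h] sp by metis
 \<comment> \<open>Both bracketings are computed from this one pullback, pasted on either
   side.\<close>
 obtain b a where ab: "pullback C r q b a" "a \<in> M" "b \<in> Ar C" "dom a = dom b"
  "cod a = dom q" "cod b = dom r"
  using pullback_exists[of r q] rs pq sp by (metis spans_iff)
 have 1: "pullback C (g \<cdot> q) k a (s \<cdot> b)"
  by (rule pullback_sym, rule pullback_paste[OF pullback_sym[OF rs(1)] ab(1)])
 have 2: "pullback C f (n \<cdot> r) (p \<cdot> a) b"
  by (rule pullback_paste[OF pq(1) pullback_sym[OF ab(1)]])
 have "R \<cdot>[\<P>] (T \<cdot>[\<P>] S) = pm ((m \<cdot> p) \<cdot> a) (h \<cdot> (s \<cdot> b))"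
  unfolding st Par_comp[OF sp(1,2) pq(1)] Par_comp[OF pq(2) sp(3) 1] by simp
 also have "\<dots> = pm (m \<cdot> (p \<cdot> a)) ((h \<cdot> s) \<cdot> b)"
  using sp pq rs ab by (auto simp: spans_iff)
 also have "\<dots> = (R \<cdot>[\<P>] T) \<cdot>[\<P>] S"
  unfolding st Par_comp[OF sp(2,3) rs(1)] Par_comp[OF sp(1) rs(2) 2] by simp
 finally show ?case .
qed

lemma span_restr: "(m, f) \<in> spans C M ==> (m, m) \<in> spans C M"
 by (auto simp: spans_iff)

lemma Par_comp_restr:
 assumes s: "(m, f) \<in> spans C M" "(n, g) \<in> spans C M" and pb: "pullback C m n p q"
 shows "pm n g \<cdot>[\<P>] Par_restr (pm m f) = pm (m \<cdot> p) (g \<cdot> q)"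
 using Par_comp[OF span_restr[OF s(1)] s(2) pb] Par_restr[OF s(1)] by simp

lemma restriction_category_Par: "restriction_category \<P> Par_restr"
proof -
 interpret P: category \<P> by (rule category_Par)
 show ?thesis
 proof (unfold_locales, goal_cases)
  case (1 S A B)
  then obtain m f where "S = pm m f" "(m, f) \<in> \<S> A B" by (metis Par_HomE)
  thus ?case by (auto simp: Par_restr hom_spans_def spans_iff intro!: Par_Hom)
 next
  case (2 S)
  then obtain m f where st: "S = pm m f" "(m, f) \<in> spans C M" by (auto simp: Par_Ar_iff)
  have "pullback C m m (Idt C (dom m)) (Idt C (dom m))"
   using st by (intro pullback_mono_self) (auto simp: spans_iff)
  from Par_comp_restr[OF st(2) st(2) this] show ?case using st by (auto simp: spans_iff)
 next
  case (3 S T)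
  then obtain m f n g where st: "S = pm m f" "(m, f) \<in> spans C M" "T = pm n g" "(n, g) \<in> spans C M"
   by (auto simp: Par_Ar_iff)
  hence "cod m = cod n" using 3 by (simp add: Par_Dom)
  then obtain p q where pq: "pullback C m n p q" "m \<cdot> p = n \<cdot> q"
   using pullback_span[OF span_restr[OF st(2)] span_restr[OF st(4)]] by metis
  show ?case
   using Par_comp[OF span_restr[OF st(2)] span_restr[OF st(4)] pq(1)]
    Par_comp[OF span_restr[OF st(4)] span_restr[OF st(2)] pullback_sym[OF pq(1)]] st pq
   by (simp add: Par_restr)
 next
  case (4 S T)
  then obtain m f n g where st: "S = pm m f" "(m, f) \<in> spans C M" "T = pm n g" "(n, g) \<in> spans C M"
   by (auto simp: Par_Ar_iff)
  hence "cod m = cod n" using 4 by (simp add: Par_Dom)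
  then obtain p q where pq: "pullback C m n p q" "m \<cdot> p = n \<cdot> q" "(m \<cdot> p, g \<cdot> q) \<in> spans C M"
   using pullback_span[OF span_restr[OF st(2)] st(4)] by metis
  show ?case
   using Par_comp[OF span_restr[OF st(2)] st(4) pq(1)]
    Par_comp[OF span_restr[OF st(2)] span_restr[OF st(4)] pq(1)] st pq
   by (simp add: Par_restr)
 next
  case (5 S T)
  then obtain m f n g where st: "S = pm m f" "(m, f) \<in> spans C M" "T = pm n g" "(n, g) \<in> spans C M"
   by (auto simp: Par_Ar_iff)
  hence "cod f = cod n" using 5 by (simp add: Par_Dom Par_Cod)
  then obtain p q where pq: "pullback C f n p q" "f \<cdot> p = n \<cdot> q" "(m \<cdot> p, g \<cdot> q) \<in> spans C M" "p \<in> M" "cod p = dom f"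
   using pullback_span[of m f n g] st by metis
  have "pullback C (m \<cdot> p) m (Idt C (dom p)) p"
   using pq st by (intro pullback_sym[OF pullback_mono_factor]) (auto simp: spans_iff)
  from Par_comp[OF span_restr[OF pq(3)] st(2) this] show ?case
   using Par_comp[OF st(2) st(4) pq(1)] Par_comp[OF st(2) span_restr[OF st(4)] pq(1)] st pq
   by (simp add: Par_restr spans_iff)
 qed
qed

text \<open>Restricting \<open>(n, g)\<close> to the domain of \<open>(m, f)\<close> gives a span
  over the intersection of \<open>m\<close> and \<open>n\<close>. If it is isomorphic to
  \<open>(m, f)\<close>, then \<open>m\<close> factors through \<open>n\<close> by way of that
  intersection.\<close>

lemma restr_le_iff:
 assumes s: "(m, f) \<in> spans C M" "(n, g) \<in> spans C M" and eq: "cod m = cod n"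
 shows "restr_le \<P> Par_restr (pm m f) (pm n g) \<longleftrightarrow> span_le C (m, f) (n, g)"
proof
 obtain p q where pq: "pullback C m n p q" "(m \<cdot> p, g \<cdot> q) \<in> spans C M" "p \<in> M" "q \<in> Ar C"
  "cod p = dom m" "cod q = dom n" "dom p = dom q" "m \<cdot> p = n \<cdot> q"
  using pullback_span[of m m n g] s eq by (auto simp: span_restr[of m f] spans_iff)
 assume "restr_le \<P> Par_restr (pm m f) (pm n g)"
 hence "pm m f = pm (m \<cdot> p) (g \<cdot> q)"
  using Par_comp_restr[OF s pq(1)] by (simp add: restr_le_def)
 then obtain u where u: "is_iso C u" "dom u = dom m" "cod u = dom (m \<cdot> p)"
  "(m \<cdot> p) \<cdot> u = m" "(g \<cdot> q) \<cdot> u = f" using partial_map_eq_iff[OF s(1) pq(2)] by auto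
 have "n \<cdot> (q \<cdot> u) = m" "g \<cdot> (q \<cdot> u) = f"
  using u pq s comp_reassoc[OF pq(8)[symmetric], of u] by (auto simp: spans_iff)
 thus "span_le C (m, f) (n, g)"
  unfolding span_le_def using u pq s by (auto intro!: bexI[of _ "q \<cdot> u"] simp: spans_iff)
next
 assume "span_le C (m, f) (n, g)"
 then obtain u where u: "u \<in> Ar C" "dom u = dom m" "cod u = dom n" "n \<cdot> u = m" "g \<cdot> u = f"
  by (auto simp: span_le_def)
 have "pullback C m n (Idt C (dom m)) u"
  using pullback_sym[OF pullback_mono_factor[of n u]] u s by (simp add: spans_iff)
 from Par_comp_restr[OF s this] show "restr_le \<P> Par_restr (pm m f) (pm n g)"
  using u s by (simp add: restr_le_def spans_iff)
qed

lemma compatible_iff: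
 assumes s: "(m, f) \<in> spans C M" "(n, g) \<in> spans C M" and pb: "pullback C m n p q"
 shows "pm m f \<cdot>[\<P>] Par_restr (pm n g) = pm n g \<cdot>[\<P>] Par_restr (pm m f) \<longleftrightarrow> f \<cdot> p = g \<cdot> q"
proof -
 note D = pullbackD[OF pb]
 have pq: "p \<in> M" "q \<in> M"
  using M_pullback[OF pb] M_pullback[OF pullback_sym[OF pb]] s by (auto simp: spans_iff)
 have sp: "(n \<cdot> q, f \<cdot> p) \<in> spans C M" "(m \<cdot> p, g \<cdot> q) \<in> spans C M"
  using s D pq by (auto simp: spans_iff)
 have "f \<cdot> p = g \<cdot> q" if "pm (n \<cdot> q) (f \<cdot> p) = pm (m \<cdot> p) (g \<cdot> q)"
 proof -
  obtain u where u: "is_iso C u" "dom u = dom p" "cod u = dom p"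
   "(m \<cdot> p) \<cdot> u = n \<cdot> q" "(g \<cdot> q) \<cdot> u = f \<cdot> p"
   using \<open>pm (n \<cdot> q) (f \<cdot> p) = pm (m \<cdot> p) (g \<cdot> q)\<close>[unfolded partial_map_eq_iff[OF sp]] D s
   by (auto simp: spans_iff)
  \<comment> \<open>Both spans have the same first leg, since \<open>m p = n q\<close>; an
    isomorphism over a common monic is the identity, so the second legs coincide.\<close>
  have "u = Idt C (dom p)"
  proof (rule mono_cancel)
   show "is_mono C (m \<cdot> p)" using sp by (auto simp: spans_iff)
   show "(m \<cdot> p) \<cdot> u = (m \<cdot> p) \<cdot> Idt C (dom p)" using u D by simp
  qed (use u D in auto)
  thus ?thesis using u D s by (auto simp: spans_iff)
 qed
 thus ?thesis
  using Par_comp_restr[OF s pb] Par_comp_restr[OF s(2,1) pullback_sym[OF pb]] D by auto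
qed

abbreviation "pms G \<equiv> partial_map C M ` G"

text \<open>A set of partial maps is replaced by the set of all spans representing them.
  Compatibility and joins can then be treated on spans without choosing representatives.\<close>

lemma Par_set_spans:
 assumes "S \<subseteq> Hom \<P> A B"
 shows "S = pms (\<Union>S)" "\<Union>S \<subseteq> \<S> A B"
proof -
 have *: "s \<in> \<S> A B \<and> X = partial_map C M s" if "X \<in> S" "s \<in> X" for X s
 proof -
  obtain n g where n: "s = (n, g)" by fastforce
  have "X \<in> Hom \<P> A B" using assms that by blast
  then obtain m f where mf: "X = pm m f" "(m, f) \<in> \<S> A B" by (rule Par_HomE)
  hence sp: "(m, f) \<in> spans C M" by (simp add: hom_spans_def)
  have "((m, f), (n, g)) \<in> span_equiv C M" using that mf n by (simp add: partial_map_def)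
  hence "(n, g) \<in> spans C M" "pm m f = pm n g"
   using equiv_class_eq[OF equiv_span] by (auto simp: span_equiv_iff partial_map_def)
  moreover have "cod n = cod m" "cod g = cod f"
   using Par_Dom Par_Cod calculation sp by metis+
  ultimately show ?thesis using mf n by (auto simp: hom_spans_def)
 qed
 have ne: "X \<noteq> {}" if X: "X \<in> S" for X
 proof -
  have "X \<in> Hom \<P> A B" using assms X by blast
  then obtain m f where "X = pm m f" "(m, f) \<in> \<S> A B" by (rule Par_HomE)
  thus ?thesis using partial_map_self[of m f] by (auto simp: hom_spans_def)
 qed
 show "S = pms (\<Union>S)"
 proof (intro set_eqI iffI)
  fix X assume X: "X \<in> S"
  then obtain s where "s \<in> X" using ne by blast
  with * X show "X \<in> pms (\<Union>S)" by blast
 next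
  fix X assume "X \<in> pms (\<Union>S)"
  with * show "X \<in> S" by blast
 qed
 show "\<Union>S \<subseteq> \<S> A B" using * by blast
qed

lemma pms_Hom: "G \<subseteq> \<S> A B ==> pms G \<subseteq> Hom \<P> A B"
 using Par_Hom by (auto simp: subset_iff)

lemma restr_le_pm:
 assumes "s \<in> \<S> A B" "t \<in> \<S> A B'"
 shows "restr_le \<P> Par_restr (partial_map C M s) (partial_map C M t) \<longleftrightarrow> span_le C s t"
 using assms restr_le_iff[of "fst s" "snd s" "fst t" "snd t"] by (simp add: hom_spans_def)

lemma is_join_iff:
 assumes "G \<subseteq> \<S> A B" "j \<in> \<S> A B"
 shows "is_join \<P> Par_restr A B (pms G) (partial_map C M j) \<longleftrightarrow> span_join C M A B G j"
proof -
 have "(\<forall>k\<in>Hom \<P> A B. (\<forall>s\<in>pms G. restr_le \<P> Par_restr s k) \<longrightarrow> restr_le \<P> Par_restr (partial_map C M j) k) \<longleftrightarrow>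
  (\<forall>t\<in>\<S> A B. (\<forall>s\<in>G. span_le C s t) \<longrightarrow> span_le C j t)" (is "?l \<longleftrightarrow> ?r")
 proof
  assume l: ?l
  show ?r
  proof (intro ballI impI)
   fix t assume t: "t \<in> \<S> A B" "\<forall>s\<in>G. span_le C s t"
   have "partial_map C M t \<in> Hom \<P> A B" using t Par_Hom by (cases t) auto
   moreover have "\<forall>s\<in>pms G. restr_le \<P> Par_restr s (partial_map C M t)"
    using t assms restr_le_pm by blast
   ultimately show "span_le C j t" using l restr_le_pm[OF assms(2) t(1)] by blast
  qed
 next
  assume r: ?r
  show ?l
  proof (intro ballI impI)
   fix k assume k: "k \<in> Hom \<P> A B" "\<forall>s\<in>pms G. restr_le \<P> Par_restr s k"
   obtain t where t: "k = partial_map C M t" "t \<in> \<S> A B" using k Par_HomE by metis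
   hence "\<forall>s\<in>G. span_le C s t" using k assms restr_le_pm by blast
   thus "restr_le \<P> Par_restr (partial_map C M j) k"
    using r t restr_le_pm[OF assms(2) t(2)] by blast
  qed
 qed
 moreover have "(\<forall>s\<in>pms G. restr_le \<P> Par_restr s (partial_map C M j)) \<longleftrightarrow> (\<forall>s\<in>G. span_le C s j)"
  using assms restr_le_pm by blast
 moreover have "partial_map C M j \<in> Hom \<P> A B" using assms Par_Hom by (cases j) auto
 ultimately show ?thesis using assms unfolding is_join_def span_join_def by blast
qed

lemma compatible_set_iff:
 assumes "G \<subseteq> \<S> A B" "A \<in> Ob C" "B \<in> Ob C"
 shows "compatible_set \<P> Par_restr A B (pms G) \<longleftrightarrow> span_compat C G"
proof -
 have "pm m f \<cdot>[\<P>] Par_restr (pm n g) = pm n g \<cdot>[\<P>] Par_restr (pm m f) \<longleftrightarrow>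
   (\<forall>p q. pullback C m n p q \<longrightarrow> f \<cdot> p = g \<cdot> q)" if "(m, f) \<in> G" "(n, g) \<in> G" for m f n g
 proof -
  have sp: "(m, f) \<in> spans C M" "(n, g) \<in> spans C M" "cod m = cod n" "m \<in> M" "n \<in> M"
   using subsetD[OF assms(1) that(1)] subsetD[OF assms(1) that(2)] by (auto simp: hom_spans_def spans_iff)
  obtain q p where "pullback C n m q p" using pullback_exists[of n m] sp by (metis M_Ar)
  hence "pullback C m n p q" using pullback_sym by blast
  thus ?thesis using compatible_iff[OF sp(1,2)] by blast
 qed
 thus ?thesis
  using assms pms_Hom[OF assms(1)] unfolding compatible_set_def span_compat_def by fastforce
qed

lemma pms_restr:
 assumes "G \<subseteq> \<S> A B"
 shows "Par_restr ` pms G = pms ((\<lambda>(m, f). (m, m)) ` G)"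
proof -
 have "Par_restr (partial_map C M s) = partial_map C M (case s of (m, f) \<Rightarrow> (m, m))" if "s \<in> G" for s
  using assms that by (cases s) (auto simp: Par_restr hom_spans_def)
 thus ?thesis by (simp add: image_image)
qed

text \<open>Representatives of all composites of members of \<open>G\<close> with the partial map
  \<open>(p, k)\<close>, formed with every possible pullback.\<close>

definition span_precomp :: "('a \<times> 'a) set \<Rightarrow> 'a \<Rightarrow> 'a \<Rightarrow> ('a \<times> 'a) set" where
 "span_precomp G p k = {(p \<cdot> a, f \<cdot> b) | m f a b. (m, f) \<in> G \<and> pullback C k m a b}"

lemma span_precomp_hom:
 assumes "G \<subseteq> \<S> A B" "(p, k) \<in> \<S> E A"
 shows "span_precomp G p k \<subseteq> \<S> E B"
proof
 fix x assume "x \<in> span_precomp G p k"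
 then obtain m f a b where x: "x = (p \<cdot> a, f \<cdot> b)" "(m, f) \<in> G" and pb: "pullback C k m a b"
  by (auto simp: span_precomp_def)
 have "(m, f) \<in> \<S> A B" using x assms by blast
 thus "x \<in> \<S> E B"
  using x assms(2) pullbackD[OF pb] M_pullback[OF pullback_sym[OF pb]] by (auto simp: hom_spans_iff)
qed

lemma pms_precomp:
 assumes "G \<subseteq> \<S> A B" "(p, k) \<in> \<S> E A"
 shows "(\<lambda>s. s \<cdot>[\<P>] pm p k) ` pms G = pms (span_precomp G p k)"
proof -
 have sp: "(p, k) \<in> spans C M" using assms(2) by (simp add: hom_spans_def)
 have sG: "(m, f) \<in> spans C M \<and> cod k = cod m" if "(m, f) \<in> G" for m f
  using assms that by (auto simp: hom_spans_def spans_iff)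
 have *: "pm m f \<cdot>[\<P>] pm p k = pm (p \<cdot> a) (f \<cdot> b)" if "(m, f) \<in> G" "pullback C k m a b" for m f a b
  using Par_comp[OF sp _ that(2)] sG[OF that(1)] by blast
 show ?thesis
 proof (intro set_eqI iffI)
  fix x assume "x \<in> (\<lambda>s. s \<cdot>[\<P>] pm p k) ` pms G"
  then obtain m f where mf: "(m, f) \<in> G" "x = pm m f \<cdot>[\<P>] pm p k" by auto
  obtain a b where "pullback C k m a b" using pullback_span[of p k m f] sG[OF mf(1)] sp by metis
  thus "x \<in> pms (span_precomp G p k)"
   using mf * unfolding span_precomp_def by (auto intro!: image_eqI)
 next
  fix x assume "x \<in> pms (span_precomp G p k)"
  then obtain m f a b where "(m, f) \<in> G" "pullback C k m a b" "x = pm (p \<cdot> a) (f \<cdot> b)"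
   by (auto simp: span_precomp_def)
  thus "x \<in> (\<lambda>s. s \<cdot>[\<P>] pm p k) ` pms G" using *[of m f a b] by (metis imageI)
 qed
qed

text \<open>The join axioms translated from isomorphism classes to spans; this is the form in which
  they are verified for sheaves.\<close>

lemma geometricI:
 assumes ex: "\<And>A B G. [|A \<in> Ob C; B \<in> Ob C; G \<subseteq> \<S> A B; span_compat C G|] ==> \<exists>j. span_join C M A B G j"
  and J1: "\<And>A B G j h. [|G \<subseteq> \<S> A B; span_compat C G; span_join C M A B G (j, h)|] ==>
   span_join C M A A ((\<lambda>(m, f). (m, m)) ` G) (j, j)"
  and J2: "\<And>A B E G j h p k a b. [|G \<subseteq> \<S> A B; span_compat C G; span_join C M A B G (j, h);
   (p, k) \<in> \<S> E A; pullback C k j a b|] ==>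
   span_join C M E B (span_precomp G p k) (p \<cdot> a, h \<cdot> b)"
 shows "geometric U C M"
proof -
 interpret R: restriction_category \<P> Par_restr by (rule restriction_category_Par)
 have "join_restriction_category \<P> Par_restr"
 proof (unfold_locales, goal_cases)
  case (1 A B S)
  note G = Par_set_spans[of S A B]
  have S: "S \<subseteq> Hom \<P> A B" "A \<in> Ob C" "B \<in> Ob C" using 1 by (auto simp: compatible_set_def)
  have "span_compat C (\<Union>S)"
   using 1 compatible_set_iff[OF G(2)[OF S(1)] S(2,3)] G(1)[OF S(1)] by metis
  then obtain j where j: "span_join C M A B (\<Union>S) j" using ex[OF S(2,3) G(2)[OF S(1)]] by blast
  thus ?case
   using is_join_iff[OF G(2)[OF S(1)], of j] G(1)[OF S(1)] unfolding span_join_def by metis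
 next
  case (2 A B S X)
  note G = Par_set_spans[of S A B]
  have S: "S \<subseteq> Hom \<P> A B" "A \<in> Ob C" "B \<in> Ob C" using 2 by (auto simp: compatible_set_def)
  have GH: "\<Union>S \<subseteq> \<S> A B" and SG: "S = pms (\<Union>S)" using G S by auto
  have comp: "span_compat C (\<Union>S)" using 2 compatible_set_iff[OF GH S(2,3)] SG by metis
  obtain j h where j: "X = pm j h" "(j, h) \<in> \<S> A B"
   using 2 Par_HomE unfolding is_join_def by metis
  hence "span_join C M A B (\<Union>S) (j, h)" using is_join_iff[OF GH j(2)] 2 SG by metis
  note * = J1[OF GH comp this]
  have "(\<lambda>(m, f). (m, m)) ` \<Union>S \<subseteq> \<S> A A" using GH by (auto simp: hom_spans_def spans_iff)
  from is_join_iff[OF this, of "(j, j)"] * have "is_join \<P> Par_restr A A (pms ((\<lambda>(m, f). (m, m)) ` \<Union>S)) (pm j j)"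
   unfolding span_join_def by blast
  thus ?case using pms_restr[OF GH] SG j Par_restr[of j h] by (simp add: hom_spans_def)
 next
  case (3 A B S X g E)
  note G = Par_set_spans[of S A B]
  have S: "S \<subseteq> Hom \<P> A B" "A \<in> Ob C" "B \<in> Ob C" using 3 by (auto simp: compatible_set_def)
  have GH: "\<Union>S \<subseteq> \<S> A B" and SG: "S = pms (\<Union>S)" using G S by auto
  have comp: "span_compat C (\<Union>S)" using 3 compatible_set_iff[OF GH S(2,3)] SG by metis
  obtain j h where j: "X = pm j h" "(j, h) \<in> \<S> A B"
   using 3 Par_HomE unfolding is_join_def by metis
  obtain p k where pk: "g = pm p k" "(p, k) \<in> \<S> E A" using 3 Par_HomE by metis
  have j': "span_join C M A B (\<Union>S) (j, h)" using is_join_iff[OF GH j(2)] 3 j SG by metis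
  have sp: "(p, k) \<in> spans C M" "(j, h) \<in> spans C M" "cod k = cod j"
   using j pk by (auto simp: hom_spans_def)
  obtain a b where ab: "pullback C k j a b" using pullback_span[OF sp] by metis
  note * = J2[OF GH comp j' pk(2) ab]
  from is_join_iff[OF span_precomp_hom[OF GH pk(2)], of "(p \<cdot> a, h \<cdot> b)"] *
  have "is_join \<P> Par_restr E B (pms (span_precomp (\<Union>S) p k)) (pm (p \<cdot> a) (h \<cdot> b))"
   unfolding span_join_def by blast
  thus ?case using pms_precomp[OF GH pk(2)] Par_comp[OF sp(1,2) ab] j pk SG by metis
 qed
 thus ?thesis using mcat by (simp add: geometric_def)
qed

lemma Par_inclusion_simps:
 "A \<in> Ob C ==> FO (Par_inclusion C M) A = A"
 "f \<in> Ar C ==> FA (Par_inclusion C M) f = pm (Idt C (dom f)) f"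
 by (auto simp: Par_inclusion_def partial_map_def)

lemma Par_comp_total:
 assumes "(n, g) \<in> spans C M" "f \<in> Ar C" "cod f = cod n" "pullback C n f q p"
 shows "pm n g \<cdot>[\<P>] pm (Idt C (dom f)) f = pm p (g \<cdot> q)"
 using Par_comp[OF _ assms(1) pullback_sym[OF assms(4)], of "Idt C (dom f)"] assms pullbackD[OF assms(4)]
 by (auto simp: spans_iff)

lemma cat_functor_Par_inclusion: "cat_functor C \<P> (Par_inclusion C M)"
proof (rule cat_functorI, goal_cases)
 case (10 f g)
 have "pullback C (Idt C (dom g)) f f (Idt C (dom f))"
  using 10 by (intro pullback_id_left) auto
 from Par_comp_total[OF _ _ _ this, of g] show ?case
  using 10 by (simp add: Par_inclusion_simps spans_iff)
qed (auto simp: Par_inclusion_simps Par_Idt spans_iff Par_Ar Par_Dom Par_Cod category_Par category_axioms, auto simp: Par_inclusion_def)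

end

section \<open>Joins of spans, joins of M-subobjects, and covers\<close>

section \<open>Joins in geometric M-categories\<close>

lemma span_le_iff: "span_le C (m, f) (n, g) \<longleftrightarrow> (\<exists>u. u \<in> Ar C \<and> Dom C u = Dom C m \<and> Cod C u = Dom C n \<and>
   n \<cdot>[C] u = m \<and> g \<cdot>[C] u = f)"
 by (auto simp: span_le_def)

context mcat
begin

lemma subobj_le_iff: "subobj_le C m n \<longleftrightarrow> (\<exists>u\<in>Ar C. dom u = dom m \<and> cod u = dom n \<and> n \<cdot> u = m)"
 by (auto simp: subobj_le_def Hom_iff)

text \<open>An M-subobject \<open>m\<close> is handled as the partial identity
  \<open>(m, m)\<close>, so that joins of subobjects become joins of restriction idempotents, to
  which (J1) and (J2) apply.\<close>

lemma span_le_diag: "span_le C (m, m) (n, n) \<longleftrightarrow> subobj_le C m n"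
 by (auto simp: span_le_def subobj_le_iff)

lemma span_le_subobj: "span_le C s t ==> subobj_le C (fst s) (fst t)"
 by (auto simp: span_le_def subobj_le_iff)

text \<open>As \<open>j\<close> is monic, \<open>u\<close> is the pullback of \<open>m\<close> along
  \<open>j\<close>.\<close>

lemma factor_M:
 assumes "j \<in> M" "m \<in> M" "u \<in> Ar C" "cod u = dom j" "j \<cdot> u = m"
 shows "u \<in> M"
proof -
 have "pullback C m j (Idt C (dom u)) u"
  using pullback_sym[OF pullback_mono_factor[of j u]] assms by simp
 thus ?thesis using M_pullback assms(2) by blast
qed

lemma subobj_equiv_iso:
 assumes "subobj_le C m n" "subobj_le C n m" "m \<in> M" "n \<in> M" "cod m = cod n"
 obtains u where "is_iso C u" "dom u = dom m" "cod u = dom n" "n \<cdot> u = m"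
 using mono_le_antisym[of m n] assms by (metis M_mono)

lemma subobj_top_iso:
 assumes "m \<in> M" "A = cod m" "subobj_le C (Idt C A) m"
 shows "is_iso C m"
proof -
 obtain u where "u \<in> Ar C" "dom u = A" "cod u = dom m" "m \<cdot> u = Idt C A"
  using assms by (auto simp: subobj_le_iff)
 thus ?thesis using assms by (intro split_mono_iso[of m u]) auto
qed

lemma span_diag_compat: "R \<subseteq> M ==> span_compat C ((\<lambda>m. (m, m)) ` R)"
 by (auto simp: span_compat_def dest: pullbackD)

lemma span_diag_hom: "R \<subseteq> {m \<in> M. cod m = A} ==> (\<lambda>m. (m, m)) ` R \<subseteq> \<S> A A"
 by (auto simp: hom_spans_iff)

lemma span_join_subobj_join:
 assumes "span_join C M A A ((\<lambda>m. (m, m)) ` R) (j, j)"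
 shows "is_subobj_join C M A R j"
proof -
 have "subobj_le C j n" if "n \<in> M" "cod n = A" "\<forall>a\<in>R. subobj_le C a n" for n
 proof -
  have "(n, n) \<in> \<S> A A" using that by (auto simp: hom_spans_iff)
  hence "span_le C (j, j) (n, n)"
   using assms that by (auto simp: span_join_def span_le_diag)
  thus ?thesis by (simp add: span_le_diag)
 qed
 thus ?thesis
  using assms by (auto simp: is_subobj_join_def span_join_def hom_spans_iff span_le_diag)
qed

end

locale gcat = mcat C U M for C :: "('o, 'a) cat" (structure) and U :: "'u itself" and M +
 assumes join_Par: "join_restriction_category (Par C M) Par_restr"
begin

sublocale J: join_restriction_category "Par C M" Par_restr
 by (rule join_Par)

lemma geometric: "geometric U C M"
 using mcat join_Par by (simp add: geometric_def)

lemma span_join_exists: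
 assumes "A \<in> Ob C" "B \<in> Ob C" "G \<subseteq> \<S> A B" "span_compat C G"
 obtains j h where "span_join C M A B G (j, h)"
proof -
 have "compatible_set \<P> Par_restr A B (pms G)" using compatible_set_iff assms by blast
 then obtain X where X: "is_join \<P> Par_restr A B (pms G) X" using J.join_exists by blast
 then obtain j h where "X = pm j h" "(j, h) \<in> \<S> A B" using Par_HomE unfolding is_join_def by metis
 thus thesis using X is_join_iff assms that by blast
qed

lemma hom_spans_Ob: "(j, h) \<in> \<S> A B ==> A \<in> Ob C \<and> B \<in> Ob C"
 by (auto simp: hom_spans_iff)

lemma span_join_restr:
 assumes "G \<subseteq> \<S> A B" "span_compat C G" "span_join C M A B G (j, h)"
 shows "span_join C M A A ((\<lambda>m. (m, m)) ` fst ` G) (j, j)"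
proof -
 have j: "(j, h) \<in> \<S> A B" using assms by (simp add: span_join_def)
 hence AB: "A \<in> Ob C" "B \<in> Ob C" using hom_spans_Ob by auto
 have "is_join \<P> Par_restr A A (Par_restr ` pms G) (Par_restr (pm j h))"
  by (rule J.J1) (use AB compatible_set_iff is_join_iff assms j in blast)+
 moreover have "(\<lambda>(m, f). (m, m)) ` G = (\<lambda>m. (m, m)) ` fst ` G" by force
 moreover have "(\<lambda>m. (m, m)) ` fst ` G \<subseteq> \<S> A A"
  using assms by (intro span_diag_hom) (auto simp: hom_spans_def spans_iff)
 ultimately show ?thesis
  using is_join_iff[of "(\<lambda>m. (m, m)) ` fst ` G" A A "(j, j)"] pms_restr[OF assms(1)] Par_restr[of j h] j
  by (simp add: hom_spans_iff spans_iff)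
qed

text \<open>This is (J2) for precomposition with a total map, where composing amounts to pulling
  back the domain.\<close>

lemma span_join_pullback:
 assumes "G \<subseteq> \<S> A B" "span_compat C G" "span_join C M A B G (j, h)"
  and f: "f \<in> Ar C" "dom f = E" "cod f = A" and pb: "pullback C j f p i"
 shows "span_join C M E B (span_precomp G (Idt C E) f) (i, h \<cdot> p)"
proof -
 have j: "(j, h) \<in> \<S> A B" using assms by (simp add: span_join_def)
 hence AB: "A \<in> Ob C" "B \<in> Ob C" using hom_spans_Ob by auto
 have f': "(Idt C E, f) \<in> \<S> E A" using f by (auto simp: hom_spans_iff)
 have "is_join \<P> Par_restr E B ((\<lambda>s. s \<cdot>[\<P>] pm (Idt C E) f) ` pms G) (pm j h \<cdot>[\<P>] pm (Idt C E) f)"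
  by (rule J.J2) (use AB compatible_set_iff is_join_iff assms j Par_Hom[OF f'] in blast)+
 moreover have "pm j h \<cdot>[\<P>] pm (Idt C E) f = pm i (h \<cdot> p)"
  using Par_comp_total[of j h f p i] j f pb by (simp add: hom_spans_iff spans_iff)
 moreover have "(i, h \<cdot> p) \<in> \<S> E B"
  using j f pullbackD[OF pb] M_pullback[OF pb] by (auto simp: hom_spans_iff)
 ultimately show ?thesis
  using is_join_iff[OF span_precomp_hom[OF assms(1) f']] pms_precomp[OF assms(1) f'] by simp
qed

lemma subobj_join_exists:
 assumes "R \<subseteq> {m \<in> M. cod m = A}" "A \<in> Ob C"
 obtains j where "is_subobj_join C M A R j" "span_join C M A A ((\<lambda>m. (m, m)) ` R) (j, j)"
proof -
 have R: "R \<subseteq> M" "(\<lambda>m. (m, m)) ` R \<subseteq> \<S> A A" using assms span_diag_hom[OF assms(1)] by auto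
 obtain j h where "span_join C M A A ((\<lambda>m. (m, m)) ` R) (j, h)"
  using span_join_exists[OF assms(2,2) R(2) span_diag_compat[OF R(1)]] .
 from span_join_restr[OF R(2) span_diag_compat[OF R(1)] this]
 have "span_join C M A A ((\<lambda>m. (m, m)) ` R) (j, j)" by (simp add: image_image)
 thus thesis using that span_join_subobj_join by blast
qed

text \<open>Among spans the universal property is tested against more upper bounds than among
  subobjects. It still holds because the join \<open>i\<close> of the partial identities exists as a
  span and has to agree with \<open>j\<close> as a subobject.\<close>

lemma subobj_join_span_join:
 assumes R: "R \<subseteq> {m \<in> M. cod m = A}" and j: "is_subobj_join C M A R j"
 shows "span_join C M A A ((\<lambda>m. (m, m)) ` R) (j, j)"
proof -
 have A: "A \<in> Ob C" using j by (auto simp: is_subobj_join_def)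
 obtain i where i: "is_subobj_join C M A R i" "span_join C M A A ((\<lambda>m. (m, m)) ` R) (i, i)"
  using subobj_join_exists[OF R A] .
 have ij: "subobj_le C i j" "subobj_le C j i" "i \<in> M" "j \<in> M" "cod i = A" "cod j = A"
  using i(1) j by (auto simp: is_subobj_join_def)
 have "span_le C (j, j) (n, g)" if le: "span_le C (i, i) (n, g)" and "(n, g) \<in> \<S> A A" for n g
 proof -
  obtain u where u: "u \<in> Ar C" "dom u = dom i" "cod u = dom n" "n \<cdot> u = i" "g \<cdot> u = i"
   using le unfolding span_le_iff by blast
  obtain v where v: "v \<in> Ar C" "dom v = dom j" "cod v = dom i" "i \<cdot> v = j"
   using ij by (auto simp: subobj_le_iff)
  show ?thesis unfolding span_le_iff
   using u v that(2) comp_reassoc[OF u(4), of v] comp_reassoc[OF u(5), of v]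
   by (intro exI[of _ "u \<cdot> v"]) (simp add: hom_spans_iff)
 qed
 thus ?thesis
  using i(2) j ij R unfolding span_join_def is_subobj_join_def
  by (auto simp: hom_spans_iff span_le_diag)
qed

definition pb_family :: "'a set \<Rightarrow> 'a \<Rightarrow> 'a set" where
 "pb_family R f = {i. \<exists>m\<in>R. \<exists>p. pullback C m f p i}"

lemma pb_family_M: "R \<subseteq> M ==> pb_family R f \<subseteq> {m \<in> M. cod m = dom f}"
proof
 fix i assume "R \<subseteq> M" "i \<in> pb_family R f"
 then obtain m p where "m \<in> M" "pullback C m f p i" by (auto simp: pb_family_def)
 thus "i \<in> {m \<in> M. cod m = dom f}" using M_pullback pullbackD(8) by blast
qed

text \<open>Stability of joins of subobjects: (J2) pulls the join of the partial identities back
  along \<open>f\<close>, and (J1) then forgets the second legs.\<close>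

lemma subobj_join_pullback:
 assumes R: "R \<subseteq> {m \<in> M. cod m = A}" and j: "is_subobj_join C M A R j"
  and f: "f \<in> Ar C" "cod f = A" and pb: "pullback C j f p i"
 shows "is_subobj_join C M (dom f) (pb_family R f) i"
proof -
 have R': "R \<subseteq> M" "(\<lambda>m. (m, m)) ` R \<subseteq> \<S> A A" using R span_diag_hom[OF R] by auto
 note co = span_diag_compat[OF R'(1)] and sj = subobj_join_span_join[OF R j]
 note sp = span_join_pullback[OF R'(2) co sj f(1) refl f(2) pb]
 have h: "(Idt C (dom f), f) \<in> \<S> (dom f) A" using f by (auto simp: hom_spans_iff)
 let ?S = "span_precomp ((\<lambda>m. (m, m)) ` R) (Idt C (dom f)) f"
 have sub: "?S \<subseteq> \<S> (dom f) A"
  by (rule span_precomp_hom[OF R'(2) h])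
 have "a \<in> pb_family R f \<longleftrightarrow> a \<in> fst ` ?S" for a
 proof
  assume "a \<in> pb_family R f"
  then obtain m q where mq: "m \<in> R" "pullback C m f q a" by (auto simp: pb_family_def)
  hence "(Idt C (dom f) \<cdot> a, m \<cdot> q) \<in> ?S"
   unfolding span_precomp_def using pullback_sym[OF mq(2)] by blast
  thus "a \<in> fst ` ?S"
   using pullbackD[OF mq(2)] by force
 next
  assume "a \<in> fst ` ?S"
  then obtain m b q where mq: "m \<in> R" "pullback C f m b q" "a = Idt C (dom f) \<cdot> b"
   by (auto simp: span_precomp_def)
  thus "a \<in> pb_family R f"
   using pullback_sym[OF mq(2)] pullbackD[OF mq(2)] by (auto simp: pb_family_def)
 qed
 hence eq: "fst ` ?S = pb_family R f" by blast
 \<comment> \<open>Every second leg is \<open>f\<close> composed with the first, so agreement over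
   an intersection is automatic.\<close>
 have "span_compat C (?S)"
  unfolding span_compat_def
 proof (intro allI impI)
  fix m g n k p q
  assume g: "(m, g) \<in> ?S"
   and k: "(n, k) \<in> ?S" and pq: "pullback C m n p q"
  have *: "m \<in> Ar C \<and> g = f \<cdot> m \<and> cod m = dom f"
   if mg: "(m, g) \<in> ?S" for m g
  proof -
   obtain n a b where "m = Idt C (dom f) \<cdot> a" "g = n \<cdot> b" "pullback C f n a b"
    using mg by (auto simp: span_precomp_def)
   thus ?thesis using pullbackD[of f n a b] by simp
  qed
  have "m \<in> Ar C" "n \<in> Ar C" "g = f \<cdot> m" "k = f \<cdot> n" "cod m = dom f" "cod n = dom f"
   using *[OF g] *[OF k] by auto
  thus "g \<cdot> p = k \<cdot> q" using pullbackD[OF pq] f by simp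
 qed
 from span_join_restr[OF sub this sp] show ?thesis
  unfolding eq by (rule span_join_subobj_join)
qed

lemma basic_cover_M: "basic_cover C M A R ==> R \<subseteq> {a \<in> M. cod a = A}"
 by (simp add: basic_cover_def)

lemma basic_cover_Ob: "basic_cover C M A R ==> A \<in> Ob C"
 unfolding basic_cover_def is_subobj_join_def by (metis Cod_in M_Ar)

lemma basic_coverI:
 assumes "A \<in> Ob C" "R \<subseteq> {a \<in> M. cod a = A}"
  "\<And>n. n \<in> M ==> cod n = A ==> \<forall>a\<in>R. subobj_le C a n ==> subobj_le C (Idt C A) n"
 shows "basic_cover C M A R"
proof -
 have "subobj_le C a (Idt C A)" if "a \<in> R" for a
  using that assms(1,2) by (auto simp: subobj_le_iff intro!: bexI[of _ a])
 thus ?thesis using assms by (simp add: basic_cover_def is_subobj_join_def)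
qed

lemma basic_cover_le:
 assumes "basic_cover C M A R" "n \<in> M" "cod n = A" "\<forall>a\<in>R. subobj_le C a n"
 shows "is_iso C n"
 using assms basic_cover_Ob[OF assms(1)]
 by (intro subobj_top_iso[of n A]) (auto simp: basic_cover_def is_subobj_join_def)

lemma basic_cover_pullback:
 assumes "basic_cover C M A R" "f \<in> Ar C" "cod f = A"
 shows "basic_cover C M (dom f) (pb_family R f)"
proof -
 have "pullback C (Idt C A) f f (Idt C (dom f))" using assms by (intro pullback_id_left) auto
 from subobj_join_pullback[OF basic_cover_M[OF assms(1)] _ assms(2,3) this]
 have "is_subobj_join C M (dom f) (pb_family R f) (Idt C (dom f))"
  using assms(1) by (simp add: basic_cover_def)
 moreover have "R \<subseteq> M" using basic_cover_M[OF assms(1)] by blast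
 ultimately show ?thesis using pb_family_M[of R f] by (simp add: basic_cover_def)
qed

text \<open>Let \<open>n\<close> contain all the composites. Its pullback along \<open>a\<close> in
  \<open>R\<close> contains the cover \<open>S a\<close>, hence is invertible, so \<open>n\<close>
  contains \<open>a\<close>; as this holds for all of \<open>R\<close>, \<open>n\<close> is
  everything.\<close>

lemma basic_cover_trans:
 assumes R: "basic_cover C M A R" and S: "\<And>a. a \<in> R ==> basic_cover C M (dom a) (S a)"
 shows "basic_cover C M A (\<Union>a\<in>R. (\<lambda>b. a \<cdot> b) ` S a)"
proof (rule basic_coverI)
 show "A \<in> Ob C" by (rule basic_cover_Ob[OF R])
 have S': "b \<in> M" "cod b = dom a" "a \<in> M" "cod a = A" if "a \<in> R" "b \<in> S a" for a b
  using basic_cover_M[OF S[OF that(1)]] basic_cover_M[OF R] that by auto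
 thus "(\<Union>a\<in>R. (\<lambda>b. a \<cdot> b) ` S a) \<subseteq> {a \<in> M. cod a = A}" by auto
 fix n assume n: "n \<in> M" "cod n = A" "\<forall>a\<in>\<Union>a\<in>R. (\<lambda>b. a \<cdot> b) ` S a. subobj_le C a n"
 have "subobj_le C a n" if a: "a \<in> R" for a
 proof -
  have aM: "a \<in> M" "cod a = A" using basic_cover_M[OF R] a by auto
  obtain p q where pq: "pullback C n a p q" "q \<in> M" "p \<in> Ar C" "dom p = dom q"
   "cod p = dom n" "cod q = dom a" "n \<cdot> p = a \<cdot> q"
   by (rule pullback_exists[of n a]) (use aM n in auto)
  have "subobj_le C b q" if b: "b \<in> S a" for b
  proof -
   obtain u where u: "u \<in> Ar C" "dom u = dom (a \<cdot> b)" "cod u = dom n" "n \<cdot> u = a \<cdot> b"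
    using n(3) a b by (auto simp: subobj_le_iff)
   obtain w where "w \<in> Ar C" "dom w = dom b" "cod w = dom p" "q \<cdot> w = b"
    using pullback_lift[OF pq(1), of u b] u S'[OF a b] by auto
   thus ?thesis using pq by (auto simp: subobj_le_iff)
  qed
  hence "is_iso C q" using basic_cover_le[OF S[OF a], of q] pq by auto
  then obtain r where r: "r \<in> Ar C" "dom r = cod q" "cod r = dom q" "q \<cdot> r = Idt C (cod q)"
   using isoE by metis
  have "n \<cdot> (p \<cdot> r) = a" using r pq aM n comp_reassoc[OF pq(7), of r] by simp
  thus ?thesis unfolding subobj_le_iff using r pq aM n by (intro bexI[of _ "p \<cdot> r"]) simp_all
 qed
 thus "subobj_le C (Idt C A) n" using R n by (simp add: basic_cover_def is_subobj_join_def)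
qed

text \<open>The total maps \<open>f\<close> and \<open>g\<close> are both upper bounds of the spans
  \<open>(a, f a)\<close>. The join \<open>(j, h)\<close> of these lies below both, and
  \<open>j\<close> is invertible because its domain is the join of the cover.\<close>

lemma basic_cover_unique:
 assumes "basic_cover C M A R" "f \<in> Ar C" "g \<in> Ar C" "dom f = A" "dom g = A" "cod f = cod g"
  "\<And>a. a \<in> R ==> f \<cdot> a = g \<cdot> a"
 shows "f = g"
proof -
 have R: "R \<subseteq> {a \<in> M. cod a = A}" and A: "A \<in> Ob C"
  using assms basic_cover_M basic_cover_Ob by auto
 define G where "G = (\<lambda>a. (a, f \<cdot> a)) ` R"
 have G: "G \<subseteq> \<S> A (cod f)" using R assms by (auto simp: G_def hom_spans_iff)
 have co: "span_compat C G"
  unfolding span_compat_def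
 proof (intro allI impI)
  fix m g n k p q
  assume "(m, g) \<in> G" "(n, k) \<in> G" and pq: "pullback C m n p q"
  hence "g = f \<cdot> m" "k = f \<cdot> n" "cod m = A" "cod n = A" "m \<in> Ar C" "n \<in> Ar C"
   using R by (auto simp: G_def)
  thus "g \<cdot> p = k \<cdot> q" using pullbackD[OF pq] assms(2,4) by simp
 qed
 obtain j h where jh: "span_join C M A (cod f) G (j, h)"
  using span_join_exists[OF A _ G co] assms by (metis Cod_in)
 have "fst ` G = R" by (force simp: G_def)
 hence "is_subobj_join C M A R j"
  using span_join_subobj_join span_join_restr[OF G co jh] by simp
 hence j: "is_iso C j" "cod j = A"
  using basic_cover_le[OF assms(1)] by (auto simp: is_subobj_join_def)
 have le: "h = k \<cdot> j" if "k \<in> Ar C" "dom k = A" "cod k = cod f" "\<And>a. a \<in> R ==> f \<cdot> a = k \<cdot> a" for k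
 proof -
  have "span_le C (a, f \<cdot> a) (Idt C A, k)" if a: "a \<in> R" for a
  proof -
   have "a \<in> Ar C" "cod a = A" "f \<cdot> a = k \<cdot> a"
    using R a \<open>\<And>a. a \<in> R ==> f \<cdot> a = k \<cdot> a\<close> by auto
   thus ?thesis unfolding span_le_iff using A by (intro exI[of _ a]) simp
  qed
  hence "span_le C s (Idt C A, k)" if "s \<in> G" for s
   using that by (auto simp: G_def)
  moreover have "(Idt C A, k) \<in> \<S> A (cod f)" using that A by (auto simp: hom_spans_iff)
  ultimately have "span_le C (j, h) (Idt C A, k)" using jh by (auto simp: span_join_def)
  thus ?thesis using j A by (auto simp: span_le_def)
 qed
 obtain v where v: "j \<in> Ar C" "v \<in> Ar C" "dom v = cod j" "cod v = dom j" "j \<cdot> v = Idt C (cod j)"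
  using isoE[OF j(1)] by metis
 have "f \<cdot> j = g \<cdot> j" using le[of f] le[of g] assms by auto
 hence "(f \<cdot> j) \<cdot> v = (g \<cdot> j) \<cdot> v" by simp
 thus ?thesis using v j assms by simp
qed

text \<open>The join of a compatible family is total when the domains of the family cover, since by
  (J1) its domain is the join of those domains.\<close>

lemma basic_cover_glue:
 assumes "basic_cover C M A (fst ` G)" "span_compat C G" "B \<in> Ob C"
  and "\<And>m f. (m, f) \<in> G ==> f \<in> Ar C \<and> dom f = dom m \<and> cod f = B"
 obtains h where "h \<in> Ar C" "dom h = A" "cod h = B" "\<And>m f. (m, f) \<in> G ==> h \<cdot> m = f"
proof -
 have A: "A \<in> Ob C" by (rule basic_cover_Ob[OF assms(1)])
 have G: "G \<subseteq> \<S> A B"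
  using basic_cover_M[OF assms(1)] assms(4) by (force simp: hom_spans_iff)
 obtain j h where jh: "span_join C M A B G (j, h)"
  using span_join_exists[OF A assms(3) G assms(2)] .
 have "is_subobj_join C M A (fst ` G) j"
  using span_join_subobj_join span_join_restr[OF G assms(2) jh] by simp
 hence j: "is_iso C j" "cod j = A"
  using basic_cover_le[OF assms(1)] by (auto simp: is_subobj_join_def)
 obtain v where v: "j \<in> Ar C" "v \<in> Ar C" "dom v = cod j" "cod v = dom j"
  "v \<cdot> j = Idt C (dom j)"
  using isoE[OF j(1)] by metis
 have h: "h \<in> Ar C" "dom h = dom j" "cod h = B" using jh by (auto simp: span_join_def hom_spans_iff)
 have "(h \<cdot> v) \<cdot> m = f" if mf: "(m, f) \<in> G" for m f
 proof -
  have "span_le C (m, f) (j, h)" using jh mf by (auto simp: span_join_def)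
  then obtain u where u: "u \<in> Ar C" "dom u = dom m" "cod u = dom j" "j \<cdot> u = m" "h \<cdot> u = f"
   by (auto simp: span_le_def)
  thus ?thesis using v h j comp_reassoc[OF v(5), of u] unfolding u(4)[symmetric] by simp
 qed
 thus thesis using that[of "h \<cdot> v"] v h j by simp
qed

text \<open>If \<open>n\<close> contains every \<open>u\<close> through which a member of
  \<open>G\<close> sits in \<open>(j, h)\<close>, then \<open>(j n, h n)\<close> is still an upper
  bound of \<open>G\<close>; minimality of \<open>(j, h)\<close> then splits \<open>n\<close>.
  Together with \<open>span_join_coverI\<close> this describes joins by covers of their
  domain.\<close>

lemma span_join_cover:
 assumes j: "span_join C M A B G (j, h)" and G: "G \<subseteq> \<S> A B"
 shows "basic_cover C M (dom j) {u \<in> Ar C. cod u = dom j \<and> (j \<cdot> u, h \<cdot> u) \<in> G}"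
proof (rule basic_coverI)
 have jM: "j \<in> M" "cod j = A" "h \<in> Ar C" "dom h = dom j" "cod h = B"
  using j by (auto simp: span_join_def hom_spans_iff)
 show "dom j \<in> Ob C" using jM by simp
 show "{u \<in> Ar C. cod u = dom j \<and> (j \<cdot> u, h \<cdot> u) \<in> G} \<subseteq> {a \<in> M. cod a = dom j}"
 proof clarsimp
  fix u assume u: "u \<in> Ar C" "cod u = dom j" "(j \<cdot> u, h \<cdot> u) \<in> G"
  have "j \<cdot> u \<in> M" using subsetD[OF G u(3)] by (simp add: hom_spans_iff)
  thus "u \<in> M" by (rule factor_M[OF jM(1) _ u(1,2)]) simp
 qed
 fix n assume n: "n \<in> M" "cod n = dom j" and le: "\<forall>u\<in>{u \<in> Ar C. cod u = dom j \<and> (j \<cdot> u, h \<cdot> u) \<in> G}. subobj_le C u n"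
 have "span_le C (m, f) (j \<cdot> n, h \<cdot> n)" if mf: "(m, f) \<in> G" for m f
 proof -
  have "span_le C (m, f) (j, h)" using j mf by (auto simp: span_join_def)
  then obtain u where u: "u \<in> Ar C" "dom u = dom m" "cod u = dom j" "j \<cdot> u = m" "h \<cdot> u = f" by (auto simp: span_le_iff)
  then obtain w where w: "w \<in> Ar C" "dom w = dom u" "cod w = dom n" "n \<cdot> w = u" using le mf by (auto simp: subobj_le_iff)
  thus ?thesis unfolding span_le_iff using u n jM by (intro exI[of _ w]) simp
 qed
 moreover have "(j \<cdot> n, h \<cdot> n) \<in> \<S> A B" using jM n by (simp add: hom_spans_iff)
 ultimately have "span_le C (j, h) (j \<cdot> n, h \<cdot> n)" using j by (force simp: span_join_def)
 then obtain w where w: "w \<in> Ar C" "dom w = dom j" "cod w = dom n" "j \<cdot> (n \<cdot> w) = j"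
  using jM n by (auto simp: span_le_iff)
 have "n \<cdot> w = Idt C (dom j)" by (rule mono_cancel[OF M_mono[OF jM(1)]]) (use w jM n in simp_all)
 thus "subobj_le C (Idt C (dom j)) n" using w jM by (auto simp: subobj_le_iff)
qed

text \<open>For another upper bound \<open>(n, g)\<close>, the pullback of \<open>n\<close> along
  \<open>j\<close> contains the cover \<open>R\<close>, hence is invertible and yields
  \<open>w\<close> with \<open>n w = j\<close>. The maps \<open>g w\<close> and \<open>h\<close>
  agree on the cover, hence are equal.\<close>

lemma span_join_coverI:
 assumes jh: "(j, h) \<in> \<S> A B" and ub: "\<And>s. s \<in> G ==> span_le C s (j, h)"
  and R: "basic_cover C M (dom j) R" and RG: "\<And>r. r \<in> R ==> (j \<cdot> r, h \<cdot> r) \<in> G"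
 shows "span_join C M A B G (j, h)"
 unfolding span_join_def
proof (intro conjI ballI impI jh)
 have jM: "j \<in> M" "cod j = A" "h \<in> Ar C" "dom h = dom j" "cod h = B" using jh by (auto simp: hom_spans_iff)
 fix t assume t0: "t \<in> \<S> A B" and tub: "\<forall>s\<in>G. span_le C s t"
 obtain n g where t: "t = (n, g)" by fastforce
 have n: "n \<in> M" "g \<in> Ar C" "dom n = dom g" "cod n = A" "cod g = B" using t0 t by (auto simp: hom_spans_iff)
 have v: "\<exists>v\<in>Ar C. dom v = dom r \<and> cod v = dom n \<and> n \<cdot> v = j \<cdot> r \<and> g \<cdot> v = h \<cdot> r" and rM: "r \<in> M" "cod r = dom j"
  if r: "r \<in> R" for r
 proof -
  show rM: "r \<in> M" "cod r = dom j" using basic_cover_M[OF R] r by auto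
  have "span_le C (j \<cdot> r, h \<cdot> r) (n, g)" using tub RG[OF r] t by blast
  thus "\<exists>v\<in>Ar C. dom v = dom r \<and> cod v = dom n \<and> n \<cdot> v = j \<cdot> r \<and> g \<cdot> v = h \<cdot> r"
   using jM rM by (auto simp: span_le_iff)
 qed
 obtain a b where ab: "pullback C n j a b" "b \<in> M" using pullback_exists[of n j] n jM by (metis M_Ar)
 note D = pullbackD[OF ab(1)]
 have "subobj_le C r b" if r: "r \<in> R" for r
 proof -
  obtain v where v: "v \<in> Ar C" "dom v = dom r" "cod v = dom n" "n \<cdot> v = j \<cdot> r" using v[OF r] by blast
  obtain w where "w \<in> Ar C" "dom w = dom r" "cod w = dom a" "b \<cdot> w = r"
   using pullback_lift[OF ab(1), of v r] v rM[OF r] by auto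
  thus ?thesis unfolding subobj_le_iff using D by auto
 qed
 hence "is_iso C b" using basic_cover_le[OF R ab(2)] D by simp
 then obtain c where c: "c \<in> Ar C" "dom c = cod b" "cod c = dom b" "b \<cdot> c = Idt C (cod b)" using isoE by metis
 define w where "w = a \<cdot> c"
 have w: "w \<in> Ar C" "dom w = dom j" "cod w = dom n" "n \<cdot> w = j" using c D jM comp_reassoc[OF D(9), of c] by (simp_all add: w_def)
 have "g \<cdot> w = h"
 proof (rule basic_cover_unique[OF R])
  fix r assume r: "r \<in> R"
  obtain v where v: "v \<in> Ar C" "dom v = dom r" "cod v = dom n" "n \<cdot> v = j \<cdot> r" "g \<cdot> v = h \<cdot> r" using v[OF r] by blast
  have "w \<cdot> r = v"
   by (rule mono_cancel[OF M_mono[OF n(1)]]) (use v w rM[OF r] n comp_reassoc[OF w(4), of r] in simp_all)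
  thus "g \<cdot> w \<cdot> r = h \<cdot> r" using v w n rM[OF r] by simp
 qed (use w n jM in simp_all)
 thus "span_le C (j, h) t" unfolding t span_le_iff using w by blast
qed (rule ub)

end

section \<open>M-functors, and their join preservation expressed by covers\<close>

section \<open>Functors between M-categories\<close>

locale mfun = S: mcat C U M + T: mcat D V N
 for C :: "('o, 'a) cat" and U :: "'u itself" and M and D :: "('p, 'b) cat" and V :: "'v itself" and N +
 fixes F :: "('o, 'a, 'p, 'b) ftor"
 assumes mfunctor: "mfunctor C M D N F"
begin

sublocale cat_functor C D F
 using mfunctor by (simp add: mfunctor_def)

lemma FA_M [simp]: "m \<in> M ==> FA F m \<in> N"
 using mfunctor by (simp add: mfunctor_def)

lemma FA_pullback: "pullback C m f p q ==> m \<in> M ==> pullback D (FA F m) (FA F f) (FA F p) (FA F q)"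
 using mfunctor unfolding mfunctor_def by blast

abbreviation "F2 \<equiv> (\<lambda>(m, f). (FA F m, FA F f))"

lemma FA_spans: "(m, f) \<in> spans C M ==> (FA F m, FA F f) \<in> spans D N"
 by (auto simp: spans_iff)

lemma FA_hom_spans: "(m, f) \<in> hom_spans C M A B ==> (FA F m, FA F f) \<in> hom_spans D N (FO F A) (FO F B)"
 by (auto simp: hom_spans_iff)

lemma FA_span_le:
 assumes "span_le C s t" "s \<in> hom_spans C M A B" "t \<in> hom_spans C M A B"
 shows "span_le D (F2 s) (F2 t)"
proof -
 obtain m f n g where st: "s = (m, f)" "t = (n, g)" by (cases s, cases t) auto
 obtain u where u: "u \<in> Ar C" "Dom C u = Dom C m" "Cod C u = Dom C n" "n \<cdot>[C] u = m" "g \<cdot>[C] u = f"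
  using assms st by (auto simp: span_le_def)
 have "FA F n \<cdot>[D] FA F u = FA F (n \<cdot>[C] u)" "FA F g \<cdot>[D] FA F u = FA F (g \<cdot>[C] u)"
  using u assms(3) st FA_comp[of u n] FA_comp[of u g] by (simp_all add: hom_spans_iff)
 thus ?thesis unfolding st case_prod_conv span_le_iff using st u assms(2,3)
  by (intro exI[of _ "FA F u"]) (simp add: hom_spans_iff)
qed

abbreviation "PF \<equiv> Par_functor C M D N F"

lemma PF_FO [simp]: "FO PF = FO F"
 by (simp add: Par_functor_def)

text \<open>The image of an isomorphism class need not be a full class, but all its members have
  isomorphic images, so saturating it produces a single class.\<close>

lemma PF_FA:
 assumes mf: "(m, f) \<in> spans C M"
 shows "FA PF (S.pm m f) = T.pm (FA F m) (FA F f)"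
proof -
 have *: "T.pm (FA F n) (FA F g) = T.pm (FA F m) (FA F f)" if ng: "(n, g) \<in> S.pm m f" for n g
 proof -
  obtain u where u: "is_iso C u" "Dom C u = Dom C n" "Cod C u = Dom C m" "m \<cdot>[C] u = n" "f \<cdot>[C] u = g"
   using ng mf S.partial_map_mem by blast
  have "(n, g) \<in> spans C M" using mf u S.iso_M[OF u(1)] by (auto simp: spans_iff)
  moreover have "FA F m \<cdot>[D] FA F u = FA F (m \<cdot>[C] u)" "FA F f \<cdot>[D] FA F u = FA F (f \<cdot>[C] u)"
   using u mf by (auto simp: FA_comp spans_iff)
  ultimately show ?thesis
   using T.partial_map_eq_iff[OF FA_spans FA_spans[OF mf], of n g] FA_iso[OF u(1)] u mf
   by (auto simp: spans_iff intro!: exI[of _ "FA F u"])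
 qed
 have "span_equiv D N `` (F2 ` S.pm m f) = (\<Union>x\<in>S.pm m f. partial_map D N (F2 x))"
  by (auto simp: partial_map_def)
 also have "\<dots> = (\<Union>x\<in>S.pm m f. T.pm (FA F m) (FA F f))"
  by (rule SUP_cong) (use * in auto)
 also have "\<dots> = T.pm (FA F m) (FA F f)" using S.partial_map_self[OF mf] by auto
 finally show ?thesis using S.Par_Ar[OF mf] by (simp add: Par_functor_def)
qed

lemma restriction_functor_PF: "restriction_functor (Par C M) Par_restr (Par D N) Par_restr PF"
proof -
 have "cat_functor (Par C M) (Par D N) PF"
 proof (rule cat_functorI, goal_cases)
  case (4) thus ?case using FO_Ob by (auto simp: PiE_def)
 next
  case (5 X) thus ?case using PF_FA T.Par_Ar FA_spans by (auto simp: S.Par_Ar_iff)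
 next
  case (7 X)
  then obtain m f where X: "X = S.pm m f" "(m, f) \<in> spans C M" by (auto simp: S.Par_Ar_iff)
  thus ?case using PF_FA[OF X(2)] FA_spans[OF X(2)]
   by (simp add: T.Par_Dom S.Par_Dom) (simp add: spans_iff)
 next
  case (8 X)
  then obtain m f where X: "X = S.pm m f" "(m, f) \<in> spans C M" by (auto simp: S.Par_Ar_iff)
  thus ?case using PF_FA[OF X(2)] FA_spans[OF X(2)]
   by (simp add: T.Par_Cod S.Par_Cod) (simp add: spans_iff)
 next
  case (9 A) thus ?case using PF_FA[of "Idt C A" "Idt C A"] by (simp add: S.Par_Idt T.Par_Idt spans_iff)
 next
  case (10 X Y)
  then obtain m f n g where X: "X = S.pm m f" "(m, f) \<in> spans C M" "Y = S.pm n g" "(n, g) \<in> spans C M"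
   by (auto simp: S.Par_Ar_iff)
  hence "Cod C f = Cod C n" using 10 by (simp add: S.Par_Dom S.Par_Cod)
  then obtain p q where pq: "pullback C f n p q" "(m \<cdot>[C] p, g \<cdot>[C] q) \<in> spans C M"
   "p \<in> M" "q \<in> Ar C" "Cod C p = Dom C f" "Cod C q = Dom C n"
   using S.pullback_span[OF X(2,4)] by metis
  have "pullback D (FA F f) (FA F n) (FA F p) (FA F q)"
   using T.pullback_sym[OF FA_pullback[OF S.pullback_sym[OF pq(1)]]] X(4) by (simp add: spans_iff)
  from T.Par_comp[OF FA_spans[OF X(2)] FA_spans[OF X(4)] this]
  have "FA PF Y \<cdot>[Par D N] FA PF X = T.pm (FA F m \<cdot>[D] FA F p) (FA F g \<cdot>[D] FA F q)"
   using X PF_FA by simp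
  also have "\<dots> = FA PF (Y \<cdot>[Par C M] X)"
   using PF_FA[OF pq(2)] S.Par_comp[OF X(2,4) pq(1)] X pq by (simp add: FA_comp spans_iff)
  finally show ?case by simp
 qed (auto simp: S.category_Par T.category_Par Par_functor_def)
 moreover have "FA PF (Par_restr X) = Par_restr (FA PF X)" if "X \<in> Ar (Par C M)" for X
 proof -
  obtain m f where X: "X = S.pm m f" "(m, f) \<in> spans C M" using \<open>X \<in> _\<close> by (auto simp: S.Par_Ar_iff)
  thus ?thesis using FA_spans by (simp add: S.Par_restr PF_FA T.Par_restr S.span_restr)
 qed
 ultimately show ?thesis by (simp add: restriction_functor_def)
qed

lemma PF_pms: "G \<subseteq> hom_spans C M A B ==> FA PF ` S.pms G = T.pms (F2 ` G)"
proof -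
 assume G: "G \<subseteq> hom_spans C M A B"
 have "FA PF (partial_map C M s) = partial_map D N (F2 s)" if "s \<in> G" for s
  using PF_FA[of "fst s" "snd s"] G that by (auto simp: case_prod_unfold hom_spans_def)
 thus ?thesis by (simp add: image_image)
qed

lemma F2_hom_spans: "G \<subseteq> hom_spans C M A B ==> F2 ` G \<subseteq> hom_spans D N (FO F A) (FO F B)"
 using FA_hom_spans by auto

end

locale gfun = S: gcat C U M + T: gcat D V N + mfun C U M D V N F
 for C :: "('o, 'a) cat" and U :: "'u itself" and M and D :: "('p, 'b) cat" and V :: "'v itself" and N
  and F :: "('o, 'a, 'p, 'b) ftor"
begin

text \<open>A join is an upper bound whose domain is covered by members of the family, and both
  properties are preserved when covers are.\<close>

lemma join_functorI:
 assumes cov: "\<And>A R. basic_cover C M A R ==> basic_cover D N (FO F A) (FA F ` R)"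
 shows "join_restriction_functor (Par C M) Par_restr (Par D N) Par_restr PF"
 unfolding join_restriction_functor_def
proof (intro conjI allI impI restriction_functor_PF)
 fix A B X J
 assume *: "compatible_set (Par C M) Par_restr A B X \<and> is_join (Par C M) Par_restr A B X J"
 define G where "G = \<Union>X"
 have X: "X \<subseteq> Hom (Par C M) A B" "A \<in> Ob C" "B \<in> Ob C" using * by (auto simp: compatible_set_def)
 have GH: "G \<subseteq> hom_spans C M A B" and XG: "X = S.pms G" using S.Par_set_spans[OF X(1)] by (auto simp: G_def)
 have comp: "span_compat C G" using * S.compatible_set_iff[OF GH X(2,3)] XG by metis
 obtain j h where j: "J = S.pm j h" "(j, h) \<in> hom_spans C M A B"
  using * S.Par_HomE unfolding is_join_def by metis
 have J: "span_join C M A B G (j, h)" using S.is_join_iff[OF GH j(2)] * j XG by metis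
 have jM: "j \<in> M" "h \<in> Ar C" "Dom C h = Dom C j" using j by (auto simp: hom_spans_iff)
 have "span_join D N (FO F A) (FO F B) (F2 ` G) (FA F j, FA F h)"
 proof (rule T.span_join_coverI[OF FA_hom_spans[OF j(2)]])
  show "span_le D t (FA F j, FA F h)" if "t \<in> F2 ` G" for t
   using that J FA_span_le[of _ "(j, h)" A B] GH j by (force simp: span_join_def)
  show "basic_cover D N (Dom D (FA F j)) (FA F ` {u \<in> Ar C. Cod C u = Dom C j \<and> (j \<cdot>[C] u, h \<cdot>[C] u) \<in> G})"
   using cov[OF S.span_join_cover[OF J GH]] jM by simp
  fix r assume "r \<in> FA F ` {u \<in> Ar C. Cod C u = Dom C j \<and> (j \<cdot>[C] u, h \<cdot>[C] u) \<in> G}"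
  then obtain u where "u \<in> Ar C" "Cod C u = Dom C j" "(j \<cdot>[C] u, h \<cdot>[C] u) \<in> G" "r = FA F u" by blast
  thus "(FA F j \<cdot>[D] r, FA F h \<cdot>[D] r) \<in> F2 ` G"
   using jM FA_comp[of u j] FA_comp[of u h] by (auto intro!: rev_image_eqI)
 qed
 hence "is_join (Par D N) Par_restr (FO F A) (FO F B) (T.pms (F2 ` G)) (T.pm (FA F j) (FA F h))"
  using T.is_join_iff[OF F2_hom_spans[OF GH] FA_hom_spans[OF j(2)]] by blast
 thus "is_join (Par D N) Par_restr (FO PF A) (FO PF B) (FA PF ` X) (FA PF J)"
  using PF_pms[OF GH] PF_FA[of j h] j XG by (simp add: hom_spans_def)
qed

text \<open>A family is a cover exactly when the partial identities on it have the total identity as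
  join; this join is preserved.\<close>

lemma join_functor_cover:
 assumes "join_restriction_functor (Par C M) Par_restr (Par D N) Par_restr PF" "basic_cover C M A R"
 shows "basic_cover D N (FO F A) (FA F ` R)"
proof -
 have R: "R \<subseteq> {m \<in> M. Cod C m = A}" "A \<in> Ob C"
  using S.basic_cover_M[OF assms(2)] S.basic_cover_Ob[OF assms(2)] by auto
 define G where "G = (\<lambda>m. (m, m)) ` R"
 have G: "G \<subseteq> hom_spans C M A A" using S.span_diag_hom[OF R(1)] by (simp add: G_def)
 have I: "(Idt C A, Idt C A) \<in> hom_spans C M A A" using R by (auto simp: hom_spans_iff)
 have co: "span_compat C G" unfolding G_def using R by (intro S.span_diag_compat) auto
 have "is_subobj_join C M A R (Idt C A)" using assms(2) by (simp add: basic_cover_def)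
 from S.subobj_join_span_join[OF R(1) this]
 have "is_join (Par C M) Par_restr A A (S.pms G) (S.pm (Idt C A) (Idt C A))"
  using S.is_join_iff[OF G I] by (simp add: G_def)
 moreover have "compatible_set (Par C M) Par_restr A A (S.pms G)"
  using S.compatible_set_iff[OF G] R co by simp
 ultimately have "is_join (Par D N) Par_restr (FO PF A) (FO PF A) (FA PF ` S.pms G)
   (FA PF (S.pm (Idt C A) (Idt C A)))"
  using assms(1) unfolding join_restriction_functor_def by blast
 hence "span_join D N (FO F A) (FO F A) (F2 ` G) (Idt D (FO F A), Idt D (FO F A))"
  using T.is_join_iff[OF F2_hom_spans[OF G] FA_hom_spans[OF I]] PF_pms[OF G] PF_FA[of "Idt C A" "Idt C A"] R
  by (simp add: spans_iff)
 moreover have "F2 ` G = (\<lambda>m. (m, m)) ` FA F ` R" by (force simp: G_def)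
 ultimately have "is_subobj_join D N (FO F A) (FA F ` R) (Idt D (FO F A))"
  using T.span_join_subobj_join by simp
 thus ?thesis using R by (auto simp: basic_cover_def)
qed

end

section \<open>The topology in terms of sieves, and gluing along an M-functor\<close>

section \<open>Covering sieves\<close>

definition (in category) pull :: "'a set \<Rightarrow> 'a \<Rightarrow> 'a set" where
 "pull S f = {g \<in> Ar C. Cod C g = Dom C f \<and> f \<cdot> g \<in> S}"

text \<open>The principal sieve of \<open>m\<close>. M-subobjects are used through this sieve: the
  order becomes membership, and pulling back a subobject becomes pulling back the sieve.\<close>

definition (in category) factors :: "'a \<Rightarrow> 'a set" where
 "factors m = {f. \<exists>g\<in>Ar C. Cod C g = Dom C m \<and> f = m \<cdot> g}"

context category
begin

lemma sieveD:
 assumes "sieve C A S" "f \<in> S"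
 shows "f \<in> Ar C" "cod f = A" "\<And>g. g \<in> Ar C ==> cod g = dom f ==> f \<cdot> g \<in> S"
 using assms by (auto simp: sieve_def)

lemma sieveI:
 assumes "\<And>f. f \<in> S ==> f \<in> Ar C \<and> cod f = A"
  "\<And>f g. f \<in> S ==> g \<in> Ar C ==> cod g = dom f ==> f \<cdot> g \<in> S"
 shows "sieve C A S"
 using assms by (auto simp: sieve_def)

lemma sieve_pull:
 assumes "sieve C A S" "f \<in> Ar C" "cod f = A"
 shows "sieve C (dom f) (pull S f)"
proof (rule sieveI)
 fix g h assume g: "g \<in> pull S f" and h: "h \<in> Ar C" "cod h = dom g"
 hence "f \<cdot> g \<in> S" "cod h = dom (f \<cdot> g)" using assms by (auto simp: pull_def)
 hence "(f \<cdot> g) \<cdot> h \<in> S" using sieveD(3)[OF assms(1)] h by blast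
 thus "g \<cdot> h \<in> pull S f" using g h assms by (auto simp: pull_def)
qed (auto simp: pull_def)

lemma sieve_max: "sieve C A {f \<in> Ar C. cod f = A}"
 by (rule sieveI) auto

lemma sieve_factors: "m \<in> Ar C ==> sieve C (cod m) (factors m)"
proof (rule sieveI)
 fix f g assume m: "m \<in> Ar C" and "f \<in> factors m" and g: "g \<in> Ar C" "cod g = dom f"
 then obtain k where k: "k \<in> Ar C" "cod k = dom m" "f = m \<cdot> k" by (auto simp: factors_def)
 thus "f \<cdot> g \<in> factors m" unfolding factors_def using m g by (auto intro!: bexI[of _ "k \<cdot> g"])
qed (auto simp: factors_def)

lemma factors_self: "m \<in> Ar C ==> m \<in> factors m"
 unfolding factors_def by (auto intro!: bexI[of _ "Idt C (dom m)"])

lemma pull_factors: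
 assumes "pullback C m f p q"
 shows "pull (factors m) f = factors q"
proof (intro set_eqI iffI)
 note D = pullbackD[OF assms]
 fix g
 {
  assume "g \<in> pull (factors m) f"
  then obtain k where k: "k \<in> Ar C" "cod k = dom m" "f \<cdot> g = m \<cdot> k" and g: "g \<in> Ar C" "cod g = dom f"
   by (auto simp: factors_def pull_def)
  have "dom k = dom g"
   using comp_simps(2)[OF k(1) D(1) k(2)] comp_simps(2)[OF g(1) D(2) g(2)] k(3) by simp
  then obtain u where "u \<in> Ar C" "dom u = dom k" "cod u = dom p" "p \<cdot> u = k" "q \<cdot> u = g"
   using pullback_lift[OF assms k(1) g(1) _ k(2) g(2) k(3)[symmetric]] by blast
  thus "g \<in> factors q" using D unfolding factors_def by (auto intro!: bexI[of _ u])
 next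
  assume "g \<in> factors q"
  then obtain k where k: "k \<in> Ar C" "cod k = dom q" "g = q \<cdot> k" by (auto simp: factors_def)
  hence "f \<cdot> g = m \<cdot> (p \<cdot> k)" using D comp_reassoc[OF D(9), of k] by simp
  thus "g \<in> pull (factors m) f" using k D
   by (auto simp: pull_def factors_def intro!: bexI[of _ "p \<cdot> k"])
 }
qed

lemma covering_sieve_sieve: "covering_sieve C M A S ==> sieve C A S"
 by (simp add: covering_sieve_def)

lemma covering_superset: "covering_sieve C M A S ==> S \<subseteq> T ==> sieve C A T ==> covering_sieve C M A T"
 by (auto simp: covering_sieve_def)

end

context mcat
begin

lemma subobj_le_factors: "m \<in> M ==> subobj_le C n m \<longleftrightarrow> n \<in> factors m"
 by (auto simp: subobj_le_iff factors_def)

end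

context gcat
begin

abbreviation "cov \<equiv> covering_sieve C M"

lemma covering_Ob: "cov A S ==> A \<in> Ob C"
 using basic_cover_Ob by (auto simp: covering_sieve_def)

lemma covering_max:
 assumes "A \<in> Ob C" shows "cov A {f \<in> Ar C. cod f = A}"
proof -
 have "basic_cover C M A {Idt C A}" using assms by (intro basic_coverI) auto
 thus ?thesis unfolding covering_sieve_def using sieve_max assms by (auto intro!: exI[of _ "{Idt C A}"])
qed

lemma covering_pull:
 assumes "cov A S" "f \<in> Ar C" "cod f = A"
 shows "cov (dom f) (pull S f)"
proof -
 obtain R where R: "basic_cover C M A R" "R \<subseteq> S" and S: "sieve C A S"
  using assms by (auto simp: covering_sieve_def)
 have "i \<in> pull S f" if i: "i \<in> pb_family R f" for i
 proof -
  obtain m p where m: "m \<in> R" and pb: "pullback C m f p i" using i by (auto simp: pb_family_def)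
  note D = pullbackD[OF pb]
  have "m \<cdot> p \<in> S" using sieveD(3)[OF S] R m D by blast
  thus ?thesis using D by (simp add: pull_def)
 qed
 thus ?thesis using basic_cover_pullback[OF R(1) assms(2,3)] sieve_pull[OF S assms(2,3)]
  unfolding covering_sieve_def by blast
qed

text \<open>The local character of the topology: choosing a cover inside each pulled back sieve
  reduces it to transitivity of basic covers.\<close>

lemma covering_trans:
 assumes S: "cov A S" and T: "sieve C A T"
  and "\<And>f. f \<in> S ==> cov (dom f) (pull T f)"
 shows "cov A T"
proof -
 obtain R where R: "basic_cover C M A R" "R \<subseteq> S" using S by (auto simp: covering_sieve_def)
 have "\<forall>a\<in>R. \<exists>Q. basic_cover C M (dom a) Q \<and> Q \<subseteq> pull T a"
  using assms(3) R by (auto simp: covering_sieve_def)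
 then obtain Q where Q: "\<And>a. a \<in> R ==> basic_cover C M (dom a) (Q a)" "\<And>a. a \<in> R ==> Q a \<subseteq> pull T a"
  by (metis bchoice)
 have "(\<Union>a\<in>R. (\<lambda>b. a \<cdot> b) ` Q a) \<subseteq> T" using Q(2) by (auto simp: pull_def)
 thus ?thesis using basic_cover_trans[OF R(1) Q(1)] T unfolding covering_sieve_def by blast
qed

lemma covering_inter:
 assumes "cov A S" "cov A T"
 shows "cov A (S \<inter> T)"
proof (rule covering_trans[OF assms(1)])
 note s = covering_sieve_sieve[OF assms(1)] and t = covering_sieve_sieve[OF assms(2)]
 show "sieve C A (S \<inter> T)" using s t by (auto simp: sieve_def)
 thus "cov (dom f) (pull (S \<inter> T) f)" if "f \<in> S" for f
 proof -
  have f: "f \<in> Ar C" "cod f = A" using sieveD[OF s that] by auto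
  have "pull T f \<subseteq> pull (S \<inter> T) f" using sieveD[OF s that] by (auto simp: pull_def)
  thus ?thesis
   using covering_superset covering_pull[OF assms(2) f] sieve_pull[OF \<open>sieve C A (S \<inter> T)\<close> f] by blast
 qed
qed

text \<open>Principal sieves of M-maps are closed for the topology: if \<open>f\<close> factors
  through \<open>m\<close> locally, the pullback of \<open>m\<close> along \<open>f\<close> contains
  a cover and is therefore invertible.\<close>

lemma factors_closed:
 assumes "m \<in> M" "f \<in> Ar C" "cod f = cod m" "cov (dom f) (pull (factors m) f)"
 shows "f \<in> factors m"
proof -
 obtain p q where pq: "pullback C m f p q" "q \<in> M" using pullback_exists[OF assms(1-3)] by metis
 note D = pullbackD[OF pq(1)]
 obtain R where R: "basic_cover C M (dom f) R" "R \<subseteq> factors q"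
  using assms(4) pull_factors[OF pq(1)] by (auto simp: covering_sieve_def)
 hence "is_iso C q"
  using basic_cover_le[OF R(1) pq(2)] D subobj_le_factors[OF pq(2)] by blast
 then obtain r where r: "r \<in> Ar C" "dom r = cod q" "cod r = dom q" "q \<cdot> r = Idt C (cod q)"
  using isoE by metis
 have "f = m \<cdot> (p \<cdot> r)" using r D comp_reassoc[OF D(9), of r] by simp
 thus ?thesis using r D unfolding factors_def by (auto intro!: bexI[of _ "p \<cdot> r"])
qed

lemma sieve_generated:
 assumes R: "R \<subseteq> {m \<in> M. cod m = A}" shows "sieve C A (\<Union>m\<in>R. factors m)"
proof (rule sieveI)
 fix f assume "f \<in> (\<Union>m\<in>R. factors m)"
 then obtain m where m: "m \<in> R" "f \<in> factors m" by blast
 hence "m \<in> Ar C" "cod m = A" using R by auto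
 note s = sieveD[OF sieve_factors[OF this(1)] m(2), unfolded this(2)]
 show "f \<in> Ar C \<and> cod f = A" using s by simp
 show "f \<cdot> g \<in> (\<Union>m\<in>R. factors m)" if "g \<in> Ar C" "cod g = dom f" for g using s(3)[OF that] m(1) by blast
qed

lemma covering_generated:
 assumes R: "basic_cover C M A R" shows "cov A (\<Union>a\<in>R. factors a)"
proof -
 have "a \<in> factors a" if "a \<in> R" for a using factors_self M_Ar basic_cover_M[OF R] that by blast
 thus ?thesis using R sieve_generated[OF basic_cover_M[OF R]] unfolding covering_sieve_def by blast
qed

text \<open>The principal sieve of a join is the closure of the union of the principal sieves. It is
  closed by \<open>factors_closed\<close>; it is no larger because the pullback of the family along
  \<open>j\<close> covers the domain of \<open>j\<close>.\<close>

lemma factors_join: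
 assumes R: "R \<subseteq> {m \<in> M. cod m = A}" and j: "is_subobj_join C M A R j"
  and f: "f \<in> Ar C" "cod f = A"
 shows "f \<in> factors j \<longleftrightarrow> cov (dom f) (pull (\<Union>m\<in>R. factors m) f)"
proof
 let ?U = "\<Union>m\<in>R. factors m"
 have jM: "j \<in> M" "cod j = A" using j by (auto simp: is_subobj_join_def)
 {
  assume "cov (dom f) (pull ?U f)"
  moreover have "factors m \<subseteq> factors j" if m: "m \<in> R" for m
  proof
   fix g assume "g \<in> factors m"
   moreover have "m \<in> factors j"
    using m j jM subobj_le_factors by (auto simp: is_subobj_join_def)
   ultimately show "g \<in> factors j"
    using sieveD(3)[OF sieve_factors[of j]] jM by (auto simp: factors_def[of m])
  qed
  hence "pull ?U f \<subseteq> pull (factors j) f" by (auto simp: pull_def)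
  moreover have "sieve C (dom f) (pull (factors j) f)"
   using sieve_pull sieve_factors jM f by (metis M_Ar)
  ultimately show "f \<in> factors j" using covering_superset factors_closed jM f by blast
 next
  assume "f \<in> factors j"
  then obtain k where k: "k \<in> Ar C" "cod k = dom j" "f = j \<cdot> k" by (auto simp: factors_def)
  \<comment> \<open>The join \<open>j\<close> is pulled back along itself, where it becomes the
    identity.\<close>
  have "basic_cover C M (dom j) (pb_family R j)"
   unfolding basic_cover_def using subobj_join_pullback[OF R j _ _ pullback_mono_self] pb_family_M[of R j] R jM by auto
  moreover have "pb_family R j \<subseteq> pull ?U j"
  proof
   fix i assume "i \<in> pb_family R j"
   then obtain m p where mp: "m \<in> R" "pullback C m j p i" by (auto simp: pb_family_def)
   note D' = pullbackD[OF mp(2)]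
   have "j \<cdot> i \<in> factors m" using D' by (auto simp: factors_def intro!: bexI[of _ p])
   thus "i \<in> pull ?U j" using mp D' by (auto simp: pull_def)
  qed
  ultimately have "cov (dom j) (pull ?U j)"
   using sieve_pull[OF sieve_generated[OF R]] jM unfolding covering_sieve_def by (metis M_Ar)
  moreover have "pull (pull ?U j) k = pull ?U f" using k jM by (auto simp: pull_def)
  ultimately show "cov (dom f) (pull ?U f)"
   using covering_pull[of "dom j" "pull ?U j" k] k jM by simp
 }
qed

lemma factors_join_exists:
 assumes R: "R \<subseteq> {m \<in> M. cod m = A}" and A: "A \<in> Ob C"
 obtains j where "j \<in> M" "cod j = A" "\<And>f. f \<in> Ar C ==> cod f = A ==>
  f \<in> factors j \<longleftrightarrow> cov (dom f) (pull (\<Union>m\<in>R. factors m) f)"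
proof -
 obtain j where "is_subobj_join C M A R j" using subobj_join_exists[OF R A] by metis
 thus thesis using that[of j] factors_join[OF R] by (auto simp: is_subobj_join_def)
qed

end

text \<open>Geometric M-functors, with join preservation in its equivalent form on covers.\<close>

locale cfun = gfun +
 assumes cover: "basic_cover C M A R ==> basic_cover D N (FO F A) (FA F ` R)"
begin

lemma covering_unique:
 assumes S: "covering_sieve C M A S"
  and h: "h \<in> Ar D" "h' \<in> Ar D" "Dom D h = FO F A" "Dom D h' = FO F A" "Cod D h = Cod D h'"
  and eq: "\<And>f. f \<in> S ==> h \<cdot>[D] FA F f = h' \<cdot>[D] FA F f"
 shows "h = h'"
proof -
 obtain R where R: "basic_cover C M A R" "R \<subseteq> S" using S by (auto simp: covering_sieve_def)
 show ?thesis by (rule T.basic_cover_unique[OF cover[OF R(1)]]) (use R h eq in auto)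
qed

text \<open>With \<open>covering_unique\<close> this says that \<open>D(F -, B)\<close> is a sheaf.
  Matching data on the generating M-cover are compatible because \<open>F\<close> preserves the
  pullbacks of its members; agreement on an arbitrary arrow of the sieve is checked on the cover
  pulled back along it.\<close>

lemma covering_glue:
 assumes S: "covering_sieve C M A S" and B: "B \<in> Ob D"
  and x: "\<And>f. f \<in> S ==> x f \<in> Ar D \<and> Dom D (x f) = FO F (Dom C f) \<and> Cod D (x f) = B"
  and match: "\<And>f g. f \<in> S ==> g \<in> Ar C ==> Cod C g = Dom C f ==> x (f \<cdot>[C] g) = x f \<cdot>[D] FA F g"
 obtains h where "h \<in> Ar D" "Dom D h = FO F A" "Cod D h = B" "\<And>f. f \<in> S ==> h \<cdot>[D] FA F f = x f"
proof -
 obtain R where R: "basic_cover C M A R" "R \<subseteq> S" and sS: "sieve C A S" using S by (auto simp: covering_sieve_def)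
 define G where "G = (\<lambda>a. (FA F a, x a)) ` R"
 have RM: "a \<in> M" "Cod C a = A" "a \<in> S" if "a \<in> R" for a using S.basic_cover_M[OF R(1)] R(2) that by auto
 have "fst ` G = FA F ` R" by (force simp: G_def)
 hence bc: "basic_cover D N (FO F A) (fst ` G)" using cover[OF R(1)] by simp
 have "span_compat D G"
  unfolding span_compat_def
 proof (intro allI impI)
  fix m f n g p q assume "(m, f) \<in> G" "(n, g) \<in> G" and pq: "pullback D m n p q"
  then obtain a b where a: "a \<in> R" "m = FA F a" "f = x a" and b: "b \<in> R" "n = FA F b" "g = x b"
   by (auto simp: G_def)
  obtain r s where rs: "pullback C a b r s"
   using S.pullback_exists[of a b] RM[OF a(1)] RM[OF b(1)] by (metis S.M_Ar)
  note D = S.pullbackD[OF rs]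
  have "pullback D m n (FA F r) (FA F s)" using FA_pullback[OF rs] RM[OF a(1)] a b by simp
  then obtain w where w: "is_iso D w" "Cod D w = FO F (Dom C r)" "FA F r \<cdot>[D] w = p" "FA F s \<cdot>[D] w = q"
   using T.pullback_iso_unique[OF _ pq] D by (metis FA_simps(1))
  have "x a \<cdot>[D] FA F r = x b \<cdot>[D] FA F s"
   using match[OF RM(3)[OF a(1)] D(3)] match[OF RM(3)[OF b(1)] D(4)] D by simp
  from T.comp_reassoc[OF this, of w] show "f \<cdot>[D] p = g \<cdot>[D] q"
   using w a b D x[OF RM(3)[OF a(1)]] x[OF RM(3)[OF b(1)]] unfolding w(3,4)[symmetric] by simp
 qed
 moreover have "f \<in> Ar D \<and> Dom D f = Dom D m \<and> Cod D f = B" if "(m, f) \<in> G" for m f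
  using that RM x by (auto simp: G_def)
 ultimately obtain h where h: "h \<in> Ar D" "Dom D h = FO F A" "Cod D h = B" "\<And>m f. (m, f) \<in> G ==> h \<cdot>[D] m = f"
  using T.basic_cover_glue[OF bc _ B] by metis
 have hR: "h \<cdot>[D] FA F a = x a" if "a \<in> R" for a using h(4) that by (auto simp: G_def)
 have "h \<cdot>[D] FA F f = x f" if f: "f \<in> S" for f
 proof -
  have fA: "f \<in> Ar C" "Cod C f = A" using S.sieveD[OF sS f] by auto
  show ?thesis
  proof (rule T.basic_cover_unique[OF cover[OF S.basic_cover_pullback[OF R(1) fA]]])
   fix i' assume "i' \<in> FA F ` S.pb_family R f"
   then obtain i a k where i: "i' = FA F i" "a \<in> R" and pb: "pullback C a f k i"
    by (auto simp: S.pb_family_def)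
   note D = S.pullbackD[OF pb]
   have "(h \<cdot>[D] FA F f) \<cdot>[D] FA F i = h \<cdot>[D] FA F (f \<cdot>[C] i)"
    using h fA D FA_comp[of i f] by simp
   also have "\<dots> = x a \<cdot>[D] FA F k"
    using h(1-3) D RM[OF i(2)] FA_comp[of k a] T.comp_reassoc[OF hR[OF i(2)], of "FA F k"] by simp
   also have "\<dots> = x f \<cdot>[D] FA F i"
    using match[OF RM(3)[OF i(2)] D(3)] match[OF f D(4)] D by simp
   finally show "(h \<cdot>[D] FA F f) \<cdot>[D] i' = x f \<cdot>[D] i'" using i by simp
  qed (use h fA x[OF f] in auto)
 qed
 thus thesis using that h by blast
qed

end

text \<open>For the identity functor, the gluing lemmas are the sheaf condition for representables,
  so the topology is subcanonical.\<close>

lemma (in gcat) cfun_id: "cfun C U M C U M (id_functor C)"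
proof -
 have "mfunctor C M C M (id_functor C)"
  using cat_functor_id[OF category_axioms] pullbackD by (auto simp: mfunctor_def)
 then interpret mfun C U M C U M "id_functor C" by unfold_locales
 show ?thesis
 proof (unfold_locales)
  fix A R assume R: "basic_cover C M A R"
  hence "R \<subseteq> Ar C" "A \<in> Ob C" using basic_cover_M[OF R] basic_cover_Ob[OF R] by auto
  hence "FA (id_functor C) ` R = R" "FO (id_functor C) A = A" by (force simp: image_iff)+
  thus "basic_cover C M (FO (id_functor C) A) (FA (id_functor C) ` R)" using R by simp
 qed
qed

section \<open>Presheaves as families of sets with an action\<close>

section \<open>Presheaves and sheaves\<close>

lemma category_op: "category C ==> category (op_cat C)"
proof -
 assume "category C"
 then interpret category C .
 show ?thesis
  by unfold_locales (auto simp: op_cat_def Hom_iff)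
qed

lemma op_cat_simps [simp]:
 "Ob (op_cat C) = Ob C" "Ar (op_cat C) = Ar C" "Dom (op_cat C) = Cod C" "Cod (op_cat C) = Dom C"
 "Idt (op_cat C) = Idt C" "g \<cdot>[op_cat C] f = f \<cdot>[C] g"
 by (simp_all add: op_cat_def)

lemma Set_cat_simps [simp]:
 "X \<in> Ob (Set_cat :: ('u set, 'u set_arrow) cat) \<longleftrightarrow> small TYPE('u) X"
 "t \<in> Ar (Set_cat :: ('u set, 'u set_arrow) cat) \<longleftrightarrow>
   small TYPE('u) (fst t) \<and> small TYPE('u) (fst (snd t)) \<and> snd (snd t) \<in> fst t \<rightarrow>\<^sub>E fst (snd t)"
 "Dom Set_cat t = fst t" "Cod Set_cat t = fst (snd t)"
 "Idt Set_cat X = (X, X, \<lambda>x\<in>X. x)"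
 "t \<cdot>[Set_cat] s = (fst s, fst (snd t), \<lambda>x\<in>fst s. snd (snd t) (snd (snd s) x))"
 by (auto simp: Set_cat_def case_prod_unfold)

lemma category_Set: "category Set_cat"
proof (unfold_locales, goal_cases)
 case (4 s A B t E)
 thus ?case unfolding Hom_iff Set_cat_simps by (auto simp: PiE_iff)
next
 case (5 t) thus ?case
  by (cases t) (auto intro!: ext simp: PiE_iff extensional_def)
next
 case (6 t) thus ?case
  by (cases t) (auto intro!: ext simp: PiE_iff extensional_def)
next
 case (7 s A B t D r E)
 thus ?case unfolding Hom_iff Set_cat_simps by (auto intro!: ext simp: PiE_iff extensional_def)
qed (auto simp: Hom_iff)

text \<open>The values may lie in any type \<open>'x\<close>. Constructions whose elements are pairs
  or sets of pairs can be carried out without coding them in \<open>'u\<close>;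
  \<open>realize\<close> does the coding once at the end.\<close>

definition raw_presheaf :: "('o, 'a) cat \<Rightarrow> ('o \<Rightarrow> 'x set) \<Rightarrow> ('a \<Rightarrow> 'x \<Rightarrow> 'x) \<Rightarrow> bool" where
 "raw_presheaf C V act \<longleftrightarrow>
   (\<forall>f\<in>Ar C. \<forall>x\<in>V (Cod C f). act f x \<in> V (Dom C f)) \<and>
   (\<forall>A\<in>Ob C. \<forall>x\<in>V A. act (Idt C A) x = x) \<and>
   (\<forall>f\<in>Ar C. \<forall>g\<in>Ar C. Cod C g = Dom C f \<longrightarrow>
    (\<forall>x\<in>V (Cod C f). act (f \<cdot>[C] g) x = act g (act f x)))"

definition raw_map :: "('o, 'a) cat \<Rightarrow> ('o \<Rightarrow> 'x set) \<Rightarrow> ('a \<Rightarrow> 'x \<Rightarrow> 'x) \<Rightarrow>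
  ('o \<Rightarrow> 'y set) \<Rightarrow> ('a \<Rightarrow> 'y \<Rightarrow> 'y) \<Rightarrow> ('o \<Rightarrow> 'x \<Rightarrow> 'y) \<Rightarrow> bool" where
 "raw_map C V a W b \<phi> \<longleftrightarrow>
   (\<forall>A\<in>Ob C. \<forall>x\<in>V A. \<phi> A x \<in> W A) \<and>
   (\<forall>f\<in>Ar C. \<forall>x\<in>V (Cod C f). \<phi> (Dom C f) (a f x) = b f (\<phi> (Cod C f) x))"

definition raw_sheaf :: "('o, 'a) cat \<Rightarrow> 'a set \<Rightarrow> ('o \<Rightarrow> 'x set) \<Rightarrow> ('a \<Rightarrow> 'x \<Rightarrow> 'x) \<Rightarrow> bool" where
 "raw_sheaf C M V act \<longleftrightarrow>
   (\<forall>A\<in>Ob C. \<forall>S (x :: 'a \<Rightarrow> 'x). covering_sieve C M A S \<and> (\<forall>f\<in>S. x f \<in> V (Dom C f)) \<and>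
    (\<forall>f\<in>S. \<forall>g\<in>Ar C. Cod C g = Dom C f \<longrightarrow> x (f \<cdot>[C] g) = act g (x f)) \<longrightarrow>
    (\<exists>a\<in>V A. \<forall>f\<in>S. act f a = x f)) \<and>
   (\<forall>A\<in>Ob C. \<forall>S. covering_sieve C M A S \<longrightarrow>
    (\<forall>a\<in>V A. \<forall>b\<in>V A. (\<forall>f\<in>S. act f a = act f b) \<longrightarrow> a = b))"

abbreviation res :: "('o, 'u) presheaf \<Rightarrow> 'u \<Rightarrow> 'u \<Rightarrow> 'u" where
 "res \<equiv> restrict_along"

definition app :: "('o, 'u) presheaf_map \<Rightarrow> 'o \<Rightarrow> 'u \<Rightarrow> 'u" where
 "app t A x = snd (snd (component t A)) x"

definition mk_presheaf :: "('o, 'u) cat \<Rightarrow> ('o \<Rightarrow> 'u set) \<Rightarrow> ('u \<Rightarrow> 'u \<Rightarrow> 'u) \<Rightarrow> ('o, 'u) presheaf" where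
 "mk_presheaf C V act = \<lparr>FO = (\<lambda>A\<in>Ob C. V A),
   FA = (\<lambda>f\<in>Ar C. (V (Cod C f), V (Dom C f), \<lambda>x\<in>V (Cod C f). act f x))\<rparr>"

definition mk_map :: "('o, 'u) cat \<Rightarrow> ('o, 'u) presheaf \<Rightarrow> ('o, 'u) presheaf \<Rightarrow> ('o \<Rightarrow> 'u \<Rightarrow> 'u) \<Rightarrow>
  ('o, 'u) presheaf_map" where
 "mk_map C P Q \<phi> = \<lparr>Src = P, Tgt = Q, component = (\<lambda>A\<in>Ob C. (FO P A, FO Q A, \<lambda>x\<in>FO P A. \<phi> A x))\<rparr>"

lemma mk_map_simps [simp]: "Src (mk_map C P Q \<phi>) = P" "Tgt (mk_map C P Q \<phi>) = Q"
 by (simp_all add: mk_map_def)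

lemma app_mk_map [simp]: "A \<in> Ob C ==> x \<in> FO P A ==> app (mk_map C P Q \<phi>) A x = \<phi> A x"
 by (simp add: mk_map_def app_def)

lemma mk_presheaf_FO [simp]: "A \<in> Ob C ==> FO (mk_presheaf C V act) A = V A"
 by (simp add: mk_presheaf_def)

lemma mk_presheaf_res [simp]: "f \<in> Ar C ==> x \<in> V (Cod C f) ==> res (mk_presheaf C V act) f x = act f x"
 by (simp add: mk_presheaf_def restrict_along_def)

lemma mk_presheaf_Ob:
 fixes C :: "('o, 'u) cat"
 assumes C: "category C" and V: "raw_presheaf C V act" and small: "\<And>A. A \<in> Ob C ==> small TYPE('u) (V A)"
 shows "mk_presheaf C V act \<in> Ob (PSh C)"
proof -
 interpret category C by (rule C)
 have "cat_functor (op_cat C) Set_cat (mk_presheaf C V act)"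
 proof (rule cat_functorI, goal_cases)
  case (9 A) thus ?case using V
   by (auto simp: mk_presheaf_def raw_presheaf_def intro!: ext)
 next
  case (10 f g) thus ?case using V
   by (auto simp: mk_presheaf_def raw_presheaf_def intro!: ext)
 qed (use small V in \<open>auto simp: category_op[OF C] category_Set mk_presheaf_def raw_presheaf_def\<close>)
 thus ?thesis by (simp add: PSh_def)
qed

lemma category_PSh: "category (PSh C)"
 unfolding PSh_def by (rule category_functor_cat[OF category_Set])

lemma PSh_simps [simp]:
 "Dom (PSh C) = Src" "Cod (PSh C) = Tgt"
 "Src (Idt (PSh C) P) = P" "Tgt (Idt (PSh C) P) = P"
 "Src (t \<cdot>[PSh C] s) = Src s" "Tgt (t \<cdot>[PSh C] s) = Tgt t"
 by (simp_all add: PSh_def)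

lemma PSh_ArD: "t \<in> Ar (PSh C) ==> Src t \<in> Ob (PSh C) \<and> Tgt t \<in> Ob (PSh C)"
 by (auto simp: PSh_def dest: nat_transD)

lemma PSh_Ob_raw:
 fixes C :: "('o, 'u) cat"
 assumes C: "category C" and P: "P \<in> Ob (PSh C)"
 shows "raw_presheaf C (FO P) (res P)" "A \<in> Ob C ==> small TYPE('u) (FO P A)"
proof -
 interpret category C by (rule C)
 interpret P: cat_functor "op_cat C" Set_cat P using P by (simp add: PSh_def)
 have fa: "fst (FA P f) = FO P (Cod C f) \<and> fst (snd (FA P f)) = FO P (Dom C f) \<and>
   snd (snd (FA P f)) \<in> FO P (Cod C f) \<rightarrow>\<^sub>E FO P (Dom C f)" if "f \<in> Ar C" for f
  using P.FA_in[of f] P.FA_simps(1,2)[of f] that by auto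
 show "raw_presheaf C (FO P) (res P)"
  unfolding raw_presheaf_def
 proof (intro conjI ballI impI)
  fix f x assume "f \<in> Ar C" "x \<in> FO P (Cod C f)"
  thus "res P f x \<in> FO P (Dom C f)" using fa by (auto simp: restrict_along_def)
 next
  fix A x assume "A \<in> Ob C" "x \<in> FO P A"
  thus "res P (Idt C A) x = x" using P.FA_simps(3)[of A] by (simp add: restrict_along_def)
 next
  fix f g x assume "f \<in> Ar C" "g \<in> Ar C" "Cod C g = Dom C f" "x \<in> FO P (Cod C f)"
  thus "res P (f \<cdot>[C] g) x = res P g (res P f x)"
   using P.FA_comp[of f g] fa[of f] by (simp add: restrict_along_def)
 qed
 show "A \<in> Ob C ==> small TYPE('u) (FO P A)" using P.FO_in[of A] by simp
qed

lemma PSh_component: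
 fixes C :: "('o, 'u) cat"
 assumes t: "t \<in> Ar (PSh C)" and A: "A \<in> Ob C"
 shows "component t A = (FO (Src t) A, FO (Tgt t) A, app t A)"
  "app t A \<in> FO (Src t) A \<rightarrow>\<^sub>E FO (Tgt t) A"
proof -
 have n: "nat_trans (op_cat C) Set_cat t" using t by (simp add: PSh_def)
 have "fst (component t A) = FO (Src t) A" "fst (snd (component t A)) = FO (Tgt t) A"
  "snd (snd (component t A)) \<in> FO (Src t) A \<rightarrow>\<^sub>E FO (Tgt t) A"
  using nat_transD(4-6)[OF n] A by (auto simp del: PiE_iff)
 moreover have "app t A = snd (snd (component t A))" by (auto simp: app_def)
 ultimately show "component t A = (FO (Src t) A, FO (Tgt t) A, app t A)"
  "app t A \<in> FO (Src t) A \<rightarrow>\<^sub>E FO (Tgt t) A" by (simp_all add: prod_eq_iff)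
qed

lemma PSh_Ar_raw:
 assumes C: "category C" and t: "t \<in> Ar (PSh C)"
 shows "raw_map C (FO (Src t)) (res (Src t)) (FO (Tgt t)) (res (Tgt t)) (app t)"
proof -
 interpret category C by (rule C)
 have n: "nat_trans (op_cat C) Set_cat t" using t by (simp add: PSh_def)
 interpret P: cat_functor "op_cat C" Set_cat "Src t" using nat_transD(1)[OF n] .
 show ?thesis
  unfolding raw_map_def
 proof (intro conjI ballI)
  fix A x assume "A \<in> Ob C" "x \<in> FO (Src t) A"
  thus "app t A x \<in> FO (Tgt t) A" using PSh_component(2)[OF t] by auto
 next
  fix f x assume f: "f \<in> Ar C" and x: "x \<in> FO (Src t) (Cod C f)"
  have "fst (FA (Src t) f) = FO (Src t) (Cod C f)" using P.FA_simps(1)[of f] f by simp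
  have c: "component t (Dom C f) = (FO (Src t) (Dom C f), FO (Tgt t) (Dom C f), app t (Dom C f))"
   "component t (Cod C f) = (FO (Src t) (Cod C f), FO (Tgt t) (Cod C f), app t (Cod C f))"
   using PSh_component(1)[OF t] f by simp_all
  have "component t (Dom C f) \<cdot>[Set_cat] FA (Src t) f = FA (Tgt t) f \<cdot>[Set_cat] component t (Cod C f)"
   using nat_transD(7)[OF n, of f] f unfolding op_cat_simps by blast
  hence "snd (snd (component t (Dom C f) \<cdot>[Set_cat] FA (Src t) f)) x =
    snd (snd (FA (Tgt t) f \<cdot>[Set_cat] component t (Cod C f))) x" by (simp only:)
  thus "app t (Dom C f) (res (Src t) f x) = res (Tgt t) f (app t (Cod C f) x)"
   using x \<open>fst (FA (Src t) f) = _\<close> by (simp add: c restrict_along_def)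
 qed
qed

lemma PSh_ext:
 assumes "s \<in> Ar (PSh C)" "t \<in> Ar (PSh C)" "Src s = Src t" "Tgt s = Tgt t"
  "\<And>A x. A \<in> Ob C ==> x \<in> FO (Src s) A ==> app s A x = app t A x"
 shows "s = t"
proof (rule nat_trans_eqI)
 show "nat_trans (op_cat C) Set_cat s" "nat_trans (op_cat C) Set_cat t" using assms by (simp_all add: PSh_def)
 fix A assume "A \<in> Ob (op_cat C)"
 hence A: "A \<in> Ob C" by simp
 have "app s A = app t A"
  by (rule PiE_ext[OF PSh_component(2)[OF assms(1) A]]) (use PSh_component(2)[OF assms(2) A] assms A in auto)
 thus "component s A = component t A"
  using PSh_component(1)[OF assms(1) A] PSh_component(1)[OF assms(2) A] assms by simp
qed (use assms in auto)

lemma mk_map_Ar: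
 assumes C: "category C" and P: "P \<in> Ob (PSh C)" "Q \<in> Ob (PSh C)"
  and \<phi>: "raw_map C (FO P) (res P) (FO Q) (res Q) \<phi>"
 shows "mk_map C P Q \<phi> \<in> Ar (PSh C)"
proof -
 interpret category C by (rule C)
 interpret P: cat_functor "op_cat C" Set_cat P using P by (simp add: PSh_def)
 interpret Q: cat_functor "op_cat C" Set_cat Q using P by (simp add: PSh_def)
 note raw = PSh_Ob_raw[OF C P(1)] PSh_Ob_raw[OF C P(2)]
 have fa: "fst (FA P f) = FO P (Cod C f)" "fst (snd (FA P f)) = FO P (Dom C f)"
  "fst (FA Q f) = FO Q (Cod C f)" "fst (snd (FA Q f)) = FO Q (Dom C f)" if "f \<in> Ar C" for f
  using P.FA_simps(1,2)[of f] Q.FA_simps(1,2)[of f] that by auto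
 have "nat_trans (op_cat C) Set_cat (mk_map C P Q \<phi>)"
 proof (rule nat_transI, goal_cases)
  case (4 A) thus ?case using \<phi> raw by (auto simp: mk_map_def raw_map_def)
 next
  case (7 f)
  thus ?case using \<phi> raw(1,3) fa[of f]
   by (auto simp: mk_map_def raw_map_def raw_presheaf_def restrict_along_def[symmetric] intro!: ext)
 qed (auto simp: P.cat_functor_axioms Q.cat_functor_axioms mk_map_def)
 thus ?thesis by (simp add: PSh_def)
qed

lemma app_comp: "A \<in> Ob C ==> x \<in> FO (Src s) A ==> s \<in> Ar (PSh C) ==>
  app (t \<cdot>[PSh C] s) A x = app t A (app s A x)"
proof -
 assume A: "A \<in> Ob C" and x: "x \<in> FO (Src s) A" and s: "s \<in> Ar (PSh C)"
 have "component (t \<cdot>[PSh C] s) A = component t A \<cdot>[Set_cat] component s A" using A by (simp add: PSh_def)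
 thus ?thesis using x PSh_component(1)[OF s A] app_def[of "t \<cdot>[PSh C] s" A x] app_def[of t A]
  by simp
qed

lemma app_id: "A \<in> Ob C ==> x \<in> FO P A ==> app (Idt (PSh C) P) A x = x"
 by (simp add: app_def PSh_def)

lemma is_sheaf_iff:
 assumes C: "category C"
 shows "is_sheaf C M Q \<longleftrightarrow> Q \<in> Ob (PSh C) \<and> raw_sheaf C M (FO Q) (res Q)"
proof
 assume Q: "is_sheaf C M Q"
 hence ob: "Q \<in> Ob (PSh C)" and ex: "\<And>A S x. A \<in> Ob C ==> covering_sieve C M A S ==> matching_family C Q S x ==>
    \<exists>!a. a \<in> FO Q A \<and> (\<forall>f\<in>S. res Q f a = x f)" by (auto simp: is_sheaf_def)
 interpret category C by (rule C)
 have raw: "raw_presheaf C (FO Q) (res Q)" using PSh_Ob_raw(1)[OF C ob] .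
 have "a = b" if *: "A \<in> Ob C" "covering_sieve C M A S" "a \<in> FO Q A" "b \<in> FO Q A" "\<forall>f\<in>S. res Q f a = res Q f b"
  for A S a b
 proof -
  have "sieve C A S" using *(2) by (simp add: covering_sieve_def)
  hence "matching_family C Q S (\<lambda>f. res Q f a)"
   using raw *(3) sieveD(1,2)[of A S] unfolding matching_family_def raw_presheaf_def by metis
  from ex[OF *(1,2) this] show ?thesis using * by auto
 qed
 moreover have "\<exists>a\<in>FO Q A. \<forall>f\<in>S. res Q f a = x f"
  if "A \<in> Ob C" "covering_sieve C M A S" "\<forall>f\<in>S. x f \<in> FO Q (Dom C f)"
   "\<forall>f\<in>S. \<forall>g\<in>Ar C. Cod C g = Dom C f \<longrightarrow> x (f \<cdot>[C] g) = res Q g (x f)" for A S x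
  using ex[OF that(1,2), of x] that(3,4) unfolding matching_family_def by blast
 ultimately show "Q \<in> Ob (PSh C) \<and> raw_sheaf C M (FO Q) (res Q)"
  using ob unfolding raw_sheaf_def by blast
next
 assume Q: "Q \<in> Ob (PSh C) \<and> raw_sheaf C M (FO Q) (res Q)"
 have "\<exists>!a. a \<in> FO Q A \<and> (\<forall>f\<in>S. res Q f a = x f)"
  if A: "A \<in> Ob C" and S: "covering_sieve C M A S" and x: "matching_family C Q S x" for A S x
 proof -
  have "\<exists>a\<in>FO Q A. \<forall>f\<in>S. res Q f a = x f"
   using Q A S x unfolding raw_sheaf_def matching_family_def by blast
  then obtain a where a: "a \<in> FO Q A" "\<forall>f\<in>S. res Q f a = x f" by blast
  moreover have "b = a" if "b \<in> FO Q A" "\<forall>f\<in>S. res Q f b = x f" for b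
  proof -
   have "\<forall>f\<in>S. res Q f b = res Q f a" using a that by simp
   thus ?thesis using Q A S a(1) that(1) unfolding raw_sheaf_def by blast
  qed
  ultimately show ?thesis by blast
 qed
 thus "is_sheaf C M Q" using Q unfolding is_sheaf_def by blast
qed

section \<open>Sheaves and their maps in elementary terms\<close>

section \<open>The category of sheaves\<close>

lemma raw_presheafD:
 assumes "raw_presheaf C V act"
 shows "f \<in> Ar C ==> x \<in> V (Cod C f) ==> act f x \<in> V (Dom C f)"
  and "A \<in> Ob C ==> x \<in> V A ==> act (Idt C A) x = x"
  and "f \<in> Ar C ==> g \<in> Ar C ==> Cod C g = Dom C f ==> x \<in> V (Cod C f) ==>
   act (f \<cdot>[C] g) x = act g (act f x)"
 using assms unfolding raw_presheaf_def by blast+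

locale site = gcat C "TYPE('u)" M for C :: "('o, 'u) cat" (structure) and M +
 assumes univ: "universe TYPE('u)" and small_cat: "small_category TYPE('u) C"
begin

abbreviation "E \<equiv> Sh C M"

lemma small_Ar: "small TYPE('u) (Ar C)" and small_Ob: "small TYPE('u) (Ob C)"
 using small_cat by (auto simp: small_category_def)

lemma E_Ob: "Q \<in> Ob E \<longleftrightarrow> is_sheaf C M Q"
 by (auto simp: Sh_def is_sheaf_def)

lemma E_Ob_PSh: "Q \<in> Ob E ==> Q \<in> Ob (PSh C)"
 by (simp add: E_Ob is_sheaf_def)

lemma E_Dom: "Dom E = Src" and E_Cod: "Cod E = Tgt" and E_Cmp: "Cmp E = Cmp (PSh C)" and
 E_Idt: "Idt E = Idt (PSh C)"
 by (simp_all add: Sh_def)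

lemma E_Ar: "t \<in> Ar E \<longleftrightarrow> t \<in> Ar (PSh C) \<and> Dom E t \<in> Ob E \<and> Cod E t \<in> Ob E"
 using PSh_ArD by (auto simp: Sh_def)

sublocale PSh: category "PSh C"
 by (rule category_PSh)

sublocale E: category E
 unfolding Sh_def by (rule category_subcategory[OF category_PSh]) auto

lemma raw_presheaf: "Q \<in> Ob E ==> raw_presheaf C (FO Q) (res Q)"
 and small_FO: "Q \<in> Ob E ==> A \<in> Ob C ==> small TYPE('u) (FO Q A)"
 using PSh_Ob_raw[OF category_axioms E_Ob_PSh] by auto

lemma res_in [simp]: "Q \<in> Ob E ==> f \<in> Ar C ==> x \<in> FO Q (cod f) ==> res Q f x \<in> FO Q (dom f)"
 using raw_presheafD[OF raw_presheaf] by blast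

lemma res_id [simp]: "Q \<in> Ob E ==> A \<in> Ob C ==> x \<in> FO Q A ==> res Q (Idt C A) x = x"
 using raw_presheafD[OF raw_presheaf] by blast

lemma res_comp [simp]: "Q \<in> Ob E ==> f \<in> Ar C ==> g \<in> Ar C ==> cod g = dom f ==>
  x \<in> FO Q (cod f) ==> res Q (f \<cdot> g) x = res Q g (res Q f x)"
 using raw_presheafD[OF raw_presheaf] by blast

lemma raw_sheaf: "Q \<in> Ob E ==> raw_sheaf C M (FO Q) (res Q)"
 using E_Ob is_sheaf_iff[OF category_axioms] by blast

lemma E_ObI: "Q \<in> Ob (PSh C) ==> raw_sheaf C M (FO Q) (res Q) ==> Q \<in> Ob E"
 using E_Ob is_sheaf_iff[OF category_axioms] by blast

lemma sheaf_separated: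
 assumes "Q \<in> Ob E" "cov A S" "x \<in> FO Q A" "y \<in> FO Q A"
  "\<And>f. f \<in> S ==> res Q f x = res Q f y"
 shows "x = y"
 using conjunct2[OF raw_sheaf[OF assms(1), unfolded raw_sheaf_def], rule_format, of A S x y]
  covering_Ob[OF assms(2)] assms(2-) by simp

lemma sheaf_glue:
 assumes "Q \<in> Ob E" "cov A S" "\<And>f. f \<in> S ==> x f \<in> FO Q (dom f)"
  "\<And>f g. f \<in> S ==> g \<in> Ar C ==> cod g = dom f ==> x (f \<cdot> g) = res Q g (x f)"
 obtains a where "a \<in> FO Q A" "\<And>f. f \<in> S ==> res Q f a = x f"
proof -
 have "\<exists>a\<in>FO Q A. \<forall>f\<in>S. res Q f a = x f"
  using conjunct1[OF raw_sheaf[OF assms(1), unfolded raw_sheaf_def], rule_format, of A S x]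
   covering_Ob[OF assms(2)] assms(2-) by simp
 thus thesis using that by blast
qed

lemma app_in [simp]: "t \<in> Ar E ==> A \<in> Ob C ==> x \<in> FO (Dom E t) A ==> app t A x \<in> FO (Cod E t) A"
 using PSh_Ar_raw[OF category_axioms, of t] unfolding E_Ar E_Dom E_Cod raw_map_def by blast

lemma app_nat: "t \<in> Ar E ==> f \<in> Ar C ==> x \<in> FO (Dom E t) (cod f) ==>
  app t (dom f) (res (Dom E t) f x) = res (Cod E t) f (app t (cod f) x)"
 using PSh_Ar_raw[OF category_axioms, of t] unfolding E_Ar E_Dom E_Cod raw_map_def by blast

lemma E_ext:
 assumes "s \<in> Ar E" "t \<in> Ar E" "Dom E s = Dom E t" "Cod E s = Cod E t"
  "\<And>A x. A \<in> Ob C ==> x \<in> FO (Dom E s) A ==> app s A x = app t A x"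
 shows "s = t"
 using assms by (intro PSh_ext) (auto simp: E_Ar E_Dom E_Cod)

lemma E_app_comp [simp]: "s \<in> Ar E ==> A \<in> Ob C ==> x \<in> FO (Dom E s) A ==>
  app (t \<cdot>[E] s) A x = app t A (app s A x)"
 using app_comp[of A C x s t] by (simp add: E_Cmp E_Dom E_Ar)

lemma E_app_id [simp]: "A \<in> Ob C ==> x \<in> FO P A ==> app (Idt E P) A x = x"
 using app_id E_Idt by metis

lemma E_map:
 assumes "P \<in> Ob E" "Q \<in> Ob E" "raw_map C (FO P) (res P) (FO Q) (res Q) \<phi>"
 shows "mk_map C P Q \<phi> \<in> Ar E" "Dom E (mk_map C P Q \<phi>) = P" "Cod E (mk_map C P Q \<phi>) = Q"
 using mk_map_Ar[OF category_axioms E_Ob_PSh[OF assms(1)] E_Ob_PSh[OF assms(2)] assms(3)] assms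
 by (auto simp: E_Ar E_Dom E_Cod)

lemma raw_mapI:
 assumes "\<And>A x. A \<in> Ob C ==> x \<in> V A ==> \<phi> A x \<in> W A"
  "\<And>f x. f \<in> Ar C ==> x \<in> V (cod f) ==> \<phi> (dom f) (a f x) = b f (\<phi> (cod f) x)"
 shows "raw_map C V a W b \<phi>"
 using assms by (auto simp: raw_map_def)

text \<open>Each small set of values is embedded in \<open>'u\<close> and the action is transported
  along the resulting bijections. The sheaf property is a separate conclusion that requires the
  source to be a sheaf.\<close>

lemma realize:
 fixes V :: "'o \<Rightarrow> 'x set"
 assumes V: "raw_presheaf C V act" and small: "\<And>A. A \<in> Ob C ==> small TYPE('u) (V A)"
 obtains Q enc where "Q \<in> Ob (PSh C)" "\<And>A. A \<in> Ob C ==> bij_betw (enc A) (V A) (FO Q A)"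
  "\<And>f x. f \<in> Ar C ==> x \<in> V (cod f) ==> res Q f (enc (cod f) x) = enc (dom f) (act f x)"
  "raw_sheaf C M V act ==> Q \<in> Ob E"
proof -
 note V1 = raw_presheafD(1)[OF V] and V2 = raw_presheafD(2)[OF V] and V3 = raw_presheafD(3)[OF V]
 have "\<forall>A\<in>Ob C. \<exists>e :: 'x \<Rightarrow> 'u. inj_on e (V A)" using small small_encoding by blast
 then obtain enc :: "'o \<Rightarrow> 'x \<Rightarrow> 'u" where enc: "\<And>A. A \<in> Ob C ==> inj_on (enc A) (V A)"
  by (metis bchoice)
 define dec where "dec A = inv_into (V A) (enc A)" for A
 have dec [simp]: "dec A (enc A x) = x" if "A \<in> Ob C" "x \<in> V A" for A x
  using enc that by (simp add: dec_def)
 define W where "W A = enc A ` V A" for A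
 define b where "b f y = enc (dom f) (act f (dec (cod f) y))" for f y
 have W: "raw_presheaf C W b"
  unfolding raw_presheaf_def W_def b_def using V1 V2 V3 by auto
 define Q where "Q = mk_presheaf C W b"
 have Q: "Q \<in> Ob (PSh C)" unfolding Q_def
  by (rule mk_presheaf_Ob[OF category_axioms W]) (use small small_image in \<open>auto simp: W_def\<close>)
 have QF: "FO Q A = enc A ` V A" if "A \<in> Ob C" for A using that by (simp add: Q_def W_def)
 have Qr: "res Q f (enc (cod f) x) = enc (dom f) (act f x)" if "f \<in> Ar C" "x \<in> V (cod f)" for f x
  using that by (simp add: Q_def W_def b_def)
 have "Q \<in> Ob E" if sh: "raw_sheaf C M V act"
 proof (rule E_ObI[OF Q])
  show "raw_sheaf C M (FO Q) (res Q)"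
   unfolding raw_sheaf_def
  proof (intro conjI ballI allI impI, goal_cases)
   case (1 A S x)
   hence S: "sieve C A S" by (simp add: covering_sieve_def)
   note sD = sieveD[OF S]
   define y where "y f = dec (dom f) (x f)" for f
   have y: "y f \<in> V (dom f) \<and> x f = enc (dom f) (y f)" if "f \<in> S" for f
   proof -
    have "x f \<in> enc (dom f) ` V (dom f)" using 1 that sD(1)[OF that] QF[of "dom f"] by auto
    thus ?thesis using sD(1)[OF that] by (auto simp: y_def)
   qed
   have "y (f \<cdot> g) = act g (y f)" if "f \<in> S" "g \<in> Ar C" "cod g = dom f" for f g
   proof -
    have "x (f \<cdot> g) = res Q g (x f)" using 1 that by blast
    hence "x (f \<cdot> g) = enc (dom g) (act g (y f))" using y[OF that(1)] that Qr[of g "y f"] by simp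
    thus ?thesis using that sD(1)[OF that(1)] V1[of g "y f"] y[OF that(1)] by (simp add: y_def[of "f \<cdot> g"])
   qed
   then obtain a where a: "a \<in> V A" "\<forall>f\<in>S. act f a = y f"
    using sh 1 y unfolding raw_sheaf_def by blast
   have "res Q f (enc A a) = x f" if "f \<in> S" for f
    using Qr[of f a] a sD(1,2)[OF that] y[OF that] that by simp
   thus ?case using a QF[of A] 1 by blast
  next
   case (2 A S c d)
   hence S: "sieve C A S" by (simp add: covering_sieve_def)
   obtain a b where ab: "a \<in> V A" "b \<in> V A" "c = enc A a" "d = enc A b" using 2 QF[of A] by auto
   have "act f a = act f b" if "f \<in> S" for f
   proof -
    have f: "f \<in> Ar C" "cod f = A" using sieveD[OF S that] by auto
    have "enc (dom f) (act f a) = enc (dom f) (act f b)" using 2 ab Qr[of f a] Qr[of f b] f that by simp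
    thus ?thesis using enc[of "dom f"] V1[of f a] V1[of f b] f ab by (simp add: inj_on_eq_iff)
   qed
   hence "a = b"
    using conjunct2[OF sh[unfolded raw_sheaf_def], rule_format, of A S a b] 2(1,2) ab by simp
   thus ?case using ab by simp
  qed
 qed
 thus thesis using that[of Q enc] Q QF Qr enc by (simp add: bij_betw_def)
qed

section \<open>Free sheaves on presheaves with identifications\<close>

subsection \<open>Free sheaves\<close>

text \<open>The identifications \<open>Er\<close> need be neither an equivalence relation nor stable
  under restriction; only the maps that respect them matter.\<close>

definition resp_rel :: "('o \<Rightarrow> 'x set) \<Rightarrow> ('o \<Rightarrow> ('x \<times> 'x) set) \<Rightarrow> ('o \<Rightarrow> 'x \<Rightarrow> 'u) \<Rightarrow> bool" where
 "resp_rel V Er \<phi> \<longleftrightarrow> (\<forall>A\<in>Ob C. \<forall>(x, y)\<in>Er A. x \<in> V A \<longrightarrow> y \<in> V A \<longrightarrow> \<phi> A x = \<phi> A y)"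

text \<open>\<open>h\<close> is the universal map from \<open>V\<close> to a sheaf among those that
  respect the identifications \<open>Er\<close>.\<close>

definition is_free_sheaf :: "('o \<Rightarrow> 'x set) \<Rightarrow> ('u \<Rightarrow> 'x \<Rightarrow> 'x) \<Rightarrow> ('o \<Rightarrow> ('x \<times> 'x) set) \<Rightarrow>
  ('o, 'u) presheaf \<Rightarrow> ('o \<Rightarrow> 'x \<Rightarrow> 'u) \<Rightarrow> bool" where
 "is_free_sheaf V act Er Z h \<longleftrightarrow> Z \<in> Ob E \<and> raw_map C V act (FO Z) (res Z) h \<and> resp_rel V Er h \<and>
   (\<forall>Q \<phi>. Q \<in> Ob E \<longrightarrow> raw_map C V act (FO Q) (res Q) \<phi> \<longrightarrow> resp_rel V Er \<phi> \<longrightarrow>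
    (\<exists>t\<in>Ar E. Dom E t = Z \<and> Cod E t = Q \<and> (\<forall>A\<in>Ob C. \<forall>x\<in>V A. app t A (h A x) = \<phi> A x))) \<and>
   (\<forall>s\<in>Ar E. \<forall>t\<in>Ar E. Dom E s = Z \<longrightarrow> Dom E t = Z \<longrightarrow> Cod E s = Cod E t \<longrightarrow>
    (\<forall>A\<in>Ob C. \<forall>x\<in>V A. app s A (h A x) = app t A (h A x)) \<longrightarrow> s = t)"

lemma is_free_sheafD:
 assumes "is_free_sheaf V act Er Z h"
 shows "Z \<in> Ob E" "raw_map C V act (FO Z) (res Z) h" "resp_rel V Er h"
  "Q \<in> Ob E ==> raw_map C V act (FO Q) (res Q) \<phi> ==> resp_rel V Er \<phi> ==>
   \<exists>t\<in>Ar E. Dom E t = Z \<and> Cod E t = Q \<and> (\<forall>A\<in>Ob C. \<forall>x\<in>V A. app t A (h A x) = \<phi> A x)"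
  "s \<in> Ar E ==> t \<in> Ar E ==> Dom E s = Z ==> Dom E t = Z ==> Cod E s = Cod E t ==>
   (\<And>A x. A \<in> Ob C ==> x \<in> V A ==> app s A (h A x) = app t A (h A x)) ==> s = t"
 using assms unfolding is_free_sheaf_def by simp_all

context
 fixes V :: "'o \<Rightarrow> 'x set" and act :: "'u \<Rightarrow> 'x \<Rightarrow> 'x" and Er :: "'o \<Rightarrow> ('x \<times> 'x) set"
 assumes V: "raw_presheaf C V act" and small_V: "\<And>A. A \<in> Ob C ==> small TYPE('u) (V A)"
begin

private abbreviation "resp \<equiv> resp_rel V Er"

text \<open>Two elements are identified when no map to a sheaf separates them.\<close>

private definition eqv :: "'o \<Rightarrow> 'x \<Rightarrow> 'x \<Rightarrow> bool" where
 "eqv A x y \<longleftrightarrow> (\<forall>Q\<in>Ob E. \<forall>\<phi>. raw_map C V act (FO Q) (res Q) \<phi> \<and> resp \<phi> \<longrightarrow> \<phi> A x = \<phi> A y)"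

private lemma eqv_refl: "eqv A x x" and eqv_sym: "eqv A x y ==> eqv A y x"
 and eqv_trans: "eqv A x y ==> eqv A y z ==> eqv A x z"
 unfolding eqv_def by (blast, metis, metis)

private lemma eqv_act:
 assumes "f \<in> Ar C" "x \<in> V (cod f)" "y \<in> V (cod f)" "eqv (cod f) x y"
 shows "eqv (dom f) (act f x) (act f y)"
 using assms unfolding eqv_def raw_map_def by metis

text \<open>Sheaves are separated, so a map to a sheaf that fails to separate two elements on a
  cover fails to separate them.\<close>

private lemma eqv_local:
 assumes T: "cov A T" and xy: "x \<in> V A" "y \<in> V A"
  and e: "\<And>g. g \<in> T ==> eqv (dom g) (act g x) (act g y)"
 shows "eqv A x y"
 unfolding eqv_def
proof (intro ballI allI impI)
 fix Q \<phi> assume Q: "Q \<in> Ob E" and \<phi>: "raw_map C V act (FO Q) (res Q) \<phi> \<and> resp \<phi>"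
 have "sieve C A T" using T by (simp add: covering_sieve_def)
 show "\<phi> A x = \<phi> A y"
 proof (rule sheaf_separated[OF Q T])
  fix g assume g: "g \<in> T"
  have gA: "g \<in> Ar C" "cod g = A" using sieveD[OF \<open>sieve C A T\<close> g] by auto
  have "\<phi> (dom g) (act g x) = \<phi> (dom g) (act g y)" using e[OF g] Q \<phi> unfolding eqv_def by blast
  thus "res Q g (\<phi> A x) = res Q g (\<phi> A y)" using \<phi> gA xy unfolding raw_map_def by metis
 qed (use \<phi> xy covering_Ob[OF T] in \<open>auto simp: raw_map_def\<close>)
qed

text \<open>An element over \<open>A\<close> is a relation \<open>R\<close>, where
  \<open>(f, x)\<close> in \<open>R\<close> means that the element restricts along \<open>f\<close>
  to the one represented by \<open>x\<close>. It is stable under restriction, single-valued up to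
  \<open>eqv\<close> and defined on a covering sieve. The last two conditions saturate it under
  local membership and under \<open>eqv\<close>, so that each element has exactly one such relation
  and a single step replaces the twofold plus construction.\<close>

private definition X :: "'o \<Rightarrow> ('u \<times> 'x) set set" where
 "X A = {R. R \<subseteq> {(f, x). f \<in> Ar C \<and> cod f = A \<and> x \<in> V (dom f)} \<and>
   (\<forall>f x g. (f, x) \<in> R \<longrightarrow> g \<in> Ar C \<longrightarrow> cod g = dom f \<longrightarrow> (f \<cdot> g, act g x) \<in> R) \<and>
   (\<forall>f x y. (f, x) \<in> R \<longrightarrow> (f, y) \<in> R \<longrightarrow> eqv (dom f) x y) \<and>
   cov A (fst ` R) \<and>
   (\<forall>f x T. f \<in> Ar C \<longrightarrow> cod f = A \<longrightarrow> x \<in> V (dom f) \<longrightarrow> cov (dom f) T \<longrightarrow>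
    (\<forall>g\<in>T. (f \<cdot> g, act g x) \<in> R) \<longrightarrow> (f, x) \<in> R) \<and>
   (\<forall>f x y. (f, x) \<in> R \<longrightarrow> y \<in> V (dom f) \<longrightarrow> eqv (dom f) x y \<longrightarrow> (f, y) \<in> R)}"

private lemma XD:
 assumes "R \<in> X A"
 shows "(f, x) \<in> R ==> f \<in> Ar C \<and> cod f = A \<and> x \<in> V (dom f)"
  "(f, x) \<in> R ==> g \<in> Ar C ==> cod g = dom f ==> (f \<cdot> g, act g x) \<in> R"
  "(f, x) \<in> R ==> (f, y) \<in> R ==> eqv (dom f) x y"
  "cov A (fst ` R)"
  "f \<in> Ar C ==> cod f = A ==> x \<in> V (dom f) ==> cov (dom f) T ==>
    (\<And>g. g \<in> T ==> (f \<cdot> g, act g x) \<in> R) ==> (f, x) \<in> R"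
  "(f, x) \<in> R ==> y \<in> V (dom f) ==> eqv (dom f) x y ==> (f, y) \<in> R"
 using assms unfolding X_def mem_Collect_eq by (blast, blast, blast, blast, blast, blast)

private lemma XI:
 assumes "\<And>f x. (f, x) \<in> R ==> f \<in> Ar C \<and> cod f = A \<and> x \<in> V (dom f)"
  "\<And>f x g. (f, x) \<in> R ==> g \<in> Ar C ==> cod g = dom f ==> (f \<cdot> g, act g x) \<in> R"
  "\<And>f x y. (f, x) \<in> R ==> (f, y) \<in> R ==> eqv (dom f) x y"
  "cov A (fst ` R)"
  "\<And>f x T. f \<in> Ar C ==> cod f = A ==> x \<in> V (dom f) ==> cov (dom f) T ==>
    (\<And>g. g \<in> T ==> (f \<cdot> g, act g x) \<in> R) ==> (f, x) \<in> R"
  "\<And>f x y. (f, x) \<in> R ==> y \<in> V (dom f) ==> eqv (dom f) x y ==> (f, y) \<in> R"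
 shows "R \<in> X A"
 unfolding X_def mem_Collect_eq
proof (intro conjI)
 show "R \<subseteq> {(f, x). f \<in> Ar C \<and> cod f = A \<and> x \<in> V (dom f)}" using assms(1) by auto
 show "\<forall>f x T. f \<in> Ar C \<longrightarrow> cod f = A \<longrightarrow> x \<in> V (dom f) \<longrightarrow> cov (dom f) T \<longrightarrow>
    (\<forall>g\<in>T. (f \<cdot> g, act g x) \<in> R) \<longrightarrow> (f, x) \<in> R"
  by (intro allI impI, rule assms(5)) (assumption | erule bspec)+
 show "\<forall>f x g. (f, x) \<in> R \<longrightarrow> g \<in> Ar C \<longrightarrow> cod g = dom f \<longrightarrow> (f \<cdot> g, act g x) \<in> R"
  by (intro allI impI) (rule assms(2))
 show "\<forall>f x y. (f, x) \<in> R \<longrightarrow> (f, y) \<in> R \<longrightarrow> eqv (dom f) x y"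
  by (intro allI impI) (rule assms(3))
 show "\<forall>f x y. (f, x) \<in> R \<longrightarrow> y \<in> V (dom f) \<longrightarrow> eqv (dom f) x y \<longrightarrow> (f, y) \<in> R"
  by (intro allI impI) (rule assms(6))
qed (rule assms(4))

private definition xact :: "'u \<Rightarrow> ('u \<times> 'x) set \<Rightarrow> ('u \<times> 'x) set" where
 "xact h R = {(f, x). f \<in> Ar C \<and> cod f = dom h \<and> (h \<cdot> f, x) \<in> R}"

private lemma xact_iff: "(f, x) \<in> xact h R \<longleftrightarrow> f \<in> Ar C \<and> cod f = dom h \<and> (h \<cdot> f, x) \<in> R"
 by (simp add: xact_def)

private lemma fst_xact: "fst ` xact h R = pull (fst ` R) h"
 by (force simp: xact_def pull_def)

private lemma xact_X:
 assumes h: "h \<in> Ar C" and R: "R \<in> X (cod h)"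
 shows "xact h R \<in> X (dom h)"
proof (rule XI, unfold xact_iff, goal_cases)
 case (1 f x) thus ?case using XD(1)[OF R] h by fastforce
next
 case (2 f x g) thus ?case using XD(2)[OF R, of "h \<cdot> f" x g] h by simp
next
 case (3 f x y) thus ?case using XD(3)[OF R, of "h \<cdot> f" x y] h by simp
next
 case 4 thus ?case unfolding fst_xact by (rule covering_pull[OF XD(4)[OF R] h refl])
next
 case (5 f x T)
 have "(h \<cdot> f, x) \<in> R"
 proof (rule XD(5)[OF R])
  fix g assume "g \<in> T"
  thus "((h \<cdot> f) \<cdot> g, act g x) \<in> R"
   using 5(5)[of g] 5(1,2) h sieveD(1,2)[OF covering_sieve_sieve[OF 5(4)], of g] by simp
 qed (use 5 h in simp_all)
 thus ?case using 5 by simp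
next
 case (6 f x y) thus ?case using XD(6)[OF R, of "h \<cdot> f" x y] h by simp
qed

private lemma raw_X: "raw_presheaf C X xact"
 unfolding raw_presheaf_def
proof (intro conjI ballI impI)
 fix A R assume A: "A \<in> Ob C" and R: "R \<in> X A"
 have "(f, x) \<in> xact (Idt C A) R \<longleftrightarrow> (f, x) \<in> R" for f x
  unfolding xact_iff using A XD(1)[OF R, of f x] by auto
 thus "xact (Idt C A) R = R" by auto
next
 fix f g R assume "f \<in> Ar C" "g \<in> Ar C" "cod g = dom f"
 thus "xact (f \<cdot> g) R = xact g (xact f R)" unfolding xact_def by auto
qed (rule xact_X)

private lemma small_X: "A \<in> Ob C ==> small TYPE('u) (X A)"
proof (rule small_subset[OF small_Pow[OF univ small_Sigma[OF univ small_Ar]]])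
 show "X A \<subseteq> Pow (Sigma (Ar C) (\<lambda>f. V (dom f)))" using XD(1) by fastforce
qed (use small_V in auto)

text \<open>Membership of \<open>(h g, act g x)\<close> is membership at the identity after acting
  by \<open>h g\<close>, hence is shared by \<open>R\<close> and \<open>R'\<close> on a cover;
  saturation of \<open>R'\<close> removes the word locally.\<close>

private lemma X_separated:
 assumes R: "R \<in> X A" "R' \<in> X A" and T: "cov A T"
  and eq: "\<And>f. f \<in> T ==> xact f R = xact f R'"
 shows "R \<subseteq> R'"
proof (rule subrelI)
 fix h x assume hx: "(h, x) \<in> R"
 have h: "h \<in> Ar C" "cod h = A" "x \<in> V (dom h)" using XD(1)[OF R(1) hx] by auto
 show "(h, x) \<in> R'"
 proof (rule XD(5)[OF R(2) h covering_pull[OF T h(1,2)]])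
  fix g assume g: "g \<in> pull T h"
  hence g': "g \<in> Ar C" "cod g = dom h" "h \<cdot> g \<in> T" by (auto simp: pull_def)
  have "(h \<cdot> g, act g x) \<in> R" by (rule XD(2)[OF R(1) hx g'(1,2)])
  hence "(Idt C (dom g), act g x) \<in> xact (h \<cdot> g) R" using g' h by (simp add: xact_iff)
  hence "(Idt C (dom g), act g x) \<in> xact (h \<cdot> g) R'" using eq[OF g'(3)] by simp
  thus "(h \<cdot> g, act g x) \<in> R'" using g' h by (simp add: xact_iff)
 qed
qed

text \<open>The glued relation contains \<open>(f, x)\<close> when, on a cover of the domain of
  \<open>f\<close>, the restrictions of \<open>x\<close> belong to the prescribed relations; this is
  the only saturated candidate.\<close>

private lemma X_glue:
 assumes T: "cov A T" and R: "\<And>f. f \<in> T ==> R f \<in> X (dom f)"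
  and match: "\<And>f g. f \<in> T ==> g \<in> Ar C ==> cod g = dom f ==> R (f \<cdot> g) = xact g (R f)"
 shows "\<exists>Q\<in>X A. \<forall>f\<in>T. xact f Q = R f"
proof -
 define L where "L f x = {g \<in> pull T f. (Idt C (dom g), act g x) \<in> R (f \<cdot> g)}" for f x
 define Q where "Q = {(f, x). f \<in> Ar C \<and> cod f = A \<and> x \<in> V (dom f) \<and> cov (dom f) (L f x)}"
 have sT: "sieve C A T" using T by (rule covering_sieve_sieve)
 have L_iff: "g \<in> L f x \<longleftrightarrow> g \<in> Ar C \<and> cod g = dom f \<and> f \<cdot> g \<in> T \<and> (Idt C (dom g), act g x) \<in> R (f \<cdot> g)" for g f x
  by (auto simp: L_def pull_def)
 \<comment> \<open>Because the family matches, membership at the identity in \<open>R (f g)\<close>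
   can be read as membership at \<open>g\<close> in \<open>R f\<close>.\<close>
 have R_id: "(Idt C (dom g), y) \<in> R (f \<cdot> g) \<longleftrightarrow> (g, y) \<in> R f"
  if "f \<in> T" "g \<in> Ar C" "cod g = dom f" for f g y
  unfolding match[OF that] using that by (simp add: xact_iff)
 have L_sieve: "sieve C (dom f) (L f x)" if f: "f \<in> Ar C" "cod f = A" "x \<in> V (dom f)" for f x
 proof (rule sieveI)
  fix g k assume g: "g \<in> L f x" and k: "k \<in> Ar C" "cod k = dom g"
  hence g': "g \<in> Ar C" "cod g = dom f" "f \<cdot> g \<in> T" "(Idt C (dom g), act g x) \<in> R (f \<cdot> g)"
   by (auto simp: L_iff)
  have fg: "dom (f \<cdot> g) = dom g" using g' f by simp
  have "(Idt C (dom g) \<cdot> k, act k (act g x)) \<in> R (f \<cdot> g)"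
   using XD(2)[OF R[OF g'(3)] g'(4), of k] k g' fg by simp
  hence "(Idt C (dom k), act k (act g x)) \<in> R ((f \<cdot> g) \<cdot> k)"
   using R_id[OF g'(3), of k] k fg by simp
  moreover have "(f \<cdot> g) \<cdot> k \<in> T" using sieveD(3)[OF sT g'(3)] k fg by simp
  ultimately show "g \<cdot> k \<in> L f x" unfolding L_iff using g' k f raw_presheafD(3)[OF V, of g k x] by simp
 qed (auto simp: L_iff)
 have L_pull: "pull (L f x) g = L (f \<cdot> g) (act g x)"
  if "f \<in> Ar C" "x \<in> V (dom f)" "g \<in> Ar C" "cod g = dom f" for f g x
  using that raw_presheafD(3)[OF V, of g _ x] by (auto simp: pull_def[of "L f x"] L_iff)
 have QX: "Q \<in> X A"
 proof (rule XI, goal_cases)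
  case (1 f x) thus ?case by (simp add: Q_def)
 next
  case (2 f x g)
  hence f: "f \<in> Ar C" "cod f = A" "x \<in> V (dom f)" "cov (dom f) (L f x)" by (auto simp: Q_def)
  thus ?case using 2 covering_pull[OF f(4), of g] L_pull[of f x g] raw_presheafD(1)[OF V, of g x] by (auto simp: Q_def)
 next
  case (3 f x y)
  hence f: "f \<in> Ar C" "cod f = A" "x \<in> V (dom f)" "y \<in> V (dom f)"
   "cov (dom f) (L f x)" "cov (dom f) (L f y)" by (auto simp: Q_def)
  show ?case
  proof (rule eqv_local[OF covering_inter[OF f(5,6)] f(3,4)])
   fix g assume "g \<in> L f x \<inter> L f y"
   hence g: "f \<cdot> g \<in> T" "(Idt C (dom g), act g x) \<in> R (f \<cdot> g)" "(Idt C (dom g), act g y) \<in> R (f \<cdot> g)"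
    "g \<in> Ar C" by (auto simp: L_iff)
   thus "eqv (dom g) (act g x) (act g y)" using XD(3)[OF R[OF g(1)] g(2,3)] by simp
  qed
 next
  case 4
  show ?case
  proof (rule covering_trans[OF T])
   show s: "sieve C A (fst ` Q)"
   proof (rule sieveI)
    fix f g assume "f \<in> fst ` Q" and g: "g \<in> Ar C" "cod g = dom f"
    then obtain x where x: "f \<in> Ar C" "cod f = A" "x \<in> V (dom f)" "cov (dom f) (L f x)"
     by (auto simp: Q_def)
    hence "(f \<cdot> g, act g x) \<in> Q"
     using g covering_pull[OF x(4), of g] L_pull[of f x g] raw_presheafD(1)[OF V, of g x] by (auto simp: Q_def)
    thus "f \<cdot> g \<in> fst ` Q" by force
   qed (auto simp: Q_def)
   fix f assume f: "f \<in> T"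
   have fA: "f \<in> Ar C" "cod f = A" using sieveD[OF sT f] by auto
   have "fst ` R f \<subseteq> pull (fst ` Q) f"
   proof
    fix g assume "g \<in> fst ` R f"
    then obtain x where x: "(g, x) \<in> R f" by auto
    hence g: "g \<in> Ar C" "cod g = dom f" "x \<in> V (dom g)" using XD(1)[OF R[OF f]] by blast+
    have "L (f \<cdot> g) x = {k \<in> Ar C. cod k = dom g}"
    proof (intro set_eqI iffI)
     fix k assume k: "k \<in> {k \<in> Ar C. cod k = dom g}"
     have "(g \<cdot> k, act k x) \<in> R f" using XD(2)[OF R[OF f] x] k by simp
     hence "(Idt C (dom k), act k x) \<in> R (f \<cdot> (g \<cdot> k))" using R_id[OF f, of "g \<cdot> k"] k g by simp
     thus "k \<in> L (f \<cdot> g) x" unfolding L_iff using k g fA sieveD(3)[OF sT f, of "g \<cdot> k"] by simp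
    qed (use g fA in \<open>auto simp: L_iff\<close>)
    hence "(f \<cdot> g, x) \<in> Q" using g fA covering_max[of "dom g"] by (simp add: Q_def)
    thus "g \<in> pull (fst ` Q) f" using g by (force simp: pull_def)
   qed
   thus "cov (dom f) (pull (fst ` Q) f)"
    using covering_superset XD(4)[OF R[OF f]] sieve_pull[OF s fA] by blast
  qed
 next
  case (5 f x U)
  have "cov (dom f) (L f x)"
  proof (rule covering_trans[OF 5(4) L_sieve[OF 5(1,2,3)]])
   fix g assume g: "g \<in> U"
   have gA: "g \<in> Ar C" "cod g = dom f" using sieveD[OF covering_sieve_sieve[OF 5(4)] g] by auto
   thus "cov (dom g) (pull (L f x) g)"
    using 5(5)[OF g] L_pull[of f x g] 5 by (simp add: Q_def)
  qed
  thus ?case using 5 by (simp add: Q_def)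
 next
  case (6 f x y)
  hence f: "f \<in> Ar C" "cod f = A" "x \<in> V (dom f)" "y \<in> V (dom f)"
   "cov (dom f) (L f x)" by (auto simp: Q_def)
  have "L f x \<subseteq> L f y"
  proof
   fix g assume g: "g \<in> L f x"
   hence g': "g \<in> Ar C" "cod g = dom f" "f \<cdot> g \<in> T" "(Idt C (dom g), act g x) \<in> R (f \<cdot> g)" by (auto simp: L_iff)
   have "eqv (dom g) (act g x) (act g y)" using eqv_act[of g x y] g' f 6 by simp
   hence "(Idt C (dom g), act g y) \<in> R (f \<cdot> g)"
    using XD(6)[OF R[OF g'(3)] g'(4)] raw_presheafD(1)[OF V, of g y] g' f by simp
   thus "g \<in> L f y" using g' by (simp add: L_iff)
  qed
  thus ?case using f covering_superset[OF f(5) _ L_sieve[OF f(1,2,4)]] by (simp add: Q_def)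
 qed
 have "xact h Q = R h" if h: "h \<in> T" for h
 proof -
  have hA: "h \<in> Ar C" "cod h = A" using sieveD[OF sT h] by auto
  have L_h: "L (h \<cdot> f) x = {g \<in> Ar C. cod g = dom f \<and> (f \<cdot> g, act g x) \<in> R h}"
   if "f \<in> Ar C" "cod f = dom h" for f x
  proof -
   have "h \<cdot> (f \<cdot> g) \<in> T \<and> ((Idt C (dom g), act g x) \<in> R (h \<cdot> (f \<cdot> g)) \<longleftrightarrow> (f \<cdot> g, act g x) \<in> R h)"
    if "g \<in> Ar C" "cod g = dom f" for g
    using R_id[OF h, of "f \<cdot> g" "act g x"] sieveD(3)[OF sT h, of "f \<cdot> g"] that \<open>f \<in> Ar C\<close> \<open>cod f = dom h\<close> by simp
   thus ?thesis using that hA by (auto simp: L_iff)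
  qed
  have "(f, x) \<in> xact h Q \<longleftrightarrow> (f, x) \<in> R h" for f x
  proof
   assume "(f, x) \<in> xact h Q"
   hence f: "f \<in> Ar C" "cod f = dom h" "x \<in> V (dom f)" "cov (dom f) (L (h \<cdot> f) x)"
    using hA by (auto simp: xact_iff Q_def)
   thus "(f, x) \<in> R h" using XD(5)[OF R[OF h] f] L_h[OF f(1,2)] by simp
  next
   assume fx: "(f, x) \<in> R h"
   hence f: "f \<in> Ar C" "cod f = dom h" "x \<in> V (dom f)" using XD(1)[OF R[OF h]] by blast+
   have "L (h \<cdot> f) x = {g \<in> Ar C. cod g = dom f}"
    unfolding L_h[OF f(1,2)] using XD(2)[OF R[OF h] fx] by blast
   thus "(f, x) \<in> xact h Q" using f hA covering_max[of "dom f"] by (simp add: xact_iff Q_def)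
  qed
  thus ?thesis by auto
 qed
 thus ?thesis using QX by blast
qed

private lemma sheaf_X: "raw_sheaf C M X xact"
 unfolding raw_sheaf_def
proof (intro conjI ballI allI impI, goal_cases)
 case (1 A S x) thus ?case by (intro X_glue) auto
next
 case (2 A S a b)
 thus ?case using X_separated[of a A b S] X_separated[of b A a S] by blast
qed

text \<open>The saturated relation generated by \<open>x\<close>, defined on the maximal sieve; it
  serves as the unit.\<close>

private definition eta :: "'o \<Rightarrow> 'x \<Rightarrow> ('u \<times> 'x) set" where
 "eta A x = {(f, y). f \<in> Ar C \<and> cod f = A \<and> y \<in> V (dom f) \<and> eqv (dom f) y (act f x)}"

private lemma eta_X:
 assumes "A \<in> Ob C" "x \<in> V A" shows "eta A x \<in> X A"
proof (rule XI, unfold eta_def mem_Collect_eq case_prod_conv, goal_cases)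
 case (2 f y g)
 thus ?case using assms eqv_act[of g y "act f x"] raw_presheafD(1)[OF V, of g y] raw_presheafD(1)[OF V, of f x] raw_presheafD(3)[OF V, of f g x] by simp
next
 case (3 f y z) thus ?case using eqv_trans eqv_sym by blast
next
 case 4
 have "fst ` {(f, y). f \<in> Ar C \<and> cod f = A \<and> y \<in> V (dom f) \<and> eqv (dom f) y (act f x)} = {f \<in> Ar C. cod f = A}"
  using raw_presheafD(1)[OF V] eqv_refl assms by (force simp: image_iff)
 thus ?case using covering_max[OF assms(1)] by simp
next
 case (5 f y T)
 have "eqv (dom f) y (act f x)"
 proof (rule eqv_local[OF 5(4) 5(3)])
  show "act f x \<in> V (dom f)" using raw_presheafD(1)[OF V] 5 assms by simp
  fix g assume g: "g \<in> T"
  have gA: "g \<in> Ar C" "cod g = dom f" using sieveD[OF covering_sieve_sieve[OF 5(4)] g] by auto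
  thus "eqv (dom g) (act g y) (act g (act f x))"
   using 5(1,2) 5(5)[OF g] raw_presheafD(3)[OF V, of f g x] assms by simp
 qed
 thus ?case using 5 by simp
next
 case (6 f y z) thus ?case using eqv_trans eqv_sym by blast
qed auto

private lemma eta_nat:
 assumes "f \<in> Ar C" "x \<in> V (cod f)"
 shows "eta (dom f) (act f x) = xact f (eta (cod f) x)"
 using assms raw_presheafD(3)[OF V, of f _ x] by (auto simp: eta_def xact_iff)

text \<open>Every element of \<open>X A\<close> is in the image of the unit locally, on its own
  sieve of definition. Maps to sheaves are therefore determined by their values on the unit.\<close>

private lemma xact_eta:
 assumes "R \<in> X A" "(f, x) \<in> R"
 shows "xact f R = eta (dom f) x"
proof -
 have f: "f \<in> Ar C" "cod f = A" "x \<in> V (dom f)" using XD(1)[OF assms] by auto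
 have "(g, y) \<in> xact f R \<longleftrightarrow> (g, y) \<in> eta (dom f) x" for g y
 proof
  assume gy: "(g, y) \<in> xact f R"
  hence g: "g \<in> Ar C" "cod g = dom f" "(f \<cdot> g, y) \<in> R" by (auto simp: xact_iff)
  have "(f \<cdot> g, act g x) \<in> R" using XD(2)[OF assms g(1,2)] .
  thus "(g, y) \<in> eta (dom f) x"
   using XD(3)[OF assms(1) g(3)] XD(1)[OF assms(1) g(3)] g f by (simp add: eta_def)
 next
  assume "(g, y) \<in> eta (dom f) x"
  hence g: "g \<in> Ar C" "cod g = dom f" "y \<in> V (dom g)" "eqv (dom g) y (act g x)" by (auto simp: eta_def)
  have "(f \<cdot> g, act g x) \<in> R" using XD(2)[OF assms g(1,2)] .
  thus "(g, y) \<in> xact f R"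
   using XD(6)[OF assms(1), of "f \<cdot> g" "act g x" y] g f eqv_sym by (simp add: xact_iff)
 qed
 thus ?thesis by auto
qed

text \<open>The values of \<open>\<phi>\<close> at the representatives in \<open>R\<close> form a
  matching family on the sieve of definition of \<open>R\<close>, which the target sheaf
  glues.\<close>

private lemma X_universal:
 assumes Q: "Q \<in> Ob E" and \<phi>: "raw_map C V act (FO Q) (res Q) \<phi>" "resp \<phi>"
 shows "\<exists>\<psi>. raw_map C X xact (FO Q) (res Q) \<psi> \<and> (\<forall>A\<in>Ob C. \<forall>x\<in>V A. \<psi> A (eta A x) = \<phi> A x)"
proof -
 have \<phi>e: "\<phi> A x = \<phi> A y" if "eqv A x y" for A x y using that Q \<phi> unfolding eqv_def by blast
 have \<phi>1: "\<phi> A x \<in> FO Q A" if "A \<in> Ob C" "x \<in> V A" for A x using \<phi> that unfolding raw_map_def by blast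
 have \<phi>2: "\<phi> (dom f) (act f x) = res Q f (\<phi> (cod f) x)" if "f \<in> Ar C" "x \<in> V (cod f)" for f x
  using \<phi> that unfolding raw_map_def by blast
 have ex: "\<exists>q\<in>FO Q A. \<forall>f x. (f, x) \<in> R \<longrightarrow> res Q f q = \<phi> (dom f) x" if R: "R \<in> X A" for A R
 proof -
  \<comment> \<open>The choice of representative is harmless: any two are \<open>eqv\<close>, and
    \<open>\<phi>\<close> does not separate them.\<close>
  define x where "x f = (SOME x. (f, x) \<in> R)" for f
  have x: "(f, x f) \<in> R" if "f \<in> fst ` R" for f using that unfolding x_def by (auto intro: someI)
  have phi_eq: "\<phi> (dom f) y = \<phi> (dom f) (x f)" if "(f, y) \<in> R" for f y
   using \<phi>e XD(3)[OF R that x[of f]] that by force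
  obtain q where q: "q \<in> FO Q A" "\<And>f. f \<in> fst ` R ==> res Q f q = \<phi> (dom f) (x f)"
  proof (rule sheaf_glue[OF Q XD(4)[OF R], of "\<lambda>f. \<phi> (dom f) (x f)"])
   fix f assume f: "f \<in> fst ` R"
   thus "\<phi> (dom f) (x f) \<in> FO Q (dom f)" using \<phi>1 XD(1)[OF R x[OF f]] by simp
   fix g assume g: "g \<in> Ar C" "cod g = dom f"
   have "(f \<cdot> g, act g (x f)) \<in> R" using XD(2)[OF R x[OF f] g] .
   from phi_eq[OF this] show "\<phi> (dom (f \<cdot> g)) (x (f \<cdot> g)) = res Q g (\<phi> (dom f) (x f))"
    using \<phi>2[of g "x f"] XD(1)[OF R x[OF f]] g by simp
  qed blast
  have "res Q f q = \<phi> (dom f) y" if "(f, y) \<in> R" for f y using q(2)[of f] phi_eq[OF that] that by force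
  thus ?thesis using q(1) by blast
 qed
 define \<psi>0 where "\<psi>0 A R = (SOME q. q \<in> FO Q A \<and> (\<forall>f x. (f, x) \<in> R \<longrightarrow> res Q f q = \<phi> (dom f) x))" for A R
 have \<psi>0: "\<psi>0 A R \<in> FO Q A" "\<And>f x. (f, x) \<in> R ==> res Q f (\<psi>0 A R) = \<phi> (dom f) x" if "R \<in> X A" for A R
  using someI_ex[OF ex[OF that, unfolded Bex_def]] unfolding \<psi>0_def by blast+
 have "raw_map C X xact (FO Q) (res Q) \<psi>0"
 proof (rule raw_mapI)
  fix f R assume f: "f \<in> Ar C" and R: "R \<in> X (cod f)"
  note fR = xact_X[OF f R]
  show "\<psi>0 (dom f) (xact f R) = res Q f (\<psi>0 (cod f) R)"
  proof (rule sheaf_separated[OF Q XD(4)[OF fR]])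
   fix g assume "g \<in> fst ` xact f R"
   then obtain x where x: "(g, x) \<in> xact f R" by auto
   thus "res Q g (\<psi>0 (dom f) (xact f R)) = res Q g (res Q f (\<psi>0 (cod f) R))"
    using \<psi>0(2)[OF fR x] \<psi>0(2)[OF R, of "f \<cdot> g" x] f \<psi>0(1)[OF R] Q by (simp add: xact_iff)
  qed (use \<psi>0 fR R f Q in simp_all)
 qed (rule \<psi>0)
 moreover have "\<psi>0 A (eta A x) = \<phi> A x" if "A \<in> Ob C" "x \<in> V A" for A x
 proof -
  have "(Idt C A, x) \<in> eta A x" using that raw_presheafD(2)[OF V] eqv_refl by (simp add: eta_def)
  thus ?thesis using \<psi>0[OF eta_X[OF that]] that Q by force
 qed
 ultimately show ?thesis by blast
qed

text \<open>The presheaf \<open>X\<close> is coded in \<open>'u\<close>, and its unit identifies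
  \<open>Er\<close>. With empty \<open>Er\<close> the result is the associated sheaf; with the
  transition maps of a diagram as identifications it is a colimit.\<close>

lemma free_sheaf: "\<exists>Z h. is_free_sheaf V act Er Z h"
proof -
 obtain Z enc where Z: "Z \<in> Ob E" and enc: "\<And>A. A \<in> Ob C ==> bij_betw (enc A) (X A) (FO Z A)"
  and res: "\<And>f x. f \<in> Ar C ==> x \<in> X (cod f) ==> res Z f (enc (cod f) x) = enc (dom f) (xact f x)"
  using realize[OF raw_X small_X] sheaf_X by metis
 define dec where "dec A = inv_into (X A) (enc A)" for A
 have encX: "enc A R \<in> FO Z A" "dec A (enc A R) = R" if "A \<in> Ob C" "R \<in> X A" for A R
  using enc[OF that(1)] that by (auto simp: bij_betw_def dec_def)
 have decX: "dec A z \<in> X A" "enc A (dec A z) = z" if "A \<in> Ob C" "z \<in> FO Z A" for A z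
  using enc[OF that(1)] that unfolding bij_betw_def dec_def by (metis inv_into_into, metis f_inv_into_f)
 define h where "h A x = enc A (eta A x)" for A x
 have h: "raw_map C V act (FO Z) (res Z) h"
  by (rule raw_mapI) (use encX eta_X res eta_nat in \<open>auto simp: h_def\<close>)
 moreover have "resp_rel V Er h"
  unfolding resp_rel_def
 proof (intro ballI, clarify)
  fix A x y assume xy: "A \<in> Ob C" "(x, y) \<in> Er A" "x \<in> V A" "y \<in> V A"
  \<comment> \<open>Related elements are inseparable by definition, because only maps that respect
    \<open>Er\<close> are tested.\<close>
  have e: "eqv A x y" unfolding eqv_def resp_rel_def using xy by blast
  have "eqv (dom f) (act f x) (act f y)" if "f \<in> Ar C" "cod f = A" for f
   using eqv_act[of f x y] that e xy by simp
  hence "eta A x = eta A y" unfolding eta_def using eqv_trans eqv_sym by blast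
  thus "h A x = h A y" by (simp add: h_def)
 qed
 moreover have "\<exists>t\<in>Ar E. Dom E t = Z \<and> Cod E t = Q \<and> (\<forall>A\<in>Ob C. \<forall>x\<in>V A. app t A (h A x) = \<phi> A x)"
  if Q: "Q \<in> Ob E" and \<phi>: "raw_map C V act (FO Q) (res Q) \<phi>" "resp \<phi>" for Q \<phi>
 proof -
  obtain \<psi> where \<psi>: "raw_map C X xact (FO Q) (res Q) \<psi>" "\<forall>A\<in>Ob C. \<forall>x\<in>V A. \<psi> A (eta A x) = \<phi> A x"
   using X_universal[OF Q \<phi>] by blast
  have "raw_map C (FO Z) (res Z) (FO Q) (res Q) (\<lambda>A z. \<psi> A (dec A z))"
  proof (rule raw_mapI)
   fix f z assume f: "f \<in> Ar C" and z: "z \<in> FO Z (cod f)"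
   have d: "dec (cod f) z \<in> X (cod f)" "enc (cod f) (dec (cod f) z) = z" using decX f z by auto
   have "dec (dom f) (res Z f z) = xact f (dec (cod f) z)"
    using res[OF f d(1)] d xact_X[OF f d(1)] encX f by simp
   thus "\<psi> (dom f) (dec (dom f) (res Z f z)) = res Q f (\<psi> (cod f) (dec (cod f) z))"
    using \<psi>(1) f d by (simp add: raw_map_def)
  qed (use \<psi>(1) decX in \<open>auto simp: raw_map_def\<close>)
  note m = E_map[OF Z Q this]
  show ?thesis
   by (rule bexI[OF _ m(1)]) (use m \<psi> h encX eta_X in \<open>auto simp: h_def\<close>)
 qed
 moreover have "s = t" if st: "s \<in> Ar E" "t \<in> Ar E" "Dom E s = Z" "Dom E t = Z" "Cod E s = Cod E t"
  and eq: "\<And>A x. A \<in> Ob C ==> x \<in> V A ==> app s A (h A x) = app t A (h A x)" for s t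
 proof (rule E_ext)
  fix A z assume A: "A \<in> Ob C" and "z \<in> FO (Dom E s) A"
  hence z: "z \<in> FO Z A" using st by simp
  note R = decX[OF A z]
  have S: "cov A (fst ` dec A z)" using XD(4)[OF R(1)] .
  show "app s A z = app t A z"
  proof (rule sheaf_separated[OF _ S])
   fix f assume "f \<in> fst ` dec A z"
   then obtain x where x: "(f, x) \<in> dec A z" by auto
   hence f: "f \<in> Ar C" "cod f = A" "x \<in> V (dom f)" using XD(1)[OF R(1)] by blast+
   have "res Z f z = h (dom f) x" using res[of f "dec A z"] xact_eta[OF R(1) x] R f by (simp add: h_def)
   thus "res (Cod E t) f (app s A z) = res (Cod E t) f (app t A z)"
    using app_nat[OF st(1) f(1), of z] app_nat[OF st(2) f(1), of z] eq[OF _ f(3)] st z f by simp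
  qed (use st A z app_in[OF st(1) A] app_in[OF st(2) A] in auto)
 qed (use st in auto)
 ultimately show ?thesis unfolding is_free_sheaf_def using Z by (intro exI[of _ Z] exI[of _ h]) blast
qed

end

end

section \<open>Sheafification, the Yoneda lemma, and universal elements of
  \<open>ay A\<close>\<close>

section \<open>The associated sheaf functor\<close>

text \<open>The action on arrows is forced by uniqueness in the universal arrows, and the same
  uniqueness gives functoriality.\<close>

lemma left_adjoint_exists:
 assumes R: "cat_functor D C R"
  and univ: "\<And>A. A \<in> Ob C ==> \<exists>B e. B \<in> Ob D \<and> e \<in> Hom C A (FO R B) \<and>
   (\<forall>B'\<in>Ob D. \<forall>f\<in>Hom C A (FO R B'). \<exists>!g. g \<in> Hom D B B' \<and> FA R g \<cdot>[C] e = f)"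
 shows "\<exists>L. left_adjoint C D L R"
proof -
 interpret R: cat_functor D C R by (rule R)
 obtain L0 e where L0: "\<And>A. A \<in> Ob C ==> L0 A \<in> Ob D"
  and e: "\<And>A. A \<in> Ob C ==> e A \<in> Hom C A (FO R (L0 A))"
  and u: "\<And>A B' f. A \<in> Ob C ==> B' \<in> Ob D ==> f \<in> Hom C A (FO R B') ==>
   \<exists>!g. g \<in> Hom D (L0 A) B' \<and> FA R g \<cdot>[C] e A = f"
 proof -
  have "\<forall>A\<in>Ob C. \<exists>Be. fst Be \<in> Ob D \<and> snd Be \<in> Hom C A (FO R (fst Be)) \<and>
   (\<forall>B'\<in>Ob D. \<forall>f\<in>Hom C A (FO R B'). \<exists>!g. g \<in> Hom D (fst Be) B' \<and> FA R g \<cdot>[C] snd Be = f)"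
   using univ by simp
  then obtain Be where "\<forall>A\<in>Ob C. fst (Be A) \<in> Ob D \<and> snd (Be A) \<in> Hom C A (FO R (fst (Be A))) \<and>
   (\<forall>B'\<in>Ob D. \<forall>f\<in>Hom C A (FO R B'). \<exists>!g. g \<in> Hom D (fst (Be A)) B' \<and> FA R g \<cdot>[C] snd (Be A) = f)"
   by (rule bchoice[THEN exE])
  thus thesis using that[of "\<lambda>A. fst (Be A)" "\<lambda>A. snd (Be A)"] by blast
 qed
 have e': "e A \<in> Ar C" "Dom C (e A) = A" "Cod C (e A) = FO R (L0 A)" if "A \<in> Ob C" for A
  using e[OF that] by (auto simp: Hom_iff)
 have uniq: "g = g'" if "A \<in> Ob C" "g \<in> Ar D" "g' \<in> Ar D" "Dom D g = L0 A" "Dom D g' = L0 A" "Cod D g = Cod D g'"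
  "FA R g \<cdot>[C] e A = FA R g' \<cdot>[C] e A" for A g g'
 proof -
  have "\<exists>!h. h \<in> Hom D (L0 A) (Cod D g) \<and> FA R h \<cdot>[C] e A = FA R g \<cdot>[C] e A"
   by (rule u) (use that e' in \<open>auto simp: Hom_iff\<close>)
  thus ?thesis by (rule ex1E) (use that in \<open>metis Hom_iff\<close>)
 qed
 define l where "l f = (THE g. g \<in> Hom D (L0 (Dom C f)) (L0 (Cod C f)) \<and>
   FA R g \<cdot>[C] e (Dom C f) = e (Cod C f) \<cdot>[C] f)" for f
 have l: "l f \<in> Ar D" "Dom D (l f) = L0 (Dom C f)" "Cod D (l f) = L0 (Cod C f)"
  "FA R (l f) \<cdot>[C] e (Dom C f) = e (Cod C f) \<cdot>[C] f" if f: "f \<in> Ar C" for f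
 proof -
  have "l f \<in> Hom D (L0 (Dom C f)) (L0 (Cod C f)) \<and> FA R (l f) \<cdot>[C] e (Dom C f) = e (Cod C f) \<cdot>[C] f"
   unfolding l_def by (rule theI', rule u) (use f L0 e' in \<open>auto simp: Hom_iff\<close>)
  thus "l f \<in> Ar D" "Dom D (l f) = L0 (Dom C f)" "Cod D (l f) = L0 (Cod C f)"
   "FA R (l f) \<cdot>[C] e (Dom C f) = e (Cod C f) \<cdot>[C] f" by (auto simp: Hom_iff)
 qed
 define L where "L = \<lparr>FO = (\<lambda>A\<in>Ob C. L0 A), FA = (\<lambda>f\<in>Ar C. l f)\<rparr>"
 have Ls [simp]: "A \<in> Ob C ==> FO L A = L0 A" "f \<in> Ar C ==> FA L f = l f" for A f
  by (simp_all add: L_def)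
 have L: "cat_functor C D L"
 proof (rule cat_functorI, goal_cases)
  case (9 A)
  have "l (Idt C A) = Idt D (L0 A)"
   by (rule uniq[of A]) (use 9 l[of "Idt C A"] L0 e' in auto)
  thus ?case using 9 by simp
 next
  case (10 f g)
  have eq: "FA R (l g) \<cdot>[C] (FA R (l f) \<cdot>[C] e (Dom C f)) = (e (Cod C g) \<cdot>[C] g) \<cdot>[C] f"
   using 10 l(4)[OF 10(1)] e' L0 l(1-3) R.tgt.comp_reassoc[OF l(4)[OF 10(2)], of f] by simp
  have "l (g \<cdot>[C] f) = l g \<cdot>[D] l f"
   by (rule uniq[of "Dom C f"])
    (use 10 eq l[of "g \<cdot>[C] f"] l(1-3)[of f] l(1-3)[of g] e' L0 R.FA_comp[of "l f" "l g"] in simp_all)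
  thus ?case using 10 by simp
 qed (use L0 l R.src.category_axioms R.tgt.category_axioms in \<open>auto simp: L_def\<close>)
 show ?thesis
  unfolding left_adjoint_def
 proof (intro exI conjI)
  show "cat_functor C D L" by (rule L)
  show "cat_functor D C R" by (rule R)
  show "nat_trans C C \<lparr>Src = id_functor C, Tgt = comp_functor C R L, component = (\<lambda>A\<in>Ob C. e A)\<rparr>"
  proof (rule nat_transI, goal_cases)
   case (7 f) thus ?case using l(4)[of f] by simp
  qed (use e' L R in \<open>auto intro: cat_functor_id cat_functor_comp R.tgt.category_axioms\<close>)
  show "\<forall>A\<in>Ob C. \<forall>B\<in>Ob D. \<forall>f\<in>Hom C A (FO R B). \<exists>!g. g \<in> Hom D (FO L A) B \<and>
   FA R g \<cdot>[C] component \<lparr>Src = id_functor C, Tgt = comp_functor C R L, component = (\<lambda>A\<in>Ob C. e A)\<rparr> A = f"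
   using u by simp
 qed auto
qed

lemma representable_mk: "representable C A = mk_presheaf C (\<lambda>B. Hom C B A) (\<lambda>f h. h \<cdot>[C] f)"
 by (simp add: representable_def mk_presheaf_def)

context site
begin

abbreviation "yo A \<equiv> representable C A"

lemma raw_representable: "raw_presheaf C (\<lambda>B. Hom C B A) (\<lambda>f h. h \<cdot> f)"
 by (auto simp: raw_presheaf_def Hom_iff)

lemma small_Hom: "small TYPE('u) (Hom C B A)"
 by (rule small_subset[OF small_Ar]) (auto simp: Hom_iff)

lemma representable_PSh: "yo A \<in> Ob (PSh C)"
 unfolding representable_mk
 by (rule mk_presheaf_Ob[OF category_axioms raw_representable]) (rule small_Hom)

lemma representable_FO [simp]: "B \<in> Ob C ==> FO (yo A) B = Hom C B A"
 by (simp add: representable_mk)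

lemma representable_res [simp]: "f \<in> Ar C ==> h \<in> Ar C ==> dom h = cod f ==> cod h = A ==> res (yo A) f h = h \<cdot> f"
 by (simp add: representable_mk Hom_iff)

sublocale idf: cfun C "TYPE('u)" M C "TYPE('u)" M "id_functor C"
 by (rule cfun_id)

lemma representable_sheaf:
 assumes A: "A \<in> Ob C" shows "yo A \<in> Ob E"
proof (rule E_ObI[OF representable_PSh])
 show "raw_sheaf C M (FO (yo A)) (res (yo A))"
  unfolding raw_sheaf_def
 proof (intro conjI ballI allI impI, goal_cases)
  case (1 B S x)
  hence S: "cov B S" by simp
  note sD = sieveD[OF covering_sieve_sieve[OF S]]
  have x: "x f \<in> Ar C \<and> dom (x f) = dom f \<and> cod (x f) = A" if "f \<in> S" for f
   using 1 sD(1)[OF that] that by (auto simp: Hom_iff)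
  obtain h where h: "h \<in> Ar C" "dom h = B" "cod h = A" "\<And>f. f \<in> S ==> h \<cdot> f = x f"
  proof (rule idf.covering_glue[OF S A, of x])
   fix f g assume "f \<in> S" "g \<in> Ar C" "cod g = dom f"
   moreover from this have "x (f \<cdot> g) = res (yo A) g (x f)" using 1 by blast
   ultimately show "x (f \<cdot> g) = x f \<cdot> FA (id_functor C) g" using x[of f] by simp
  qed (use x sD(1) 1(1) in auto)
  thus ?case using 1(1) sD(1,2) by (intro bexI[of _ h]) (auto simp: Hom_iff)
 next
  case (2 B S a b)
  note sD = sieveD[OF covering_sieve_sieve[OF 2(2)]]
  show ?case by (rule idf.covering_unique[OF 2(2)]) (use 2 sD(1,2) in \<open>auto simp: Hom_iff\<close>)
 qed
qed

definition yoneda_elem :: "('o, 'u) presheaf \<Rightarrow> 'o \<Rightarrow> 'u \<Rightarrow> ('o, 'u) presheaf_map" where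
 "yoneda_elem Q A q = mk_map C (yo A) Q (\<lambda>B h. res Q h q)"

lemma yoneda_elem:
 assumes Q: "Q \<in> Ob E" and A: "A \<in> Ob C" and q: "q \<in> FO Q A"
 shows "yoneda_elem Q A q \<in> Hom (PSh C) (yo A) Q" "app (yoneda_elem Q A q) A (Idt C A) = q"
proof -
 have "raw_map C (FO (yo A)) (res (yo A)) (FO Q) (res Q) (\<lambda>B h. res Q h q)"
  by (rule raw_mapI) (use assms in \<open>auto simp: Hom_iff\<close>)
 hence "yoneda_elem Q A q \<in> Ar (PSh C)"
  unfolding yoneda_elem_def by (rule mk_map_Ar[OF category_axioms representable_PSh E_Ob_PSh[OF Q]])
 thus "yoneda_elem Q A q \<in> Hom (PSh C) (yo A) Q" by (simp add: Hom_iff yoneda_elem_def)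
 show "app (yoneda_elem Q A q) A (Idt C A) = q" using assms by (simp add: yoneda_elem_def Hom_iff)
qed

lemma yoneda_unique:
 assumes A: "A \<in> Ob C" and st: "s \<in> Hom (PSh C) (yo A) Q" "t \<in> Hom (PSh C) (yo A) Q"
  and eq: "app s A (Idt C A) = app t A (Idt C A)"
 shows "s = t"
proof (rule PSh_ext)
 show s: "s \<in> Ar (PSh C)" and t: "t \<in> Ar (PSh C)" using st by (auto simp: Hom_iff)
 fix B h assume "B \<in> Ob C" "h \<in> FO (Src s) B"
 hence h: "h \<in> Ar C" "dom h = B" "cod h = A" using st by (auto simp: Hom_iff)
 have *: "app u B h = res Q h (app u A (Idt C A))" if u: "u \<in> Hom (PSh C) (yo A) Q" for u
 proof -
  have "raw_map C (FO (yo A)) (res (yo A)) (FO Q) (res Q) (app u)"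
   using PSh_Ar_raw[OF category_axioms, of u] u by (simp add: Hom_iff)
  moreover have "Idt C A \<in> FO (yo A) (cod h)" using h A by (simp add: Hom_iff)
  ultimately have "app u (dom h) (res (yo A) h (Idt C A)) = res Q h (app u (cod h) (Idt C A))"
   using h unfolding raw_map_def by blast
  thus ?thesis using h A by simp
 qed
 show "app s B h = app t B h" using *[OF st(1)] *[OF st(2)] eq by simp
qed (use st in \<open>auto simp: Hom_iff\<close>)

lemma yoneda_FO [simp]: "A \<in> Ob C ==> FO (yoneda C) A = yo A"
 by (simp add: yoneda_def)

lemma yoneda_FA: "g \<in> Ar C ==> FA (yoneda C) g = mk_map C (yo (dom g)) (yo (cod g)) (\<lambda>B h. g \<cdot> h)"
 by (simp add: yoneda_def mk_map_def cong: restrict_cong)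

lemma yoneda_FA_app: "g \<in> Ar C ==> h \<in> Ar C ==> cod h = dom g ==> app (FA (yoneda C) g) (dom h) h = g \<cdot> h"
 by (simp add: yoneda_FA Hom_iff)

lemma yoneda_FA_Ar: "g \<in> Ar C ==> FA (yoneda C) g \<in> Ar (PSh C)"
 unfolding yoneda_FA
 by (rule mk_map_Ar[OF category_axioms representable_PSh representable_PSh], rule raw_mapI)
  (auto simp: Hom_iff)

lemma cat_functor_yoneda: "cat_functor C (PSh C) (yoneda C)"
proof (rule cat_functorI, goal_cases)
 case (9 A)
 thus ?case
  by (intro PSh_ext[of _ C]) (simp_all add: yoneda_FA_Ar, simp_all add: yoneda_FA representable_PSh app_id Hom_iff)
next
 case (10 f g)
 have P: "FA (yoneda C) g \<cdot>[PSh C] FA (yoneda C) f \<in> Ar (PSh C)"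
  using 10 by (intro PSh.comp_simps) (auto simp: yoneda_FA_Ar, simp add: yoneda_FA)
 show ?case
 proof (rule PSh_ext[OF yoneda_FA_Ar P])
  fix A x assume "A \<in> Ob C" "x \<in> FO (Src (FA (yoneda C) (g \<cdot> f))) A"
  thus "app (FA (yoneda C) (g \<cdot> f)) A x = app (FA (yoneda C) g \<cdot>[PSh C] FA (yoneda C) f) A x"
   using 10 app_comp[of A C x "FA (yoneda C) f" "FA (yoneda C) g"] yoneda_FA_Ar[OF 10(1)]
   by (simp add: yoneda_FA Hom_iff)
 qed (use 10 in \<open>auto simp: yoneda_FA\<close>)
qed (simp_all add: category_axioms category_PSh representable_PSh yoneda_FA_Ar,
  simp_all add: yoneda_FA, simp_all add: yoneda_def)

lemma cat_functor_inclusion: "cat_functor E (PSh C) (id_functor E)"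
proof (rule cat_functorI, goal_cases)
 case (10 f g)
 hence "g \<cdot>[E] f \<in> Ar E" by (rule E.comp_simps)
 thus ?case using 10 by (simp add: E_Cmp)
next
 case (9 A)
 hence "Idt E A \<in> Ar E" by simp
 thus ?case using 9 by (simp add: E_Idt)
qed (use E.category_axioms category_PSh E_Ob_PSh E_Ar in \<open>simp_all add: E_Dom E_Cod\<close>, simp_all add: id_functor_def)

lemma sheafification: "left_adjoint (PSh C) E (associated_sheaf C M) (id_functor E)"
 unfolding associated_sheaf_def
proof (rule someI_ex, rule left_adjoint_exists[OF cat_functor_inclusion])
 fix P assume P: "P \<in> Ob (PSh C)"
 \<comment> \<open>The universal arrow at \<open>P\<close> is the free sheaf on \<open>P\<close>
   without identifications.\<close>
 obtain Z h where "is_free_sheaf (FO P) (res P) (\<lambda>_. {}) Z h"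
  using free_sheaf[OF PSh_Ob_raw(1)[OF category_axioms P] PSh_Ob_raw(2)[OF category_axioms P]] by blast
 note free = is_free_sheafD[OF this]
 note Z = free(1)
 define e where "e = mk_map C P Z h"
 have e: "e \<in> Ar (PSh C)" unfolding e_def by (rule mk_map_Ar[OF category_axioms P E_Ob_PSh[OF Z] free(2)])
 have eZ: "Dom (PSh C) e = P" "Cod (PSh C) e = Z" by (simp_all add: e_def)
 have comp: "app (t \<cdot>[PSh C] e) A x = app t A (h A x)" if "A \<in> Ob C" "x \<in> FO P A" for t A x
  using app_comp[of A C x e t] e that by (simp add: e_def)
 show "\<exists>B e. B \<in> Ob E \<and> e \<in> Hom (PSh C) P (FO (id_functor E) B) \<and>
   (\<forall>B'\<in>Ob E. \<forall>f\<in>Hom (PSh C) P (FO (id_functor E) B'). \<exists>!g. g \<in> Hom E B B' \<and> FA (id_functor E) g \<cdot>[PSh C] e = f)"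
 proof (intro exI conjI ballI)
  show "e \<in> Hom (PSh C) P (FO (id_functor E) Z)" using e Z by (simp add: Hom_iff e_def)
  fix Q f assume Q: "Q \<in> Ob E" and "f \<in> Hom (PSh C) P (FO (id_functor E) Q)"
  hence f: "f \<in> Ar (PSh C)" "Src f = P" "Tgt f = Q" by (auto simp: Hom_iff)
  obtain t where t: "t \<in> Ar E" "Dom E t = Z" "Cod E t = Q" "\<forall>A\<in>Ob C. \<forall>x\<in>FO P A. app t A (h A x) = app f A x"
   using free(4)[OF Q, of "app f"] PSh_Ar_raw[OF category_axioms f(1)] f by (auto simp: resp_rel_def)
  have tP: "t \<in> Ar (PSh C)" using t(1) E_Ar by blast
  have c: "u \<cdot>[PSh C] e \<in> Ar (PSh C)" if "u \<in> Ar E" "Dom E u = Z" for u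
   using that e eZ E_Ar[of u] E_Dom by (intro PSh.comp_simps) auto
  show "\<exists>!g. g \<in> Hom E Z Q \<and> FA (id_functor E) g \<cdot>[PSh C] e = f"
  proof (rule ex1I[of _ t])
   have "t \<cdot>[PSh C] e = f"
    by (rule PSh_ext[OF c f(1)]) (use t f comp in \<open>auto simp: E_Cod e_def\<close>)
   thus "t \<in> Hom E Z Q \<and> FA (id_functor E) t \<cdot>[PSh C] e = f" using t by (simp add: Hom_iff)
   fix g assume "g \<in> Hom E Z Q \<and> FA (id_functor E) g \<cdot>[PSh C] e = f"
   hence g: "g \<in> Ar E" "Dom E g = Z" "Cod E g = Q" "g \<cdot>[PSh C] e = f" by (auto simp: Hom_iff)
   show "g = t"
   proof (rule free(5))
    fix A x assume A: "A \<in> Ob C" "x \<in> FO P A"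
    have "app g A (h A x) = app f A x" using comp[OF A, of g] g(4) by simp
    thus "app g A (h A x) = app t A (h A x)" using t(4) A by simp
   qed (use g t in auto)
  qed
 qed (rule Z)
qed

abbreviation "K \<equiv> ay C M"

lemma cat_functor_K: "cat_functor C E K"
 unfolding ay_def using sheafification cat_functor_yoneda by (auto simp: left_adjoint_def intro: cat_functor_comp)

sublocale K: cat_functor C E K
 by (rule cat_functor_K)

text \<open>All that is used about \<open>ay\<close>, whose left adjoint is an arbitrary one. By the
  second clause maps out of \<open>ay A\<close> are elements of the target, by the third
  \<open>ay f\<close> acts by restriction, and the last says that \<open>ay A\<close> is represented
  by \<open>A\<close> with generic element \<open>e A\<close>.\<close>

definition universal_elements :: "('o \<Rightarrow> 'u) \<Rightarrow> bool" where
 "universal_elements e \<longleftrightarrow> (\<forall>A\<in>Ob C. e A \<in> FO (FO K A) A) \<and>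
   (\<forall>A\<in>Ob C. \<forall>Q\<in>Ob E. \<forall>q\<in>FO Q A. \<exists>!t. t \<in> Hom E (FO K A) Q \<and> app t A (e A) = q) \<and>
   (\<forall>f\<in>Ar C. app (FA K f) (dom f) (e (dom f)) = res (FO K (cod f)) f (e (cod f))) \<and>
   (\<forall>A\<in>Ob C. \<forall>B\<in>Ob C. \<forall>z\<in>FO (FO K A) B. \<exists>!f. f \<in> Hom C B A \<and> res (FO K A) f (e A) = z)"

lemma universal_elements_exist: "\<exists>e. universal_elements e"
proof -
 let ?L = "associated_sheaf C M" and ?i = "id_functor E"
 interpret L: cat_functor "PSh C" E ?L using sheafification by (simp add: left_adjoint_def)
 obtain n where n: "nat_trans (PSh C) (PSh C) n" "Src n = id_functor (PSh C)" "Tgt n = comp_functor (PSh C) ?i ?L"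
  and nu: "\<And>P Q f. P \<in> Ob (PSh C) ==> Q \<in> Ob E ==> f \<in> Hom (PSh C) P (FO ?i Q) ==>
   \<exists>!g. g \<in> Hom E (FO ?L P) Q \<and> FA ?i g \<cdot>[PSh C] component n P = f"
  using sheafification unfolding left_adjoint_def by blast
 have nP: "component n P \<in> Ar (PSh C)" "Src (component n P) = P" "Tgt (component n P) = FO ?L P"
  if "P \<in> Ob (PSh C)" for P
  using nat_transD(4-6)[OF n(1) that] n(2,3) that by (simp_all)
 let ?n = "\<lambda>A. component n (yo A)"
 define e where "e A = app (?n A) A (Idt C A)" for A
 have KL: "FO K A = FO ?L (yo A)" if "A \<in> Ob C" for A using that by (simp add: ay_def)
 have eK: "e A \<in> FO (FO K A) A" if A: "A \<in> Ob C" for A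
 proof -
  have "raw_map C (FO (yo A)) (res (yo A)) (FO (FO K A)) (res (FO K A)) (app (?n A))"
   using PSh_Ar_raw[OF category_axioms nP(1)[OF representable_PSh]] nP[OF representable_PSh] KL[OF A] by simp
  thus ?thesis using A unfolding e_def raw_map_def by (auto simp: Hom_iff)
 qed
 have n_res: "app (?n A) (dom f) f = res (FO K A) f (e A)"
  if "f \<in> Ar C" "cod f = A" for f A
 proof -
  have A: "A \<in> Ob C" using that by auto
  have "raw_map C (FO (yo A)) (res (yo A)) (FO (FO K A)) (res (FO K A)) (app (?n A))"
   using PSh_Ar_raw[OF category_axioms nP(1)[OF representable_PSh]] nP[OF representable_PSh] KL[OF A] by simp
  moreover have "Idt C A \<in> FO (yo A) (cod f)" using that A by (simp add: Hom_iff)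
  ultimately have "app (?n A) (dom f) (res (yo A) f (Idt C A)) = res (FO K A) f (app (?n A) (cod f) (Idt C A))"
   using that unfolding raw_map_def by blast
  thus ?thesis using that A by (simp add: e_def)
 qed
 have app_n: "app (t \<cdot>[PSh C] ?n A) A (Idt C A) = app t A (e A)" if "A \<in> Ob C" for A t
  using app_comp[of A C "Idt C A" "?n A" t] nP[OF representable_PSh, of A] that by (simp add: e_def Hom_iff)
 have univ: "\<exists>!t. t \<in> Hom E (FO K A) Q \<and> app t A (e A) = q"
  if A: "A \<in> Ob C" and Q: "Q \<in> Ob E" and q: "q \<in> FO Q A" for A Q q
 proof -
  note Y = yoneda_elem[OF Q A q]
  have "\<exists>!g. g \<in> Hom E (FO ?L (yo A)) Q \<and> FA ?i g \<cdot>[PSh C] ?n A = yoneda_elem Q A q"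
   by (rule nu) (use Y(1) Q representable_PSh in simp_all)
  moreover have "FA ?i g \<cdot>[PSh C] ?n A = yoneda_elem Q A q \<longleftrightarrow> app g A (e A) = q"
   if g: "g \<in> Hom E (FO ?L (yo A)) Q" for g
  proof
   have ig: "FA ?i g = g" using g by (simp add: Hom_iff)
   {
    assume "FA ?i g \<cdot>[PSh C] ?n A = yoneda_elem Q A q"
    thus "app g A (e A) = q" using app_n[OF A, of g] Y(2) ig by simp
   next
    assume *: "app g A (e A) = q"
    have "g \<in> Ar (PSh C)" "Src g = FO ?L (yo A)" "Tgt g = Q" using g by (auto simp: Hom_iff E_Ar E_Dom E_Cod)
    hence "g \<cdot>[PSh C] ?n A \<in> Hom (PSh C) (yo A) Q"
     using nP[OF representable_PSh, of A] PSh.comp_simps[of "?n A" g] by (auto simp: Hom_iff)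
    thus "FA ?i g \<cdot>[PSh C] ?n A = yoneda_elem Q A q"
     unfolding ig by (rule yoneda_unique[OF A _ Y(1)]) (simp add: app_n[OF A] * Y(2))
   }
  qed
  ultimately show ?thesis unfolding KL[OF A] by (simp cong: conj_cong)
 qed
 have Ke: "app (FA K f) (dom f) (e (dom f)) = res (FO K (cod f)) f (e (cod f))" if f: "f \<in> Ar C" for f
 proof -
  let ?A = "dom f" and ?B = "cod f"
  have Kf: "FA K f = FA ?L (FA (yoneda C) f)" using f by (simp add: ay_def)
  have yf: "FA (yoneda C) f \<in> Ar (PSh C)" "Src (FA (yoneda C) f) = yo ?A" "Tgt (FA (yoneda C) f) = yo ?B"
   using f yoneda_FA_Ar by (auto simp: yoneda_FA)
  have "component n (yo ?B) \<cdot>[PSh C] FA (yoneda C) f = FA K f \<cdot>[PSh C] component n (yo ?A)"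
   using nat_transD(7)[OF n(1) yf(1)] yf n(2,3) Kf L.FA_in[OF yf(1)] by simp
  moreover have "app (component n (yo ?B) \<cdot>[PSh C] FA (yoneda C) f) ?A (Idt C ?A) = app (component n (yo ?B)) ?A f"
   using app_comp[of ?A C "Idt C ?A" "FA (yoneda C) f" "component n (yo ?B)"] yf f yoneda_FA_app[of f "Idt C ?A"]
   by (simp add: Hom_iff)
  ultimately show ?thesis using app_n[of ?A "FA K f"] n_res[of f ?B] f by simp
 qed
 \<comment> \<open>The topology being subcanonical, the representable at \<open>A\<close> is a
   sheaf, so the universal property yields \<open>s\<close> from \<open>ay A\<close> back to it,
   sending \<open>e A\<close> to the identity. The unit composed with \<open>s\<close> fixes
   \<open>e A\<close> and is thus the identity; hence \<open>z\<close> is the restriction of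
   \<open>e A\<close> along \<open>s z\<close>.\<close>
 have elem: "\<exists>!f. f \<in> Hom C B A \<and> res (FO K A) f (e A) = z"
  if A: "A \<in> Ob C" and B: "B \<in> Ob C" and z: "z \<in> FO (FO K A) B" for A B z
 proof -
  have yA: "yo A \<in> Ob E" by (rule representable_sheaf[OF A])
  have KA: "FO K A \<in> Ob E" using A by simp
  have "Idt C A \<in> FO (yo A) A" using A by (simp add: Hom_iff)
  then obtain s where s: "s \<in> Ar E" "Dom E s = FO K A" "Cod E s = yo A" "app s A (e A) = Idt C A"
   using ex1_implies_ex[OF univ[OF A yA]] unfolding Hom_iff by blast
  have nE: "?n A \<in> Ar E" "Dom E (?n A) = yo A" "Cod E (?n A) = FO K A"
   using nP[OF representable_PSh, of A] yA KA KL[OF A] by (simp_all add: E_Ar E_Dom E_Cod)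
  have "?n A \<cdot>[E] s = Idt E (FO K A)"
  proof -
   have "?n A \<cdot>[E] s \<in> Hom E (FO K A) (FO K A) \<and> app (?n A \<cdot>[E] s) A (e A) = e A"
    using nE s eK[OF A] A by (simp add: Hom_iff) (simp add: e_def)
   moreover have "Idt E (FO K A) \<in> Hom E (FO K A) (FO K A) \<and> app (Idt E (FO K A)) A (e A) = e A"
    using KA eK[OF A] A by (simp add: Hom_iff)
   ultimately show ?thesis using univ[OF A KA eK[OF A]] by blast
  qed
  hence "app (?n A) B (app s B z) = z"
   using E_app_comp[OF s(1) B, of z "?n A"] z s(2) B by simp
  moreover have "app s B z \<in> Hom C B A" using app_in[OF s(1) B, of z] z s B by simp
  ultimately have ex: "app s B z \<in> Hom C B A \<and> res (FO K A) (app s B z) (e A) = z"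
   using n_res[of "app s B z" A] by (auto simp: Hom_iff)
  have "f = app s B z" if f: "f \<in> Hom C B A \<and> res (FO K A) f (e A) = z" for f
  proof -
   have "app s B z = res (yo A) f (app s A (e A))"
    using f app_nat[OF s(1), of f "e A"] s eK[OF A] by (auto simp: Hom_iff)
   thus ?thesis using f s A by (auto simp: Hom_iff)
  qed
  thus ?thesis using ex by blast
 qed
 have "universal_elements e"
  unfolding universal_elements_def using eK univ Ke elem by blast
 thus ?thesis by blast
qed

definition ue :: "'o \<Rightarrow> 'u" where
 "ue = (SOME e. universal_elements e)"

lemma ue: "universal_elements ue"
 unfolding ue_def using someI_ex[OF universal_elements_exist] .

lemma ue_in [simp]: "A \<in> Ob C ==> ue A \<in> FO (FO K A) A"
 using ue unfolding universal_elements_def by blast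

lemma app_K [simp]: "f \<in> Ar C ==> dom f = A ==> app (FA K f) A (ue A) = res (FO K (cod f)) f (ue (cod f))"
 using ue unfolding universal_elements_def by blast

text \<open>The point of \<open>Q\<close> named by \<open>q\<close>: the Yoneda correspondence for
  \<open>ay A\<close> instead of the representable presheaf.\<close>

definition pt :: "('o, 'u) presheaf \<Rightarrow> 'o \<Rightarrow> 'u \<Rightarrow> ('o, 'u) presheaf_map" where
 "pt Q A q = (THE t. t \<in> Hom E (FO K A) Q \<and> app t A (ue A) = q)"

lemma pt [simp]:
 assumes "Q \<in> Ob E" "A \<in> Ob C" "q \<in> FO Q A"
 shows "pt Q A q \<in> Ar E" "Dom E (pt Q A q) = FO K A" "Cod E (pt Q A q) = Q" "app (pt Q A q) A (ue A) = q"
proof -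
 have "\<exists>!t. t \<in> Hom E (FO K A) Q \<and> app t A (ue A) = q"
  using ue assms unfolding universal_elements_def by blast
 from theI'[OF this] show "pt Q A q \<in> Ar E" "Dom E (pt Q A q) = FO K A" "Cod E (pt Q A q) = Q" "app (pt Q A q) A (ue A) = q"
  unfolding pt_def by (auto simp: Hom_iff)
qed

lemma K_ext:
 assumes "A \<in> Ob C" "s \<in> Ar E" "t \<in> Ar E" "Dom E s = FO K A" "Dom E t = FO K A" "Cod E s = Cod E t"
  "app s A (ue A) = app t A (ue A)"
 shows "s = t"
proof -
 have "app s A (ue A) \<in> FO (Cod E s) A" using assms by simp
 hence "\<exists>!u. u \<in> Hom E (FO K A) (Cod E s) \<and> app u A (ue A) = app s A (ue A)"
  using ue assms(1,2) E.Cod_in unfolding universal_elements_def by blast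
 thus ?thesis by (rule ex1E) (use assms in \<open>metis Hom_iff\<close>)
qed

lemma K_elem:
 assumes "A \<in> Ob C" "B \<in> Ob C" "z \<in> FO (FO K A) B"
 obtains f where "f \<in> Ar C" "dom f = B" "cod f = A" "z = res (FO K A) f (ue A)"
 using ue assms unfolding universal_elements_def Hom_iff by metis

lemma K_elem_unique:
 assumes "f \<in> Ar C" "g \<in> Ar C" "dom f = dom g" "cod f = A" "cod g = A"
  "res (FO K A) f (ue A) = res (FO K A) g (ue A)"
 shows "f = g"
proof -
 have "A \<in> Ob C" "dom g \<in> Ob C" using assms by auto
 moreover from this have "res (FO K A) g (ue A) \<in> FO (FO K A) (dom g)" using assms by simp
 ultimately have "\<exists>!h. h \<in> Hom C (dom g) A \<and> res (FO K A) h (ue A) = res (FO K A) g (ue A)"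
  using ue unfolding universal_elements_def by blast
 thus ?thesis by (rule ex1E) (use assms in \<open>metis Hom_iff\<close>)
qed

lemma pt_res:
 assumes "Q \<in> Ob E" "f \<in> Ar C" "q \<in> FO Q (cod f)"
 shows "pt Q (dom f) (res Q f q) = pt Q (cod f) q \<cdot>[E] FA K f"
 by (rule K_ext[of "dom f"]) (use assms app_nat[of "pt Q (cod f) q" f "ue (cod f)"] in simp_all)

lemma pt_comp:
 assumes "t \<in> Ar E" "A \<in> Ob C" "q \<in> FO (Dom E t) A"
 shows "t \<cdot>[E] pt (Dom E t) A q = pt (Cod E t) A (app t A q)"
 by (rule K_ext[of A]) (use assms in simp_all)

lemma app_pt: "Q \<in> Ob E ==> f \<in> Ar C ==> cod f = A ==> q \<in> FO Q A ==>
  app (pt Q A q) (dom f) (res (FO K A) f (ue A)) = res Q f q"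
 using app_nat[of "pt Q A q" f "ue A"] by auto

lemma pt_eta: "t \<in> Ar E ==> A \<in> Ob C ==> Dom E t = FO K A ==> t = pt (Cod E t) A (app t A (ue A))"
 by (rule K_ext[of A]) simp_all

section \<open>M-maps of sheaves in elementary terms, and the M-category axioms\<close>

section \<open>M-subsheaves\<close>

abbreviation "\<N> \<equiv> M_Sh C M"

definition im :: "('o, 'u) presheaf_map \<Rightarrow> 'o \<Rightarrow> 'u set" where
 "im t A = app t A ` FO (Dom E t) A"

text \<open>The sieve of arrows along which \<open>x\<close> restricts into the image of
  \<open>t\<close>. For an M-map of sheaves it is the principal sieve of an M-map of
  \<open>C\<close>.\<close>

definition hits :: "('o, 'u) presheaf_map \<Rightarrow> 'o \<Rightarrow> 'u \<Rightarrow> 'u set" where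
 "hits t A x = {f \<in> Ar C. cod f = A \<and> res (Cod E t) f x \<in> im t (dom f)}"

definition inj_map :: "('o, 'u) presheaf_map \<Rightarrow> bool" where
 "inj_map t \<longleftrightarrow> (\<forall>A\<in>Ob C. inj_on (app t A) (FO (Dom E t) A))"

lemma inj_mapD: "inj_map t ==> A \<in> Ob C ==> x \<in> FO (Dom E t) A ==> z \<in> FO (Dom E t) A ==>
  app t A x = app t A z ==> x = z"
 by (auto simp: inj_map_def inj_on_def)

lemma im_sub: "t \<in> Ar E ==> A \<in> Ob C ==> im t A \<subseteq> FO (Cod E t) A"
 by (auto simp: im_def)

lemma inj_map_mono: assumes "t \<in> Ar E" "inj_map t" shows "is_mono E t"
proof (rule E.monoI)
 fix f g assume fg: "f \<in> Ar E" "g \<in> Ar E" "Dom E f = Dom E g" "Cod E f = Dom E t" "Cod E g = Dom E t"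
  "t \<cdot>[E] f = t \<cdot>[E] g"
 show "f = g"
 proof (rule E_ext)
  fix A x assume A: "A \<in> Ob C" and x: "x \<in> FO (Dom E f) A"
  have "app t A (app f A x) = app t A (app g A x)"
   using E_app_comp[OF fg(1) A x, of t] E_app_comp[OF fg(2) A, of x t] x fg by simp
  thus "app f A x = app g A x"
   using inj_mapD[OF assms(2) A] app_in[OF fg(1) A x] app_in[OF fg(2) A, of x] x fg by simp
 qed (use fg in auto)
qed fact

text \<open>Preimages under an injective map are unique, so they may be taken elementwise;
  naturality of the factor is checked after applying \<open>t\<close>.\<close>

lemma map_factor:
 assumes s: "s \<in> Ar E" and t: "t \<in> Ar E" "inj_map t" and C: "Cod E s = Cod E t"
  and im: "\<And>A x. A \<in> Ob C ==> x \<in> FO (Dom E s) A ==> app s A x \<in> im t A"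
 obtains u where "u \<in> Ar E" "Dom E u = Dom E s" "Cod E u = Dom E t" "t \<cdot>[E] u = s"
proof -
 define \<phi> where "\<phi> A x = inv_into (FO (Dom E t) A) (app t A) (app s A x)" for A x
 have \<phi>: "\<phi> A x \<in> FO (Dom E t) A" "app t A (\<phi> A x) = app s A x" if "A \<in> Ob C" "x \<in> FO (Dom E s) A" for A x
  using im[OF that] unfolding \<phi>_def im_def by (auto intro: inv_into_into simp: f_inv_into_f)
 have PQ: "Dom E s \<in> Ob E" "Dom E t \<in> Ob E" using s t by auto
 have "raw_map C (FO (Dom E s)) (res (Dom E s)) (FO (Dom E t)) (res (Dom E t)) \<phi>"
 proof (rule raw_mapI)
  fix f x assume f: "f \<in> Ar C" and x: "x \<in> FO (Dom E s) (cod f)"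
  show "\<phi> (dom f) (res (Dom E s) f x) = res (Dom E t) f (\<phi> (cod f) x)"
  proof (rule inj_mapD[OF t(2)])
   show "app t (dom f) (\<phi> (dom f) (res (Dom E s) f x)) = app t (dom f) (res (Dom E t) f (\<phi> (cod f) x))"
    using \<phi>[of "dom f" "res (Dom E s) f x"] \<phi>[of "cod f" x] f x PQ app_nat[OF s f x]
     app_nat[OF t(1) f, of "\<phi> (cod f) x"] C by simp
  qed (use \<phi> f x PQ in auto)
 qed (rule \<phi>)
 note m = E_map[OF PQ this]
 have "t \<cdot>[E] mk_map C (Dom E s) (Dom E t) \<phi> = s"
  by (rule E_ext) (use m s t C \<phi> in simp_all)
 thus thesis using that m by blast
qed

text \<open>With injective legs the universal property reduces to images: a cone factors through
  \<open>\<nu>\<close> elementwise, and the other triangle commutes because \<open>\<mu>\<close> is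
  monic.\<close>

lemma pullback_criterion:
 assumes "\<mu> \<in> Ar E" "\<alpha> \<in> Ar E" "\<beta> \<in> Ar E" "\<nu> \<in> Ar E" "Cod E \<mu> = Cod E \<alpha>" "Dom E \<beta> = Dom E \<nu>"
  "Cod E \<beta> = Dom E \<mu>" "Cod E \<nu> = Dom E \<alpha>" "\<mu> \<cdot>[E] \<beta> = \<alpha> \<cdot>[E] \<nu>" "inj_map \<mu>" "inj_map \<nu>"
  and im: "\<And>A z. A \<in> Ob C ==> z \<in> FO (Dom E \<alpha>) A ==> app \<alpha> A z \<in> im \<mu> A ==> z \<in> im \<nu> A"
 shows "pullback E \<mu> \<alpha> \<beta> \<nu>"
proof (rule E.pullbackI_mono)
 show "is_mono E \<nu>" using inj_map_mono assms by blast
 fix h k assume hk: "h \<in> Ar E" "k \<in> Ar E" "Dom E h = Dom E k" "Cod E h = Dom E \<mu>" "Cod E k = Dom E \<alpha>"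
  "\<mu> \<cdot>[E] h = \<alpha> \<cdot>[E] k"
 have "app k A x \<in> im \<nu> A" if A: "A \<in> Ob C" and x: "x \<in> FO (Dom E k) A" for A x
 proof (rule im[OF A])
  show "app k A x \<in> FO (Dom E \<alpha>) A" using app_in[OF hk(2) A x] hk by simp
  have "app \<alpha> A (app k A x) = app \<mu> A (app h A x)"
   using E_app_comp[OF hk(1) A, of x \<mu>] E_app_comp[OF hk(2) A x, of \<alpha>] hk x by simp
  thus "app \<alpha> A (app k A x) \<in> im \<mu> A" using app_in[OF hk(1) A, of x] hk x unfolding im_def by auto
 qed
 then obtain u where u: "u \<in> Ar E" "Dom E u = Dom E k" "Cod E u = Dom E \<nu>" "\<nu> \<cdot>[E] u = k"
  using map_factor[OF hk(2) assms(4,11)] hk assms(8) by metis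
 have "\<beta> \<cdot>[E] u = h"
  by (rule E.mono_cancel[OF inj_map_mono[OF assms(1,10)]])
   (use u hk assms(1-9) E.comp_reassoc[OF assms(9), of u] in simp_all)
 thus "\<exists>u\<in>Ar E. Dom E u = Dom E h \<and> Cod E u = Dom E \<beta> \<and> \<beta> \<cdot>[E] u = h \<and> \<nu> \<cdot>[E] u = k"
  using u hk assms by (intro bexI[of _ u]) simp_all
qed (use assms in simp_all)

text \<open>Two elements with equal image name two maps out of \<open>ay A\<close> that form a cone;
  the generic element is carried by the induced map to the required element of the pullback.\<close>

lemma pullback_elem:
 assumes pb: "pullback E \<mu> \<alpha> \<beta> \<nu>" and A: "A \<in> Ob C" and z: "z \<in> FO (Dom E \<alpha>) A" and p: "p \<in> FO (Dom E \<mu>) A"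
  and eq: "app \<mu> A p = app \<alpha> A z"
 obtains w where "w \<in> FO (Dom E \<nu>) A" "app \<nu> A w = z" "app \<beta> A w = p"
proof -
 note D = E.pullbackD[OF pb]
 have PQ: "Dom E \<alpha> \<in> Ob E" "Dom E \<mu> \<in> Ob E" using D by auto
 have "\<mu> \<cdot>[E] pt (Dom E \<mu>) A p = \<alpha> \<cdot>[E] pt (Dom E \<alpha>) A z"
  using pt_comp[OF D(1) A p] pt_comp[OF D(2) A z] D eq by simp
 then obtain u where u: "u \<in> Ar E" "Dom E u = FO K A" "Cod E u = Dom E \<beta>"
  "\<beta> \<cdot>[E] u = pt (Dom E \<mu>) A p" "\<nu> \<cdot>[E] u = pt (Dom E \<alpha>) A z"
  using E.pullback_lift[OF pb, of "pt (Dom E \<mu>) A p" "pt (Dom E \<alpha>) A z"] pt[OF PQ(1) A z] pt[OF PQ(2) A p] by auto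
 have "app \<nu> A (app u A (ue A)) = z" "app \<beta> A (app u A (ue A)) = p"
  using E_app_comp[OF u(1) A, of "ue A" \<nu>] E_app_comp[OF u(1) A, of "ue A" \<beta>] u(2,4,5) A
   pt[OF PQ(1) A z] pt[OF PQ(2) A p] by simp_all
 moreover have "app u A (ue A) \<in> FO (Dom E \<nu>) A" using app_in[OF u(1) A, of "ue A"] u D A by simp
 ultimately show thesis using that by blast
qed

lemma pullback_im:
 assumes pb: "pullback E \<mu> \<alpha> \<beta> \<nu>" and A: "A \<in> Ob C" and z: "z \<in> FO (Dom E \<alpha>) A"
 shows "z \<in> im \<nu> A \<longleftrightarrow> app \<alpha> A z \<in> im \<mu> A"
proof
 note D = E.pullbackD[OF pb]
 {
  assume "z \<in> im \<nu> A"
  then obtain w where w: "w \<in> FO (Dom E \<nu>) A" "z = app \<nu> A w" by (auto simp: im_def)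
  hence "app \<alpha> A z = app \<mu> A (app \<beta> A w)"
   using E_app_comp[OF D(3) A, of w \<mu>] E_app_comp[OF D(4) A, of w \<alpha>] D by simp
  thus "app \<alpha> A z \<in> im \<mu> A" using app_in[OF D(3) A, of w] D w unfolding im_def by auto
 next
  assume "app \<alpha> A z \<in> im \<mu> A"
  then obtain p where "p \<in> FO (Dom E \<mu>) A" "app \<mu> A p = app \<alpha> A z" by (auto simp: im_def)
  thus "z \<in> im \<nu> A" using pullback_elem[OF pb A z] unfolding im_def by blast
 }
qed

lemma app_K_elem:
 assumes "f \<in> Ar C" "g \<in> Ar C" "cod f = dom g"
 shows "app (FA K g) (dom f) (res (FO K (dom g)) f (ue (dom g))) = res (FO K (cod g)) (g \<cdot> f) (ue (cod g))"
 using app_nat[of "FA K g" f "ue (dom g)"] assms by simp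

lemma inj_map_K: assumes "is_mono C m" shows "inj_map (FA K m)"
 unfolding inj_map_def
proof (intro ballI inj_onI)
 have m: "m \<in> Ar C" using assms by simp
 fix B x z assume B: "B \<in> Ob C" and xz: "x \<in> FO (Dom E (FA K m)) B" "z \<in> FO (Dom E (FA K m)) B"
  and eq: "app (FA K m) B x = app (FA K m) B z"
 obtain f where f: "f \<in> Ar C" "dom f = B" "cod f = dom m" "x = res (FO K (dom m)) f (ue (dom m))"
  using K_elem[OF _ B, of "dom m" x] xz m by auto
 obtain g where g: "g \<in> Ar C" "dom g = B" "cod g = dom m" "z = res (FO K (dom m)) g (ue (dom m))"
  using K_elem[OF _ B, of "dom m" z] xz m by auto
 have "m \<cdot> f = m \<cdot> g"
  by (rule K_elem_unique[of _ _ "cod m"]) (use eq f g m app_K_elem[OF f(1) m f(3)] app_K_elem[OF g(1) m g(3)] in simp_all)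
 hence "f = g" by (rule mono_cancel[OF assms]) (use f g in simp_all)
 thus "x = z" using f g by simp
qed

lemma im_K:
 assumes "m \<in> Ar C" "f \<in> Ar C" "cod f = cod m"
 shows "res (FO K (cod m)) f (ue (cod m)) \<in> im (FA K m) (dom f) \<longleftrightarrow> f \<in> factors m"
proof
 assume "res (FO K (cod m)) f (ue (cod m)) \<in> im (FA K m) (dom f)"
 then obtain x where x: "x \<in> FO (FO K (dom m)) (dom f)" "res (FO K (cod m)) f (ue (cod m)) = app (FA K m) (dom f) x"
  using assms by (auto simp: im_def)
 obtain g where g: "g \<in> Ar C" "dom g = dom f" "cod g = dom m" "x = res (FO K (dom m)) g (ue (dom m))"
  using K_elem[OF _ _ x(1)] assms by auto
 have "f = m \<cdot> g"
  by (rule K_elem_unique[of _ _ "cod m"]) (use x g assms app_K_elem[OF g(1) assms(1) g(3)] in simp_all)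
 thus "f \<in> factors m" using g by (auto simp: factors_def)
next
 assume "f \<in> factors m"
 then obtain g where g: "g \<in> Ar C" "cod g = dom m" "f = m \<cdot> g" by (auto simp: factors_def)
 thus "res (FO K (cod m)) f (ue (cod m)) \<in> im (FA K m) (dom f)"
  using app_K_elem[OF g(1) assms(1) g(2), symmetric] assms unfolding im_def by (auto intro!: image_eqI)
qed

text \<open>Two elements with the same image \<open>q\<close> lift to the pullback along the point
  \<open>q\<close>, both over the generic element; since \<open>ay m\<close> is injective the lifts
  agree, hence so do the elements. Given injectivity, a square over a point is a pullback exactly
  when the images match, that is, when the sieve of hits is the principal sieve of
  \<open>m\<close>.\<close>

lemma M_Sh_iff: "\<mu> \<in> \<N> \<longleftrightarrow> \<mu> \<in> Ar E \<and> inj_map \<mu> \<and>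
  (\<forall>A\<in>Ob C. \<forall>x\<in>FO (Cod E \<mu>) A. \<exists>m\<in>M. cod m = A \<and> hits \<mu> A x = factors m)"
proof
 assume mu: "\<mu> \<in> \<N>"
 hence \<mu>: "\<mu> \<in> Ar E" by (simp add: M_Sh_def)
 have P: "Dom E \<mu> \<in> Ob E" "Cod E \<mu> \<in> Ob E" using \<mu> by auto
 have pb: "\<exists>m\<in>M. cod m = A \<and> (\<exists>\<beta>. pullback E \<mu> (pt (Cod E \<mu>) A x) \<beta> (FA K m))"
  if "A \<in> Ob C" "x \<in> FO (Cod E \<mu>) A" for A x
  using mu that pt[OF P(2) that] unfolding M_Sh_def by (auto simp: Hom_iff)
 have "inj_map \<mu>"
  unfolding inj_map_def
 proof (intro ballI inj_onI)
  fix A x z assume A: "A \<in> Ob C" and xz: "x \<in> FO (Dom E \<mu>) A" "z \<in> FO (Dom E \<mu>) A" and eq: "app \<mu> A x = app \<mu> A z"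
  define q where "q = app \<mu> A x"
  have q: "q \<in> FO (Cod E \<mu>) A" using \<mu> A xz by (simp add: q_def)
  obtain m \<beta> where m: "m \<in> M" "cod m = A" and pbm: "pullback E \<mu> (pt (Cod E \<mu>) A q) \<beta> (FA K m)"
   using pb[OF A q] by blast
  note D = E.pullbackD[OF pbm]
  have e: "ue A \<in> FO (Dom E (pt (Cod E \<mu>) A q)) A" using pt[OF P(2) A q] A by simp
  obtain w where w: "w \<in> FO (Dom E (FA K m)) A" "app (FA K m) A w = ue A" "app \<beta> A w = x"
   using pullback_elem[OF pbm A e xz(1)] pt[OF P(2) A q] q_def by metis
  obtain v where v: "v \<in> FO (Dom E (FA K m)) A" "app (FA K m) A v = ue A" "app \<beta> A v = z"
   using pullback_elem[OF pbm A e xz(2)] pt[OF P(2) A q] q_def eq by metis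
  have "w = v" by (rule inj_mapD[OF inj_map_K[OF M_mono[OF m(1)]] A w(1) v(1)]) (simp add: w v)
  thus "x = z" using w v by simp
 qed
 moreover have "\<exists>m\<in>M. cod m = A \<and> hits \<mu> A x = factors m" if A: "A \<in> Ob C" and x: "x \<in> FO (Cod E \<mu>) A" for A x
 proof -
  obtain m \<beta> where m: "m \<in> M" "cod m = A" and pbm: "pullback E \<mu> (pt (Cod E \<mu>) A x) \<beta> (FA K m)"
   using pb[OF A x] by blast
  have "f \<in> hits \<mu> A x \<longleftrightarrow> f \<in> factors m" if f: "f \<in> Ar C" "cod f = A" for f
  proof -
   have "f \<in> hits \<mu> A x \<longleftrightarrow> app (pt (Cod E \<mu>) A x) (dom f) (res (FO K A) f (ue A)) \<in> im \<mu> (dom f)"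
    using f app_pt[OF P(2) f(1,2) x] by (simp add: hits_def)
   also have "\<dots> \<longleftrightarrow> res (FO K A) f (ue A) \<in> im (FA K m) (dom f)"
    by (rule pullback_im[OF pbm, symmetric]) (use f A pt[OF P(2) A x] in auto)
   also have "\<dots> \<longleftrightarrow> f \<in> factors m" using im_K[of m f] m f by simp
   finally show ?thesis .
  qed
  moreover have "f \<in> Ar C \<and> cod f = A" if "f \<in> hits \<mu> A x \<or> f \<in> factors m" for f
   using that m by (auto simp: hits_def factors_def)
  ultimately show ?thesis using m by blast
 qed
 ultimately show "\<mu> \<in> Ar E \<and> inj_map \<mu> \<and>
  (\<forall>A\<in>Ob C. \<forall>x\<in>FO (Cod E \<mu>) A. \<exists>m\<in>M. cod m = A \<and> hits \<mu> A x = factors m)" using \<mu> by blast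
next
 assume a: "\<mu> \<in> Ar E \<and> inj_map \<mu> \<and>
  (\<forall>A\<in>Ob C. \<forall>x\<in>FO (Cod E \<mu>) A. \<exists>m\<in>M. cod m = A \<and> hits \<mu> A x = factors m)"
 hence \<mu>: "\<mu> \<in> Ar E" by blast
 have P: "Dom E \<mu> \<in> Ob E" "Cod E \<mu> \<in> Ob E" using \<mu> by auto
 have "\<exists>m\<in>M. cod m = D \<and> (\<exists>\<beta>. pullback E \<mu> \<alpha> \<beta> (FA K m))"
  if D: "D \<in> Ob C" and "\<alpha> \<in> Hom E (FO K D) (Cod E \<mu>)" for D \<alpha>
 proof -
  have \<alpha>: "\<alpha> \<in> Ar E" "Dom E \<alpha> = FO K D" "Cod E \<alpha> = Cod E \<mu>" using that by (auto simp: Hom_iff)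
  define x where "x = app \<alpha> D (ue D)"
  have x: "x \<in> FO (Cod E \<mu>) D" using app_in[OF \<alpha>(1) D, of "ue D"] \<alpha> D by (simp add: x_def)
  obtain m where m: "m \<in> M" "cod m = D" "hits \<mu> D x = factors m" using a D x by blast
  \<comment> \<open>As \<open>m\<close> itself is a hit, \<open>x\<close> restricted along
    \<open>m\<close> has a preimage \<open>p\<close>, which names the missing projection.\<close>
  have "m \<in> hits \<mu> D x" using m factors_self[of m] by simp
  then obtain p where p: "p \<in> FO (Dom E \<mu>) (dom m)" "app \<mu> (dom m) p = res (Cod E \<mu>) m x"
   by (auto simp: hits_def im_def)
  have ares: "app \<alpha> (dom f) (res (FO K D) f (ue D)) = res (Cod E \<mu>) f x" if "f \<in> Ar C" "cod f = D" for f
   using app_nat[OF \<alpha>(1) that(1), of "ue D"] that \<alpha> D by (simp add: x_def)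
  have "pullback E \<mu> \<alpha> (pt (Dom E \<mu>) (dom m) p) (FA K m)"
  proof (rule pullback_criterion)
   show "\<mu> \<cdot>[E] pt (Dom E \<mu>) (dom m) p = \<alpha> \<cdot>[E] FA K m"
    by (rule K_ext[of "dom m"]) (use \<mu> \<alpha> m p P ares[of m] in simp_all)
   fix A z assume A: "A \<in> Ob C" and z: "z \<in> FO (Dom E \<alpha>) A" and i: "app \<alpha> A z \<in> im \<mu> A"
   obtain f where f: "f \<in> Ar C" "dom f = A" "cod f = D" "z = res (FO K D) f (ue D)"
    using K_elem[OF D A, of z] z \<alpha> by auto
   hence "f \<in> hits \<mu> D x" using i ares[of f] by (auto simp: hits_def)
   thus "z \<in> im (FA K m) A" using im_K[of m f] m f by simp
  qed (use a \<mu> \<alpha> m p P inj_map_K in simp_all)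
  thus ?thesis using m by blast
 qed
 thus "\<mu> \<in> \<N>" using \<mu> by (auto simp: M_Sh_def)
qed

lemma N_Ar [simp]: "\<mu> \<in> \<N> ==> \<mu> \<in> Ar E" and N_inj: "\<mu> \<in> \<N> ==> inj_map \<mu>"
 and N_hits: "\<mu> \<in> \<N> ==> A \<in> Ob C ==> x \<in> FO (Cod E \<mu>) A ==> \<exists>m\<in>M. cod m = A \<and> hits \<mu> A x = factors m"
 using M_Sh_iff by blast+

definition M_subset :: "('o, 'u) presheaf \<Rightarrow> ('o \<Rightarrow> 'u set) \<Rightarrow> bool" where
 "M_subset Q R \<longleftrightarrow> (\<forall>A\<in>Ob C. R A \<subseteq> FO Q A) \<and>
   (\<forall>A\<in>Ob C. \<forall>x\<in>FO Q A. \<exists>m\<in>M. cod m = A \<and> {f \<in> Ar C. cod f = A \<and> res Q f x \<in> R (dom f)} = factors m)"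

text \<open>Principal sieves make \<open>R\<close> stable under restriction: an element of
  \<open>R\<close> puts the identity, hence every arrow, into its sieve. They also make
  \<open>R\<close> a subsheaf, since by \<open>factors_closed\<close> an element that lies in
  \<open>R\<close> locally lies in \<open>R\<close>.\<close>

lemma M_subset_inclusion:
 assumes Q: "Q \<in> Ob E" and R: "M_subset Q R"
 obtains i where "i \<in> \<N>" "Cod E i = Q" "\<And>A. A \<in> Ob C ==> FO (Dom E i) A = R A"
  "\<And>A x. A \<in> Ob C ==> x \<in> R A ==> app i A x = x" "\<And>f x. f \<in> Ar C ==> x \<in> R (cod f) ==> res (Dom E i) f x = res Q f x"
proof -
 have RQ: "x \<in> FO Q A" if "A \<in> Ob C" "x \<in> R A" for A x using R that by (auto simp: M_subset_def)
 have cl: "\<exists>m\<in>M. cod m = A \<and> {f \<in> Ar C. cod f = A \<and> res Q f x \<in> R (dom f)} = factors m"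
  if "A \<in> Ob C" "x \<in> FO Q A" for A x using R that by (auto simp: M_subset_def)
 have res_R: "res Q f x \<in> R (dom f)" if f: "f \<in> Ar C" and x: "x \<in> R (cod f)" for f x
 proof -
  obtain m where m: "m \<in> M" "cod m = cod f" "{g \<in> Ar C. cod g = cod f \<and> res Q g x \<in> R (dom g)} = factors m"
   using cl[of "cod f" x] RQ f x by auto
  have "Idt C (cod f) \<in> {g \<in> Ar C. cod g = cod f \<and> res Q g x \<in> R (dom g)}"
   using x f RQ[of "cod f" x] Q by simp
  hence "Idt C (cod f) \<in> factors m" using m(3) by blast
  hence "Idt C (cod f) \<cdot> f \<in> factors m"
   using sieveD(3)[OF sieve_factors[of m] \<open>Idt C (cod f) \<in> factors m\<close> f] m(1) f by (simp del: id_comp)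
  thus ?thesis using m(3) f by auto
 qed
 have raw: "raw_presheaf C R (res Q)"
  unfolding raw_presheaf_def using res_R RQ Q by auto
 define P where "P = mk_presheaf C R (res Q)"
 have PF: "FO P A = R A" if "A \<in> Ob C" for A using that by (simp add: P_def)
 have Pr: "res P f x = res Q f x" if "f \<in> Ar C" "x \<in> R (cod f)" for f x using that by (simp add: P_def)
 have "P \<in> Ob (PSh C)" unfolding P_def
  by (rule mk_presheaf_Ob[OF category_axioms raw]) (use RQ small_subset[OF small_FO[OF Q]] in blast)
 hence P: "P \<in> Ob E"
 proof (rule E_ObI, unfold raw_sheaf_def, intro conjI ballI allI impI, goal_cases)
  case (1 A S x)
  hence S: "cov A S" by blast
  note sD = sieveD[OF covering_sieve_sieve[OF S]]
  have xR: "x f \<in> R (dom f)" if "f \<in> S" for f using 1 that sD(1)[OF that] PF by auto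
  obtain a where a: "a \<in> FO Q A" "\<And>f. f \<in> S ==> res Q f a = x f"
  proof (rule sheaf_glue[OF Q S, of x])
   show "x f \<in> FO Q (dom f)" if "f \<in> S" for f using RQ xR sD(1) that by simp
   show "x (f \<cdot> g) = res Q g (x f)" if "f \<in> S" "g \<in> Ar C" "cod g = dom f" for f g
   proof -
    have "x (f \<cdot> g) = res P g (x f)" using 1 that by blast
    thus ?thesis using Pr[of g "x f"] xR[OF that(1)] that by simp
   qed
  qed blast
  obtain m where m: "m \<in> M" "cod m = A" "{f \<in> Ar C. cod f = A \<and> res Q f a \<in> R (dom f)} = factors m"
   using cl[OF _ a(1)] 1 by auto
  have "S \<subseteq> factors m" using m(3) a(2) xR sD(1,2) by force
  hence "cov A (factors m)" using covering_superset[OF S] sieve_factors[of m] m by simp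
  hence "cov A (pull (factors m) (Idt C A))"
   using covering_pull[of A "factors m" "Idt C A"] 1 by simp
  hence "Idt C A \<in> factors m" using factors_closed[of m "Idt C A"] m 1 by simp
  hence "res Q (Idt C A) a \<in> R (dom (Idt C A))" using m(3) by blast
  hence "a \<in> R A" using 1 a Q by simp
  thus ?case using a 1 PF Pr sD(1,2) by (intro bexI[of _ a]) auto
 next
  case (2 A S a b)
  hence S: "cov A S" by blast
  note sD = sieveD[OF covering_sieve_sieve[OF S]]
  have ab: "a \<in> R A" "b \<in> R A" "A \<in> Ob C" using 2 PF by auto
  show ?case
  proof (rule sheaf_separated[OF Q S])
   fix f assume f: "f \<in> S"
   hence "res P f a = res P f b" using 2 by blast
   thus "res Q f a = res Q f b" using Pr sD(1,2)[OF f] ab by simp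
  qed (use ab RQ in auto)
 qed
 have rm: "raw_map C (FO P) (res P) (FO Q) (res Q) (\<lambda>A x. x)"
  by (rule raw_mapI) (use PF Pr RQ in auto)
 define i where "i = mk_map C P Q (\<lambda>A x. x)"
 have i: "i \<in> Ar E" "Dom E i = P" "Cod E i = Q" unfolding i_def using E_map[OF P Q rm] by auto
 have ia: "app i A x = x" if "A \<in> Ob C" "x \<in> R A" for A x using that PF by (simp add: i_def)
 have im: "im i A = R A" if "A \<in> Ob C" for A using that ia PF i by (auto simp: im_def)
 have "hits i A x = {f \<in> Ar C. cod f = A \<and> res Q f x \<in> R (dom f)}" for A x
  using im i by (auto simp: hits_def)
 moreover have "inj_map i" unfolding inj_map_def using ia PF i by (auto simp: inj_on_def)
 ultimately have "i \<in> \<N>" unfolding M_Sh_iff using i cl by auto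
 thus thesis using that[of i] i PF Pr ia by simp
qed

lemma N_pointI:
 assumes "\<mu> \<in> Ar E" "\<And>A \<alpha>. A \<in> Ob C ==> \<alpha> \<in> Ar E ==> Dom E \<alpha> = FO K A ==> Cod E \<alpha> = Cod E \<mu> ==>
  \<exists>m\<in>M. cod m = A \<and> (\<exists>\<beta>. pullback E \<mu> \<alpha> \<beta> (FA K m))"
 shows "\<mu> \<in> \<N>"
 unfolding M_Sh_def using assms by (simp add: Hom_iff)

lemma N_point:
 assumes "\<mu> \<in> \<N>" "A \<in> Ob C" "\<alpha> \<in> Ar E" "Dom E \<alpha> = FO K A" "Cod E \<alpha> = Cod E \<mu>"
 obtains m \<beta> where "m \<in> M" "cod m = A" "pullback E \<mu> \<alpha> \<beta> (FA K m)"
proof -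
 have \<alpha>: "\<alpha> \<in> Hom E (FO K A) (Cod E \<mu>)" using assms by (simp add: Hom_iff)
 have "\<forall>A\<in>Ob C. \<forall>\<alpha>\<in>Hom E (FO K A) (Cod E \<mu>). \<exists>m\<in>M. cod m = A \<and> (\<exists>\<beta>. pullback E \<mu> \<alpha> \<beta> (FA K m))"
  using assms(1) unfolding M_Sh_def by simp
 from bspec[OF bspec[OF this assms(2)] \<alpha>] show thesis using that by blast
qed

lemma iso_N: assumes "is_iso E t" shows "t \<in> \<N>"
proof (rule N_pointI)
 obtain s where s: "t \<in> Ar E" "s \<in> Ar E" "Dom E s = Cod E t" "Cod E s = Dom E t"
  "t \<cdot>[E] s = Idt E (Cod E t)" using E.isoE[OF assms] by metis
 show "t \<in> Ar E" by fact
 fix A \<alpha> assume A: "A \<in> Ob C" and \<alpha>: "\<alpha> \<in> Ar E" "Dom E \<alpha> = FO K A" "Cod E \<alpha> = Cod E t"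
 have "pullback E t \<alpha> (s \<cdot>[E] \<alpha>) (FA K (Idt C A))"
  by (rule E.pullback_isos[OF assms]) (use A \<alpha> s E.comp_reassoc[OF s(5), of \<alpha>] in simp_all)
 thus "\<exists>m\<in>M. cod m = A \<and> (\<exists>\<beta>. pullback E t \<alpha> \<beta> (FA K m))" using A by (intro bexI[of _ "Idt C A"]) auto
qed

lemma N_comp:
 assumes "\<mu> \<in> \<N>" "\<nu> \<in> \<N>" "Cod E \<mu> = Dom E \<nu>" shows "\<nu> \<cdot>[E] \<mu> \<in> \<N>"
proof (rule N_pointI)
 show "\<nu> \<cdot>[E] \<mu> \<in> Ar E" using assms by simp
 fix A \<alpha> assume \<alpha>: "A \<in> Ob C" "\<alpha> \<in> Ar E" "Dom E \<alpha> = FO K A" "Cod E \<alpha> = Cod E (\<nu> \<cdot>[E] \<mu>)"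
 obtain n \<beta> where n: "n \<in> M" "cod n = A" and pb: "pullback E \<nu> \<alpha> \<beta> (FA K n)"
  by (rule N_point[OF assms(2) \<alpha>(1-3)]) (use \<alpha>(4) assms in simp_all)
 note D = E.pullbackD[OF pb]
 obtain m \<gamma> where m: "m \<in> M" "cod m = dom n" and pb': "pullback E \<mu> \<beta> \<gamma> (FA K m)"
  by (rule N_point[OF assms(1), of "dom n" \<beta>]) (use D(3,6,7) n(1) assms(3) in simp_all)
 have "pullback E \<alpha> (\<nu> \<cdot>[E] \<mu>) (FA K n \<cdot>[E] FA K m) \<gamma>"
  by (rule E.pullback_paste[OF E.pullback_sym[OF pb] E.pullback_sym[OF pb']])
 hence "pullback E (\<nu> \<cdot>[E] \<mu>) \<alpha> \<gamma> (FA K (n \<cdot> m))" using E.pullback_sym K.FA_comp[of m n] m n by simp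
 thus "\<exists>m\<in>M. cod m = A \<and> (\<exists>\<beta>. pullback E (\<nu> \<cdot>[E] \<mu>) \<alpha> \<beta> (FA K m))"
  using m n by (intro bexI[of _ "n \<cdot> m"]) auto
qed

lemma N_pullback:
 assumes "\<mu> \<in> \<N>" "pullback E \<mu> \<alpha> \<beta> \<nu>" shows "\<nu> \<in> \<N>"
proof (rule N_pointI)
 note D = E.pullbackD[OF assms(2)]
 show "\<nu> \<in> Ar E" by fact
 fix A \<delta> assume A: "A \<in> Ob C" and \<delta>: "\<delta> \<in> Ar E" "Dom E \<delta> = FO K A" "Cod E \<delta> = Cod E \<nu>"
 obtain m \<gamma> where m: "m \<in> M" "cod m = A" and pb: "pullback E \<mu> (\<alpha> \<cdot>[E] \<delta>) \<gamma> (FA K m)"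
  by (rule N_point[OF assms(1) A, of "\<alpha> \<cdot>[E] \<delta>"]) (use \<delta> D in simp_all)
 obtain \<rho> where "pullback E \<nu> \<delta> \<rho> (FA K m)" using E.pullback_cancel[OF assms(2) pb \<delta>(1)] \<delta>(3) D(8) by metis
 thus "\<exists>m\<in>M. cod m = A \<and> (\<exists>\<beta>. pullback E \<nu> \<delta> \<beta> (FA K m))" using m by blast
qed

text \<open>The pullback is the inclusion of the elements sent by \<open>\<alpha>\<close> into the
  image of \<open>\<mu>\<close>; their sieves are the hit sieves of \<open>\<mu>\<close> at the
  translated elements.\<close>

lemma N_pullback_exists:
 assumes \<mu>: "\<mu> \<in> \<N>" and \<alpha>: "\<alpha> \<in> Ar E" "Cod E \<alpha> = Cod E \<mu>"
 shows "\<exists>\<beta> \<nu>. pullback E \<mu> \<alpha> \<beta> \<nu>"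
proof -
 define R where "R A = {z \<in> FO (Dom E \<alpha>) A. app \<alpha> A z \<in> im \<mu> A}" for A
 have Q: "Dom E \<alpha> \<in> Ob E" using \<alpha> by simp
 have "M_subset (Dom E \<alpha>) R"
  unfolding M_subset_def
 proof (intro conjI ballI)
  fix A x assume A: "A \<in> Ob C" and x: "x \<in> FO (Dom E \<alpha>) A"
  have ax: "app \<alpha> A x \<in> FO (Cod E \<mu>) A" using app_in[OF \<alpha>(1) A x] \<alpha> by simp
  have "{f \<in> Ar C. cod f = A \<and> res (Dom E \<alpha>) f x \<in> R (dom f)} = hits \<mu> A (app \<alpha> A x)"
   unfolding hits_def R_def using app_nat[OF \<alpha>(1), of _ x] x \<alpha>(2) Q by auto
  thus "\<exists>m\<in>M. cod m = A \<and> {f \<in> Ar C. cod f = A \<and> res (Dom E \<alpha>) f x \<in> R (dom f)} = factors m"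
   using N_hits[OF \<mu> A ax] by simp
 qed (auto simp: R_def)
 then obtain i where i: "i \<in> \<N>" "Cod E i = Dom E \<alpha>" "\<And>A. A \<in> Ob C ==> FO (Dom E i) A = R A"
  "\<And>A x. A \<in> Ob C ==> x \<in> R A ==> app i A x = x"
  using M_subset_inclusion[OF Q] by metis
 have iA: "i \<in> Ar E" using i by simp
 have "app (\<alpha> \<cdot>[E] i) A x \<in> im \<mu> A" if A: "A \<in> Ob C" and x: "x \<in> FO (Dom E (\<alpha> \<cdot>[E] i)) A" for A x
  using A x i(2-4) iA \<alpha> by (auto simp: R_def)
 then obtain \<beta> where \<beta>: "\<beta> \<in> Ar E" "Dom E \<beta> = Dom E i" "Cod E \<beta> = Dom E \<mu>" "\<mu> \<cdot>[E] \<beta> = \<alpha> \<cdot>[E] i"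
  using map_factor[of "\<alpha> \<cdot>[E] i" \<mu>] \<mu> N_inj[OF \<mu>] iA \<alpha> i(2) by auto
 have "pullback E \<mu> \<alpha> \<beta> i"
 proof (rule pullback_criterion)
  fix A z assume A: "A \<in> Ob C" and z: "z \<in> FO (Dom E \<alpha>) A" "app \<alpha> A z \<in> im \<mu> A"
  hence "z \<in> R A" by (simp add: R_def)
  thus "z \<in> im i A" using i(3,4)[OF A] unfolding im_def by (metis image_eqI)
 qed (use \<mu> \<alpha> \<beta> i N_inj in auto)
 thus ?thesis by blast
qed

lemma locally_small_E: "locally_small TYPE('u) E"
 unfolding locally_small_def
proof (intro ballI)
 fix P Q assume P: "P \<in> Ob E" and Q: "Q \<in> Ob E"
 let ?X = "Sigma (Ob C) (\<lambda>A. FO P A \<times> FO Q A)"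
 let ?g = "\<lambda>t. {(A, x, z). A \<in> Ob C \<and> x \<in> FO P A \<and> z = app t A x}"
 have "inj_on ?g (Hom E P Q)"
 proof (rule inj_onI)
  fix s t assume st: "s \<in> Hom E P Q" "t \<in> Hom E P Q" and eq: "?g s = ?g t"
  show "s = t"
  proof (rule E_ext)
   fix A x assume "A \<in> Ob C" "x \<in> FO (Dom E s) A"
   hence "(A, x, app s A x) \<in> ?g s" using st by (simp add: Hom_iff)
   hence "(A, x, app s A x) \<in> ?g t" unfolding eq .
   thus "app s A x = app t A x" by simp
  qed (use st in \<open>auto simp: Hom_iff\<close>)
 qed
 moreover have "?g ` Hom E P Q \<subseteq> Pow ?X" by (auto simp: Hom_iff)
 moreover have "small TYPE('u) (Pow ?X)"
  by (intro small_Pow[OF univ] small_Sigma[OF univ] small_Ob small_FO P Q)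
 ultimately show "small TYPE('u) (Hom E P Q)" by (rule small_inj_on)
qed

lemma im_le:
 assumes "\<mu> \<in> \<N>" "\<nu> \<in> \<N>" "Cod E \<mu> = Cod E \<nu>"
 shows "subobj_le E \<mu> \<nu> \<longleftrightarrow> (\<forall>A\<in>Ob C. im \<mu> A \<subseteq> im \<nu> A)"
proof
 assume "subobj_le E \<mu> \<nu>"
 then obtain u where u: "u \<in> Ar E" "Dom E u = Dom E \<mu>" "Cod E u = Dom E \<nu>" "\<nu> \<cdot>[E] u = \<mu>"
  by (auto simp: subobj_le_def Hom_iff)
 have "app \<mu> A x \<in> im \<nu> A" if "A \<in> Ob C" "x \<in> FO (Dom E \<mu>) A" for A x
  using E_app_comp[OF u(1) that(1), of x \<nu>] that u app_in[OF u(1) that(1), of x] unfolding im_def by auto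
 thus "\<forall>A\<in>Ob C. im \<mu> A \<subseteq> im \<nu> A" by (auto simp: im_def[of \<mu>])
next
 assume "\<forall>A\<in>Ob C. im \<mu> A \<subseteq> im \<nu> A"
 hence "\<And>A x. A \<in> Ob C ==> x \<in> FO (Dom E \<mu>) A ==> app \<mu> A x \<in> im \<nu> A" by (auto simp: im_def[of \<mu>])
 then obtain u where "u \<in> Ar E" "Dom E u = Dom E \<mu>" "Cod E u = Dom E \<nu>" "\<nu> \<cdot>[E] u = \<mu>"
  using map_factor[of \<mu> \<nu>] N_inj assms by (metis N_Ar)
 thus "subobj_le E \<mu> \<nu>" by (auto simp: subobj_le_def Hom_iff)
qed

text \<open>An M-subobject is determined up to isomorphism by its image, a subset of the small set
  of all elements of \<open>Q\<close>.\<close>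

lemma small_Sub_E:
 assumes Q: "Q \<in> Ob E"
 shows "small TYPE('u) ({m \<in> \<N>. Cod E m = Q} // subobj_equiv E \<N> Q)"
proof -
 let ?X = "Sigma (Ob C) (FO Q)"
 define I where "I n = {(A, x). A \<in> Ob C \<and> x \<in> im n A}" for n
 define \<Psi> where "\<Psi> J = {n \<in> \<N>. Cod E n = Q \<and> I n = J}" for J
 have "(a, n) \<in> subobj_equiv E \<N> Q \<longleftrightarrow> n \<in> \<Psi> (I a)" if a: "a \<in> \<N>" "Cod E a = Q" for a n
 proof -
  have "I n = I a \<longleftrightarrow> subobj_le E a n \<and> subobj_le E n a" if "n \<in> \<N>" "Cod E n = Q"
   unfolding im_le[OF a(1) that(1) trans[OF a(2) that(2)[symmetric]]] im_le[OF that(1) a(1) trans[OF that(2) a(2)[symmetric]]] I_def by blast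
  thus ?thesis using E.subobj_equiv_iff[of "\<N>" a n Q] inj_map_mono N_inj a by (auto simp: \<Psi>_def)
 qed
 hence "{m \<in> \<N>. Cod E m = Q} // subobj_equiv E \<N> Q \<subseteq> (\<lambda>a. \<Psi> (I a)) ` {m \<in> \<N>. Cod E m = Q}"
  by (auto simp: quotient_def Image_singleton)
 also have "\<dots> \<subseteq> \<Psi> ` Pow ?X"
 proof (rule image_subsetI)
  fix a assume a: "a \<in> {m \<in> \<N>. Cod E m = Q}"
  hence "I a \<subseteq> ?X" using im_sub[of a] by (auto simp: I_def)
  thus "\<Psi> (I a) \<in> \<Psi> ` Pow ?X" by blast
 qed
 finally show ?thesis
  by (rule small_subset[rotated])
   (intro small_image small_Pow[OF univ] small_Sigma[OF univ] small_Ob small_FO Q)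
qed

lemma mcategory_E: "mcategory TYPE('u) E \<N>"
 unfolding mcategory_def
 using E.category_axioms locally_small_E inj_map_mono N_inj iso_N N_comp N_pullback N_pullback_exists small_Sub_E
 by (auto simp: )

section \<open>Partial maps of sheaves as graphs, and joins of partial maps\<close>

section \<open>Partial maps of sheaves\<close>

sublocale ME: mcat E "TYPE('u)" \<N>
 by unfold_locales (rule mcategory_E)

abbreviation "\<H> \<equiv> hom_spans E \<N>"

text \<open>The graph of the partial map represented by a span. It is invariant under isomorphism of
  spans and turns the restriction order into inclusion, so joins can be computed
  elementwise.\<close>

definition graph :: "('o, 'u) presheaf_map \<times> ('o, 'u) presheaf_map \<Rightarrow> 'o \<Rightarrow> ('u \<times> 'u) set" where
 "graph s A = (\<lambda>p. (app (fst s) A p, app (snd s) A p)) ` FO (Dom E (fst s)) A"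

text \<open>\<open>W Y\<close> is the sheaf of partial sections of \<open>Y\<close> over representables that are defined on an
 \<open>M\<close>-subobject; it classifies partial maps into \<open>Y\<close>.\<close>

definition W :: "('o, 'u) presheaf \<Rightarrow> 'o \<Rightarrow> ('u \<times> 'u) set set" where
 "W Y A = {\<gamma>. (\<forall>(f, y)\<in>\<gamma>. f \<in> Ar C \<and> cod f = A \<and> y \<in> FO Y (dom f)) \<and>
   (\<forall>(f, y)\<in>\<gamma>. \<forall>g\<in>Ar C. cod g = dom f \<longrightarrow> (f \<cdot> g, res Y g y) \<in> \<gamma>) \<and>
   single_valued \<gamma> \<and> (\<exists>m\<in>M. cod m = A \<and> Domain \<gamma> = factors m)}"

lemma WD:
 assumes "\<gamma> \<in> W Y A"
 shows "(f, y) \<in> \<gamma> ==> f \<in> Ar C" "(f, y) \<in> \<gamma> ==> cod f = A" "(f, y) \<in> \<gamma> ==> y \<in> FO Y (dom f)"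
  "(f, y) \<in> \<gamma> ==> g \<in> Ar C ==> cod g = dom f ==> (f \<cdot> g, res Y g y) \<in> \<gamma>"
  "(f, y) \<in> \<gamma> ==> (f, z) \<in> \<gamma> ==> y = z" "\<exists>m\<in>M. cod m = A \<and> Domain \<gamma> = factors m"
 using assms unfolding W_def by (auto dest: single_valuedD)

lemma WI:
 assumes "\<And>f y. (f, y) \<in> \<gamma> ==> f \<in> Ar C \<and> cod f = A \<and> y \<in> FO Y (dom f)"
  "\<And>f y g. (f, y) \<in> \<gamma> ==> g \<in> Ar C ==> cod g = dom f ==> (f \<cdot> g, res Y g y) \<in> \<gamma>"
  "\<And>f y z. (f, y) \<in> \<gamma> ==> (f, z) \<in> \<gamma> ==> y = z" "\<exists>m\<in>M. cod m = A \<and> Domain \<gamma> = factors m"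
 shows "\<gamma> \<in> W Y A"
 using assms unfolding W_def single_valued_def by blast

text \<open>The domain of a partial section is closed by \<open>factors_closed\<close>, so it
  contains \<open>f\<close>; the value there is \<open>y\<close> because \<open>Y\<close> is
  separated.\<close>

lemma W_local:
 assumes Y: "Y \<in> Ob E" and \<gamma>: "\<gamma> \<in> W Y A" and f: "f \<in> Ar C" "cod f = A" and y: "y \<in> FO Y (dom f)"
  and S: "cov (dom f) S" and loc: "\<And>g. g \<in> S ==> (f \<cdot> g, res Y g y) \<in> \<gamma>"
 shows "(f, y) \<in> \<gamma>"
proof -
 note W = WD[OF \<gamma>]
 note gD = sieveD[OF covering_sieve_sieve[OF S]]
 obtain m where m: "m \<in> M" "cod m = A" "Domain \<gamma> = factors m" using W(6) by blast
 have "S \<subseteq> pull (factors m) f" using loc gD(1,2) unfolding m(3)[symmetric] pull_def by blast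
 hence "cov (dom f) (pull (factors m) f)"
  using covering_superset[OF S _ sieve_pull[OF sieve_factors f(1)]] m f by simp
 hence "f \<in> Domain \<gamma>" using factors_closed[OF m(1) f(1)] m f by simp
 then obtain z where z: "(f, z) \<in> \<gamma>" by blast
 have "y = z"
  by (rule sheaf_separated[OF Y S y W(3)[OF z]]) (use W(5)[OF loc W(4)[OF z gD(1,2)]] in blast)
 thus ?thesis using z by simp
qed

definition local_at :: "('o, 'u) presheaf \<Rightarrow> ('u \<times> 'u) set \<Rightarrow> 'u \<Rightarrow> 'u \<Rightarrow> 'u set" where
 "local_at Y \<gamma> h y = {k \<in> Ar C. cod k = dom h \<and> (h \<cdot> k, res Y k y) \<in> \<gamma>}"

definition local_closure :: "('o, 'u) presheaf \<Rightarrow> 'o \<Rightarrow> ('u \<times> 'u) set \<Rightarrow> ('u \<times> 'u) set" where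
 "local_closure Y A \<gamma> = {(h, y). h \<in> Ar C \<and> cod h = A \<and> y \<in> FO Y (dom h) \<and> cov (dom h) (local_at Y \<gamma> h y)}"

text \<open>A union of principal sieves is in general not principal, but its closure is: by
  \<open>factors_join\<close> it is the principal sieve of the join of \<open>R\<close>. Values on
  the closure exist by gluing in \<open>Y\<close>.\<close>

lemma local_closure_W:
 assumes Y: "Y \<in> Ob E" and A: "A \<in> Ob C" and R: "R \<subseteq> {m \<in> M. cod m = A}" and dom: "Domain \<gamma> = (\<Union>m\<in>R. factors m)"
  and inY: "\<And>f y. (f, y) \<in> \<gamma> ==> y \<in> FO Y (dom f)"
  and res: "\<And>f y g. (f, y) \<in> \<gamma> ==> g \<in> Ar C ==> cod g = dom f ==> (f \<cdot> g, res Y g y) \<in> \<gamma>"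
  and single: "\<And>f y z. (f, y) \<in> \<gamma> ==> (f, z) \<in> \<gamma> ==> y = z"
 shows "local_closure Y A \<gamma> \<in> W Y A"
proof (rule WI)
 let ?L = "local_closure Y A \<gamma>"
 let ?U = "\<Union>m\<in>R. factors m"
 note lc = local_closure_def[of Y A \<gamma>] and la = local_at_def
 note uD = sieveD[OF sieve_generated[OF R]]
 have pU: "pull ?U h = {k \<in> Ar C. cod k = dom h \<and> h \<cdot> k \<in> Domain \<gamma>}" for h unfolding dom pull_def ..
 show "h \<in> Ar C \<and> cod h = A \<and> y \<in> FO Y (dom h)" if "(h, y) \<in> ?L" for h y using that by (simp add: lc)
 show "(h \<cdot> g, res Y g y) \<in> ?L" if hy: "(h, y) \<in> ?L" and g: "g \<in> Ar C" "cod g = dom h" for h y g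
 proof -
  have h: "h \<in> Ar C" "cod h = A" "y \<in> FO Y (dom h)" and S: "cov (dom h) (local_at Y \<gamma> h y)" using hy by (auto simp: lc)
  have "pull (local_at Y \<gamma> h y) g = local_at Y \<gamma> (h \<cdot> g) (res Y g y)" using g h Y by (auto simp: la pull_def)
  thus ?thesis using covering_pull[OF S g] g h Y by (simp add: lc)
 qed
 show "y = z" if "(h, y) \<in> ?L" "(h, z) \<in> ?L" for h y z
 proof (rule sheaf_separated[OF Y])
  show "cov (dom h) (local_at Y \<gamma> h y \<inter> local_at Y \<gamma> h z)" using that covering_inter by (auto simp: lc)
 qed (use that single in \<open>auto simp: lc la\<close>)
 have "h \<in> Domain (?L) \<longleftrightarrow> cov (dom h) (pull ?U h)" if h: "h \<in> Ar C" "cod h = A" for h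
 proof
  note sU = sieve_pull[OF sieve_generated[OF R] h]
  assume "h \<in> Domain (?L)"
  then obtain y where "cov (dom h) (local_at Y \<gamma> h y)" by (auto simp: lc)
  moreover have "local_at Y \<gamma> h y \<subseteq> pull ?U h" unfolding pU la by blast
  ultimately show "cov (dom h) (pull ?U h)" using covering_superset sU by blast
 next
  assume V: "cov (dom h) (pull ?U h)"
  note vD = sieveD[OF covering_sieve_sieve[OF V]]
  have "\<exists>y. (h \<cdot> k, y) \<in> \<gamma>" if "k \<in> pull ?U h" for k using that unfolding pU by blast
  then obtain v where v: "\<And>k. k \<in> pull ?U h ==> (h \<cdot> k, v k) \<in> \<gamma>" by metis
  obtain y where y: "y \<in> FO Y (dom h)" "\<And>k. k \<in> pull ?U h ==> res Y k y = v k"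
  proof (rule sheaf_glue[OF Y V, of v])
   show "v k \<in> FO Y (dom k)" if "k \<in> pull ?U h" for k using inY[OF v[OF that]] vD(1,2)[OF that] h by simp
   fix k g assume k: "k \<in> pull ?U h" and g: "g \<in> Ar C" "cod g = dom k"
   show "v (k \<cdot> g) = res Y g (v k)"
    using single[OF v[OF vD(3)[OF k g]]] res[OF v[OF k] g(1)] vD(1,2)[OF k] g h by simp
  qed (rule that, assumption+)
  have "pull ?U h = local_at Y \<gamma> h y"
  proof
   show "pull ?U h \<subseteq> local_at Y \<gamma> h y" using v y(2) vD(1,2) by (auto simp: la)
   show "local_at Y \<gamma> h y \<subseteq> pull ?U h" unfolding pU la by blast
  qed
  hence "(h, y) \<in> ?L" using V h y(1) by (simp add: lc)
  thus "h \<in> Domain (?L)" by blast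
 qed
 moreover obtain j where j: "j \<in> M" "cod j = A" "\<And>f. f \<in> Ar C ==> cod f = A ==> f \<in> factors j \<longleftrightarrow> cov (dom f) (pull ?U f)"
  by (rule factors_join_exists[OF R A]) (rule that)
 moreover have "h \<in> Ar C \<and> cod h = A" if "h \<in> Domain (?L) \<or> h \<in> factors j" for h using that j(1,2) by (auto simp: lc factors_def)
 ultimately have "Domain (?L) = factors j" by blast
 thus "\<exists>m\<in>M. cod m = A \<and> Domain (?L) = factors m" using j(1,2) by blast
qed

text \<open>The partial section of \<open>Y\<close> over \<open>A\<close> obtained by precomposing
  the partial map \<open>\<gamma>\<close> with the point \<open>x\<close>; it is the value at
  \<open>x\<close> of the classifying map of \<open>\<gamma>\<close>.\<close>

definition fib :: "('o, 'u) presheaf \<Rightarrow> ('o \<Rightarrow> ('u \<times> 'u) set) \<Rightarrow> 'o \<Rightarrow> 'u \<Rightarrow> ('u \<times> 'u) set" where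
 "fib Q \<gamma> A x = {(f, y). f \<in> Ar C \<and> cod f = A \<and> (res Q f x, y) \<in> \<gamma> (dom f)}"

lemma fib_iff: "(f, y) \<in> fib Q \<gamma> A x \<longleftrightarrow> f \<in> Ar C \<and> cod f = A \<and> (res Q f x, y) \<in> \<gamma> (dom f)"
 by (simp add: fib_def)

lemma fib_Id: "Q \<in> Ob E ==> A \<in> Ob C ==> x \<in> FO Q A ==> (Idt C A, y) \<in> fib Q \<gamma> A x \<longleftrightarrow> (x, y) \<in> \<gamma> A"
 by (simp add: fib_iff)

text \<open>Intrinsic description of the graphs of partial maps from \<open>Q\<close> to
  \<open>Y\<close>: each point of \<open>Q\<close> yields a partial section with M-domain.\<close>

definition partial_graph :: "('o, 'u) presheaf \<Rightarrow> ('o, 'u) presheaf \<Rightarrow> ('o \<Rightarrow> ('u \<times> 'u) set) \<Rightarrow> bool" where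
 "partial_graph Q Y \<gamma> \<longleftrightarrow> (\<forall>A\<in>Ob C. Domain (\<gamma> A) \<subseteq> FO Q A) \<and> (\<forall>A\<in>Ob C. \<forall>x\<in>FO Q A. fib Q \<gamma> A x \<in> W Y A)"

lemma partial_graphD:
 assumes \<gamma>: "partial_graph Q Y \<gamma>" and Q: "Q \<in> Ob E"
 shows "A \<in> Ob C ==> (x, y) \<in> \<gamma> A ==> x \<in> FO Q A" "A \<in> Ob C ==> (x, y) \<in> \<gamma> A ==> y \<in> FO Y A"
  "A \<in> Ob C ==> (x, y) \<in> \<gamma> A ==> (x, z) \<in> \<gamma> A ==> y = z"
  "f \<in> Ar C ==> (x, y) \<in> \<gamma> (cod f) ==> (res Q f x, res Y f y) \<in> \<gamma> (dom f)"
  "M_subset Q (\<lambda>A. Domain (\<gamma> A))"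
proof -
 have x: "x \<in> FO Q A" if "A \<in> Ob C" "(x, y) \<in> \<gamma> A" for A x y using \<gamma> that unfolding partial_graph_def by blast
 have W: "fib Q \<gamma> A x \<in> W Y A" if "A \<in> Ob C" "x \<in> FO Q A" for A x using \<gamma> that unfolding partial_graph_def by blast
 have f: "(Idt C A, y) \<in> fib Q \<gamma> A x" if "A \<in> Ob C" "(x, y) \<in> \<gamma> A" for A x y using fib_Id[OF Q that(1) x[OF that]] that by simp
 show "A \<in> Ob C ==> (x, y) \<in> \<gamma> A ==> x \<in> FO Q A" by (rule x)
 show "A \<in> Ob C ==> (x, y) \<in> \<gamma> A ==> y \<in> FO Y A" using WD(3)[OF W[OF _ x] f] by fastforce
 show "A \<in> Ob C ==> (x, y) \<in> \<gamma> A ==> (x, z) \<in> \<gamma> A ==> y = z" using WD(5)[OF W[OF _ x] f f] by blast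
 show "(res Q f x, res Y f y) \<in> \<gamma> (dom f)" if a: "f \<in> Ar C" "(x, y) \<in> \<gamma> (cod f)"
  using WD(4)[OF W[OF Cod_in x[OF Cod_in]] f[OF Cod_in], OF a(1) a a a(1)] a(1) by (simp add: fib_iff)
 have "{f \<in> Ar C. cod f = A \<and> res Q f x \<in> Domain (\<gamma> (dom f))} = Domain (fib Q \<gamma> A x)" for A x by (auto simp: fib_iff)
 thus "M_subset Q (\<lambda>A. Domain (\<gamma> A))" using WD(6)[OF W] \<gamma> unfolding M_subset_def partial_graph_def by simp
qed

lemma graph_iff: "(x, y) \<in> graph s A \<longleftrightarrow> (\<exists>p\<in>FO (Dom E (fst s)) A. x = app (fst s) A p \<and> y = app (snd s) A p)"
 by (auto simp: graph_def)

lemma Domain_graph: "Domain (graph s A) = im (fst s) A"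
 by (auto simp: graph_def im_def)

lemma \<H>D:
 assumes "s \<in> \<H> Q Y"
 shows "fst s \<in> \<N>" "fst s \<in> Ar E" "snd s \<in> Ar E" "Dom E (snd s) = Dom E (fst s)" "Cod E (fst s) = Q" "Cod E (snd s) = Y"
  "Q \<in> Ob E" "Y \<in> Ob E" "Dom E (fst s) \<in> Ob E"
 using assms by (cases s; auto simp: hom_spans_iff)+

lemma partial_graph_graph:
 assumes s: "s \<in> \<H> Q Y" shows "partial_graph Q Y (graph s)"
 unfolding partial_graph_def
proof (intro conjI ballI)
 note s = \<H>D[OF s]
 show "Domain (graph s A) \<subseteq> FO Q A" if "A \<in> Ob C" for A using im_sub[OF s(2) that] s(5) by (simp add: Domain_graph)
 have single: "single_valued (graph s A)" if "A \<in> Ob C" for A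
  by (rule single_valuedI) (auto simp: graph_iff dest: inj_mapD[OF N_inj[OF s(1)] that])
 fix A x assume A: "A \<in> Ob C" and x: "x \<in> FO Q A"
 show "fib Q (graph s) A x \<in> W Y A"
 proof (rule WI)
  show "f \<in> Ar C \<and> cod f = A \<and> y \<in> FO Y (dom f)" if "(f, y) \<in> fib Q (graph s) A x" for f y
   using that app_in[OF s(3), of "dom f"] s(4,6) by (auto simp: fib_iff graph_iff)
  show "y = z" if "(f, y) \<in> fib Q (graph s) A x" "(f, z) \<in> fib Q (graph s) A x" for f y z
   using that single_valuedD[OF single[OF Dom_in]] unfolding fib_iff by blast
  have "Domain (fib Q (graph s) A x) = hits (fst s) A x" using s(5) unfolding hits_def Domain_graph[symmetric] by (auto simp: fib_iff)
  thus "\<exists>m\<in>M. cod m = A \<and> Domain (fib Q (graph s) A x) = factors m" using N_hits[OF s(1) A, of x] x s(5) by simp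
  fix f y g assume "(f, y) \<in> fib Q (graph s) A x" and g: "g \<in> Ar C" "cod g = dom f"
  then obtain p where f: "f \<in> Ar C" "cod f = A" and p: "p \<in> FO (Dom E (fst s)) (cod g)" "res Q f x = app (fst s) (cod g) p" "y = app (snd s) (cod g) p"
   by (auto simp: fib_iff graph_iff)
  have "res Q (f \<cdot> g) x = app (fst s) (dom g) (res (Dom E (fst s)) g p) \<and> res Y g y = app (snd s) (dom g) (res (Dom E (fst s)) g p)"
   using app_nat[OF s(2) g(1) p(1)] app_nat[OF s(3) g(1), of p] f g p s x by simp
  moreover have "res (Dom E (fst s)) g p \<in> FO (Dom E (fst s)) (dom g)" using g p s by simp
  ultimately show "(f \<cdot> g, res Y g y) \<in> fib Q (graph s) A x" using f g by (auto simp: fib_iff graph_iff)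
 qed
qed

text \<open>The converse of \<open>partial_graph_graph\<close>: the domain of the graph is an
  M-subset of \<open>Q\<close>, its inclusion is the first leg, and the second leg is read off from
  single-valuedness.\<close>

lemma partial_graph_span:
 assumes Q: "Q \<in> Ob E" and Y: "Y \<in> Ob E" and \<gamma>: "partial_graph Q Y \<gamma>"
 obtains s where "s \<in> \<H> Q Y" "\<And>A. A \<in> Ob C ==> graph s A = \<gamma> A"
proof -
 note \<gamma> = partial_graphD[OF \<gamma> Q]
 obtain i where i: "i \<in> \<N>" "Cod E i = Q" "\<And>A. A \<in> Ob C ==> FO (Dom E i) A = Domain (\<gamma> A)"
  "\<And>A x. A \<in> Ob C ==> x \<in> Domain (\<gamma> A) ==> app i A x = x"
  "\<And>f x. f \<in> Ar C ==> x \<in> Domain (\<gamma> (cod f)) ==> res (Dom E i) f x = res Q f x"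
  by (rule M_subset_inclusion[OF Q \<gamma>(5)]) (rule that)
 have P: "Dom E i \<in> Ob E" using i by simp
 define \<phi> where "\<phi> A x = (SOME y. (x, y) \<in> \<gamma> A)" for A x
 have \<phi>: "(x, \<phi> A x) \<in> \<gamma> A" if "x \<in> Domain (\<gamma> A)" for A x using that unfolding \<phi>_def by (auto intro: someI)
 have "raw_map C (FO (Dom E i)) (res (Dom E i)) (FO Y) (res Y) \<phi>"
 proof (rule raw_mapI)
  show "\<phi> A x \<in> FO Y A" if "A \<in> Ob C" "x \<in> FO (Dom E i) A" for A x using \<gamma>(2) \<phi> i(3) that by blast
  fix f x assume f: "f \<in> Ar C" "x \<in> FO (Dom E i) (cod f)"
  hence "(res Q f x, res Y f (\<phi> (cod f) x)) \<in> \<gamma> (dom f)" using \<gamma>(4) \<phi> i(3) by simp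
  thus "\<phi> (dom f) (res (Dom E i) f x) = res Y f (\<phi> (cod f) x)"
   using \<gamma>(3)[OF _ \<phi>] i(3,5) f by (metis DomainI Cod_in Dom_in)
 qed
 note h = E_map[OF P Y this]
 let ?s = "(i, mk_map C (Dom E i) Y \<phi>)"
 have "?s \<in> \<H> Q Y" using i h by (simp add: hom_spans_iff)
 moreover have "graph ?s A = \<gamma> A" if A: "A \<in> Ob C" for A
 proof -
  have "(x, y) \<in> graph ?s A \<longleftrightarrow> x \<in> Domain (\<gamma> A) \<and> y = \<phi> A x" for x y using i(3,4)[OF A] A by (auto simp: graph_iff)
  moreover have "(x, y) \<in> \<gamma> A \<longleftrightarrow> x \<in> Domain (\<gamma> A) \<and> y = \<phi> A x" for x y using \<phi>[of x A] \<gamma>(3)[OF A, of x y "\<phi> A x"] by blast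
  ultimately show ?thesis by (simp add: set_eq_iff)
 qed
 ultimately show thesis by (rule that)
qed

text \<open>Inclusion of graphs gives inclusion of images, hence a factor \<open>u\<close> through
  the first leg. That \<open>u\<close> also respects the second legs follows from injectivity of the
  first leg of \<open>t\<close>.\<close>

lemma span_le_graph:
 assumes s: "s \<in> \<H> Q Y" and t: "t \<in> \<H> Q Y"
 shows "span_le E s t \<longleftrightarrow> (\<forall>A\<in>Ob C. graph s A \<subseteq> graph t A)"
proof
 note sD = \<H>D[OF s] and tD = \<H>D[OF t]
 show "\<forall>A\<in>Ob C. graph s A \<subseteq> graph t A" if le: "span_le E s t"
 proof
  fix A assume A: "A \<in> Ob C"
  obtain u where u: "u \<in> Ar E" "Dom E u = Dom E (fst s)" "Cod E u = Dom E (fst t)" "fst t \<cdot>[E] u = fst s" "snd t \<cdot>[E] u = snd s"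
   using le unfolding span_le_def by blast
  have "(app (fst s) A p, app (snd s) A p) \<in> graph t A" if "p \<in> FO (Dom E (fst s)) A" for p
   using E_app_comp[OF u(1) A, of p "fst t"] E_app_comp[OF u(1) A, of p "snd t"] app_in[OF u(1) A, of p] u that by (auto simp: graph_iff)
  thus "graph s A \<subseteq> graph t A" by (auto simp: graph_def[of s])
 qed
 assume le: "\<forall>A\<in>Ob C. graph s A \<subseteq> graph t A"
 have "app (fst s) A p \<in> im (fst t) A" if "A \<in> Ob C" "p \<in> FO (Dom E (fst s)) A" for A p
  using le that unfolding graph_def im_def by blast
 then obtain u where u: "u \<in> Ar E" "Dom E u = Dom E (fst s)" "Cod E u = Dom E (fst t)" "fst t \<cdot>[E] u = fst s"
  using map_factor[OF sD(2) tD(2) N_inj[OF tD(1)]] sD(5) tD(5) by metis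
 have "snd t \<cdot>[E] u = snd s"
 proof (rule E_ext)
  fix A p assume A: "A \<in> Ob C" and "p \<in> FO (Dom E (snd t \<cdot>[E] u)) A"
  hence p: "p \<in> FO (Dom E (fst s)) A" "p \<in> FO (Dom E u) A" using u tD by simp_all
  hence "(app (fst s) A p, app (snd s) A p) \<in> graph t A" using le A by (auto simp: graph_def)
  then obtain q where q: "q \<in> FO (Dom E (fst t)) A" "app (fst s) A p = app (fst t) A q" "app (snd s) A p = app (snd t) A q"
   by (auto simp: graph_iff)
  have "app u A p = q"
   by (rule inj_mapD[OF N_inj[OF tD(1)] A]) (use E_app_comp[OF u(1) A p(2), of "fst t"] app_in[OF u(1) A p(2)] u q in simp_all)
  thus "app (snd t \<cdot>[E] u) A p = app (snd s) A p" using E_app_comp[OF u(1) A p(2), of "snd t"] q by simp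
 qed (use u sD tD in simp_all)
 thus "span_le E s t" using u unfolding span_le_def by blast
qed

lemma graph_local:
 assumes s: "s \<in> \<H> Q Y" and A: "A \<in> Ob C" and xy: "x \<in> FO Q A" "y \<in> FO Y A" and S: "cov A S"
  and loc: "\<And>f. f \<in> S ==> (res Q f x, res Y f y) \<in> graph s (dom f)"
 shows "(x, y) \<in> graph s A"
proof -
 note fD = sieveD[OF covering_sieve_sieve[OF S]]
 have W: "fib Q (graph s) A x \<in> W Y A" using partial_graph_graph[OF s] A xy by (simp add: partial_graph_def)
 have "(Idt C A, y) \<in> fib Q (graph s) A x"
  by (rule W_local[OF \<H>D(8)[OF s] W, of _ _ S]) (use A xy S loc fD(1,2) in \<open>auto simp: fib_iff\<close>)
 thus ?thesis using fib_Id[OF \<H>D(7)[OF s] A xy(1)] by simp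
qed

lemma graph_precomp:
 assumes s: "(m, f) \<in> \<H> Q Y" and pb: "pullback E m t b n" and A: "A \<in> Ob C"
 shows "(z, y) \<in> graph (n, f \<cdot>[E] b) A \<longleftrightarrow> z \<in> FO (Dom E t) A \<and> (app t A z, y) \<in> graph (m, f) A"
proof
 note D = E.pullbackD[OF pb] and s = \<H>D[OF s, simplified]
 show "z \<in> FO (Dom E t) A \<and> (app t A z, y) \<in> graph (m, f) A" if zy: "(z, y) \<in> graph (n, f \<cdot>[E] b) A"
 proof -
  obtain p where p: "p \<in> FO (Dom E n) A" "z = app n A p" "y = app (f \<cdot>[E] b) A p" using zy by (auto simp: graph_iff)
  have p': "p \<in> FO (Dom E b) A" using p D by simp
  have "app t A z = app m A (app b A p)" "y = app f A (app b A p)"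
   using E_app_comp[OF D(4) A p(1), of t] E_app_comp[OF D(3) A p', of m] E_app_comp[OF D(3) A p', of f] p D(9) by simp_all
  thus ?thesis using app_in[OF D(4) A p(1)] app_in[OF D(3) A p'] p D unfolding graph_iff by auto
 qed
 assume a: "z \<in> FO (Dom E t) A \<and> (app t A z, y) \<in> graph (m, f) A"
 then obtain p where p: "p \<in> FO (Dom E m) A" "app m A p = app t A z" "y = app f A p" by (auto simp: graph_iff)
 obtain w where w: "w \<in> FO (Dom E n) A" "app n A w = z" "app b A w = p"
  by (rule pullback_elem[OF pb A _ p(1,2)]) (use a in simp_all)
 thus "(z, y) \<in> graph (n, f \<cdot>[E] b) A" using E_app_comp[OF D(3) A, of w f] p D unfolding graph_iff by auto
qed

lemma graph_comp:
 assumes s: "(m, f) \<in> \<H> Q Y" and p: "(p, k) \<in> \<H> Z Q" and pb: "pullback E k m a b" and A: "A \<in> Ob C"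
 shows "(x, w) \<in> graph (p \<cdot>[E] a, f \<cdot>[E] b) A \<longleftrightarrow> (\<exists>z\<in>FO (Dom E p) A. x = app p A z \<and> (app k A z, w) \<in> graph (m, f) A)"
proof -
 note D = E.pullbackD[OF pb] and pD = \<H>D[OF p, simplified] and sD = \<H>D[OF s, simplified]
 have "(x, w) \<in> graph (p \<cdot>[E] a, f \<cdot>[E] b) A \<longleftrightarrow> (\<exists>z. x = app p A z \<and> (z, w) \<in> graph (a, f \<cdot>[E] b) A)"
  using D pD E_app_comp[OF D(3) A, of _ p] by (auto simp: graph_iff)
 thus ?thesis using graph_precomp[OF s E.pullback_sym[OF pb] A] pD(4) by auto
qed

definition matches :: "('o, 'u) presheaf \<Rightarrow> ('o, 'u) presheaf \<Rightarrow> (('o, 'u) presheaf_map \<times> ('o, 'u) presheaf_map) set \<Rightarrow>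
  'o \<Rightarrow> 'u \<Rightarrow> 'u \<Rightarrow> 'u set" where
 "matches Q Y G A x y = {f \<in> Ar C. cod f = A \<and> (\<exists>s\<in>G. (res Q f x, res Y f y) \<in> graph s (dom f))}"

text \<open>The join of the family \<open>G\<close>: the union of the graphs, closed under gluing
  along covers.\<close>

definition graph_closure :: "('o, 'u) presheaf \<Rightarrow> ('o, 'u) presheaf \<Rightarrow> (('o, 'u) presheaf_map \<times> ('o, 'u) presheaf_map) set \<Rightarrow>
  'o \<Rightarrow> ('u \<times> 'u) set" where
 "graph_closure Q Y G A = {(x, y). x \<in> FO Q A \<and> y \<in> FO Y A \<and> cov A (matches Q Y G A x y)}"

context
 fixes Q Y :: "('o, 'u) presheaf" and G
 assumes G: "G \<subseteq> \<H> Q Y" and Q: "Q \<in> Ob E" and Y: "Y \<in> Ob E"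
begin

private lemma graphD:
 assumes "s \<in> G"
 shows "A \<in> Ob C ==> (x, y) \<in> graph s A ==> x \<in> FO Q A \<and> y \<in> FO Y A"
  "f \<in> Ar C ==> (x, y) \<in> graph s (cod f) ==> (res Q f x, res Y f y) \<in> graph s (dom f)"
 using partial_graphD(1,2,4)[OF partial_graph_graph Q] G assms by blast+

lemma sieve_matches: "x \<in> FO Q A ==> y \<in> FO Y A ==> sieve C A (matches Q Y G A x y)"
proof (rule sieveI)
 fix f g assume xy: "x \<in> FO Q A" "y \<in> FO Y A" and f: "f \<in> matches Q Y G A x y" and g: "g \<in> Ar C" "cod g = dom f"
 then obtain s where s: "f \<in> Ar C" "cod f = A" "s \<in> G" "(res Q f x, res Y f y) \<in> graph s (dom f)" by (auto simp: matches_def)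
 thus "f \<cdot> g \<in> matches Q Y G A x y" using graphD(2)[OF s(3) g(1), of "res Q f x" "res Y f y"] g xy Q Y by (auto simp: matches_def)
qed (simp add: matches_def)

lemma span_joinI:
 assumes j: "j \<in> \<H> Q Y" and eq: "\<And>A. A \<in> Ob C ==> graph j A = graph_closure Q Y G A"
 shows "span_join E \<N> Q Y G j"
 unfolding span_join_def
proof (intro conjI ballI impI j)
 fix s assume s: "s \<in> G"
 have "(x, y) \<in> graph_closure Q Y G A" if A: "A \<in> Ob C" and xy: "(x, y) \<in> graph s A" for A x y
 proof -
  have "matches Q Y G A x y = {f \<in> Ar C. cod f = A}" using graphD(2)[OF s] s xy by (auto simp: matches_def)
  thus ?thesis using graphD(1)[OF s A xy] covering_max[OF A] by (simp add: graph_closure_def)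
 qed
 thus "span_le E s j" using eq span_le_graph[OF subsetD[OF G s] j] by auto
next
 fix t assume t: "t \<in> \<H> Q Y" and ub: "\<forall>s\<in>G. span_le E s t"
 have le: "graph s B \<subseteq> graph t B" if "s \<in> G" "B \<in> Ob C" for s B
  using ub span_le_graph[OF _ t] G that by blast
 have "(x, y) \<in> graph t A" if A: "A \<in> Ob C" and "(x, y) \<in> graph_closure Q Y G A" for A x y
 proof (rule graph_local[OF t A])
  show "x \<in> FO Q A" "y \<in> FO Y A" "cov A (matches Q Y G A x y)" using that(2) by (auto simp: graph_closure_def)
  fix f assume "f \<in> matches Q Y G A x y"
  then obtain s where s: "f \<in> Ar C" "s \<in> G" "(res Q f x, res Y f y) \<in> graph s (dom f)" unfolding matches_def by blast
  thus "(res Q f x, res Y f y) \<in> graph t (dom f)" using subsetD[OF le[OF s(2) Dom_in[OF s(1)]] s(3)] by simp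
 qed
 thus "span_le E j t" using eq span_le_graph[OF j t] by auto
qed

context
 assumes compat: "span_compat E G"
begin

text \<open>Two preimages of \<open>x\<close> in the two domains come from one element of their
  intersection, on which compatible spans agree.\<close>

private lemma graph_single:
 assumes A: "A \<in> Ob C" and s: "s \<in> G" "(x, y) \<in> graph s A" and t: "t \<in> G" "(x, z) \<in> graph t A" shows "y = z"
proof -
 obtain p where p: "p \<in> FO (Dom E (fst s)) A" "x = app (fst s) A p" "y = app (snd s) A p" using s(2) by (auto simp: graph_iff)
 obtain q where q: "q \<in> FO (Dom E (fst t)) A" "x = app (fst t) A q" "z = app (snd t) A q" using t(2) by (auto simp: graph_iff)
 note S = \<H>D[OF subsetD[OF G s(1)]] and T = \<H>D[OF subsetD[OF G t(1)]]
 obtain a b where ab: "pullback E (fst s) (fst t) a b" using ME.pullback_exists[OF S(1) T(2)] S T by metis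
 note D = E.pullbackD[OF ab]
 obtain w where w: "w \<in> FO (Dom E b) A" "app b A w = q" "app a A w = p"
  by (rule pullback_elem[OF ab A q(1) p(1)]) (use p q in simp_all)
 have "snd s \<cdot>[E] a = snd t \<cdot>[E] b" using compat s(1) t(1) ab unfolding span_compat_def by (metis prod.collapse)
 thus ?thesis using E_app_comp[OF D(3) A, of w "snd s"] E_app_comp[OF D(4) A, of w "snd t"] w D(6) p q by simp
qed

text \<open>Over a fixed \<open>x\<close> the closure is the \<open>local_closure\<close> of the
  union of the partial sections, whose domains are the principal sieves of M-maps
  \<open>n s\<close>; so \<open>local_closure_W\<close> applies point by point.\<close>

lemma partial_graph_closure: "partial_graph Q Y (graph_closure Q Y G)"
 unfolding partial_graph_def
proof (intro conjI ballI)
 fix A x assume A: "A \<in> Ob C" and x: "x \<in> FO Q A"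
 define \<gamma> where "\<gamma> = {(f, y). f \<in> Ar C \<and> cod f = A \<and> (\<exists>s\<in>G. (res Q f x, y) \<in> graph s (dom f))}"
 have "fib Q (graph_closure Q Y G) A x = local_closure Y A \<gamma>"
 proof -
  have "matches Q Y G (dom f) (res Q f x) (res Y (Idt C (dom f)) y) = local_at Y \<gamma> f y" if "f \<in> Ar C" "cod f = A" "y \<in> FO Y (dom f)" for f y
   using that x Q Y by (auto simp: matches_def local_at_def \<gamma>_def)
  thus ?thesis using x Q Y by (auto simp: fib_def graph_closure_def local_closure_def)
 qed
 moreover have "local_closure Y A \<gamma> \<in> W Y A"
 proof -
  have "\<exists>n. n \<in> M \<and> cod n = A \<and> hits (fst s) A x = factors n" if "s \<in> G" for s
   using N_hits[of "fst s" A x] \<H>D(1,5) G A x that by blast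
  then obtain n where n: "\<And>s. s \<in> G ==> n s \<in> M \<and> cod (n s) = A \<and> hits (fst s) A x = factors (n s)" by metis
  show ?thesis
  proof (rule local_closure_W[OF Y A, of "n ` G"])
   show "n ` G \<subseteq> {m \<in> M. cod m = A}" using n by blast
   have "hits (fst s) A x = {f \<in> Ar C. cod f = A \<and> res Q f x \<in> Domain (graph s (dom f))}" if "s \<in> G" for s
    using \<H>D(5)[OF subsetD[OF G that]] by (simp add: hits_def Domain_graph)
   thus "Domain \<gamma> = (\<Union>m\<in>n ` G. factors m)" using n unfolding \<gamma>_def by auto
   show "y \<in> FO Y (dom f)" if "(f, y) \<in> \<gamma>" for f y using that graphD(1) unfolding \<gamma>_def by (blast intro: Dom_in)
   show "y = z" if "(f, y) \<in> \<gamma>" "(f, z) \<in> \<gamma>" for f y z using that graph_single[OF Dom_in] unfolding \<gamma>_def by blast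
   fix f y g assume "(f, y) \<in> \<gamma>" and g: "g \<in> Ar C" "cod g = dom f"
   then obtain s where s: "f \<in> Ar C" "cod f = A" "s \<in> G" "(res Q f x, y) \<in> graph s (cod g)" by (auto simp: \<gamma>_def)
   show "(f \<cdot> g, res Y g y) \<in> \<gamma>" using graphD(2)[OF s(3) g(1) s(4)] s g x Q by (auto simp: \<gamma>_def)
  qed
 qed
 ultimately show "fib Q (graph_closure Q Y G) A x \<in> W Y A" by simp
qed (auto simp: graph_closure_def)

lemma span_joinD:
 assumes j: "span_join E \<N> Q Y G j" and A: "A \<in> Ob C"
 shows "graph j A = graph_closure Q Y G A"
proof -
 obtain i where i: "i \<in> \<H> Q Y" "\<And>A. A \<in> Ob C ==> graph i A = graph_closure Q Y G A"
  by (rule partial_graph_span[OF Q Y partial_graph_closure]) (rule that)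
 have jH: "j \<in> \<H> Q Y" using j by (simp add: span_join_def)
 have "span_le E i j" "span_le E j i" using span_joinI[OF i] j i(1) unfolding span_join_def by blast+
 thus ?thesis using span_le_graph[OF i(1) jH] span_le_graph[OF jH i(1)] i(2)[OF A] A by blast
qed

end

end

text \<open>With joins computed by \<open>graph_closure\<close>, (J1) and (J2) become comparisons of
  covering sieves. One inclusion enlarges a covering sieve of matches; the other uses that the graph
  of the candidate is closed under gluing, by \<open>graph_local\<close>.\<close>

lemma geometric_E: "geometric TYPE('u) E \<N>"
proof (rule ME.geometricI)
 fix Q Y :: "('o, 'u) presheaf" and G
 assume a: "Q \<in> Ob E" "Y \<in> Ob E" "G \<subseteq> \<H> Q Y" "span_compat E G"
 obtain s where "s \<in> \<H> Q Y" "\<And>A. A \<in> Ob C ==> graph s A = graph_closure Q Y G A"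
  by (rule partial_graph_span[OF a(1,2) partial_graph_closure[OF a(3,1,2,4)]]) (rule that)
 thus "\<exists>j. span_join E \<N> Q Y G j" using span_joinI[OF a(3,1,2)] by blast
next
 fix Q Y :: "('o, 'u) presheaf" and G j h
 assume G: "G \<subseteq> \<H> Q Y" "span_compat E G" and j: "span_join E \<N> Q Y G (j, h)"
 have jh: "(j, h) \<in> \<H> Q Y" using j by (simp add: span_join_def)
 note jD = \<H>D[OF jh, simplified]
 let ?G = "(\<lambda>(m, f). (m, m)) ` G"
 have G': "?G \<subseteq> \<H> Q Q" using G(1) by (auto simp: hom_spans_iff)
 have jj: "(j, j) \<in> \<H> Q Q" using jD by (simp add: hom_spans_iff)
 have dg: "(x, y) \<in> graph (m, m) A \<longleftrightarrow> x = y \<and> x \<in> im m A" for m x y A by (auto simp: graph_iff im_def)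
 show "span_join E \<N> Q Q ?G (j, j)"
 proof (rule span_joinI[OF G' jD(7,7) jj], intro subset_antisym subrelI)
  fix A x y assume A: "A \<in> Ob C" and "(x, y) \<in> graph_closure Q Q ?G A"
  hence xy: "x \<in> FO Q A" "y \<in> FO Q A" and S: "cov A (matches Q Q ?G A x y)" by (auto simp: graph_closure_def)
  have "res Q f x = res Q f y \<and> res Q f x \<in> im j (dom f)" if f: "f \<in> matches Q Q ?G A x y" for f
  proof -
   obtain m k where mk: "(m, k) \<in> G" "res Q f x = res Q f y" "res Q f x \<in> im m (dom f)" using f by (auto simp: dg matches_def)
   have "span_le E (m, k) (j, h)" using j mk(1) by (auto simp: span_join_def)
   hence "graph (m, k) (dom f) \<subseteq> graph (j, h) (dom f)"
    using span_le_graph[OF subsetD[OF G(1) mk(1)] jh] f by (auto simp: matches_def)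
   hence "im m (dom f) \<subseteq> im j (dom f)" using Domain_mono Domain_graph by (metis fst_conv)
   thus ?thesis using mk by blast
  qed
  thus "(x, y) \<in> graph (j, j) A" using graph_local[OF jj A xy S] dg by blast
 next
  fix A x y assume A: "A \<in> Ob C" and "(x, y) \<in> graph (j, j) A"
  hence "x = y" "x \<in> Domain (graph (j, h) A)" by (auto simp: dg Domain_graph)
  then obtain z where z: "x = y" "(x, z) \<in> graph_closure Q Y G A" using span_joinD[OF G(1) jD(7,8) G(2) j A] by blast
  hence x: "x \<in> FO Q A" and S: "cov A (matches Q Y G A x z)" by (auto simp: graph_closure_def)
  \<comment> \<open>Wherever \<open>(x, z)\<close> lies in the graph of a member, \<open>x\<close>
    lies in its domain, so the sieve for the partial identities is at least as large.\<close>
  have "matches Q Y G A x z \<subseteq> matches Q Q ?G A x x" using dg Domain_graph unfolding matches_def by (force simp: case_prod_unfold)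
  hence "cov A (matches Q Q ?G A x x)" by (rule covering_superset[OF S _ sieve_matches[OF G' jD(7,7) x x]])
  thus "(x, y) \<in> graph_closure Q Q ?G A" using z x by (simp add: graph_closure_def)
 qed
next
 fix Q Y Z :: "('o, 'u) presheaf" and G j h p k a b
 assume G: "G \<subseteq> \<H> Q Y" "span_compat E G" and j: "span_join E \<N> Q Y G (j, h)"
  and pk: "(p, k) \<in> \<H> Z Q" and ab: "pullback E k j a b"
 have jh: "(j, h) \<in> \<H> Q Y" using j by (simp add: span_join_def)
 note jD = \<H>D[OF jh, simplified] and pD = \<H>D[OF pk, simplified] and D = E.pullbackD[OF ab]
 let ?G = "ME.span_precomp G p k" and ?s = "(p \<cdot>[E] a, h \<cdot>[E] b)"
 have GZ: "?G \<subseteq> \<H> Z Y" by (rule ME.span_precomp_hom[OF G(1) pk])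
 have "a \<in> \<N>" using ME.M_pullback[OF E.pullback_sym[OF ab]] jD by simp
 hence s: "?s \<in> \<H> Z Y" using pD D jD by (simp add: hom_spans_iff)
 note gs = graph_comp[OF jh pk ab]
 show "span_join E \<N> Z Y ?G ?s"
 proof (rule span_joinI[OF GZ pD(7) jD(8) s], intro subset_antisym subrelI)
  fix A x w assume A: "A \<in> Ob C" and "(x, w) \<in> graph ?s A"
  then obtain z where z: "z \<in> FO (Dom E p) A" "x = app p A z" "(app k A z, w) \<in> graph_closure Q Y G A"
   using gs[OF A] span_joinD[OF G(1) jD(7,8) G(2) j A] by blast
  hence w: "w \<in> FO Y A" and S: "cov A (matches Q Y G A (app k A z) w)" by (auto simp: graph_closure_def)
  have x: "x \<in> FO Z A" using app_in[OF pD(2) A z(1)] z(2) pD by simp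
  have "matches Q Y G A (app k A z) w \<subseteq> matches Z Y ?G A x w"
  proof
   fix f assume "f \<in> matches Q Y G A (app k A z) w"
   then obtain m g where f: "f \<in> Ar C" "cod f = A" and mg: "(m, g) \<in> G" "(res Q f (app k A z), res Y f w) \<in> graph (m, g) (dom f)"
    by (force simp: matches_def)
   note mD = \<H>D[OF subsetD[OF G(1) mg(1)], simplified]
   obtain b' a' where pb: "pullback E m k b' a'" using ME.pullback_exists[OF mD(1) pD(3)] pD mD by metis
   have "(res Z f x, res Y f w) \<in> graph (p \<cdot>[E] a', g \<cdot>[E] b') (dom f)"
    using graph_comp[OF subsetD[OF G(1) mg(1)] pk E.pullback_sym[OF pb], of "dom f"] mg(2) f z app_nat[OF pD(2) f(1), of z]
     app_nat[OF pD(3) f(1), of z] pD by (auto intro!: bexI[of _ "res (Dom E p) f z"])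
   moreover have "(p \<cdot>[E] a', g \<cdot>[E] b') \<in> ?G" unfolding ME.span_precomp_def using mg(1) E.pullback_sym[OF pb] by blast
   ultimately show "f \<in> matches Z Y ?G A x w" using f by (auto simp: matches_def)
  qed
  hence "cov A (matches Z Y ?G A x w)" by (rule covering_superset[OF S _ sieve_matches[OF GZ pD(7) jD(8) x w]])
  thus "(x, w) \<in> graph_closure Z Y ?G A" using x w by (simp add: graph_closure_def)
 next
  fix A x w assume A: "A \<in> Ob C" and "(x, w) \<in> graph_closure Z Y ?G A"
  hence xw: "x \<in> FO Z A" "w \<in> FO Y A" and S: "cov A (matches Z Y ?G A x w)" by (auto simp: graph_closure_def)
  show "(x, w) \<in> graph ?s A"
  proof (rule graph_local[OF s A xw S])
   fix f assume "f \<in> matches Z Y ?G A x w"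
   then obtain m g a' b' where f: "f \<in> Ar C" and mg: "(m, g) \<in> G" "pullback E k m a' b'"
    "(res Z f x, res Y f w) \<in> graph (p \<cdot>[E] a', g \<cdot>[E] b') (dom f)" by (auto simp: matches_def ME.span_precomp_def)
   have B: "dom f \<in> Ob C" using f by simp
   have "span_le E (m, g) (j, h)" using j mg(1) by (auto simp: span_join_def)
   hence "graph (m, g) (dom f) \<subseteq> graph (j, h) (dom f)" using span_le_graph[OF subsetD[OF G(1) mg(1)] jh] B by blast
   thus "(res Z f x, res Y f w) \<in> graph ?s (dom f)"
    using graph_comp[OF subsetD[OF G(1) mg(1)] pk mg(2) B] mg(3) gs[OF B] by blast
  qed
 qed
qed

end

section \<open>Colimits, and the functors that preserve them\<close>

section \<open>Colimits\<close>

lemma colimitD: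
 assumes "colimit J C F X c"
 shows "X \<in> Ob C" "\<And>j. j \<in> Ob J ==> c j \<in> Ar C" "\<And>j. j \<in> Ob J ==> Dom C (c j) = FO F j"
  "\<And>j. j \<in> Ob J ==> Cod C (c j) = X" "\<And>a. a \<in> Ar J ==> c (Cod J a) \<cdot>[C] FA F a = c (Dom J a)"
 using assms by (auto simp: colimit_def cocone_def Hom_iff)

lemma colimit_lift:
 assumes "colimit J C F X c" "Y \<in> Ob C" "\<And>j. j \<in> Ob J ==> d j \<in> Ar C \<and> Dom C (d j) = FO F j \<and> Cod C (d j) = Y"
  "\<And>a. a \<in> Ar J ==> d (Cod J a) \<cdot>[C] FA F a = d (Dom J a)"
 obtains u where "u \<in> Ar C" "Dom C u = X" "Cod C u = Y" "\<And>j. j \<in> Ob J ==> u \<cdot>[C] c j = d j"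
proof -
 have "cocone J C F Y d" using assms(2-) by (simp add: cocone_def Hom_iff)
 thus thesis using assms(1) that unfolding colimit_def Hom_iff by metis
qed

lemma colimit_unique:
 assumes "category C" "category J" "cat_functor J C F" "colimit J C F X c"
  "u \<in> Ar C" "v \<in> Ar C" "Dom C u = X" "Dom C v = X" "Cod C u = Cod C v"
  "\<And>j. j \<in> Ob J ==> u \<cdot>[C] c j = v \<cdot>[C] c j"
 shows "u = v"
proof -
 interpret category C by fact
 interpret J: category J by fact
 interpret F: cat_functor J C F by fact
 note D = colimitD[OF assms(4)]
 have "cocone J C F (Cod C u) (\<lambda>j. u \<cdot>[C] c j)"
  unfolding cocone_def Hom_iff using D assms(5-) by auto
 hence "\<exists>!w. w \<in> Hom C X (Cod C u) \<and> (\<forall>j\<in>Ob J. w \<cdot>[C] c j = u \<cdot>[C] c j)"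
  using assms(4) by (simp add: colimit_def)
 thus ?thesis by (rule ex1E) (use assms(5-) in \<open>metis Hom_iff\<close>)
qed

lemma colimitI:
 assumes "X \<in> Ob C" "\<And>j. j \<in> Ob J ==> c j \<in> Ar C \<and> Dom C (c j) = FO F j \<and> Cod C (c j) = X"
  "\<And>a. a \<in> Ar J ==> c (Cod J a) \<cdot>[C] FA F a = c (Dom J a)"
  "\<And>Y d. Y \<in> Ob C ==> (\<And>j. j \<in> Ob J ==> d j \<in> Ar C \<and> Dom C (d j) = FO F j \<and> Cod C (d j) = Y) ==>
    (\<And>a. a \<in> Ar J ==> d (Cod J a) \<cdot>[C] FA F a = d (Dom J a)) ==>
    \<exists>u\<in>Ar C. Dom C u = X \<and> Cod C u = Y \<and> (\<forall>j\<in>Ob J. u \<cdot>[C] c j = d j)"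
  "\<And>u v. u \<in> Ar C ==> v \<in> Ar C ==> Dom C u = X ==> Dom C v = X ==> Cod C u = Cod C v ==>
    (\<And>j. j \<in> Ob J ==> u \<cdot>[C] c j = v \<cdot>[C] c j) ==> u = v"
 shows "colimit J C F X c"
 unfolding colimit_def
proof (intro conjI allI impI)
 show "cocone J C F X c" using assms(1-3) by (simp add: cocone_def Hom_iff)
 fix Y d assume "cocone J C F Y d"
 then obtain u where u: "u \<in> Ar C" "Dom C u = X" "Cod C u = Y" "\<forall>j\<in>Ob J. u \<cdot>[C] c j = d j"
  using assms(4)[of Y d] by (auto simp: cocone_def Hom_iff)
 show "\<exists>!u. u \<in> Hom C X Y \<and> (\<forall>j\<in>Ob J. u \<cdot>[C] c j = d j)"
 proof (rule ex1I[of _ u])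
  fix v assume "v \<in> Hom C X Y \<and> (\<forall>j\<in>Ob J. v \<cdot>[C] c j = d j)"
  thus "v = u" using u by (auto simp: Hom_iff intro!: assms(5)[of v u])
 qed (use u in \<open>simp add: Hom_iff\<close>)
qed

text \<open>The functor sending \<open>Q\<close> to the maps from \<open>G Q\<close> to
  \<open>Y\<close> is representable, that is, \<open>G\<close> has a right adjoint at the single
  object \<open>Y\<close>. For the inclusion into partial maps, \<open>Y'\<close> is the partial map
  classifier.\<close>

definition right_adjoint_at :: "('o, 'a) cat \<Rightarrow> ('p, 'b) cat \<Rightarrow> ('o, 'a, 'p, 'b) ftor \<Rightarrow> 'p \<Rightarrow> bool" where
 "right_adjoint_at E P G Y \<longleftrightarrow> (\<exists>Y'\<in>Ob E. \<exists>\<Theta>. (\<forall>Q\<in>Ob E. bij_betw (\<Theta> Q) (Hom P (FO G Q) Y) (Hom E Q Y')) \<and>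
   (\<forall>t\<in>Ar E. \<forall>d\<in>Hom P (FO G (Cod E t)) Y. \<Theta> (Dom E t) (d \<cdot>[P] FA G t) = \<Theta> (Cod E t) d \<cdot>[E] t))"

text \<open>Cocones under the image diagram with vertex \<open>Y\<close> correspond to cocones under
  \<open>F\<close> with vertex \<open>Y'\<close>, by naturality of \<open>\<Theta>\<close>.\<close>

lemma relative_adjoint_colimit:
 assumes G: "cat_functor E P G" and F: "cat_functor J E F" and colim: "colimit J E F X c"
  and adj: "\<And>Y. Y \<in> Ob P ==> right_adjoint_at E P G Y"
 shows "colimit J P (comp_functor J G F) (FO G X) (\<lambda>j. FA G (c j))"
proof -
 interpret G: cat_functor E P G by fact
 interpret F: cat_functor J E F by fact
 note D = colimitD[OF colim]
 show ?thesis
 proof (rule colimitI)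
  show "FO G X \<in> Ob P" using D by simp
  show "FA G (c j) \<in> Ar P \<and> Dom P (FA G (c j)) = FO (comp_functor J G F) j \<and> Cod P (FA G (c j)) = FO G X"
   if "j \<in> Ob J" for j using D that by simp
  show "FA G (c (Cod J a)) \<cdot>[P] FA (comp_functor J G F) a = FA G (c (Dom J a))" if "a \<in> Ar J" for a
   using D that G.FA_comp[of "FA F a" "c (Cod J a)"] by simp
 next
  fix Y d assume Y: "Y \<in> Ob P"
   and d: "\<And>j. j \<in> Ob J ==> d j \<in> Ar P \<and> Dom P (d j) = FO (comp_functor J G F) j \<and> Cod P (d j) = Y"
   and dc: "\<And>a. a \<in> Ar J ==> d (Cod J a) \<cdot>[P] FA (comp_functor J G F) a = d (Dom J a)"
  obtain Y' \<Theta> where Y': "Y' \<in> Ob E" and bij: "\<And>Q. Q \<in> Ob E ==> bij_betw (\<Theta> Q) (Hom P (FO G Q) Y) (Hom E Q Y')"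
   and nat: "\<And>t d. t \<in> Ar E ==> d \<in> Hom P (FO G (Cod E t)) Y ==> \<Theta> (Dom E t) (d \<cdot>[P] FA G t) = \<Theta> (Cod E t) d \<cdot>[E] t"
   using adj[OF Y] unfolding right_adjoint_at_def by metis
  have dH: "d j \<in> Hom P (FO G (FO F j)) Y" if "j \<in> Ob J" for j using d[OF that] that by (simp add: Hom_iff)
  have \<delta>: "\<Theta> (FO F j) (d j) \<in> Hom E (FO F j) Y'" if "j \<in> Ob J" for j
   using bij[of "FO F j"] dH[OF that] that by (auto simp: bij_betw_def)
  obtain u where u: "u \<in> Ar E" "Dom E u = X" "Cod E u = Y'" "\<And>j. j \<in> Ob J ==> u \<cdot>[E] c j = \<Theta> (FO F j) (d j)"
  proof (rule colimit_lift[OF colim Y'])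
   show "\<Theta> (FO F j) (d j) \<in> Ar E \<and> Dom E (\<Theta> (FO F j) (d j)) = FO F j \<and> Cod E (\<Theta> (FO F j) (d j)) = Y'"
    if "j \<in> Ob J" for j using \<delta>[OF that] by (simp add: Hom_iff)
   show "\<Theta> (FO F (Cod J a)) (d (Cod J a)) \<cdot>[E] FA F a = \<Theta> (FO F (Dom J a)) (d (Dom J a))" if "a \<in> Ar J" for a
    using nat[of "FA F a" "d (Cod J a)"] dH[of "Cod J a"] dc[OF that] that by simp
  qed blast
  obtain v where v: "v \<in> Hom P (FO G X) Y" "\<Theta> X v = u"
   using bij_betw_imp_surj_on[OF bij[OF D(1)]] u(1-3) by (metis (no_types, lifting) Hom_iff imageE)
  have "v \<cdot>[P] FA G (c j) = d j" if j: "j \<in> Ob J" for j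
  proof -
   have "\<Theta> (FO F j) (v \<cdot>[P] FA G (c j)) = \<Theta> (FO F j) (d j)"
    using nat[of "c j" v] D j v u by simp
   moreover have "v \<cdot>[P] FA G (c j) \<in> Hom P (FO G (FO F j)) Y" using v D j by (simp add: Hom_iff)
   ultimately show ?thesis using bij[of "FO F j"] dH[OF j] j by (auto simp: bij_betw_def inj_on_def)
  qed
  thus "\<exists>u\<in>Ar P. Dom P u = FO G X \<and> Cod P u = Y \<and> (\<forall>j\<in>Ob J. u \<cdot>[P] FA G (c j) = d j)"
   using v by (auto simp: Hom_iff)
 next
  fix u v assume uv: "u \<in> Ar P" "v \<in> Ar P" "Dom P u = FO G X" "Dom P v = FO G X" "Cod P u = Cod P v"
   and eq: "\<And>j. j \<in> Ob J ==> u \<cdot>[P] FA G (c j) = v \<cdot>[P] FA G (c j)"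
  define Y where "Y = Cod P v"
  have Y: "Y \<in> Ob P" using uv by (simp add: Y_def)
  obtain Y' \<Theta> where Y': "Y' \<in> Ob E" and bij: "\<And>Q. Q \<in> Ob E ==> bij_betw (\<Theta> Q) (Hom P (FO G Q) Y) (Hom E Q Y')"
   and nat: "\<And>t d. t \<in> Ar E ==> d \<in> Hom P (FO G (Cod E t)) Y ==> \<Theta> (Dom E t) (d \<cdot>[P] FA G t) = \<Theta> (Cod E t) d \<cdot>[E] t"
   using adj[OF Y] unfolding right_adjoint_at_def by metis
  have uvH: "u \<in> Hom P (FO G X) Y" "v \<in> Hom P (FO G X) Y" using uv by (auto simp: Hom_iff Y_def)
  hence \<Theta>: "\<Theta> X u \<in> Hom E X Y'" "\<Theta> X v \<in> Hom E X Y'" using bij[OF D(1)] by (auto simp: bij_betw_def)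
  have "\<Theta> X u = \<Theta> X v"
  proof (rule colimit_unique[OF G.src.category_axioms F.src.category_axioms F colim])
   fix j assume j: "j \<in> Ob J"
   show "\<Theta> X u \<cdot>[E] c j = \<Theta> X v \<cdot>[E] c j"
    using nat[of "c j" u] nat[of "c j" v] D j uvH eq[OF j] by simp
  qed (use \<Theta> in \<open>auto simp: Hom_iff\<close>)
  thus "u = v" using bij[OF D(1)] uvH by (auto simp: bij_betw_def inj_on_def)
 qed
qed

section \<open>Existence of colimits of sheaves\<close>

subsection \<open>Colimits of sheaves\<close>

context site
begin

lemma cocomplete_E: "cocomplete TYPE('u) E"
 unfolding cocomplete_def
proof (intro conjI allI impI E.category_axioms)
 fix J :: "('u, 'u) cat" and F
 assume JF: "small_category TYPE('u) J \<and> cat_functor J E F"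
 hence smJ: "small TYPE('u) (Ob J)" by (simp add: small_category_def)
 interpret F: cat_functor J E F using JF by blast
 \<comment> \<open>The coproduct of the presheaves in the diagram. \<open>Er\<close> relates an
   element to its image under each transition map, so the free sheaf on this data is the
   colimit.\<close>
 define V where "V A = Sigma (Ob J) (\<lambda>j. FO (FO F j) A)" for A
 define act where "act f = (\<lambda>(j, v). (j, res (FO F j) f v))" for f
 define Er where "Er A = {((Dom J a, v), (Cod J a, app (FA F a) A v)) | a v. a \<in> Ar J \<and> v \<in> FO (FO F (Dom J a)) A}" for A
 have FJ: "FO F j \<in> Ob E" if "j \<in> Ob J" for j using that by simp
 have V: "raw_presheaf C V act" unfolding raw_presheaf_def V_def act_def by auto
 have smV: "small TYPE('u) (V A)" if "A \<in> Ob C" for A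
  unfolding V_def by (rule small_Sigma[OF univ smJ small_FO[OF FJ that]])
 obtain Z h where "is_free_sheaf V act Er Z h" using free_sheaf[OF V smV] by blast
 note free = is_free_sheafD[OF this]
 note Z = free(1) and h = free(2)
 have h1: "h A (j, v) \<in> FO Z A" if "A \<in> Ob C" "j \<in> Ob J" "v \<in> FO (FO F j) A" for A j v
  using h that by (auto simp: raw_map_def V_def)
 have h2: "h (dom f) (j, res (FO F j) f v) = res Z f (h (cod f) (j, v))"
  if "f \<in> Ar C" "j \<in> Ob J" "v \<in> FO (FO F j) (cod f)" for f j v
  using h that unfolding raw_map_def V_def act_def by force
 define c where "c j = mk_map C (FO F j) Z (\<lambda>A v. h A (j, v))" for j
 have c: "c j \<in> Ar E" "Dom E (c j) = FO F j" "Cod E (c j) = Z" if "j \<in> Ob J" for j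
  unfolding c_def using E_map[OF FJ[OF that] Z, of "\<lambda>A v. h A (j, v)"] h1 h2 that by (auto simp: raw_map_def)
 have ca: "app (c j) A v = h A (j, v)" if "A \<in> Ob C" "v \<in> FO (FO F j) A" for A v j
  using that by (simp add: c_def)
 have "colimit J E F Z c"
 proof (rule colimitI[OF Z])
  show "c j \<in> Ar E \<and> Dom E (c j) = FO F j \<and> Cod E (c j) = Z" if "j \<in> Ob J" for j using c[OF that] by blast
 next
  fix a assume a: "a \<in> Ar J"
  show "c (Cod J a) \<cdot>[E] FA F a = c (Dom J a)"
  proof (rule E_ext)
   fix A v assume A: "A \<in> Ob C" and "v \<in> FO (Dom E (c (Cod J a) \<cdot>[E] FA F a)) A"
   hence v: "v \<in> FO (FO F (Dom J a)) A" using a c by simp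
   have av: "app (FA F a) A v \<in> FO (FO F (Cod J a)) A" using app_in[of "FA F a" A v] a A v by simp
   have "h A (Dom J a, v) = h A (Cod J a, app (FA F a) A v)"
   proof -
    have "((Dom J a, v), (Cod J a, app (FA F a) A v)) \<in> Er A" "(Dom J a, v) \<in> V A" "(Cod J a, app (FA F a) A v) \<in> V A"
     using a v av by (auto simp: Er_def V_def)
    thus ?thesis using free(3) A unfolding resp_rel_def by fast
   qed
   thus "app (c (Cod J a) \<cdot>[E] FA F a) A v = app (c (Dom J a)) A v"
    using a A v av ca by simp
  qed (use a c in auto)
 next
  fix Q d assume Q: "Q \<in> Ob E" and d: "\<And>j. j \<in> Ob J ==> d j \<in> Ar E \<and> Dom E (d j) = FO F j \<and> Cod E (d j) = Q"
   and dc: "\<And>a. a \<in> Ar J ==> d (Cod J a) \<cdot>[E] FA F a = d (Dom J a)"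
  define \<phi> where "\<phi> A = (\<lambda>(j, v). app (d j) A v)" for A
  have "\<exists>t\<in>Ar E. Dom E t = Z \<and> Cod E t = Q \<and> (\<forall>A\<in>Ob C. \<forall>x\<in>V A. app t A (h A x) = \<phi> A x)"
  proof (rule free(4)[OF Q])
   show "raw_map C V act (FO Q) (res Q) \<phi>"
   proof (rule raw_mapI)
    fix A x assume A: "A \<in> Ob C" and "x \<in> V A"
    then obtain j v where x: "x = (j, v)" "j \<in> Ob J" "v \<in> FO (FO F j) A" by (auto simp: V_def)
    thus "\<phi> A x \<in> FO Q A" using app_in[of "d j" A v] d[of j] A by (simp add: \<phi>_def)
   next
    fix f x assume f: "f \<in> Ar C" and "x \<in> V (cod f)"
    then obtain j v where x: "x = (j, v)" "j \<in> Ob J" "v \<in> FO (FO F j) (cod f)" by (auto simp: V_def)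
    thus "\<phi> (dom f) (act f x) = res Q f (\<phi> (cod f) x)"
     using app_nat[of "d j" f v] d[of j] f by (simp add: \<phi>_def act_def)
   qed
   show "resp_rel V Er \<phi>"
    unfolding resp_rel_def
   proof (intro ballI, clarify)
   fix A x y assume A: "A \<in> Ob C" and "(x, y) \<in> Er A"
   then obtain a v where a: "a \<in> Ar J" "v \<in> FO (FO F (Dom J a)) A" "x = (Dom J a, v)" "y = (Cod J a, app (FA F a) A v)"
    by (auto simp: Er_def)
   have "app (d (Cod J a)) A (app (FA F a) A v) = app (d (Dom J a)) A v"
    using E_app_comp[of "FA F a" A v "d (Cod J a)"] dc[OF a(1)] a A by simp
   thus "\<phi> A x = \<phi> A y" using a by (simp add: \<phi>_def)
   qed
  qed
  then obtain t where t: "t \<in> Ar E" "Dom E t = Z" "Cod E t = Q" "\<forall>A\<in>Ob C. \<forall>x\<in>V A. app t A (h A x) = \<phi> A x" by blast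
  have "t \<cdot>[E] c j = d j" if j: "j \<in> Ob J" for j
  proof (rule E_ext)
   fix A v assume A: "A \<in> Ob C" and "v \<in> FO (Dom E (t \<cdot>[E] c j)) A"
   hence v: "v \<in> FO (FO F j) A" using t c[OF j] by simp
   thus "app (t \<cdot>[E] c j) A v = app (d j) A v"
    using c[OF j] ca[OF A v] t(4) A j by (simp add: \<phi>_def V_def)
  qed (use t c[OF j] d[OF j] in auto)
  thus "\<exists>u\<in>Ar E. Dom E u = Z \<and> Cod E u = Q \<and> (\<forall>j\<in>Ob J. u \<cdot>[E] c j = d j)" using t by blast
 next
  fix u v assume uv: "u \<in> Ar E" "v \<in> Ar E" "Dom E u = Z" "Dom E v = Z" "Cod E u = Cod E v"
   and eq: "\<And>j. j \<in> Ob J ==> u \<cdot>[E] c j = v \<cdot>[E] c j"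
  show "u = v"
  proof (rule free(5))
   fix A x assume A: "A \<in> Ob C" and "x \<in> V A"
   then obtain j w where x: "x = (j, w)" "j \<in> Ob J" "w \<in> FO (FO F j) A" by (auto simp: V_def)
   have "app (u \<cdot>[E] c j) A w = app (v \<cdot>[E] c j) A w" using eq[OF x(2)] by simp
   thus "app u A (h A x) = app v A (h A x)"
    using c[OF x(2)] ca[OF A x(3)] x A by simp
  qed (use uv in auto)
 qed
 thus "\<exists>X c. colimit J E F X c" by blast
qed

text \<open>The representing object is presented by a sheaf \<open>W\<close> with values in any
  type, and \<open>\<nu>\<close> turns a map from \<open>G Q\<close> to \<open>Y\<close> into a map
  from \<open>Q\<close> to \<open>W\<close>, naturally and bijectively. It serves for the partial
  map classifier and for the right adjoint of the extension.\<close>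

lemma realize_right_adjoint:
 fixes W :: "'o \<Rightarrow> 'x set" and \<nu> :: "('o, 'u) presheaf \<Rightarrow> 'b \<Rightarrow> 'o \<Rightarrow> 'u \<Rightarrow> 'x"
 assumes W: "raw_presheaf C W act" and small: "\<And>A. A \<in> Ob C ==> small TYPE('u) (W A)" and sheaf: "raw_sheaf C M W act"
  and G: "cat_functor E P G"
  and map: "\<And>Q h. Q \<in> Ob E ==> h \<in> Hom P (FO G Q) Y ==> raw_map C (FO Q) (res Q) W act (\<nu> Q h)"
  and inj: "\<And>Q h k. Q \<in> Ob E ==> h \<in> Hom P (FO G Q) Y ==> k \<in> Hom P (FO G Q) Y ==>
   (\<And>A x. A \<in> Ob C ==> x \<in> FO Q A ==> \<nu> Q h A x = \<nu> Q k A x) ==> h = k"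
  and surj: "\<And>Q d. Q \<in> Ob E ==> raw_map C (FO Q) (res Q) W act d ==>
   \<exists>h\<in>Hom P (FO G Q) Y. \<forall>A\<in>Ob C. \<forall>x\<in>FO Q A. \<nu> Q h A x = d A x"
  and nat: "\<And>t h A z. t \<in> Ar E ==> h \<in> Hom P (FO G (Cod E t)) Y ==> A \<in> Ob C ==> z \<in> FO (Dom E t) A ==>
   \<nu> (Dom E t) (h \<cdot>[P] FA G t) A z = \<nu> (Cod E t) h A (app t A z)"
 shows "right_adjoint_at E P G Y"
proof -
 interpret G: cat_functor E P G by (rule G)
 obtain Z enc where Z: "Z \<in> Ob E" and enc: "\<And>A. A \<in> Ob C ==> bij_betw (enc A) (W A) (FO Z A)"
  and resZ: "\<And>f x. f \<in> Ar C ==> x \<in> W (cod f) ==> res Z f (enc (cod f) x) = enc (dom f) (act f x)"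
 proof (rule realize[OF W small], goal_cases)
  case (2 Z enc)
  show ?thesis by (rule 2(1)[OF 2(5)[OF sheaf] 2(3,4)])
 qed
 have enc_eq: "enc A w = enc A w' \<longleftrightarrow> w = w'" if "A \<in> Ob C" "w \<in> W A" "w' \<in> W A" for A w w'
  using inj_on_eq_iff[OF bij_betw_imp_inj_on[OF enc]] that by blast
 have \<nu>: "\<And>A x. A \<in> Ob C ==> x \<in> FO Q A ==> \<nu> Q h A x \<in> W A"
  "\<And>f z. f \<in> Ar C ==> z \<in> FO Q (cod f) ==> \<nu> Q h (dom f) (res Q f z) = act f (\<nu> Q h (cod f) z)"
  if "Q \<in> Ob E" "h \<in> Hom P (FO G Q) Y" for Q h
  using map[OF that] by (simp_all add: raw_map_def)
 define \<Theta> where "\<Theta> Q h = mk_map C Q Z (\<lambda>A x. enc A (\<nu> Q h A x))" for Q h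
 have \<Theta>: "\<Theta> Q h \<in> Ar E" "Dom E (\<Theta> Q h) = Q" "Cod E (\<Theta> Q h) = Z"
  "\<And>A x. A \<in> Ob C ==> x \<in> FO Q A ==> app (\<Theta> Q h) A x = enc A (\<nu> Q h A x)"
  if Q: "Q \<in> Ob E" and h: "h \<in> Hom P (FO G Q) Y" for Q h
 proof -
  have "raw_map C (FO Q) (res Q) (FO Z) (res Z) (\<lambda>A x. enc A (\<nu> Q h A x))"
   by (rule raw_mapI) (use bij_betwE[OF enc] \<nu>[OF Q h] resZ in auto)
  note m = E_map[OF Q Z this]
  show "\<Theta> Q h \<in> Ar E" "Dom E (\<Theta> Q h) = Q" "Cod E (\<Theta> Q h) = Z" using m by (simp_all add: \<Theta>_def)
 qed (simp add: \<Theta>_def)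
 have "bij_betw (\<Theta> Q) (Hom P (FO G Q) Y) (Hom E Q Z)" if Q: "Q \<in> Ob E" for Q
  unfolding bij_betw_def
 proof (intro conjI inj_onI set_eqI iffI)
  fix h k assume hk: "h \<in> Hom P (FO G Q) Y" "k \<in> Hom P (FO G Q) Y" and eq: "\<Theta> Q h = \<Theta> Q k"
  show "h = k"
   by (rule inj[OF Q hk]) (use \<Theta>(4)[OF Q hk(1)] \<Theta>(4)[OF Q hk(2)] \<nu>(1)[OF Q hk(1)] \<nu>(1)[OF Q hk(2)] eq enc_eq in metis)
 next
  fix t assume "t \<in> \<Theta> Q ` Hom P (FO G Q) Y"
  thus "t \<in> Hom E Q Z" using \<Theta>(1-3)[OF Q] by (auto simp: Hom_iff)
 next
  fix t assume "t \<in> Hom E Q Z"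
  hence t: "t \<in> Ar E" "Dom E t = Q" "Cod E t = Z" by (simp_all add: Hom_iff)
  define d where "d A x = inv_into (W A) (enc A) (app t A x)" for A x
  have d: "d A x \<in> W A" "enc A (d A x) = app t A x" if A: "A \<in> Ob C" "x \<in> FO Q A" for A x
  proof -
   have "app t A x \<in> enc A ` W A" using app_in[OF t(1) A(1)] A(2) t bij_betw_imp_surj_on[OF enc[OF A(1)]] by simp
   thus "d A x \<in> W A" "enc A (d A x) = app t A x" unfolding d_def by (rule inv_into_into, rule f_inv_into_f)
  qed
  have "raw_map C (FO Q) (res Q) W act d"
  proof (rule raw_mapI)
   fix f x assume f: "f \<in> Ar C" "x \<in> FO Q (cod f)"
   have O: "dom f \<in> Ob C" "res Q f x \<in> FO Q (dom f)" "cod f \<in> Ob C" using f Q by simp_all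
   have "act f (d (cod f) x) \<in> W (dom f)" using W f d(1)[OF O(3) f(2)] unfolding raw_presheaf_def by blast
   moreover have "enc (dom f) (d (dom f) (res Q f x)) = enc (dom f) (act f (d (cod f) x))"
    using resZ[OF f(1) d(1)[OF O(3) f(2)]] d(2)[OF O(3) f(2)] d(2)[OF O(1,2)] app_nat[OF t(1) f(1), of x] f t by simp
   ultimately show "d (dom f) (res Q f x) = act f (d (cod f) x)" using enc_eq[OF O(1) d(1)[OF O(1,2)]] by blast
  qed (rule d)
  then obtain h where h: "h \<in> Hom P (FO G Q) Y" "\<forall>A\<in>Ob C. \<forall>x\<in>FO Q A. \<nu> Q h A x = d A x" using surj[OF Q] by blast
  have "t = \<Theta> Q h" by (rule E_ext) (use t \<Theta>[OF Q h(1)] h(2) d(2) in simp_all)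
  thus "t \<in> \<Theta> Q ` Hom P (FO G Q) Y" using h(1) by blast
 qed
 moreover have "\<Theta> (Dom E t) (h \<cdot>[P] FA G t) = \<Theta> (Cod E t) h \<cdot>[E] t" if t: "t \<in> Ar E" and h: "h \<in> Hom P (FO G (Cod E t)) Y" for t h
 proof -
  have O: "Dom E t \<in> Ob E" "Cod E t \<in> Ob E" using t by simp_all
  have ht: "h \<cdot>[P] FA G t \<in> Hom P (FO G (Dom E t)) Y" using t h by (simp add: Hom_iff)
  note T1 = \<Theta>[OF O(2) h] and T2 = \<Theta>[OF O(1) ht]
  show ?thesis
  proof (rule E_ext)
   fix A x assume A: "A \<in> Ob C" and "x \<in> FO (Dom E (\<Theta> (Dom E t) (h \<cdot>[P] FA G t))) A"
   hence x: "x \<in> FO (Dom E t) A" using T2(2) by simp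
   thus "app (\<Theta> (Dom E t) (h \<cdot>[P] FA G t)) A x = app (\<Theta> (Cod E t) h \<cdot>[E] t) A x"
    using T1(4)[OF A app_in[OF t A x]] T2(4)[OF A x] E_app_comp[OF t A x, of "\<Theta> (Cod E t) h"] nat[OF t h A x] by simp
  qed (use T1(1-3) T2(1-3) t in simp_all)
 qed
 ultimately show ?thesis unfolding right_adjoint_at_def using Z by blast
qed

section \<open>The sheaf of partial sections represents partial maps\<close>

subsection \<open>The partial map classifier\<close>

lemma partial_map_eq_graph:
 assumes s: "s \<in> \<H> Q Y" and t: "t \<in> \<H> Q Y"
 shows "partial_map E \<N> s = partial_map E \<N> t \<longleftrightarrow> (\<forall>A\<in>Ob C. graph s A = graph t A)"
proof -
 obtain m f n g where mf: "s = (m, f)" "t = (n, g)" by fastforce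
 have sp: "(m, f) \<in> spans E \<N>" "(n, g) \<in> spans E \<N>" using s t mf by (simp_all add: hom_spans_def)
 note sD = \<H>D[OF s, unfolded mf fst_conv snd_conv] and tD = \<H>D[OF t, unfolded mf fst_conv snd_conv]
 have "span_le E (m, f) (n, g)" if "ME.pm m f = ME.pm n g"
  using that ME.partial_map_eq_iff[OF sp] unfolding span_le_iff by (metis E.iso_Ar)
 moreover have "span_le E (n, g) (m, f)" if "ME.pm m f = ME.pm n g"
  using that[symmetric] ME.partial_map_eq_iff[OF sp(2,1)] unfolding span_le_iff by (metis E.iso_Ar)
 moreover have "ME.pm m f = ME.pm n g" if le: "span_le E (m, f) (n, g)" "span_le E (n, g) (m, f)"
 proof -
  obtain u where u: "u \<in> Ar E" "Dom E u = Dom E m" "Cod E u = Dom E n" "n \<cdot>[E] u = m" "g \<cdot>[E] u = f"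
   using le(1) unfolding span_le_iff by blast
  have "subobj_le E m n" "subobj_le E n m" using ME.span_le_subobj le by fastforce+
  then obtain v where v: "is_iso E v" "Dom E v = Dom E m" "Cod E v = Dom E n" "n \<cdot>[E] v = m"
   using ME.subobj_equiv_iso sD(1,5) tD(1,5) by metis
  \<comment> \<open>The comparison of the spans is forced to be the isomorphism of their domains,
    because \<open>n\<close> is monic.\<close>
  have "u = v" by (rule E.mono_cancel[OF ME.M_mono[OF tD(1)]]) (use u v in simp_all)
  thus ?thesis using ME.partial_map_eq_iff[OF sp] u v by blast
 qed
 ultimately show ?thesis using span_le_graph[OF s t] span_le_graph[OF t s] mf by blast
qed

context
 fixes Y :: "('o, 'u) presheaf"
 assumes Y: "Y \<in> Ob E"
begin

private definition wact :: "'u \<Rightarrow> ('u \<times> 'u) set \<Rightarrow> ('u \<times> 'u) set" where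
 "wact g \<gamma> = {(f, y). f \<in> Ar C \<and> cod f = dom g \<and> (g \<cdot> f, y) \<in> \<gamma>}"

private lemma wact_iff: "(f, y) \<in> wact g \<gamma> \<longleftrightarrow> f \<in> Ar C \<and> cod f = dom g \<and> (g \<cdot> f, y) \<in> \<gamma>"
 by (simp add: wact_def)

private lemma wact_W:
 assumes g: "g \<in> Ar C" and \<gamma>: "\<gamma> \<in> W Y (cod g)" shows "wact g \<gamma> \<in> W Y (dom g)"
proof (rule WI)
 note W = WD[OF \<gamma>]
 obtain m where m: "m \<in> M" "cod m = cod g" "Domain \<gamma> = factors m" using W(6) by blast
 obtain p q where pq: "pullback C m g p q" "q \<in> M" using pullback_exists[OF m(1) g] m(2) by metis
 have "Domain (wact g \<gamma>) = pull (Domain \<gamma>) g" by (auto simp: wact_def pull_def)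
 thus "\<exists>m\<in>M. cod m = dom g \<and> Domain (wact g \<gamma>) = factors m"
  using pull_factors[OF pq(1)] pullbackD(8)[OF pq(1)] pq(2) m(3) by auto
 show "f \<in> Ar C \<and> cod f = dom g \<and> y \<in> FO Y (dom f)" if "(f, y) \<in> wact g \<gamma>" for f y
  using that W(3)[of "g \<cdot> f" y] g by (simp add: wact_iff)
 show "(f \<cdot> h, res Y h y) \<in> wact g \<gamma>" if "(f, y) \<in> wact g \<gamma>" "h \<in> Ar C" "cod h = dom f" for f y h
  using that W(4)[of "g \<cdot> f" y h] g by (simp add: wact_iff)
 show "y = z" if "(f, y) \<in> wact g \<gamma>" "(f, z) \<in> wact g \<gamma>" for f y z using that W(5) by (auto simp: wact_iff)
qed

private lemma raw_W: "raw_presheaf C (W Y) wact"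
 unfolding raw_presheaf_def
proof (intro conjI ballI impI)
 fix A \<gamma> assume A: "A \<in> Ob C" and \<gamma>: "\<gamma> \<in> W Y A"
 have "(f, y) \<in> wact (Idt C A) \<gamma> \<longleftrightarrow> (f, y) \<in> \<gamma>" for f y
 proof -
  have "Idt C A \<cdot> f = f" if "f \<in> Ar C" "cod f = A" using that by simp
  thus ?thesis using WD(1,2)[OF \<gamma>, of f y] unfolding wact_iff Idt_simps(2)[OF A] by metis
 qed
 thus "wact (Idt C A) \<gamma> = \<gamma>" by (simp add: set_eq_iff)
next
 fix f g \<gamma> assume "f \<in> Ar C" "g \<in> Ar C" "cod g = dom f" "\<gamma> \<in> W Y (cod f)"
 thus "wact (f \<cdot> g) \<gamma> = wact g (wact f \<gamma>)"
  by (simp add: set_eq_iff wact_iff cong: conj_cong)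
qed (rule wact_W)

private lemma small_W: "A \<in> Ob C ==> small TYPE('u) (W Y A)"
proof (rule small_subset)
 have "small TYPE('u) (Sigma (Ar C) (\<lambda>f. FO Y (dom f)))" by (intro small_Sigma[OF univ] small_Ar small_FO[OF Y]) auto
 thus "small TYPE('u) (Pow (Sigma (Ar C) (\<lambda>f. FO Y (dom f))))" by (rule small_Pow[OF univ])
 show "W Y A \<subseteq> Pow (Sigma (Ar C) (\<lambda>f. FO Y (dom f)))" using WD(1,3) by fastforce
qed

private lemma W_Id: "f \<in> Ar C ==> (Idt C (dom f), y) \<in> wact f \<gamma> \<longleftrightarrow> (f, y) \<in> \<gamma>"
 by (simp add: wact_iff)

private lemma W_separated:
 assumes \<gamma>: "\<gamma> \<in> W Y A" "\<delta> \<in> W Y A" and T: "cov A T" and eq: "\<And>f. f \<in> T ==> wact f \<gamma> = wact f \<delta>"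
 shows "\<gamma> \<subseteq> \<delta>"
proof (intro subrelI)
 fix f y assume fy: "(f, y) \<in> \<gamma>"
 note W = WD[OF \<gamma>(1)]
 show "(f, y) \<in> \<delta>"
 proof (rule W_local[OF Y \<gamma>(2) W(1-3)[OF fy] covering_pull[OF T W(1,2)[OF fy]]])
  fix g assume "g \<in> pull T f"
  hence g: "g \<in> Ar C" "cod g = dom f" "f \<cdot> g \<in> T" by (auto simp: pull_def)
  thus "(f \<cdot> g, res Y g y) \<in> \<delta>"
   using W(4)[OF fy g(1,2)] W_Id[of "f \<cdot> g" _ \<gamma>] W_Id[of "f \<cdot> g" _ \<delta>] eq[OF g(3)] W(1)[OF fy] by simp
 qed
qed

private lemma W_glue:
 assumes T: "cov A T" and R: "\<And>f. f \<in> T ==> R f \<in> W Y (dom f)"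
  and match: "\<And>f g. f \<in> T ==> g \<in> Ar C ==> cod g = dom f ==> R (f \<cdot> g) = wact g (R f)"
 shows "\<exists>\<gamma>\<in>W Y A. \<forall>f\<in>T. wact f \<gamma> = R f"
proof -
 note tD = sieveD[OF covering_sieve_sieve[OF T]]
 \<comment> \<open>The domain of the glued section must be a closure of principal sieves of M-maps
   (\<open>local_closure_W\<close>), while arrows of \<open>T\<close> need not be in M. The data are
   therefore first restricted to the sieve generated by an M-cover inside \<open>T\<close>.\<close>
 obtain B where B: "basic_cover C M A B" "B \<subseteq> T" using T unfolding covering_sieve_def by blast
 have BM: "b \<in> M" "cod b = A" "b \<in> T" if "b \<in> B" for b using basic_cover_M[OF B(1)] B(2) that by auto
 define S where "S = (\<Union>b\<in>B. factors b)"
 have S: "cov A S" unfolding S_def by (rule covering_generated[OF B(1)])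
 note sD = sieveD[OF covering_sieve_sieve[OF S]]
 have ST: "f \<in> T" if "f \<in> S" for f using that BM tD(3) by (auto simp: S_def factors_def)
 \<comment> \<open>The value at \<open>h\<close> is the value of the prescribed section
   \<open>R h\<close> at the identity.\<close>
 define \<gamma> where "\<gamma> = {(h, y). h \<in> S \<and> (Idt C (dom h), y) \<in> R h}"
 have \<gamma>_iff: "(f \<cdot> g, y) \<in> \<gamma> \<longleftrightarrow> f \<cdot> g \<in> S \<and> (g, y) \<in> R f" if "f \<in> T" "g \<in> Ar C" "cod g = dom f" for f g y
  using match[OF that] W_Id[OF that(2)] tD(1)[OF that(1)] that unfolding \<gamma>_def by simp
 have "\<exists>m. m \<in> M \<and> cod m = dom b \<and> Domain (R b) = factors m" if "b \<in> B" for b using WD(6)[OF R[OF BM(3)[OF that]]] by blast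
 then obtain m where m: "\<And>b. b \<in> B ==> m b \<in> M \<and> cod (m b) = dom b \<and> Domain (R b) = factors (m b)" by metis
 have W: "local_closure Y A \<gamma> \<in> W Y A"
 proof (rule local_closure_W[OF Y covering_Ob[OF T], of "(\<lambda>b. b \<cdot> m b) ` B"])
  show "(\<lambda>b. b \<cdot> m b) ` B \<subseteq> {n \<in> M. cod n = A}" using m BM by auto
  have dom: "h \<in> Domain \<gamma> \<longleftrightarrow> (\<exists>b\<in>B. \<exists>g\<in>factors (m b). h = b \<cdot> g)" for h
  proof -
   have "b \<cdot> g \<in> Domain \<gamma> \<longleftrightarrow> g \<in> factors (m b)" if "b \<in> B" "g \<in> Ar C" "cod g = dom b" for b g
   proof -
    have "b \<cdot> g \<in> S" using that by (auto simp: S_def factors_def)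
    thus ?thesis using \<gamma>_iff[OF BM(3) that(2,3)] m that(1) by blast
   qed
   moreover have "\<exists>b\<in>B. \<exists>g\<in>Ar C. cod g = dom b \<and> h = b \<cdot> g" if "h \<in> Domain \<gamma>" using that by (auto simp: \<gamma>_def S_def factors_def)
   moreover have "g \<in> Ar C \<and> cod g = dom b" if "b \<in> B" "g \<in> factors (m b)" for b g using m that by (auto simp: factors_def)
   ultimately show ?thesis by blast
  qed
  have "h \<in> factors (b \<cdot> m b) \<longleftrightarrow> (\<exists>g\<in>factors (m b). h = b \<cdot> g)" if "b \<in> B" for b h
  proof -
   have "b \<in> Ar C" "m b \<in> Ar C" "cod (m b) = dom b" using m[OF that] BM[OF that] by auto
   thus ?thesis by (auto simp: factors_def)
  qed
  thus "Domain \<gamma> = (\<Union>n\<in>(\<lambda>b. b \<cdot> m b) ` B. factors n)" unfolding set_eq_iff dom by simp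
  show "y \<in> FO Y (dom f)" if "(f, y) \<in> \<gamma>" for f y using WD(3)[OF R[OF ST]] that sD(1) by (fastforce simp: \<gamma>_def)
  show "y = z" if "(f, y) \<in> \<gamma>" "(f, z) \<in> \<gamma>" for f y z using WD(5)[OF R[OF ST]] that by (auto simp: \<gamma>_def)
  fix f y g assume "(f, y) \<in> \<gamma>" and g: "g \<in> Ar C" "cod g = dom f"
  hence f: "f \<in> S" "(Idt C (dom f), y) \<in> R f" by (auto simp: \<gamma>_def)
  show "(f \<cdot> g, res Y g y) \<in> \<gamma>" using WD(4)[OF R[OF ST[OF f(1)]] f(2) g(1)] \<gamma>_iff[OF ST[OF f(1)] g] sD(1,3)[OF f(1)] g by simp
 qed
 moreover have "wact f (local_closure Y A \<gamma>) = R f" if f: "f \<in> T" for f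
 proof (intro subset_antisym subrelI)
  fix g y assume "(g, y) \<in> wact f (local_closure Y A \<gamma>)"
  hence g: "g \<in> Ar C" "cod g = dom f" "y \<in> FO Y (dom g)" and L: "cov (dom g) (local_at Y \<gamma> (f \<cdot> g) y)"
   using tD(1)[OF f] by (auto simp: wact_iff local_closure_def)
  show "(g, y) \<in> R f"
  proof (rule W_local[OF Y R[OF f] g L])
   fix k assume "k \<in> local_at Y \<gamma> (f \<cdot> g) y"
   thus "(g \<cdot> k, res Y k y) \<in> R f" using \<gamma>_iff[OF f, of "g \<cdot> k"] g tD(1)[OF f] by (auto simp: local_at_def)
  qed
 next
  fix g y assume gy: "(g, y) \<in> R f"
  note g = WD(1-3)[OF R[OF f] gy]
  have "local_at Y \<gamma> (f \<cdot> g) y = pull S (f \<cdot> g)"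
   using \<gamma>_iff[OF f] WD(4)[OF R[OF f] gy] g tD(1)[OF f] by (auto simp: local_at_def pull_def)
  thus "(g, y) \<in> wact f (local_closure Y A \<gamma>)"
   using covering_pull[OF S, of "f \<cdot> g"] g tD(1,2)[OF f] by (simp add: wact_iff local_closure_def)
 qed
 ultimately show ?thesis by blast
qed

private lemma sheaf_W: "raw_sheaf C M (W Y) wact"
 unfolding raw_sheaf_def
proof (intro conjI ballI allI impI, goal_cases)
 case (1 A S x)
 show ?case by (rule W_glue) (use 1 in blast)+
next
 case (2 A S a b)
 have eq: "wact f a = wact f b" if "f \<in> S" for f using 2(5) that by blast
 show ?case using W_separated[OF 2(3,4,2) eq] W_separated[OF 2(4,3,2) eq[symmetric]] by blast
qed

private lemma wact_fib:
 "Q \<in> Ob E ==> g \<in> Ar C ==> x \<in> FO Q (cod g) ==> wact g (fib Q \<gamma> (cod g) x) = fib Q \<gamma> (dom g) (res Q g x)"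
 by (simp add: set_eq_iff wact_iff fib_iff cong: conj_cong)

text \<open>A partial map is sent to the map \<open>x \<mapsto> fib x\<close> into
  \<open>W Y\<close>, which is natural by \<open>wact_fib\<close>. Conversely, the values at
  identity arrows of a map into \<open>W Y\<close> form a partial graph, which is represented by a
  span.\<close>

lemma partial_map_classifier: "right_adjoint_at E (Par E \<N>) (Par_inclusion E \<N>) Y"
proof -
 \<comment> \<open>A representing span is chosen for each partial map; only its graph is used, and
   that does not depend on the choice.\<close>
 define rep where "rep Q d = (SOME s. s \<in> \<H> Q Y \<and> d = partial_map E \<N> s)" for Q d
 have rep: "rep Q d \<in> \<H> Q Y" "partial_map E \<N> (rep Q d) = d" if "d \<in> Hom (Par E \<N>) Q Y" for Q d
 proof -
  have "\<exists>s. s \<in> \<H> Q Y \<and> d = partial_map E \<N> s" using ME.Par_HomE[OF that] by metis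
  from someI_ex[OF this] show "rep Q d \<in> \<H> Q Y" "partial_map E \<N> (rep Q d) = d" by (simp_all add: rep_def)
 qed
 have pm: "partial_map E \<N> s \<in> Hom (Par E \<N>) Q Y" "A \<in> Ob C ==> graph (rep Q (partial_map E \<N> s)) A = graph s A" if s: "s \<in> \<H> Q Y" for Q s A
 proof -
  show h: "partial_map E \<N> s \<in> Hom (Par E \<N>) Q Y" using ME.Par_Hom[of "fst s" "snd s"] s by simp
  show "A \<in> Ob C ==> graph (rep Q (partial_map E \<N> s)) A = graph s A"
   using partial_map_eq_graph[OF rep(1)[OF h] s] rep(2)[OF h] by blast
 qed
 let ?I = "Par_inclusion E \<N>"
 show ?thesis
 proof (rule realize_right_adjoint[OF raw_W small_W sheaf_W ME.cat_functor_Par_inclusion, where \<nu> = "\<lambda>Q d. fib Q (graph (rep Q d))"])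
  fix Q d assume Q: "Q \<in> Ob E" and "d \<in> Hom (Par E \<N>) (FO ?I Q) Y"
  hence d: "d \<in> Hom (Par E \<N>) Q Y" by (simp add: ME.Par_inclusion_simps)
  note G = partial_graph_graph[OF rep(1)[OF d]]
  show "raw_map C (FO Q) (res Q) (W Y) wact (fib Q (graph (rep Q d)))"
   by (rule raw_mapI) (use G wact_fib[OF Q] in \<open>simp_all add: partial_graph_def\<close>)
  fix e assume "e \<in> Hom (Par E \<N>) (FO ?I Q) Y"
   and eq: "\<And>A x. A \<in> Ob C ==> x \<in> FO Q A ==> fib Q (graph (rep Q d)) A x = fib Q (graph (rep Q e)) A x"
  hence e: "e \<in> Hom (Par E \<N>) Q Y" using Q by (simp add: ME.Par_inclusion_simps)
  note H = partial_graph_graph[OF rep(1)[OF e]]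
  have "(x, y) \<in> graph (rep Q d) A \<longleftrightarrow> (x, y) \<in> graph (rep Q e) A" if A: "A \<in> Ob C" for A x y
   using fib_Id[OF Q A, of x y "graph (rep Q d)"] fib_Id[OF Q A, of x y "graph (rep Q e)"] eq[OF A, of x]
    partial_graphD(1)[OF G Q A] partial_graphD(1)[OF H Q A] by blast
  thus "d = e" using partial_map_eq_graph[OF rep(1)[OF d] rep(1)[OF e]] rep(2)[OF d] rep(2)[OF e] by (simp add: set_eq_iff)
 next
  fix Q D assume Q: "Q \<in> Ob E" and "raw_map C (FO Q) (res Q) (W Y) wact D"
  hence D: "\<And>A x. A \<in> Ob C ==> x \<in> FO Q A ==> D A x \<in> W Y A"
   and D_res: "\<And>f x. f \<in> Ar C ==> x \<in> FO Q (cod f) ==> D (dom f) (res Q f x) = wact f (D (cod f) x)"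
   by (simp_all add: raw_map_def)
  define \<gamma> where "\<gamma> A = {(x, y). x \<in> FO Q A \<and> (Idt C A, y) \<in> D A x}" for A
  have fib: "fib Q \<gamma> A x = D A x" if A: "A \<in> Ob C" and x: "x \<in> FO Q A" for A x
  proof (intro subset_antisym subrelI)
   fix f y
   have iff: "(f, y) \<in> fib Q \<gamma> A x \<longleftrightarrow> (f, y) \<in> D A x" if "f \<in> Ar C" "cod f = A"
    using D_res[of f x] W_Id[OF that(1), of y "D A x"] that x Q by (simp add: \<gamma>_def fib_iff)
   thus "(f, y) \<in> D A x" if "(f, y) \<in> fib Q \<gamma> A x" using that by (auto simp: fib_iff)
   show "(f, y) \<in> fib Q \<gamma> A x" if "(f, y) \<in> D A x" using iff WD(1,2)[OF D[OF A x] that] that by blast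
  qed
  have "partial_graph Q Y \<gamma>" unfolding partial_graph_def using fib D by (auto simp: \<gamma>_def)
  then obtain s where s: "s \<in> \<H> Q Y" "\<And>A. A \<in> Ob C ==> graph s A = \<gamma> A" by (rule partial_graph_span[OF Q Y]) (rule that)
  have "fib Q (graph (rep Q (partial_map E \<N> s))) A x = D A x" if A: "A \<in> Ob C" "x \<in> FO Q A" for A x
   using s(2)[OF Dom_in] pm(2)[OF s(1) Dom_in] unfolding fib[OF A, symmetric] fib_def by auto
  thus "\<exists>d\<in>Hom (Par E \<N>) (FO ?I Q) Y. \<forall>A\<in>Ob C. \<forall>x\<in>FO Q A. fib Q (graph (rep Q d)) A x = D A x"
   using pm(1)[OF s(1)] Q by (auto simp: ME.Par_inclusion_simps)
 next
  fix t d A z assume t: "t \<in> Ar E" and "d \<in> Hom (Par E \<N>) (FO ?I (Cod E t)) Y" and A: "A \<in> Ob C" and z: "z \<in> FO (Dom E t) A"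
  hence d: "d \<in> Hom (Par E \<N>) (Cod E t) Y" by (simp add: ME.Par_inclusion_simps)
  obtain m f where mf: "rep (Cod E t) d = (m, f)" by fastforce
  note s = rep(1)[OF d, unfolded mf] and ds = rep(2)[OF d, unfolded mf]
  note sD = \<H>D[OF s, simplified]
  obtain b n where pb: "pullback E m t b n" and n: "n \<in> \<N>" using ME.pullback_exists[OF sD(1) t] sD by metis
  note D = E.pullbackD[OF pb]
  have nf: "(n, f \<cdot>[E] b) \<in> \<H> (Dom E t) Y" using n D sD by (simp add: hom_spans_iff)
  have dt: "d \<cdot>[Par E \<N>] FA ?I t = partial_map E \<N> (n, f \<cdot>[E] b)"
   using ME.Par_comp_total[OF _ t _ pb, of f] sD t ds by (simp add: ME.Par_inclusion_simps spans_iff)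
  have "(k, y) \<in> fib (Dom E t) (graph (rep (Dom E t) (d \<cdot>[Par E \<N>] FA ?I t))) A z \<longleftrightarrow> (k, y) \<in> fib (Cod E t) (graph (rep (Cod E t) d)) A (app t A z)" for k y
   using graph_precomp[OF s pb Dom_in] pm(2)[OF nf Dom_in] app_nat[OF t, of k z] z t unfolding dt mf by (auto simp: fib_iff)
  thus "fib (Dom E t) (graph (rep (Dom E t) (d \<cdot>[Par E \<N>] FA ?I t))) A z = fib (Cod E t) (graph (rep (Cod E t) d)) A (app t A z)"
   by (simp add: set_eq_iff)
 qed
qed

end

lemma cocomplete_mcategory_E: "cocomplete_mcategory TYPE('u) E \<N>"
 unfolding cocomplete_mcategory_def
proof (intro conjI mcategory_E cocomplete_E)
 show "preserves_colimits TYPE('u) E (Par E \<N>) (Par_inclusion E \<N>)"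
  unfolding preserves_colimits_def
  by (intro allI impI, elim conjE) (rule relative_adjoint_colimit[OF ME.cat_functor_Par_inclusion _ _ partial_map_classifier], simp_all)
qed

end

section \<open>Colimits over categories of elements, and density of \<open>ay\<close>\<close>

section \<open>Categories of elements\<close>

text \<open>Index categories of colimits have objects and arrows in \<open>'u\<close>, so pairs of
  an arrow and an element must be coded there; such an injection exists because \<open>'u\<close> is
  infinite.\<close>

definition code :: "'u \<times> 'u \<Rightarrow> 'u" where
 "code = (SOME f. inj f)"

context site
begin

lemma inj_code: "inj (code :: 'u \<times> 'u \<Rightarrow> 'u)"
proof -
 have "infinite (UNIV :: 'u set)" using univ by (simp add: universe_def)
 from card_of_Times_same_infinite[OF this]
 obtain f :: "'u \<times> 'u \<Rightarrow> 'u" where "bij_betw f (UNIV \<times> UNIV) UNIV" unfolding card_of_ordIso[symmetric] by blast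
 hence "inj f" by (simp add: bij_betw_def)
 thus ?thesis unfolding code_def by (rule someI[where P = inj])
qed

lemma code_eq [simp]: "code p = code q \<longleftrightarrow> p = (q :: 'u \<times> 'u)"
 by (rule inj_eq[OF inj_code])

lemma dec_code [simp]: "inv code (code p) = (p :: 'u \<times> 'u)"
 by (rule inv_f_f[OF inj_code])

text \<open>The category of elements of a presheaf \<open>V\<close>: the element \<open>x\<close> of \<open>V A\<close> is coded, together with
 \<open>A\<close>, as its identity arrow \<open>(1\<^sub>A, x)\<close>, since index categories of colimits have objects and
 arrows in \<open>'u\<close>.\<close>

definition El :: "('o \<Rightarrow> 'u set) \<Rightarrow> ('u \<Rightarrow> 'u \<Rightarrow> 'u) \<Rightarrow> ('u, 'u) cat" where
 "El V act =
   \<lparr>Ob = {code (Idt C A, x) | A x. A \<in> Ob C \<and> x \<in> V A},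
   Ar = {code (f, x) | f x. f \<in> Ar C \<and> x \<in> V (cod f)},
   Dom = (\<lambda>a. case inv code a of (f, x) \<Rightarrow> code (Idt C (dom f), act f x)),
   Cod = (\<lambda>a. case inv code a of (f, x) \<Rightarrow> code (Idt C (cod f), x)),
   Idt = (\<lambda>j. j),
   Cmp = (\<lambda>b a. code (fst (inv code b) \<cdot> fst (inv code a), snd (inv code b)))\<rparr>"

definition El_proj :: "('o \<Rightarrow> 'u set) \<Rightarrow> ('u \<Rightarrow> 'u \<Rightarrow> 'u) \<Rightarrow> ('u, 'u, 'o, 'u) ftor" where
 "El_proj V act =
   \<lparr>FO = (\<lambda>j\<in>Ob (El V act). dom (fst (inv code j))), FA = (\<lambda>a\<in>Ar (El V act). fst (inv code a))\<rparr>"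

lemma El_simps [simp]:
 "Dom (El V act) (code (f, x)) = code (Idt C (dom f), act f x)"
 "Cod (El V act) (code (f, x)) = code (Idt C (cod f), x)"
 "Idt (El V act) j = j"
 "code (f, x) \<cdot>[El V act] code (g, z) = code (f \<cdot> g, x)"
 "code (f, x) \<in> Ar (El V act) \<longleftrightarrow> f \<in> Ar C \<and> x \<in> V (cod f)"
 "A \<in> Ob C ==> code (Idt C A, x) \<in> Ob (El V act) \<longleftrightarrow> x \<in> V A"
 "A \<in> Ob C ==> x \<in> V A ==> FO (El_proj V act) (code (Idt C A, x)) = A"
 "f \<in> Ar C ==> x \<in> V (cod f) ==> FA (El_proj V act) (code (f, x)) = f"
proof -
 show "code (Idt C A, x) \<in> Ob (El V act) \<longleftrightarrow> x \<in> V A" if "A \<in> Ob C"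
 proof
  assume "code (Idt C A, x) \<in> Ob (El V act)"
  then obtain B where B: "B \<in> Ob C" "Idt C A = Idt C B" "x \<in> V B" by (auto simp: El_def)
  hence "A = B" using Idt_simps(2) that by metis
  thus "x \<in> V A" using B by simp
 qed (use that in \<open>auto simp: El_def\<close>)
 thus "FO (El_proj V act) (code (Idt C A, x)) = A" if "A \<in> Ob C" "x \<in> V A"
  using that by (simp add: El_proj_def)
qed (auto simp: El_def El_proj_def)

lemma El_ObE:
 assumes "j \<in> Ob (El V act)" obtains A x where "A \<in> Ob C" "x \<in> V A" "j = code (Idt C A, x)"
 using assms by (auto simp: El_def)

lemma El_ArE:
 assumes "a \<in> Ar (El V act)" obtains f x where "f \<in> Ar C" "x \<in> V (cod f)" "a = code (f, x)"
 using assms by (auto simp: El_def)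

text \<open>\<open>X\<close> is the colimit of \<open>F\<close> weighted by the presheaf
  \<open>V\<close>. The injections are indexed by pairs \<open>(A, x)\<close>, which hides the
  coding from everything that follows.\<close>

definition El_colimit :: "('p, 'd) cat \<Rightarrow> ('o, 'u, 'p, 'd) ftor \<Rightarrow> ('o \<Rightarrow> 'u set) \<Rightarrow> ('u \<Rightarrow> 'u \<Rightarrow> 'u) \<Rightarrow>
  'p \<Rightarrow> ('o \<Rightarrow> 'u \<Rightarrow> 'd) \<Rightarrow> bool" where
 "El_colimit D F V act X \<iota> \<longleftrightarrow> colimit (El V act) D (comp_functor (El V act) F (El_proj V act)) X
   (\<lambda>j. \<iota> (dom (fst (inv code j))) (snd (inv code j)))"

context
 fixes V :: "'o \<Rightarrow> 'u set" and act :: "'u \<Rightarrow> 'u \<Rightarrow> 'u"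
 assumes V: "raw_presheaf C V act" and small_V: "\<forall>A\<in>Ob C. small TYPE('u) (V A)"
begin

lemma small_category_El: "small_category TYPE('u) (El V act)"
 unfolding small_category_def
proof (intro conjI)
 have "Ob (El V act) = (\<lambda>(A, x). code (Idt C A, x)) ` Sigma (Ob C) V" by (auto simp: El_def)
 thus "small TYPE('u) (Ob (El V act))" by (simp add: small_image small_Sigma[OF univ small_Ob] small_V)
 have "Ar (El V act) = code ` Sigma (Ar C) (\<lambda>f. V (cod f))" by (auto simp: El_def)
 thus "small TYPE('u) (Ar (El V act))" by (simp add: small_image small_Sigma[OF univ small_Ar] small_V)
 show "category (El V act)"
 proof
  fix f g h X Y Z W
  show "Dom (El V act) f \<in> Ob (El V act)" "Cod (El V act) f \<in> Ob (El V act)"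
   "f \<cdot>[El V act] Idt (El V act) (Dom (El V act) f) = f"
   "Idt (El V act) (Cod (El V act) f) \<cdot>[El V act] f = f" if "f \<in> Ar (El V act)"
   using that by (auto elim!: El_ArE simp: raw_presheafD(1)[OF V])
  show "Idt (El V act) X \<in> Hom (El V act) X X" if "X \<in> Ob (El V act)"
   using that by (auto elim!: El_ObE simp: Hom_iff raw_presheafD(2)[OF V])
  have Id: "A = B" if "Idt C A = Idt C B" "A \<in> Ob C" "B \<in> Ob C" for A B
   using that Idt_simps(2) by metis
  assume "f \<in> Hom (El V act) X Y" "g \<in> Hom (El V act) Y Z"
  hence fg: "f \<in> Ar (El V act)" "g \<in> Ar (El V act)" "Cod (El V act) f = Dom (El V act) g"
   "Dom (El V act) f = X" "Cod (El V act) g = Z" by (auto simp: Hom_iff)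
  obtain f' x where f: "f' \<in> Ar C" "x \<in> V (cod f')" "f = code (f', x)" using El_ArE[OF fg(1)] by blast
  obtain g' y where g: "g' \<in> Ar C" "y \<in> V (cod g')" "g = code (g', y)" using El_ArE[OF fg(2)] by blast
  have c: "cod f' = dom g'" "x = act g' y" using fg(3) f g Id by auto
  have "act (g' \<cdot> f') y = act f' (act g' y)" using raw_presheafD(3)[OF V] f g c by simp
  thus "g \<cdot>[El V act] f \<in> Hom (El V act) X Z" using fg(4,5) f g c by (auto simp: Hom_iff)
  assume "h \<in> Hom (El V act) Z W"
  hence h': "h \<in> Ar (El V act)" "Cod (El V act) g = Dom (El V act) h" using fg(5) by (auto simp: Hom_iff)
  obtain k z where h: "k \<in> Ar C" "z \<in> V (cod k)" "h = code (k, z)" using El_ArE[OF h'(1)] by blast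
  have "cod g' = dom k" using h'(2) g h Id by auto
  thus "h \<cdot>[El V act] (g \<cdot>[El V act] f) = (h \<cdot>[El V act] g) \<cdot>[El V act] f"
   using f g h c by simp
 qed
qed

lemma cat_functor_El_proj: "cat_functor (El V act) C (El_proj V act)"
proof (rule cat_functorI)
 show "category (El V act)" using small_category_El by (simp add: small_category_def)
 show "FO (El_proj V act) \<in> extensional (Ob (El V act))" "FA (El_proj V act) \<in> extensional (Ar (El V act))"
  by (simp_all add: El_proj_def)
 fix a b assume ab: "a \<in> Ar (El V act)" "b \<in> Ar (El V act)" "Cod (El V act) a = Dom (El V act) b"
 obtain f x where f: "f \<in> Ar C" "x \<in> V (cod f)" "a = code (f, x)" using El_ArE[OF ab(1)] by blast
 obtain g z where g: "g \<in> Ar C" "z \<in> V (cod g)" "b = code (g, z)" using El_ArE[OF ab(2)] by blast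
 have "Idt C (cod f) = Idt C (dom g)" using ab(3) f g by simp
 hence "cod f = dom g" using Idt_simps(2) f g by (metis Cod_in Dom_in)
 thus "FA (El_proj V act) (b \<cdot>[El V act] a) = FA (El_proj V act) b \<cdot> FA (El_proj V act) a"
  using f g by simp
qed (auto elim!: El_ObE El_ArE simp: category_axioms raw_presheafD(1)[OF V])

lemma El_colimitD:
 assumes "El_colimit D F V act X \<iota>"
 shows "X \<in> Ob D"
  "A \<in> Ob C ==> x \<in> V A ==> \<iota> A x \<in> Ar D"
  "A \<in> Ob C ==> x \<in> V A ==> Dom D (\<iota> A x) = FO F A"
  "A \<in> Ob C ==> x \<in> V A ==> Cod D (\<iota> A x) = X"
  "f \<in> Ar C ==> x \<in> V (cod f) ==> \<iota> (cod f) x \<cdot>[D] FA F f = \<iota> (dom f) (act f x)"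
 using colimitD[OF assms[unfolded El_colimit_def]] colimitD(2-4)[OF assms[unfolded El_colimit_def], of "code (Idt C A, x)"]
  colimitD(5)[OF assms[unfolded El_colimit_def], of "code (f, x)"] raw_presheafD(1)[OF V] by simp_all

lemma El_colimit_lift:
 assumes "El_colimit D F V act X \<iota>" "Y \<in> Ob D"
  "\<And>A x. A \<in> Ob C ==> x \<in> V A ==> d A x \<in> Ar D \<and> Dom D (d A x) = FO F A \<and> Cod D (d A x) = Y"
  "\<And>f x. f \<in> Ar C ==> x \<in> V (cod f) ==> d (cod f) x \<cdot>[D] FA F f = d (dom f) (act f x)"
 obtains u where "u \<in> Ar D" "Dom D u = X" "Cod D u = Y" "\<And>A x. A \<in> Ob C ==> x \<in> V A ==> u \<cdot>[D] \<iota> A x = d A x"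
proof (rule colimit_lift[OF assms(1)[unfolded El_colimit_def] assms(2)])
 fix u
 assume u: "u \<in> Ar D" "Dom D u = X" "Cod D u = Y"
  "\<And>j. j \<in> Ob (El V act) ==> u \<cdot>[D] \<iota> (dom (fst (inv code j))) (snd (inv code j)) = d (dom (fst (inv code j))) (snd (inv code j))"
 have "u \<cdot>[D] \<iota> A x = d A x" if "A \<in> Ob C" "x \<in> V A" for A x using u(4)[of "code (Idt C A, x)"] that by simp
 thus thesis using u(1-3) that by blast
qed (use assms(3,4) raw_presheafD(1)[OF V] in \<open>auto elim!: El_ObE El_ArE\<close>)

lemma El_colimit_unique:
 assumes "cat_functor C D F" "El_colimit D F V act X \<iota>"
  "u \<in> Ar D" "v \<in> Ar D" "Dom D u = X" "Dom D v = X" "Cod D u = Cod D v"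
  "\<And>A x. A \<in> Ob C ==> x \<in> V A ==> u \<cdot>[D] \<iota> A x = v \<cdot>[D] \<iota> A x"
 shows "u = v"
proof (rule colimit_unique[OF cat_functor.axioms(2)[OF assms(1)] cat_functor.axioms(1)[OF cat_functor_El_proj]
   cat_functor_comp[OF cat_functor_El_proj assms(1)] assms(2)[unfolded El_colimit_def] assms(3-7)])
 fix j assume "j \<in> Ob (El V act)"
 thus "u \<cdot>[D] \<iota> (dom (fst (inv code j))) (snd (inv code j)) = v \<cdot>[D] \<iota> (dom (fst (inv code j))) (snd (inv code j))"
  by (rule El_ObE) (use assms(8) in simp)
qed

lemma El_colimitI:
 assumes X: "X \<in> Ob D"
  and \<iota>: "\<And>A x. A \<in> Ob C ==> x \<in> V A ==> \<iota> A x \<in> Ar D \<and> Dom D (\<iota> A x) = FO F A \<and> Cod D (\<iota> A x) = X"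
   "\<And>f x. f \<in> Ar C ==> x \<in> V (cod f) ==> \<iota> (cod f) x \<cdot>[D] FA F f = \<iota> (dom f) (act f x)"
  and ex: "\<And>Y d. Y \<in> Ob D ==>
   (\<And>A x. A \<in> Ob C ==> x \<in> V A ==> d A x \<in> Ar D \<and> Dom D (d A x) = FO F A \<and> Cod D (d A x) = Y) ==>
   (\<And>f x. f \<in> Ar C ==> x \<in> V (cod f) ==> d (cod f) x \<cdot>[D] FA F f = d (dom f) (act f x)) ==>
   \<exists>u\<in>Ar D. Dom D u = X \<and> Cod D u = Y \<and> (\<forall>A\<in>Ob C. \<forall>x\<in>V A. u \<cdot>[D] \<iota> A x = d A x)"
  and un: "\<And>u v. u \<in> Ar D ==> v \<in> Ar D ==> Dom D u = X ==> Dom D v = X ==> Cod D u = Cod D v ==>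
   (\<And>A x. A \<in> Ob C ==> x \<in> V A ==> u \<cdot>[D] \<iota> A x = v \<cdot>[D] \<iota> A x) ==> u = v"
 shows "El_colimit D F V act X \<iota>"
 unfolding El_colimit_def
proof (rule colimitI[OF X])
 fix Y d
 let ?J = "El V act"
 assume Y: "Y \<in> Ob D" and d: "\<And>j. j \<in> Ob ?J ==> d j \<in> Ar D \<and> Dom D (d j) = FO (comp_functor ?J F (El_proj V act)) j \<and> Cod D (d j) = Y"
  and dc: "\<And>a. a \<in> Ar ?J ==> d (Cod ?J a) \<cdot>[D] FA (comp_functor ?J F (El_proj V act)) a = d (Dom ?J a)"
 have "\<exists>u\<in>Ar D. Dom D u = X \<and> Cod D u = Y \<and> (\<forall>A\<in>Ob C. \<forall>x\<in>V A. u \<cdot>[D] \<iota> A x = d (code (Idt C A, x)))"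
 proof (rule ex[OF Y])
  fix A x assume "A \<in> Ob C" "x \<in> V A"
  thus "d (code (Idt C A, x)) \<in> Ar D \<and> Dom D (d (code (Idt C A, x))) = FO F A \<and> Cod D (d (code (Idt C A, x))) = Y"
   using d[of "code (Idt C A, x)"] by simp
 next
  fix f x assume "f \<in> Ar C" "x \<in> V (cod f)"
  thus "d (code (Idt C (cod f), x)) \<cdot>[D] FA F f = d (code (Idt C (dom f), act f x))"
   using dc[of "code (f, x)"] by simp
 qed
 then obtain u where u: "u \<in> Ar D" "Dom D u = X" "Cod D u = Y"
  "\<And>A x. A \<in> Ob C ==> x \<in> V A ==> u \<cdot>[D] \<iota> A x = d (code (Idt C A, x))" by blast
 have "u \<cdot>[D] \<iota> (dom (fst (inv code j))) (snd (inv code j)) = d j" if "j \<in> Ob ?J" for j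
  by (rule El_ObE[OF that]) (use u(4) in simp)
 thus "\<exists>u\<in>Ar D. Dom D u = X \<and> Cod D u = Y \<and>
   (\<forall>j\<in>Ob ?J. u \<cdot>[D] \<iota> (dom (fst (inv code j))) (snd (inv code j)) = d j)" using u(1-3) by blast
next
 fix u v assume uv: "u \<in> Ar D" "v \<in> Ar D" "Dom D u = X" "Dom D v = X" "Cod D u = Cod D v"
  and eq: "\<And>j. j \<in> Ob (El V act) ==> u \<cdot>[D] \<iota> (dom (fst (inv code j))) (snd (inv code j)) =
   v \<cdot>[D] \<iota> (dom (fst (inv code j))) (snd (inv code j))"
 show "u = v"
 proof (rule un[OF uv])
  fix A x assume "A \<in> Ob C" "x \<in> V A"
  thus "u \<cdot>[D] \<iota> A x = v \<cdot>[D] \<iota> A x" using eq[of "code (Idt C A, x)"] by simp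
 qed
qed (use \<iota> raw_presheafD(1)[OF V] in \<open>auto elim!: El_ObE El_ArE\<close>)

lemma El_colimit_exists:
 assumes "cocomplete TYPE('u) D" "cat_functor C D F"
 obtains X \<iota> where "El_colimit D F V act X \<iota>"
proof -
 obtain X c where c: "colimit (El V act) D (comp_functor (El V act) F (El_proj V act)) X c"
  using assms small_category_El cat_functor_comp[OF cat_functor_El_proj assms(2)] unfolding cocomplete_def by blast
 let ?F = "comp_functor (El V act) F (El_proj V act)"
 \<comment> \<open>The given cocone is re-indexed by pairs. The two families agree on the objects of
   the index category, and a colimit depends on no other indices.\<close>
 have "colimit (El V act) D ?F X (\<lambda>j. (\<lambda>A x. c (code (Idt C A, x))) (dom (fst (inv code j))) (snd (inv code j)))"
 proof -
  have e: "c (code (Idt C (dom (fst (inv code j))), snd (inv code j))) = c j" if "j \<in> Ob (El V act)" for j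
   by (rule El_ObE[OF that]) simp
  have "category (El V act)" using small_category_El by (simp add: small_category_def)
  note e = e e[OF category.Dom_Ob[OF this]] e[OF category.Cod_Ob[OF this]]
  have "cocone (El V act) D ?F X' (\<lambda>j. c (code (Idt C (dom (fst (inv code j))), snd (inv code j)))) \<longleftrightarrow>
   cocone (El V act) D ?F X' c" for X' unfolding cocone_def using e by simp
  thus ?thesis using c e unfolding colimit_def by simp
 qed
 thus thesis by (intro that[of X "\<lambda>A x. c (code (Idt C A, x))"]) (simp add: El_colimit_def)
qed

lemma El_colimit_preserved:
 assumes G: "preserves_colimits TYPE('u) D P G" and F: "cat_functor C D F" and c: "El_colimit D F V act X \<iota>"
 shows "El_colimit P (comp_functor C G F) V act (FO G X) (\<lambda>A x. FA G (\<iota> A x))"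
proof -
 interpret p: cat_functor "El V act" C "El_proj V act" by (rule cat_functor_El_proj)
 have "comp_functor (El V act) G (comp_functor (El V act) F (El_proj V act)) =
  comp_functor (El V act) (comp_functor C G F) (El_proj V act)"
  unfolding comp_functor_def by (auto intro!: ext simp: restrict_def)
 thus ?thesis
  using G[unfolded preserves_colimits_def, rule_format, OF conjI, OF small_category_El conjI,
    OF cat_functor_comp[OF cat_functor_El_proj F] c[unfolded El_colimit_def]]
  unfolding El_colimit_def by simp
qed

text \<open>The hypotheses say that \<open>Q\<close> is the free sheaf on \<open>V\<close>. A cocone
  of maps out of the \<open>ay A\<close> with vertex \<open>P\<close> is, by evaluation at generic
  elements, a map from \<open>V\<close> to \<open>P\<close>. The cases of interest are
  \<open>V = Q\<close> and a covering sieve.\<close>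

lemma density:
 assumes Q: "Q \<in> Ob E" and \<eta>: "raw_map C V act (FO Q) (res Q) \<eta>"
  and ex: "\<And>P \<phi>. P \<in> Ob E ==> raw_map C V act (FO P) (res P) \<phi> ==>
   \<exists>t\<in>Ar E. Dom E t = Q \<and> Cod E t = P \<and> (\<forall>A\<in>Ob C. \<forall>x\<in>V A. app t A (\<eta> A x) = \<phi> A x)"
  and un: "\<And>s t. s \<in> Ar E ==> t \<in> Ar E ==> Dom E s = Q ==> Dom E t = Q ==> Cod E s = Cod E t ==>
   (\<And>A x. A \<in> Ob C ==> x \<in> V A ==> app s A (\<eta> A x) = app t A (\<eta> A x)) ==> s = t"
 shows "El_colimit E K V act Q (\<lambda>A x. pt Q A (\<eta> A x))"
proof (rule El_colimitI[OF Q])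
 have \<eta>1: "\<eta> A x \<in> FO Q A" if "A \<in> Ob C" "x \<in> V A" for A x using \<eta> that unfolding raw_map_def by blast
 have \<eta>2: "\<eta> (dom f) (act f x) = res Q f (\<eta> (cod f) x)" if "f \<in> Ar C" "x \<in> V (cod f)" for f x
  using \<eta> that unfolding raw_map_def by blast
 show "pt Q A (\<eta> A x) \<in> Ar E \<and> Dom E (pt Q A (\<eta> A x)) = FO K A \<and> Cod E (pt Q A (\<eta> A x)) = Q" if "A \<in> Ob C" "x \<in> V A" for A x
  using \<eta>1 Q that by simp
 show "pt Q (cod f) (\<eta> (cod f) x) \<cdot>[E] FA K f = pt Q (dom f) (\<eta> (dom f) (act f x))" if "f \<in> Ar C" "x \<in> V (cod f)" for f x
  using pt_res[OF Q that(1), of "\<eta> (cod f) x"] \<eta>1 \<eta>2 that by simp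
 have app_pt: "app (u \<cdot>[E] pt Q A (\<eta> A x)) A (ue A) = app u A (\<eta> A x)" if "u \<in> Ar E" "Dom E u = Q" "A \<in> Ob C" "x \<in> V A" for u A x
  using \<eta>1 that Q by simp
 fix P d assume P: "P \<in> Ob E"
  and d: "\<And>A x. A \<in> Ob C ==> x \<in> V A ==> d A x \<in> Ar E \<and> Dom E (d A x) = FO K A \<and> Cod E (d A x) = P"
  and dc: "\<And>f x. f \<in> Ar C ==> x \<in> V (cod f) ==> d (cod f) x \<cdot>[E] FA K f = d (dom f) (act f x)"
 have "raw_map C V act (FO P) (res P) (\<lambda>A x. app (d A x) A (ue A))"
 proof (rule raw_mapI)
  show "app (d A x) A (ue A) \<in> FO P A" if "A \<in> Ob C" "x \<in> V A" for A x
   using app_in[of "d A x" A "ue A"] d[OF that] that by simp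
  show "app (d (dom f) (act f x)) (dom f) (ue (dom f)) = res P f (app (d (cod f) x) (cod f) (ue (cod f)))"
   if f: "f \<in> Ar C" "x \<in> V (cod f)" for f x
  proof -
   have "app (d (cod f) x \<cdot>[E] FA K f) (dom f) (ue (dom f)) = res P f (app (d (cod f) x) (cod f) (ue (cod f)))"
    using app_nat[of "d (cod f) x" f "ue (cod f)"] d[of "cod f" x] f by simp
   thus ?thesis using dc[OF f] by simp
  qed
 qed
 from ex[OF P this] obtain t where t: "t \<in> Ar E" "Dom E t = Q" "Cod E t = P"
  "\<And>A x. A \<in> Ob C ==> x \<in> V A ==> app t A (\<eta> A x) = app (d A x) A (ue A)" by blast
 have "t \<cdot>[E] pt Q A (\<eta> A x) = d A x" if "A \<in> Ob C" "x \<in> V A" for A x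
  by (rule K_ext[OF that(1)]) (use t(1-3) t(4)[OF that] d[OF that] \<eta>1[OF that] that Q in simp_all)
 thus "\<exists>u\<in>Ar E. Dom E u = Q \<and> Cod E u = P \<and> (\<forall>A\<in>Ob C. \<forall>x\<in>V A. u \<cdot>[E] pt Q A (\<eta> A x) = d A x)"
  using t(1-3) by blast
next
 fix u v assume uv: "u \<in> Ar E" "v \<in> Ar E" "Dom E u = Q" "Dom E v = Q" "Cod E u = Cod E v"
  and eq: "\<And>A x. A \<in> Ob C ==> x \<in> V A ==> u \<cdot>[E] pt Q A (\<eta> A x) = v \<cdot>[E] pt Q A (\<eta> A x)"
 show "u = v"
 proof (rule un[OF uv])
  fix A x assume A: "A \<in> Ob C" "x \<in> V A"
  have "\<eta> A x \<in> FO Q A" using \<eta> A unfolding raw_map_def by blast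
  hence "app (w \<cdot>[E] pt Q A (\<eta> A x)) A (ue A) = app w A (\<eta> A x)" if "w \<in> Ar E" "Dom E w = Q" for w
   using A Q by simp
  from this[of u] this[of v] show "app u A (\<eta> A x) = app v A (\<eta> A x)" using eq[OF A] uv by simp
 qed
qed

end

lemma small_presheaf: "Q \<in> Ob E ==> \<forall>A\<in>Ob C. small TYPE('u) (FO Q A)"
 using small_FO by blast

lemma density_sheaf:
 assumes Q: "Q \<in> Ob E" shows "El_colimit E K (FO Q) (res Q) Q (pt Q)"
proof (rule density[OF raw_presheaf[OF Q] small_presheaf[OF Q] Q, where \<eta> = "\<lambda>A x. x"])
 show "raw_map C (FO Q) (res Q) (FO Q) (res Q) (\<lambda>A x. x)" by (simp add: raw_map_def)
 show "\<exists>t\<in>Ar E. Dom E t = Q \<and> Cod E t = P \<and> (\<forall>A\<in>Ob C. \<forall>x\<in>FO Q A. app t A x = \<phi> A x)"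
  if "P \<in> Ob E" "raw_map C (FO Q) (res Q) (FO P) (res P) \<phi>" for P \<phi>
  using E_map[OF Q that] by (intro bexI[of _ "mk_map C Q P \<phi>"]) auto
 show "s = t" if "s \<in> Ar E" "t \<in> Ar E" "Dom E s = Q" "Dom E t = Q" "Cod E s = Cod E t"
  "\<And>A x. A \<in> Ob C ==> x \<in> FO Q A ==> app s A x = app t A x" for s t
  by (rule E_ext) (use that in simp_all)
qed

lemma raw_sieve: "sieve C A S ==> raw_presheaf C (\<lambda>B. {f \<in> S. dom f = B}) (\<lambda>g f. f \<cdot> g)"
 unfolding raw_presheaf_def using sieveD[of A S] by auto

lemma small_sieve: "sieve C A S ==> \<forall>B\<in>Ob C. small TYPE('u) {f \<in> S. dom f = B}"
 by (intro ballI small_subset[OF small_Ar]) (auto dest: sieveD(1))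

text \<open>A map from a covering sieve to a sheaf is a matching family, so it glues to a unique
  element, which is a map out of \<open>ay A\<close>. Thus \<open>ay A\<close> is the free sheaf on
  the sieve.\<close>

lemma density_cover:
 assumes S: "cov A S"
 shows "El_colimit E K (\<lambda>B. {f \<in> S. dom f = B}) (\<lambda>g f. f \<cdot> g) (FO K A) (\<lambda>B f. pt (FO K A) B (res (FO K A) f (ue A)))"
proof -
 have A: "A \<in> Ob C" using covering_Ob[OF S] .
 have sv: "sieve C A S" using covering_sieve_sieve[OF S] .
 note sD = sieveD[OF sv]
 have KA: "FO K A \<in> Ob E" using A by simp
 show ?thesis
 proof (rule density[OF raw_sieve[OF sv] small_sieve[OF sv] KA])
  show "raw_map C (\<lambda>B. {f \<in> S. dom f = B}) (\<lambda>g f. f \<cdot> g) (FO (FO K A)) (res (FO K A)) (\<lambda>B f. res (FO K A) f (ue A))"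
   by (rule raw_mapI) (use sD KA A in auto)
 next
  fix P \<phi> assume P: "P \<in> Ob E" and \<phi>: "raw_map C (\<lambda>B. {f \<in> S. dom f = B}) (\<lambda>g f. f \<cdot> g) (FO P) (res P) \<phi>"
  have \<phi>1: "\<phi> (dom f) f \<in> FO P (dom f)" if "f \<in> S" for f
   using \<phi> that sD(1)[OF that] unfolding raw_map_def by simp
  have \<phi>2: "\<phi> (dom (f \<cdot> g)) (f \<cdot> g) = res P g (\<phi> (dom f) f)" if "f \<in> S" "g \<in> Ar C" "cod g = dom f" for f g
   using \<phi> that sD(1)[OF that(1)] unfolding raw_map_def by simp
  obtain a where a: "a \<in> FO P A" "\<And>f. f \<in> S ==> res P f a = \<phi> (dom f) f"
   by (rule sheaf_glue[OF P S, of "\<lambda>f. \<phi> (dom f) f"]) (use \<phi>1 \<phi>2 in blast)+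
  have "app (pt P A a) (dom f) (res (FO K A) f (ue A)) = \<phi> (dom f) f" if "f \<in> S" for f
   using app_pt[OF P sD(1,2)[OF that] a(1)] a(2)[OF that] by simp
  thus "\<exists>t\<in>Ar E. Dom E t = FO K A \<and> Cod E t = P \<and>
    (\<forall>B\<in>Ob C. \<forall>f\<in>{f \<in> S. dom f = B}. app t B (res (FO K A) f (ue A)) = \<phi> B f)"
   using P A a(1) by (intro bexI[of _ "pt P A a"]) auto
 next
  fix s t assume st: "s \<in> Ar E" "t \<in> Ar E" "Dom E s = FO K A" "Dom E t = FO K A" "Cod E s = Cod E t"
   and eq: "\<And>B f. B \<in> Ob C ==> f \<in> {f \<in> S. dom f = B} ==> app s B (res (FO K A) f (ue A)) = app t B (res (FO K A) f (ue A))"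
  show "s = t"
  proof (rule K_ext[OF A st])
   show "app s A (ue A) = app t A (ue A)"
   proof (rule sheaf_separated[OF _ S])
    show "Cod E t \<in> Ob E" using st by simp
    show "app s A (ue A) \<in> FO (Cod E t) A" "app t A (ue A) \<in> FO (Cod E t) A"
     using app_in[of s A "ue A"] app_in[of t A "ue A"] st A by simp_all
    fix f assume f: "f \<in> S"
    hence "app s (dom f) (res (FO K A) f (ue A)) = app t (dom f) (res (FO K A) f (ue A))"
     using eq[of "dom f" f] sD(1)[OF f] by simp
    thus "res (Cod E t) f (app s A (ue A)) = res (Cod E t) f (app t A (ue A))"
     using app_nat[OF st(1) sD(1)[OF f], of "ue A"] app_nat[OF st(2) sD(1)[OF f], of "ue A"] st sD(2)[OF f] A by simp
   qed
  qed
 qed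
qed

lemma pt_K:
 assumes "f \<in> Ar C" "cod f = A"
 shows "pt (FO K A) (dom f) (res (FO K A) f (ue A)) = FA K f"
 using pt_eta[of "FA K f" "dom f"] assms by simp

end

section \<open>Gluing of partial maps and of M-subobjects over a colimit\<close>

section \<open>Partial maps out of colimits\<close>

locale target = site C M + T: gcat D "TYPE('u)" N
 for C :: "('o, 'u) cat" (structure) and M and D :: "('p, 'd) cat" and N +
 assumes cocomp: "cocomplete_mcategory TYPE('u) D N"
begin

lemma span_along:
 assumes "(n, h) \<in> spans D N" "c \<in> Ar D" "Cod D c = Cod D n" "pullback D n c q m"
 shows "T.pm n h \<cdot>[Par D N] FA (Par_inclusion D N) c = T.pm m (h \<cdot>[D] q)"
 using T.Par_comp_total[OF assms] assms(2) by (simp add: T.Par_inclusion_simps)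

context
 fixes V :: "'o \<Rightarrow> 'u set" and act :: "'u \<Rightarrow> 'u \<Rightarrow> 'u" and F :: "('o, 'u, 'p, 'd) ftor" and X \<iota>
 assumes V: "raw_presheaf C V act" and sV: "\<forall>A\<in>Ob C. small TYPE('u) (V A)"
  and F: "cat_functor C D F" and colim: "El_colimit D F V act X \<iota>"
begin

private lemmas \<iota> = El_colimitD[OF V sV colim]

text \<open>Here cocompleteness of the M-category enters: \<open>X\<close> is also the colimit among
  partial maps. The lemmas below translate this universal property to spans.\<close>

private lemma Par_colim:
 "El_colimit (Par D N) (comp_functor C (Par_inclusion D N) F) V act X (\<lambda>A x. FA (Par_inclusion D N) (\<iota> A x))"
 using El_colimit_preserved[OF V sV _ F colim, of "Par D N" "Par_inclusion D N"] cocomp \<iota>(1)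
 by (simp add: cocomplete_mcategory_def T.Par_inclusion_simps)

text \<open>The hypothesis says that both partial maps restrict to the same one along each
  injection. Applied to partial identities, it compares two M-subobjects of a colimit.\<close>

lemma span_colimit_unique:
 assumes nh: "(n, h) \<in> hom_spans D N X Y" "(n', h') \<in> hom_spans D N X Y"
  and eq: "\<And>A x. A \<in> Ob C ==> x \<in> V A ==> \<exists>m q q'. pullback D n (\<iota> A x) q m \<and> pullback D n' (\<iota> A x) q' m \<and>
   h \<cdot>[D] q = h' \<cdot>[D] q'"
 obtains u where "is_iso D u" "Dom D u = Dom D n" "Cod D u = Dom D n'" "n' \<cdot>[D] u = n" "h' \<cdot>[D] u = h"
proof -
 have sp: "(n, h) \<in> spans D N" "(n', h') \<in> spans D N" using nh by (simp_all add: hom_spans_def)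
 have n: "Cod D n = X" "Cod D n' = X" using nh by (simp_all add: hom_spans_iff)
 have "T.pm n h = T.pm n' h'"
 proof (rule El_colimit_unique[OF V sV cat_functor_comp[OF F T.cat_functor_Par_inclusion] Par_colim])
  show "T.pm n h \<in> Ar (Par D N)" "T.pm n' h' \<in> Ar (Par D N)" "Dom (Par D N) (T.pm n h) = X" "Dom (Par D N) (T.pm n' h') = X"
   "Cod (Par D N) (T.pm n h) = Cod (Par D N) (T.pm n' h')"
   using T.Par_Hom[OF nh(1)] T.Par_Hom[OF nh(2)] by (simp_all add: Hom_iff)
  fix A x assume A: "A \<in> Ob C" "x \<in> V A"
  obtain m q q' where pb: "pullback D n (\<iota> A x) q m" "pullback D n' (\<iota> A x) q' m" and "h \<cdot>[D] q = h' \<cdot>[D] q'"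
   using eq[OF A] by blast
  thus "T.pm n h \<cdot>[Par D N] FA (Par_inclusion D N) (\<iota> A x) = T.pm n' h' \<cdot>[Par D N] FA (Par_inclusion D N) (\<iota> A x)"
   using span_along[OF sp(1) _ _ pb(1)] span_along[OF sp(2) _ _ pb(2)] \<iota>(2-4)[OF A] n by simp
 qed
 thus thesis using T.partial_map_eq_iff[OF sp] that by blast
qed

text \<open>Composing a partial map with a total one pulls back its domain, so the pullback squares
  in the hypothesis express that the spans form a cocone among partial maps.\<close>

lemma span_colimit_exists:
 assumes Y: "Y \<in> Ob D"
  and m: "\<And>A x. A \<in> Ob C ==> x \<in> V A ==> (m A x, f A x) \<in> hom_spans D N (FO F A) Y"
  and mf: "\<And>g x. g \<in> Ar C ==> x \<in> V (cod g) ==> \<exists>q. pullback D (m (cod g) x) (FA F g) q (m (dom g) (act g x)) \<and>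
   f (cod g) x \<cdot>[D] q = f (dom g) (act g x)"
 obtains n h where "(n, h) \<in> hom_spans D N X Y"
  "\<And>A x. A \<in> Ob C ==> x \<in> V A ==> \<exists>q. pullback D n (\<iota> A x) q (m A x) \<and> h \<cdot>[D] q = f A x"
proof -
 interpret F: cat_functor C D F by (rule F)
 let ?I = "Par_inclusion D N"
 have sp: "(m A x, f A x) \<in> spans D N" if "A \<in> Ob C" "x \<in> V A" for A x using m[OF that] by (simp add: hom_spans_def)
 obtain u where u: "u \<in> Ar (Par D N)" "Dom (Par D N) u = X" "Cod (Par D N) u = Y"
  "\<And>A x. A \<in> Ob C ==> x \<in> V A ==> u \<cdot>[Par D N] FA ?I (\<iota> A x) = T.pm (m A x) (f A x)"
 proof (rule El_colimit_lift[OF V sV Par_colim, of Y "\<lambda>A x. T.pm (m A x) (f A x)"])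
  show "Y \<in> Ob (Par D N)" using Y by simp
  show "T.pm (m A x) (f A x) \<in> Ar (Par D N) \<and> Dom (Par D N) (T.pm (m A x) (f A x)) = FO (comp_functor C ?I F) A \<and>
    Cod (Par D N) (T.pm (m A x) (f A x)) = Y" if "A \<in> Ob C" "x \<in> V A" for A x
   using T.Par_Hom[OF m[OF that]] that by (simp add: Hom_iff T.Par_inclusion_simps)
  show "T.pm (m (cod g) x) (f (cod g) x) \<cdot>[Par D N] FA (comp_functor C ?I F) g = T.pm (m (dom g) (act g x)) (f (dom g) (act g x))"
   if g: "g \<in> Ar C" "x \<in> V (cod g)" for g x
  proof -
   obtain q where q: "pullback D (m (cod g) x) (FA F g) q (m (dom g) (act g x))" "f (cod g) x \<cdot>[D] q = f (dom g) (act g x)"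
    using mf[OF g] by blast
   thus ?thesis using span_along[OF sp[OF Cod_in[OF g(1)] g(2)] _ _ q(1)] T.pullbackD(5)[OF q(1)] g by simp
  qed
 qed (rule that, assumption+)
 have "u \<in> Hom (Par D N) X Y" using u by (simp add: Hom_iff)
 then obtain n h where uh: "u = T.pm n h" and nh: "(n, h) \<in> hom_spans D N X Y" by (rule T.Par_HomE)
 have snh: "(n, h) \<in> spans D N" and n: "n \<in> N" "Cod D n = X" "h \<in> Ar D" "Dom D h = Dom D n" using nh by (simp_all add: hom_spans_def spans_def)
 have "\<exists>q. pullback D n (\<iota> A x) q (m A x) \<and> h \<cdot>[D] q = f A x" if A: "A \<in> Ob C" "x \<in> V A" for A x
 proof -
  note \<iota>' = \<iota>(2-4)[OF A]
  obtain q p where pq: "pullback D n (\<iota> A x) q p" "p \<in> N" using T.pullback_exists[OF n(1) \<iota>'(1)] \<iota>'(3) n(2) by metis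
  note D = T.pullbackD[OF pq(1)]
  have "T.pm p (h \<cdot>[D] q) = T.pm (m A x) (f A x)" using span_along[OF snh \<iota>'(1) _ pq(1)] \<iota>' n u(4)[OF A] uh by simp
  moreover have "(p, h \<cdot>[D] q) \<in> spans D N" using pq(2) n D by (simp add: spans_iff)
  \<comment> \<open>The restriction of the glued map is the prescribed span only up to an
    isomorphism, which is absorbed into the projection.\<close>
  ultimately obtain w where w: "is_iso D w" "Dom D w = Dom D (m A x)" "Cod D w = Dom D p" "p \<cdot>[D] w = m A x"
   "(h \<cdot>[D] q) \<cdot>[D] w = f A x" using T.partial_map_eq_iff[OF sp[OF A]] by metis
  have "pullback D n (\<iota> A x) (q \<cdot>[D] w) (m A x)" using T.pullback_iso_comp[OF pq(1) w(1)] w(3,4) D(6) by simp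
  moreover have "h \<cdot>[D] (q \<cdot>[D] w) = f A x" using w(5) T.comp_assoc[of w q h] T.iso_Ar[OF w(1)] w(3) D n by simp
  ultimately show ?thesis by blast
 qed
 thus thesis using that nh by blast
qed

text \<open>Pullbacks of M-maps along a map out of a colimit can be recognised on the injections:
  \<open>\<nu>\<close> and the true pullback \<open>n\<close> of \<open>g\<close> restrict to the
  same subobject along each of them, so they are isomorphic as subobjects.\<close>

lemma pullback_colimit:
 assumes g: "g \<in> N" and k: "k \<in> Ar D" "Dom D k = X" "Cod D k = Cod D g" and \<nu>: "\<nu> \<in> N" "Cod D \<nu> = X"
  and l: "l \<in> Ar D" "Dom D l = Dom D \<nu>" "Cod D l = Dom D g" "g \<cdot>[D] l = k \<cdot>[D] \<nu>"
  and loc: "\<And>A x. A \<in> Ob C ==> x \<in> V A ==> \<exists>m q q'. pullback D g (k \<cdot>[D] \<iota> A x) q' m \<and> pullback D \<nu> (\<iota> A x) q m"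
 shows "pullback D g k l \<nu>"
proof -
 obtain p n where pb: "pullback D g k p n" and n: "n \<in> N" using T.pullback_exists[OF g k(1,3)] by metis
 note P = T.pullbackD[OF pb]
 obtain u where u: "is_iso D u" "Dom D u = Dom D \<nu>" "Cod D u = Dom D n" "n \<cdot>[D] u = \<nu>"
 proof (rule span_colimit_unique[of \<nu> \<nu> X n n])
  show "(\<nu>, \<nu>) \<in> hom_spans D N X X" "(n, n) \<in> hom_spans D N X X" using \<nu> n P k by (simp_all add: hom_spans_iff)
  fix A x assume A: "A \<in> Ob C" "x \<in> V A"
  obtain m q q' where pq: "pullback D g (k \<cdot>[D] \<iota> A x) q' m" "pullback D \<nu> (\<iota> A x) q m" using loc[OF A] by blast
  obtain r where r: "pullback D n (\<iota> A x) r m"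
   by (rule T.pullback_cancel[OF pb pq(1)]) (use \<iota>(2-4)[OF A] k in simp_all)
  thus "\<exists>m q q'. pullback D \<nu> (\<iota> A x) q m \<and> pullback D n (\<iota> A x) q' m \<and> \<nu> \<cdot>[D] q = n \<cdot>[D] q'"
   using pq(2) T.pullbackD(9)[OF pq(2)] T.pullbackD(9)[OF r] by (intro exI[of _ m] exI[of _ q] exI[of _ r]) simp
 qed
 have uA: "u \<in> Ar D" using u(1) by simp
 have "p \<cdot>[D] u = l"
 proof (rule T.mono_cancel[OF T.M_mono[OF g]])
  show "g \<cdot>[D] (p \<cdot>[D] u) = g \<cdot>[D] l"
   using T.comp_reassoc[OF P(9), of u] T.comp_assoc[of u n k] u uA P l(4) by simp
 qed (use P uA u l in simp_all)
 thus ?thesis using T.pullback_iso_comp[OF pb u(1)] u(3,4) P(6) by simp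
qed

end

end

section \<open>\<open>ay\<close> is an M-functor, and restriction along it gives geometric
  M-functors\<close>

section \<open>Restriction along the Yoneda embedding\<close>

lemma mfunctor_comp:
 assumes "mfunctor C M D N F" "mfunctor D N E L G" "\<And>m. m \<in> M ==> m \<in> Ar C"
 shows "mfunctor C M E L (comp_functor C G F)"
 unfolding mfunctor_def
proof (intro conjI ballI allI impI)
 have F: "cat_functor C D F" using assms(1) by (simp add: mfunctor_def)
 thus "cat_functor C E (comp_functor C G F)" using assms(2) cat_functor_comp by (auto simp: mfunctor_def)
 show "FA (comp_functor C G F) m \<in> L" if "m \<in> M" for m using assms that by (simp add: mfunctor_def)
 show "pullback E (FA (comp_functor C G F) m) (FA (comp_functor C G F) f) (FA (comp_functor C G F) p) (FA (comp_functor C G F) q)"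
  if "m \<in> M" "pullback C m f p q" for m f p q
  using that assms category.pullbackD(1-4)[OF cat_functor.axioms(1)[OF F] that(2)] by (simp add: mfunctor_def)
qed

context site
begin

lemma pullback_K:
 assumes m: "m \<in> M" and pb: "pullback C m f p q"
 shows "pullback E (FA K m) (FA K f) (FA K p) (FA K q)"
proof (rule pullback_criterion)
 note P = pullbackD[OF pb]
 have q: "q \<in> M" using M_pullback[OF pb m] .
 show "FA K m \<cdot>[E] FA K p = FA K f \<cdot>[E] FA K q" using P K.FA_comp[of p m] K.FA_comp[of q f] by simp
 fix A z assume A: "A \<in> Ob C" and "z \<in> FO (Dom E (FA K f)) A" and im: "app (FA K f) A z \<in> im (FA K m) A"
 hence "z \<in> FO (FO K (dom f)) A" using P by simp
 then obtain g where g: "g \<in> Ar C" "dom g = A" "cod g = dom f" "z = res (FO K (dom f)) g (ue (dom f))"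
  using K_elem A P by (metis Dom_in)
 have "g \<in> pull (factors m) f" using im app_K_elem[OF g(1) P(2) g(3)] im_K[OF P(1), of "f \<cdot> g"] g P by (simp add: pull_def)
 thus "z \<in> im (FA K q) A" using im_K[OF P(4) g(1)] g P pull_factors[OF pb] by simp
qed (use pullbackD[OF pb] M_pullback[OF pb m] inj_map_K[OF M_mono] m in simp_all)

lemma mfunctor_K: "mfunctor C M E \<N> K"
 unfolding mfunctor_def
proof (intro conjI ballI allI impI K.cat_functor_axioms)
 fix m assume m: "m \<in> M"
 show "FA K m \<in> \<N>"
 proof (rule N_pointI)
  fix A \<alpha> assume A: "A \<in> Ob C" and \<alpha>: "\<alpha> \<in> Ar E" "Dom E \<alpha> = FO K A" "Cod E \<alpha> = Cod E (FA K m)"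
  obtain f where f: "f \<in> Ar C" "dom f = A" "cod f = cod m" "app \<alpha> A (ue A) = res (FO K (cod m)) f (ue (cod m))"
   by (rule K_elem[of "cod m" A "app \<alpha> A (ue A)"]) (use A m \<alpha> app_in[OF \<alpha>(1) A, of "ue A"] in simp_all)
  \<comment> \<open>Every point of \<open>ay (cod m)\<close> comes from an arrow of
    \<open>C\<close>, so the pullback can be formed in \<open>C\<close> and carried over by
    \<open>ay\<close>.\<close>
  hence "\<alpha> = FA K f" using pt_eta[OF \<alpha>(1) A \<alpha>(2)] pt_K[OF f(1,3)] \<alpha>(3) m by simp
  moreover obtain p q where pq: "pullback C m f p q" "q \<in> M" using pullback_exists[OF m f(1,3)] by metis
  ultimately show "\<exists>m'\<in>M. cod m' = A \<and> (\<exists>\<beta>. pullback E (FA K m) \<alpha> \<beta> (FA K m'))"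
   using pullback_K[OF m pq(1)] pullbackD(8)[OF pq(1)] f(2) by blast
 qed (use m in simp)
qed (rule pullback_K)

end

context target
begin

lemma restriction_1cell:
 assumes F: "gMCocomp_1cell TYPE('u) E \<N> D N F"
 shows "gMCat_1cell TYPE('u) C M D N (comp_functor C F K)"
proof -
 have mF: "mfunctor E \<N> D N F" and pF: "preserves_colimits TYPE('u) E D F" using F by (simp_all add: gMCocomp_1cell_def)
 then interpret F: cat_functor E D F by (simp add: mfunctor_def)
 let ?G = "comp_functor C F K"
 have mG: "mfunctor C M D N ?G" by (rule mfunctor_comp[OF mfunctor_K mF]) simp
 then interpret G: gfun C "TYPE('u)" M D "TYPE('u)" N ?G by unfold_locales
 have "basic_cover D N (FO ?G A) (FA ?G ` R)" if R: "basic_cover C M A R" for A R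
 proof -
  have A: "A \<in> Ob C" using basic_cover_Ob[OF R] .
  define S where "S = (\<Union>a\<in>R. factors a)"
  have cov: "cov A S" unfolding S_def by (rule covering_generated[OF R])
  have sv: "sieve C A S" using covering_sieve_sieve[OF cov] .
  have RM: "a \<in> M" "cod a = A" if "a \<in> R" for a using basic_cover_M[OF R] that by auto
  have colim: "El_colimit D ?G (\<lambda>B. {f \<in> S. dom f = B}) (\<lambda>g f. f \<cdot> g) (FO F (FO K A)) (\<lambda>B f. FA F (pt (FO K A) B (res (FO K A) f (ue A))))"
   by (rule El_colimit_preserved[OF raw_sieve[OF sv] small_sieve[OF sv] pF K.cat_functor_axioms density_cover[OF cov]])
  show ?thesis
  proof (rule T.basic_coverI)
   show "FO ?G A \<in> Ob D" using A by simp
   show "FA ?G ` R \<subseteq> {a \<in> N. Cod D a = FO ?G A}" using RM G.FA_M A by auto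
   fix n assume n: "n \<in> N" "Cod D n = FO ?G A" and le: "\<forall>a\<in>FA ?G ` R. subobj_le D a n"
   let ?X = "FO F (FO K A)"
   have nX: "Cod D n = ?X" using n A by simp
   have X: "?X \<in> Ob D" using A by simp
   \<comment> \<open>The identity and \<open>n\<close> are compared as subobjects of a colimit. Each
     arrow \<open>f\<close> of the sieve factors through some \<open>a\<close> in \<open>R\<close>,
     so its image factors through \<open>n\<close>; both subobjects therefore pull back to the
     identity along that injection.\<close>
   obtain u where u: "is_iso D u" "Dom D u = Dom D (Idt D ?X)" "Cod D u = Dom D n" "n \<cdot>[D] u = Idt D ?X"
   proof (rule span_colimit_unique[OF raw_sieve[OF sv] small_sieve[OF sv] G.cat_functor_axioms colim, of "Idt D ?X" "Idt D ?X" ?X n n])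
    show "(Idt D ?X, Idt D ?X) \<in> hom_spans D N ?X ?X" "(n, n) \<in> hom_spans D N ?X ?X"
     using n(1) nX X by (simp_all add: hom_spans_iff)
    fix B f assume B: "B \<in> Ob C" and "f \<in> {f \<in> S. dom f = B}"
    hence f: "f \<in> S" "dom f = B" by auto
    have fA: "f \<in> Ar C" "cod f = A" using sieveD(1,2)[OF sv f(1)] .
    define c where "c = FA F (pt (FO K A) B (res (FO K A) f (ue A)))"
    have c: "c = FA ?G f" using pt_K[OF fA] fA f(2) by (simp add: c_def)
    obtain a g where a: "a \<in> R" "g \<in> Ar C" "cod g = dom a" "f = a \<cdot> g" using f(1) by (auto simp: S_def factors_def)
    have aA: "a \<in> Ar C" using RM[OF a(1)] by simp
    have "subobj_le D (FA ?G a) n" using le a(1) by blast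
    then obtain w where w: "w \<in> Ar D" "Dom D w = Dom D (FA ?G a)" "Cod D w = Dom D n" "n \<cdot>[D] w = FA ?G a"
     unfolding T.subobj_le_iff by blast
    have Gg: "FA ?G g \<in> Ar D" "Cod D (FA ?G g) = Dom D w" using a aA w by simp_all
    have cw: "c = n \<cdot>[D] (w \<cdot>[D] FA ?G g)"
     using c a aA G.FA_comp[of g a] T.comp_assoc[of "FA ?G g" w n] w Gg n by simp
    have cA: "c \<in> Ar D" "Cod D c = ?X" using c fA A by simp_all
    have "pullback D (Idt D ?X) c c (Idt D (Dom D c))" using T.pullback_id_left[OF cA refl] .
    moreover have "pullback D n c (w \<cdot>[D] FA ?G g) (Idt D (Dom D c))"
     using T.pullback_mono_factor[OF T.M_mono[OF n(1)], of "w \<cdot>[D] FA ?G g"] cw w Gg n(1) by simp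
    moreover have "Idt D ?X \<cdot>[D] c = n \<cdot>[D] (w \<cdot>[D] FA ?G g)" using cw cA by simp
    ultimately show "\<exists>m q q'. pullback D (Idt D ?X) (FA F (pt (FO K A) B (res (FO K A) f (ue A)))) q m \<and>
      pullback D n (FA F (pt (FO K A) B (res (FO K A) f (ue A)))) q' m \<and> Idt D ?X \<cdot>[D] q = n \<cdot>[D] q'"
     unfolding c_def[symmetric] by blast
   qed
   have "subobj_le D (Idt D ?X) n" unfolding T.subobj_le_iff using u T.iso_Ar[OF u(1)] by blast
   thus "subobj_le D (Idt D (FO ?G A)) n" using A by simp
  qed
 qed
 hence "join_restriction_functor (Par C M) Par_restr (Par D N) Par_restr (Par_functor C M D N ?G)"
  by (rule G.join_functorI)
 thus ?thesis using geometric T.geometric mG by (simp add: gMCat_1cell_def)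
qed

section \<open>The extension L of a geometric M-functor\<close>

section \<open>Extension along the Yoneda embedding\<close>

text \<open>The pullback of \<open>\<mu>\<close> along the point \<open>x\<close> is represented by \<open>m\<close>, with \<open>p\<close> the point of the domain of
 \<open>\<mu>\<close> corresponding to the other leg.\<close>

definition M_point :: "('o, 'u) presheaf_map \<Rightarrow> 'o \<Rightarrow> 'u \<Rightarrow> 'u \<Rightarrow> 'u \<Rightarrow> bool" where
 "M_point \<mu> A x m p \<longleftrightarrow> m \<in> M \<and> cod m = A \<and> p \<in> FO (Dom E \<mu>) (dom m) \<and>
   pullback E \<mu> (pt (Cod E \<mu>) A x) (pt (Dom E \<mu>) (dom m) p) (FA K m)"

lemma M_point_exists:
 assumes \<mu>: "\<mu> \<in> \<N>" and A: "A \<in> Ob C" "x \<in> FO (Cod E \<mu>) A"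
 shows "\<exists>m p. M_point \<mu> A x m p"
proof -
 have "Cod E \<mu> \<in> Ob E" using \<mu> by simp
 note q = pt(1-3)[OF this A]
 obtain m \<beta> where m: "m \<in> M" "cod m = A" and pb: "pullback E \<mu> (pt (Cod E \<mu>) A x) \<beta> (FA K m)"
  by (rule N_point[OF \<mu> A(1) q])
 note P = E.pullbackD[OF pb]
 have D: "dom m \<in> Ob C" "Dom E \<beta> = FO K (dom m)" using m P by simp_all
 have "pt (Dom E \<mu>) (dom m) (app \<beta> (dom m) (ue (dom m))) = \<beta>" using pt_eta[OF P(3) D] P(7) by simp
 moreover have "app \<beta> (dom m) (ue (dom m)) \<in> FO (Dom E \<mu>) (dom m)" using app_in[OF P(3) D(1)] D P(7) by simp
 ultimately show ?thesis using m pb unfolding M_point_def by metis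
qed

context
 fixes \<mu> assumes \<mu>: "\<mu> \<in> \<N>"
begin

lemma M_point_id:
 assumes "A \<in> Ob C" "p \<in> FO (Dom E \<mu>) A"
 shows "M_point \<mu> A (app \<mu> A p) (Idt C A) p"
 using E.pullback_mono_factor[OF ME.M_mono[OF \<mu>], of "pt (Dom E \<mu>) A p"] pt_comp[of \<mu> A p] assms \<mu>
 by (simp add: M_point_def K.FA_Idt)

context
 fixes A x m p assumes A: "A \<in> Ob C" "x \<in> FO (Cod E \<mu>) A" and pt: "M_point \<mu> A x m p"
begin

lemma M_pointD: "m \<in> M" "cod m = A" "p \<in> FO (Dom E \<mu>) (dom m)" "m \<in> Ar C"
  "pullback E \<mu> (pt (Cod E \<mu>) A x) (pt (Dom E \<mu>) (dom m) p) (FA K m)"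
 using pt by (simp_all add: M_point_def)

lemma M_point_app: "app \<mu> (dom m) p = res (Cod E \<mu>) m x"
proof -
 have D: "Dom E \<mu> \<in> Ob E" "Cod E \<mu> \<in> Ob E" "dom m \<in> Ob C" using \<mu> M_pointD(4) by simp_all
 have "app (\<mu> \<cdot>[E] site.pt C M (Dom E \<mu>) (dom m) p) (dom m) (ue (dom m)) =
   app (site.pt C M (Cod E \<mu>) A x \<cdot>[E] FA K m) (dom m) (ue (dom m))"
  using E.pullbackD(9)[OF M_pointD(5)] by simp
 thus ?thesis using D A M_pointD(2,3,4) app_pt[OF D(2) M_pointD(4,2) A(2)] by simp
qed

lemma M_point_factors:
 assumes f: "f \<in> Ar C" "cod f = A"
 shows "res (Cod E \<mu>) f x \<in> im \<mu> (dom f) \<longleftrightarrow> f \<in> factors m"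
proof -
 have Q: "Cod E \<mu> \<in> Ob E" using \<mu> by simp
 have "res (FO K A) f (ue A) \<in> FO (FO K A) (dom f)" using f A by simp
 thus ?thesis
  using pullback_im[OF M_pointD(5), of "dom f" "res (FO K A) f (ue A)"] im_K[OF M_pointD(4) f(1)] app_pt[OF Q f A(2)]
   M_pointD(2) f Q A by simp
qed

end

text \<open>By \<open>M_point_factors\<close> the principal sieve of \<open>m'\<close> is the
  pullback along \<open>g\<close> of that of \<open>m\<close>, so \<open>m'\<close> is isomorphic to
  the pullback of \<open>m\<close>. The points of the domain agree because \<open>\<mu>\<close> is
  injective. This is the cocone condition for the spans to be glued.\<close>

lemma M_point_res:
 assumes g: "g \<in> Ar C" and x: "x \<in> FO (Cod E \<mu>) (cod g)"
  and m: "M_point \<mu> (cod g) x m p" and m': "M_point \<mu> (dom g) (res (Cod E \<mu>) g x) m' p'"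
 obtains q where "pullback C m g q m'" "res (Dom E \<mu>) q p = p'"
proof -
 have Q: "Cod E \<mu> \<in> Ob E" "Dom E \<mu> \<in> Ob E" using \<mu> by simp_all
 have gO: "cod g \<in> Ob C" "dom g \<in> Ob C" using g by simp_all
 have gx: "res (Cod E \<mu>) g x \<in> FO (Cod E \<mu>) (dom g)" using g x Q by simp
 note m = M_pointD[OF gO(1) x m] M_point_app[OF gO(1) x m] M_point_factors[OF gO(1) x m]
 note m' = M_pointD[OF gO(2) gx m'] M_point_app[OF gO(2) gx m'] M_point_factors[OF gO(2) gx m']
 obtain q n where pb: "pullback C m g q n" "n \<in> M" using pullback_exists[OF m(1) g] m(2) by metis
 note P = pullbackD[OF pb(1)]
 have mem: "f \<in> factors m' \<longleftrightarrow> f \<in> factors n" if f: "f \<in> Ar C" "cod f = dom g" for f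
 proof -
  have "f \<in> factors n \<longleftrightarrow> g \<cdot> f \<in> factors m" using f by (simp flip: pull_factors[OF pb(1)] add: pull_def)
  also have "\<dots> \<longleftrightarrow> res (Cod E \<mu>) (g \<cdot> f) x \<in> im \<mu> (dom f)" using m(7)[of "g \<cdot> f"] f g by simp
  finally show ?thesis using m'(7)[OF f] f g x Q by simp
 qed
 have "subobj_le C m' n" "subobj_le C n m'"
  using mem[of m'] mem[of n] factors_self m' pb(2) P by (simp_all add: subobj_le_factors)
 then obtain u where u: "is_iso C u" "dom u = dom m'" "cod u = dom n" "n \<cdot> u = m'"
  using subobj_equiv_iso m'(1,2) pb(2) P(8) by metis
 have uA: "u \<in> Ar C" using u(1) by simp
 have "pullback C m g (q \<cdot> u) m'" using pullback_iso_comp[OF pb(1) u(1)] u(3,4) P(6) by simp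
 moreover have "res (Dom E \<mu>) (q \<cdot> u) p = p'"
 proof (rule inj_mapD[OF N_inj[OF \<mu>]])
  have qu: "q \<cdot> u \<in> Ar C" "dom (q \<cdot> u) = dom m'" "cod (q \<cdot> u) = dom m" using P uA u by simp_all
  have e: "m \<cdot> (q \<cdot> u) = g \<cdot> m'" using comp_reassoc[OF P(9), of u] comp_assoc[of u n g] u uA P by simp
  show "dom m' \<in> Ob C" "p' \<in> FO (Dom E \<mu>) (dom m')" using m' by simp_all
  show "res (Dom E \<mu>) (q \<cdot> u) p \<in> FO (Dom E \<mu>) (dom m')" using res_in[OF Q(2) qu(1), of p] m(3) qu by simp
  have "app \<mu> (dom m') (res (Dom E \<mu>) (q \<cdot> u) p) = res (Cod E \<mu>) (q \<cdot> u) (res (Cod E \<mu>) m x)"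
   using app_nat[OF N_Ar[OF \<mu>] qu(1), of p] m(3,6) qu by simp
  also have "\<dots> = res (Cod E \<mu>) (m \<cdot> (q \<cdot> u)) x" using res_comp[OF Q(1) m(4) qu(1), of x] qu m(2) x by simp
  also have "\<dots> = res (Cod E \<mu>) m' (res (Cod E \<mu>) g x)" using e res_comp[OF Q(1) g m'(4), of x] m'(2) x by simp
  finally show "app \<mu> (dom m') (res (Dom E \<mu>) (q \<cdot> u) p) = app \<mu> (dom m') p'" using m'(6) by simp
 qed
 ultimately show thesis using that by blast
qed

end

end

locale extension = target C M D N
 for C :: "('o, 'u) cat" (structure) and M and D :: "('p, 'd) cat" and N +
 fixes F :: "('o, 'u, 'p, 'd) ftor"
 assumes F: "gMCat_1cell TYPE('u) C M D N F"
begin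

sublocale F: cfun C "TYPE('u)" M D "TYPE('u)" N F
proof -
 interpret gfun C "TYPE('u)" M D "TYPE('u)" N F
  using F by unfold_locales (simp add: gMCat_1cell_def)
 show "cfun C TYPE('u) M D TYPE('u) N F"
  using F by unfold_locales (simp add: gMCat_1cell_def join_functor_cover)
qed

definition colim :: "('o, 'u) presheaf \<Rightarrow> 'p \<times> ('o \<Rightarrow> 'u \<Rightarrow> 'd)" where
 "colim Q = (SOME s. El_colimit D F (FO Q) (res Q) (fst s) (snd s))"

abbreviation LO :: "('o, 'u) presheaf \<Rightarrow> 'p" where
 "LO Q \<equiv> fst (colim Q)"

abbreviation \<iota> :: "('o, 'u) presheaf \<Rightarrow> 'o \<Rightarrow> 'u \<Rightarrow> 'd" where
 "\<iota> Q \<equiv> snd (colim Q)"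

lemma L_colimit:
 assumes "Q \<in> Ob E" shows "El_colimit D F (FO Q) (res Q) (LO Q) (\<iota> Q)"
proof -
 have "cocomplete TYPE('u) D" using cocomp by (simp add: cocomplete_mcategory_def)
 hence "\<exists>s. El_colimit D F (FO Q) (res Q) (fst s) (snd s)"
  using El_colimit_exists[OF raw_presheaf[OF assms] small_presheaf[OF assms] _ F.cat_functor_axioms] by (metis fst_conv snd_conv)
 thus ?thesis unfolding colim_def by (rule someI_ex)
qed

lemma \<iota> [simp]:
 assumes "Q \<in> Ob E"
 shows "LO Q \<in> Ob D"
  "A \<in> Ob C ==> x \<in> FO Q A ==> \<iota> Q A x \<in> Ar D"
  "A \<in> Ob C ==> x \<in> FO Q A ==> Dom D (\<iota> Q A x) = FO F A"
  "A \<in> Ob C ==> x \<in> FO Q A ==> Cod D (\<iota> Q A x) = LO Q"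
 using El_colimitD(1-4)[OF raw_presheaf[OF assms] small_presheaf[OF assms] L_colimit[OF assms]] by simp_all

lemma \<iota>_res:
 assumes "Q \<in> Ob E" "f \<in> Ar C" "x \<in> FO Q (cod f)"
 shows "\<iota> Q (cod f) x \<cdot>[D] FA F f = \<iota> Q (dom f) (res Q f x)"
 using El_colimitD(5)[OF raw_presheaf[OF assms(1)] small_presheaf[OF assms(1)] L_colimit[OF assms(1)] assms(2,3)] .

lemma L_ext:
 assumes "Q \<in> Ob E" "u \<in> Ar D" "v \<in> Ar D" "Dom D u = LO Q" "Dom D v = LO Q" "Cod D u = Cod D v"
  "\<And>A x. A \<in> Ob C ==> x \<in> FO Q A ==> u \<cdot>[D] \<iota> Q A x = v \<cdot>[D] \<iota> Q A x"
 shows "u = v"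
 by (rule El_colimit_unique[OF raw_presheaf[OF assms(1)] small_presheaf[OF assms(1)] F.cat_functor_axioms L_colimit[OF assms(1)]])
  (use assms in simp_all)

lemma L_lift:
 assumes "Q \<in> Ob E" "Y \<in> Ob D"
  "\<And>A x. A \<in> Ob C ==> x \<in> FO Q A ==> d A x \<in> Ar D \<and> Dom D (d A x) = FO F A \<and> Cod D (d A x) = Y"
  "\<And>f x. f \<in> Ar C ==> x \<in> FO Q (cod f) ==> d (cod f) x \<cdot>[D] FA F f = d (dom f) (res Q f x)"
 shows "\<exists>u. u \<in> Ar D \<and> Dom D u = LO Q \<and> Cod D u = Y \<and> (\<forall>A\<in>Ob C. \<forall>x\<in>FO Q A. u \<cdot>[D] \<iota> Q A x = d A x)"
 by (rule El_colimit_lift[OF raw_presheaf[OF assms(1)] small_presheaf[OF assms(1)] L_colimit[OF assms(1)] assms(2-4)])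
  (assumption | blast)+

definition LA :: "('o, 'u) presheaf_map \<Rightarrow> 'd" where
 "LA t = (SOME u. u \<in> Ar D \<and> Dom D u = LO (Dom E t) \<and> Cod D u = LO (Cod E t) \<and>
   (\<forall>A\<in>Ob C. \<forall>x\<in>FO (Dom E t) A. u \<cdot>[D] \<iota> (Dom E t) A x = \<iota> (Cod E t) A (app t A x)))"

lemma LA [simp]:
 assumes t: "t \<in> Ar E"
 shows "LA t \<in> Ar D" "Dom D (LA t) = LO (Dom E t)" "Cod D (LA t) = LO (Cod E t)"
  "A \<in> Ob C ==> x \<in> FO (Dom E t) A ==> LA t \<cdot>[D] \<iota> (Dom E t) A x = \<iota> (Cod E t) A (app t A x)"
proof -
 have O: "Dom E t \<in> Ob E" "Cod E t \<in> Ob E" using t by simp_all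
 have "\<exists>u. u \<in> Ar D \<and> Dom D u = LO (Dom E t) \<and> Cod D u = LO (Cod E t) \<and>
   (\<forall>A\<in>Ob C. \<forall>x\<in>FO (Dom E t) A. u \<cdot>[D] \<iota> (Dom E t) A x = \<iota> (Cod E t) A (app t A x))"
 proof (rule L_lift[OF O(1) \<iota>(1)[OF O(2)]])
  fix f x assume f: "f \<in> Ar C" "x \<in> FO (Dom E t) (cod f)"
  have "app t (cod f) x \<in> FO (Cod E t) (cod f)" using app_in[OF t Cod_in[OF f(1)] f(2)] .
  thus "\<iota> (Cod E t) (cod f) (app t (cod f) x) \<cdot>[D] FA F f = \<iota> (Cod E t) (dom f) (app t (dom f) (res (Dom E t) f x))"
   using \<iota>_res[OF O(2) f(1)] app_nat[OF t f] by simp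
 qed (use O app_in[OF t] in simp)
 note so = someI_ex[OF this, folded LA_def]
 show "LA t \<in> Ar D" "Dom D (LA t) = LO (Dom E t)" "Cod D (LA t) = LO (Cod E t)"
  "A \<in> Ob C ==> x \<in> FO (Dom E t) A ==> LA t \<cdot>[D] \<iota> (Dom E t) A x = \<iota> (Cod E t) A (app t A x)" using so by blast+
qed

definition L :: "(('o, 'u) presheaf, ('o, 'u) presheaf_map, 'p, 'd) ftor" where
 "L = \<lparr>FO = (\<lambda>Q\<in>Ob E. LO Q), FA = (\<lambda>t\<in>Ar E. LA t)\<rparr>"

lemma L_simps [simp]: "Q \<in> Ob E ==> FO L Q = LO Q" "t \<in> Ar E ==> FA L t = LA t"
 by (simp_all add: L_def)

lemma cat_functor_L: "cat_functor E D L"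
proof (rule cat_functorI)
 fix Q assume Q: "Q \<in> Ob E"
 have "LA (Idt E Q) = Idt D (LO Q)"
  by (rule L_ext[OF Q]) (use LA[of "Idt E Q"] Q in simp_all)
 thus "FA L (Idt E Q) = Idt D (FO L Q)" using Q by simp
next
 fix s t assume s: "s \<in> Ar E" and t: "t \<in> Ar E" and st: "Cod E s = Dom E t"
 have O: "Dom E s \<in> Ob E" "Dom E t \<in> Ob E" using s t by simp_all
 have ts: "t \<cdot>[E] s \<in> Ar E" "Dom E (t \<cdot>[E] s) = Dom E s" "Cod E (t \<cdot>[E] s) = Cod E t" using s t st by simp_all
 have "LA (t \<cdot>[E] s) = LA t \<cdot>[D] LA s"
 proof (rule L_ext[OF O(1)])
  fix A x assume A: "A \<in> Ob C" and x: "x \<in> FO (Dom E s) A"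
  have y: "app s A x \<in> FO (Dom E t) A" using app_in[OF s A x] st by simp
  have "LA t \<cdot>[D] LA s \<cdot>[D] \<iota> (Dom E s) A x = LA t \<cdot>[D] (LA s \<cdot>[D] \<iota> (Dom E s) A x)"
   using LA(1-3)[OF s] LA(1-3)[OF t] \<iota>(2-4)[OF O(1) A x] st by simp
  also have "\<dots> = \<iota> (Cod E t) A (app t A (app s A x))" using LA(4)[OF s A x] LA(4)[OF t A y] st by simp
  finally show "LA (t \<cdot>[E] s) \<cdot>[D] \<iota> (Dom E s) A x = LA t \<cdot>[D] LA s \<cdot>[D] \<iota> (Dom E s) A x"
   using LA(4)[OF ts(1) A] ts E_app_comp[OF s A x, of t] x by simp
 qed (use LA(1-3)[OF s] LA(1-3)[OF t] LA(1-3)[OF ts(1)] ts st in simp_all)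
 thus "FA L (t \<cdot>[E] s) = FA L t \<cdot>[D] FA L s" using s t ts by simp
qed (simp_all add: E.category_axioms T.category_axioms L_def)

lemma L_right_adjoint:
 assumes Y: "Y \<in> Ob D"
 shows "right_adjoint_at E D L Y"
proof -
 define W where "W A = Hom D (FO F A) Y" for A
 define act where "act f h = h \<cdot>[D] FA F f" for f h
 have 1: "raw_presheaf C W act"
  unfolding raw_presheaf_def W_def act_def by (auto simp: Hom_iff F.FA_comp F.FA_Idt)
 have 2: "small TYPE('u) (W A)" if "A \<in> Ob C" for A
  using T.mcatD(1) Y that by (simp add: locally_small_def W_def)
 \<comment> \<open>Smallness above is local smallness of \<open>D\<close>; the sheaf condition is
   that \<open>F\<close> carries covers to covers, along which maps glue.\<close>
 have 3: "raw_sheaf C M W act"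
  unfolding raw_sheaf_def
 proof (intro conjI ballI allI impI, goal_cases)
  case (1 B S x)
  hence S: "cov B S" by simp
  note sD = sieveD[OF covering_sieve_sieve[OF S]]
  obtain h where h: "h \<in> Ar D" "Dom D h = FO F B" "Cod D h = Y" "\<And>f. f \<in> S ==> h \<cdot>[D] FA F f = x f"
   by (rule F.covering_glue[OF S Y, of x]) (use 1 in \<open>auto simp: W_def act_def Hom_iff\<close>)
  thus ?case by (intro bexI[of _ h]) (auto simp: W_def act_def Hom_iff)
 next
  case (2 B S a b)
  show ?case by (rule F.covering_unique[OF 2(2)]) (use 2 in \<open>auto simp: W_def act_def Hom_iff\<close>)
 qed
 show ?thesis
 proof (rule realize_right_adjoint[OF 1 2 3 cat_functor_L, where \<nu> = "\<lambda>Q v A x. v \<cdot>[D] \<iota> Q A x"])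
  fix Q v assume Q: "Q \<in> Ob E" and "v \<in> Hom D (FO L Q) Y"
  hence v: "v \<in> Ar D" "Dom D v = LO Q" "Cod D v = Y" by (simp_all add: Hom_iff)
  show "raw_map C (FO Q) (res Q) W act (\<lambda>A x. v \<cdot>[D] \<iota> Q A x)"
   by (rule raw_mapI) (use Q v \<iota>_res[OF Q] in \<open>simp_all add: W_def act_def Hom_iff\<close>)
  fix u assume "u \<in> Hom D (FO L Q) Y" and eq: "\<And>A x. A \<in> Ob C ==> x \<in> FO Q A ==> v \<cdot>[D] \<iota> Q A x = u \<cdot>[D] \<iota> Q A x"
  thus "v = u" by (intro L_ext[OF Q v(1) _ v(2) _ _ eq]) (use Q v in \<open>simp_all add: Hom_iff\<close>)
 next
  fix Q d assume Q: "Q \<in> Ob E" and "raw_map C (FO Q) (res Q) W act d"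
  hence "\<exists>v. v \<in> Ar D \<and> Dom D v = LO Q \<and> Cod D v = Y \<and> (\<forall>A\<in>Ob C. \<forall>x\<in>FO Q A. v \<cdot>[D] \<iota> Q A x = d A x)"
   by (intro L_lift[OF Q Y]) (simp_all add: raw_map_def W_def act_def Hom_iff)
  thus "\<exists>v\<in>Hom D (FO L Q) Y. \<forall>A\<in>Ob C. \<forall>x\<in>FO Q A. v \<cdot>[D] \<iota> Q A x = d A x" unfolding L_simps(1)[OF Q] Bex_def Hom_iff by blast
 next
  fix t d A x assume t: "t \<in> Ar E" "d \<in> Hom D (FO L (Cod E t)) Y" "A \<in> Ob C" "x \<in> FO (Dom E t) A"
  thus "(d \<cdot>[D] FA L t) \<cdot>[D] \<iota> (Dom E t) A x = d \<cdot>[D] \<iota> (Cod E t) A (app t A x)"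
   using LA[OF t(1)] LA(4)[OF t(1,3,4)] by (simp add: Hom_iff)
 qed
qed

lemma L_preserves_colimits: "preserves_colimits TYPE('u) E D L"
 unfolding preserves_colimits_def
 by (intro allI impI, elim conjE) (rule relative_adjoint_colimit[OF cat_functor_L _ _ L_right_adjoint])

end

context extension
begin

text \<open>The partial map from \<open>L Q\<close> to \<open>L P\<close> glued from the spans \<open>(F m, \<iota> p)\<close> over the points of \<open>Q\<close>
 has the form \<open>(n, h)\<close> with \<open>h\<close> invertible, which exhibits \<open>L \<mu>\<close> as the \<open>M\<close>-map \<open>n h\<inverse>\<close>.\<close>

lemma L_M_point:
 assumes \<mu>: "\<mu> \<in> \<N>"
 shows "LA \<mu> \<in> N"
  and "\<And>A x m p. A \<in> Ob C ==> x \<in> FO (Cod E \<mu>) A ==> M_point \<mu> A x m p ==>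
   pullback D (LA \<mu>) (\<iota> (Cod E \<mu>) A x) (\<iota> (Dom E \<mu>) (dom m) p) (FA F m)"
proof -
 define P Q where PQ: "P = Dom E \<mu>" "Q = Cod E \<mu>"
 have \<mu>A: "\<mu> \<in> Ar E" using \<mu> by simp
 have O: "P \<in> Ob E" "Q \<in> Ob E" using \<mu>A by (simp_all add: PQ)
 have \<mu>_in: "app \<mu> A p \<in> FO Q A" if "A \<in> Ob C" "p \<in> FO P A" for A p using app_in[OF \<mu>A] that by (simp add: PQ)
 obtain mm pp where mp: "\<And>A x. A \<in> Ob C ==> x \<in> FO Q A ==> M_point \<mu> A x (mm A x) (pp A x)"
  using M_point_exists[OF \<mu>] unfolding PQ by metis
 have MD: "m \<in> M" "cod m = A" "p \<in> FO P (dom m)" "m \<in> Ar C" "app \<mu> (dom m) p = res Q m x"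
  "FA F m \<in> N" "FA F m \<in> Ar D" "Dom D (FA F m) = FO F (dom m)" "Cod D (FA F m) = FO F A"
  if A: "A \<in> Ob C" "x \<in> FO Q A" and m: "M_point \<mu> A x m p" for A x m p
  using M_pointD(1-4)[OF \<mu> A[unfolded PQ] m] M_point_app[OF \<mu> A[unfolded PQ] m] by (simp_all add: PQ)
 \<comment> \<open>The square of \<open>M_point_res\<close> transported by \<open>F\<close>, with
   the second legs compared by naturality of \<open>\<iota>\<close>.\<close>
 have F_pb: "\<exists>q. pullback D (FA F m) (FA F g) (FA F q) (FA F m') \<and> q \<in> Ar C \<and> dom q = dom m' \<and> cod q = dom m \<and>
   \<iota> P (dom m) p \<cdot>[D] FA F q = \<iota> P (dom m') p'"
  if g: "g \<in> Ar C" and x: "x \<in> FO Q (cod g)" and m: "M_point \<mu> (cod g) x m p"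
   and m': "M_point \<mu> (dom g) (res Q g x) m' p'" for g x m p m' p'
 proof -
  obtain q where q: "pullback C m g q m'" "res P q p = p'"
   by (rule M_point_res[OF \<mu> g x[unfolded PQ] m m'[unfolded PQ]]) (simp add: PQ)
  note D = pullbackD[OF q(1)]
  have "m \<in> M" "p \<in> FO P (dom m)" using MD(1,3)[OF Cod_in[OF g] x m] .
  thus ?thesis using F.FA_pullback[OF q(1)] \<iota>_res[OF O(1) D(3), of p] q(2) D by auto
 qed
 obtain n h where nh: "(n, h) \<in> hom_spans D N (LO Q) (LO P)" and nq: "\<And>A x. A \<in> Ob C ==> x \<in> FO Q A ==>
   \<exists>q. pullback D n (\<iota> Q A x) q (FA F (mm A x)) \<and> h \<cdot>[D] q = \<iota> P (dom (mm A x)) (pp A x)"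
 proof (rule span_colimit_exists[OF raw_presheaf[OF O(2)] small_presheaf[OF O(2)] F.cat_functor_axioms L_colimit[OF O(2)] \<iota>(1)[OF O(1)],
    of "\<lambda>A x. FA F (mm A x)" "\<lambda>A x. \<iota> P (dom (mm A x)) (pp A x)"])
  fix A x assume A: "A \<in> Ob C" "x \<in> FO Q A"
  show "(FA F (mm A x), \<iota> P (dom (mm A x)) (pp A x)) \<in> hom_spans D N (FO F A) (LO P)"
   using MD[OF A mp[OF A]] O by (simp add: hom_spans_iff)
 next
  fix g x assume g: "g \<in> Ar C" "x \<in> FO Q (cod g)"
  have "cod g \<in> Ob C" "dom g \<in> Ob C" "res Q g x \<in> FO Q (dom g)" using g O by simp_all
  thus "\<exists>q. pullback D (FA F (mm (cod g) x)) (FA F g) q (FA F (mm (dom g) (res Q g x))) \<and>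
    \<iota> P (dom (mm (cod g) x)) (pp (cod g) x) \<cdot>[D] q = \<iota> P (dom (mm (dom g) (res Q g x))) (pp (dom g) (res Q g x))"
   using F_pb[OF g mp[OF _ g(2)] mp] by blast
 qed (rule that, assumption+)
 have n: "n \<in> N" "n \<in> Ar D" "h \<in> Ar D" "Dom D h = Dom D n" "Cod D n = LO Q" "Cod D h = LO P"
  using nh by (simp_all add: hom_spans_iff)
 \<comment> \<open>The span was glued from chosen representing pairs; another pair at the same point
   is related to the chosen one by \<open>F_pb\<close> along the identity.\<close>
 have npt: "\<exists>q. pullback D n (\<iota> Q A x) q (FA F m) \<and> h \<cdot>[D] q = \<iota> P (dom m) p"
  if A: "A \<in> Ob C" "x \<in> FO Q A" and m: "M_point \<mu> A x m p" for A x m p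
 proof -
  have i: "Idt C A \<in> Ar C" "x \<in> FO Q (cod (Idt C A))" "M_point \<mu> (cod (Idt C A)) x (mm A x) (pp A x)"
   "M_point \<mu> (dom (Idt C A)) (res Q (Idt C A) x) m p" using A m mp[OF A] O by simp_all
  obtain q where q: "pullback D (FA F (mm A x)) (FA F (Idt C A)) (FA F q) (FA F m)" "q \<in> Ar C" "dom q = dom m" "cod q = dom (mm A x)"
   "\<iota> P (dom (mm A x)) (pp A x) \<cdot>[D] FA F q = \<iota> P (dom m) p" using F_pb[OF i] by blast
  obtain r where r: "pullback D n (\<iota> Q A x) r (FA F (mm A x))" "h \<cdot>[D] r = \<iota> P (dom (mm A x)) (pp A x)" using nq[OF A] by blast
  note R = T.pullbackD[OF r(1)]
  have "pullback D n (\<iota> Q A x) (r \<cdot>[D] FA F q) (FA F m)"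
   using T.pullback_paste[OF r(1) q(1)] A O by (simp add: F.FA_Idt)
  moreover have "h \<cdot>[D] (r \<cdot>[D] FA F q) = \<iota> P (dom m) p"
   using T.comp_reassoc[OF r(2), of "FA F q"] q n R MD(8)[OF A mp[OF A]] by simp
  ultimately show ?thesis by blast
 qed
 \<comment> \<open>A point \<open>p\<close> of \<open>P\<close> represents the pullback of
   \<open>\<mu>\<close> along its own image with \<open>m\<close> an identity. The projection is
   then a lift of the injection at \<open>p\<close> through \<open>h\<close>, lying over the
   injection of \<open>Q\<close> at the image of \<open>p\<close>; these lifts form the components
   of \<open>v\<close>.\<close>
 have "\<exists>v. v \<in> Ar D \<and> Dom D v = FO F A \<and> Cod D v = Dom D n \<and> n \<cdot>[D] v = \<iota> Q A (app \<mu> A p) \<and> h \<cdot>[D] v = \<iota> P A p"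
  if A: "A \<in> Ob C" "p \<in> FO P A" for A p
 proof -
  obtain v where v: "pullback D n (\<iota> Q A (app \<mu> A p)) v (FA F (Idt C A))" "h \<cdot>[D] v = \<iota> P A p"
   using npt[OF A(1) \<mu>_in[OF A] M_point_id[OF \<mu> A[unfolded PQ]]] A by auto
  thus ?thesis using T.pullbackD[OF v(1)] A \<mu>_in[OF A] O by (auto simp: F.FA_Idt)
 qed
 then obtain d where d: "\<And>A p. A \<in> Ob C ==> p \<in> FO P A ==> d A p \<in> Ar D \<and> Dom D (d A p) = FO F A \<and> Cod D (d A p) = Dom D n \<and>
   n \<cdot>[D] d A p = \<iota> Q A (app \<mu> A p) \<and> h \<cdot>[D] d A p = \<iota> P A p" by metis
 have "\<exists>v. v \<in> Ar D \<and> Dom D v = LO P \<and> Cod D v = Dom D n \<and> (\<forall>A\<in>Ob C. \<forall>p\<in>FO P A. v \<cdot>[D] \<iota> P A p = d A p)"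
 proof (rule L_lift[OF O(1)])
  show "Dom D n \<in> Ob D" using n by simp
  fix f p assume f: "f \<in> Ar C" "p \<in> FO P (cod f)"
  have fO: "cod f \<in> Ob C" "dom f \<in> Ob C" "res P f p \<in> FO P (dom f)" using f O by simp_all
  note d1 = d[OF fO(1) f(2)] and d2 = d[OF fO(2,3)]
  \<comment> \<open>The lifts are compatible because \<open>n\<close> is monic and the composites
    with \<open>n\<close> are injections of \<open>Q\<close>.\<close>
  show "d (cod f) p \<cdot>[D] FA F f = d (dom f) (res P f p)"
  proof (rule T.mono_cancel[OF T.M_mono[OF n(1)]])
   have "n \<cdot>[D] (d (cod f) p \<cdot>[D] FA F f) = \<iota> Q (cod f) (app \<mu> (cod f) p) \<cdot>[D] FA F f"
    by (rule T.comp_reassoc) (use d1 n f in simp_all)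
   also have "\<dots> = n \<cdot>[D] d (dom f) (res P f p)"
    using \<iota>_res[OF O(2) f(1) \<mu>_in[OF fO(1) f(2)]] app_nat[OF \<mu>A f[unfolded PQ]] d2 by (simp add: PQ)
   finally show "n \<cdot>[D] (d (cod f) p \<cdot>[D] FA F f) = n \<cdot>[D] d (dom f) (res P f p)" .
  qed (use d1 d2 n f in simp_all)
 qed (use d in blast)
 then obtain v where v: "v \<in> Ar D" "Dom D v = LO P" "Cod D v = Dom D n" and vd: "\<And>A p. A \<in> Ob C ==> p \<in> FO P A ==> v \<cdot>[D] \<iota> P A p = d A p" by blast
 have L\<mu>: "LA \<mu> \<in> Ar D" "Dom D (LA \<mu>) = LO P" "Cod D (LA \<mu>) = LO Q" using LA(1-3)[OF \<mu>A] by (simp_all add: PQ)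
 have hv: "h \<cdot>[D] v = Idt D (LO P)"
 proof (rule L_ext[OF O(1)])
  fix A p assume A: "A \<in> Ob C" "p \<in> FO P A"
  show "h \<cdot>[D] v \<cdot>[D] \<iota> P A p = Idt D (LO P) \<cdot>[D] \<iota> P A p"
   using T.comp_assoc[of "\<iota> P A p" v h] vd[OF A] d[OF A] \<iota>(2-4)[OF O(1) A] v n by simp
 qed (use n v \<iota>(1)[OF O(1)] in simp_all)
 have nv: "n \<cdot>[D] v = LA \<mu>"
 proof (rule L_ext[OF O(1)])
  fix A p assume A: "A \<in> Ob C" "p \<in> FO P A"
  show "n \<cdot>[D] v \<cdot>[D] \<iota> P A p = LA \<mu> \<cdot>[D] \<iota> P A p"
   using T.comp_assoc[of "\<iota> P A p" v n] vd[OF A] d[OF A] \<iota>(2-4)[OF O(1) A] v n LA(4)[OF \<mu>A A[unfolded PQ]] by (simp add: PQ)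
 qed (use n v L\<mu> in simp_all)
 \<comment> \<open>Both sides are second legs over the same domain \<open>n\<close>; the two spans
   agree at every point, where each leg becomes the injection at the point restricted along
   \<open>m\<close>.\<close>
 have Lh: "LA \<mu> \<cdot>[D] h = n"
 proof (rule span_colimit_unique[OF raw_presheaf[OF O(2)] small_presheaf[OF O(2)] F.cat_functor_axioms L_colimit[OF O(2)], of n n "LO Q" n "LA \<mu> \<cdot>[D] h"])
  show "(n, n) \<in> hom_spans D N (LO Q) (LO Q)" "(n, LA \<mu> \<cdot>[D] h) \<in> hom_spans D N (LO Q) (LO Q)" using n L\<mu> by (simp_all add: hom_spans_iff)
  fix A x assume A: "A \<in> Ob C" "x \<in> FO Q A"
  note m = MD[OF A mp[OF A]]
  obtain q where q: "pullback D n (\<iota> Q A x) q (FA F (mm A x))" "h \<cdot>[D] q = \<iota> P (dom (mm A x)) (pp A x)" using nq[OF A] by blast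
  note R = T.pullbackD[OF q(1)]
  have "(LA \<mu> \<cdot>[D] h) \<cdot>[D] q = LA \<mu> \<cdot>[D] \<iota> P (dom (mm A x)) (pp A x)" using T.comp_assoc[of q h "LA \<mu>"] q(2) n L\<mu> R by simp
  also have "\<dots> = \<iota> Q (dom (mm A x)) (res Q (mm A x) x)"
   using LA(4)[OF \<mu>A, of "dom (mm A x)" "pp A x"] m by (simp add: PQ)
  also have "\<dots> = n \<cdot>[D] q" using \<iota>_res[OF O(2) m(4), of x] m(2) A(2) R(9) by simp
  finally show "\<exists>m q q'. pullback D n (\<iota> Q A x) q m \<and> pullback D n (\<iota> Q A x) q' m \<and> n \<cdot>[D] q = (LA \<mu> \<cdot>[D] h) \<cdot>[D] q'"
   using q(1) by (intro exI[of _ "FA F (mm A x)"] exI[of _ q]) simp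
 next
  \<comment> \<open>The comparison satisfies \<open>n u = n\<close>, hence is the identity, and its
    other equation is the claim.\<close>
  fix u assume u: "is_iso D u" "Dom D u = Dom D n" "Cod D u = Dom D n" "n \<cdot>[D] u = n" "(LA \<mu> \<cdot>[D] h) \<cdot>[D] u = n"
  have "u = Idt D (Dom D n)"
   by (rule T.mono_cancel[OF T.M_mono[OF n(1)]]) (use u T.iso_Ar[OF u(1)] n in simp_all)
  thus ?thesis using u(5) n L\<mu> by simp
 qed
 \<comment> \<open>Cancel the monic \<open>n\<close>: one has
   \<open>n v h = L \<mu> h = n\<close>.\<close>
 have "v \<cdot>[D] h = Idt D (Dom D n)"
 proof (rule T.mono_cancel[OF T.M_mono[OF n(1)]])
  show "n \<cdot>[D] (v \<cdot>[D] h) = n \<cdot>[D] Idt D (Dom D n)" using T.comp_reassoc[OF nv, of h] Lh n v by simp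
 qed (use n v in simp_all)
 hence iso: "is_iso D v" "is_iso D h" using hv n v by (auto intro!: T.isoI[of v h] T.isoI[of h v])
 show "LA \<mu> \<in> N" using T.M_comp[OF T.iso_M[OF iso(1)] n(1) v(3)] nv by simp
 fix A x m p assume A: "A \<in> Ob C" "x \<in> FO (Cod E \<mu>) A" and m: "M_point \<mu> A x m p"
 obtain q where q: "pullback D n (\<iota> Q A x) q (FA F m)" "h \<cdot>[D] q = \<iota> P (dom m) p" using npt[OF A[folded PQ] m] by blast
 show "pullback D (LA \<mu>) (\<iota> (Cod E \<mu>) A x) (\<iota> (Dom E \<mu>) (dom m) p) (FA F m)"
  using T.pullback_iso_change[of "LA \<mu>" h "\<iota> Q A x" q "FA F m"] q Lh iso(2) L\<mu> n by (simp add: PQ)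
qed

text \<open>Preservation of the pullback of \<open>\<mu>\<close> along any \<open>t\<close> is
  tested at the points \<open>y\<close> of the domain of \<open>t\<close>. Pasting the square over
  \<open>y\<close> with the given one represents the pullback of \<open>\<mu>\<close> at the image
  of \<open>y\<close> by the same M-map, so \<open>L_M_point\<close> applies to both.\<close>

lemma mfunctor_L: "mfunctor E \<N> D N L"
 unfolding mfunctor_def
proof (intro conjI ballI allI impI cat_functor_L)
 fix \<mu> assume \<mu>: "\<mu> \<in> \<N>"
 have \<mu>A: "\<mu> \<in> Ar E" using \<mu> by simp
 show "FA L \<mu> \<in> N" using L_M_point(1)[OF \<mu>] \<mu>A by simp
 fix t s \<nu> assume pb: "pullback E \<mu> t s \<nu>"
 note D = E.pullbackD[OF pb]
 have \<nu>: "\<nu> \<in> \<N>" using ME.M_pullback[OF pb \<mu>] .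
 have O: "Dom E t \<in> Ob E" using D by simp
 interpret L: cat_functor E D L by (rule cat_functor_L)
 have "pullback D (LA \<mu>) (LA t) (LA s) (LA \<nu>)"
 proof (rule pullback_colimit[OF raw_presheaf[OF O] small_presheaf[OF O] F.cat_functor_axioms L_colimit[OF O]])
  show "LA \<mu> \<in> N" "LA \<nu> \<in> N" using L_M_point(1) \<mu> \<nu> by blast+
  show "LA \<mu> \<cdot>[D] LA s = LA t \<cdot>[D] LA \<nu>" using L.FA_comp[of s \<mu>] L.FA_comp[of \<nu> t] D by simp
  fix A y assume A: "A \<in> Ob C" "y \<in> FO (Dom E t) A"
  have A': "y \<in> FO (Cod E \<nu>) A" using A D by simp
  have ty: "app t A y \<in> FO (Cod E \<mu>) A" using app_in[OF D(2) A] D(5) by simp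
  obtain m p where m: "M_point \<nu> A y m p" using M_point_exists[OF \<nu> A(1) A'] by blast
  note mD = M_pointD[OF \<nu> A(1) A' m]
  have B: "dom m \<in> Ob C" using mD by simp
  have p: "p \<in> FO (Dom E s) (dom m)" using mD(3) D(6) by simp
  have "pullback E \<mu> (t \<cdot>[E] pt (Dom E t) A y) (s \<cdot>[E] pt (Dom E s) (dom m) p) (FA K m)"
   using E.pullback_paste[OF pb] mD(5) D(6,8) by simp
  hence "M_point \<mu> A (app t A y) m (app s (dom m) p)"
   using pt_comp[OF D(2) A] pt_comp[OF D(3) B p] mD(1,2) app_in[OF D(3) B p] D(5,7) by (simp add: M_point_def)
  from L_M_point(2)[OF \<mu> A(1) ty this]
  have "pullback D (LA \<mu>) (LA t \<cdot>[D] \<iota> (Dom E t) A y) (\<iota> (Dom E \<mu>) (dom m) (app s (dom m) p)) (FA F m)"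
   using LA(4)[OF D(2) A] D(5) by simp
  thus "\<exists>m q q'. pullback D (LA \<mu>) (LA t \<cdot>[D] \<iota> (Dom E t) A y) q' m \<and> pullback D (LA \<nu>) (\<iota> (Dom E t) A y) q m"
   using L_M_point(2)[OF \<nu> A(1) A' m] D(8) by auto
 qed (use D \<mu>A LA(1-3) in simp_all)
 thus "pullback D (FA L \<mu>) (FA L t) (FA L s) (FA L \<nu>)" using D by simp
qed

lemma L_1cell: "gMCocomp_1cell TYPE('u) E \<N> D N L"
 using geometric_E cocomplete_mcategory_E T.geometric cocomp mfunctor_L L_preserves_colimits by (simp add: gMCocomp_1cell_def)

text \<open>The generic element is terminal in the category of elements of \<open>ay A\<close>, so
  the colimit of \<open>F\<close> over it is \<open>F A\<close>, by the injection at that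
  element.\<close>

lemma L_extends:
 "nat_trans C D \<lparr>Src = F, Tgt = comp_functor C L K, component = (\<lambda>A\<in>Ob C. \<iota> (FO K A) A (ue A))\<rparr>"
 "A \<in> Ob C ==> is_iso D (\<iota> (FO K A) A (ue A))"
proof -
 let ?e = "\<lparr>Src = F, Tgt = comp_functor C L K, component = (\<lambda>A\<in>Ob C. \<iota> (FO K A) A (ue A))\<rparr>"
 show "nat_trans C D ?e"
 proof (rule nat_transI)
  fix f assume f: "f \<in> Ar C"
  have O: "FO K (cod f) \<in> Ob E" "Dom E (FA K f) = FO K (dom f)" "FA K f \<in> Ar E" using f by simp_all
  have "\<iota> (FO K (cod f)) (cod f) (ue (cod f)) \<cdot>[D] FA F f = \<iota> (FO K (cod f)) (dom f) (res (FO K (cod f)) f (ue (cod f)))"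
   using \<iota>_res[OF O(1) f] f by simp
  also have "\<dots> = LA (FA K f) \<cdot>[D] \<iota> (FO K (dom f)) (dom f) (ue (dom f))"
   using LA(4)[OF O(3), of "dom f" "ue (dom f)"] f O by simp
  finally show "component ?e (cod f) \<cdot>[D] FA (Src ?e) f = FA (Tgt ?e) f \<cdot>[D] component ?e (dom f)" using f by simp
 qed (simp_all add: F.cat_functor_axioms cat_functor_comp[OF K.cat_functor_axioms cat_functor_L])
next
 assume A: "A \<in> Ob C"
 define Q where "Q = FO K A"
 have Q: "Q \<in> Ob E" and ueQ: "ue A \<in> FO Q A" using A by (simp_all add: Q_def)
 have "\<exists>f. f \<in> Ar C \<and> dom f = B \<and> cod f = A \<and> res Q f (ue A) = z" if "B \<in> Ob C" "z \<in> FO Q B" for B z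
  using K_elem[OF A that(1)] that(2) unfolding Q_def by metis
 \<comment> \<open>\<open>k B z\<close> is the arrow by which \<open>z\<close> is a restriction of
   the generic element; its image under \<open>F\<close> is the component at \<open>z\<close> of the
   inverse.\<close>
 then obtain k where k: "\<And>B z. B \<in> Ob C ==> z \<in> FO Q B ==>
   k B z \<in> Ar C \<and> dom (k B z) = B \<and> cod (k B z) = A \<and> res Q (k B z) (ue A) = z" by metis
 have k_res: "k B (res Q f (ue A)) = f" if "f \<in> Ar C" "dom f = B" "cod f = A" for f B
  using k[of B "res Q f (ue A)"] K_elem_unique[of "k B (res Q f (ue A))" f A] res_in[OF Q that(1), of "ue A"] ueQ that by (auto simp: Q_def)
 have "\<exists>u. u \<in> Ar D \<and> Dom D u = LO Q \<and> Cod D u = FO F A \<and> (\<forall>B\<in>Ob C. \<forall>z\<in>FO Q B. u \<cdot>[D] \<iota> Q B z = FA F (k B z))"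
 proof (rule L_lift[OF Q])
  show "FO F A \<in> Ob D" using A by simp
  show "FA F (k B z) \<in> Ar D \<and> Dom D (FA F (k B z)) = FO F B \<and> Cod D (FA F (k B z)) = FO F A" if "B \<in> Ob C" "z \<in> FO Q B" for B z
   using k[OF that] by simp
  fix f z assume f: "f \<in> Ar C" "z \<in> FO Q (cod f)"
  note kz = k[OF Cod_in[OF f(1)] f(2)]
  have "k (dom f) (res Q (k (cod f) z \<cdot> f) (ue A)) = k (cod f) z \<cdot> f" by (rule k_res) (use kz f in simp_all)
  hence "k (dom f) (res Q f z) = k (cod f) z \<cdot> f" using kz f Q ueQ by simp
  thus "FA F (k (cod f) z) \<cdot>[D] FA F f = FA F (k (dom f) (res Q f z))" using F.FA_comp[of f "k (cod f) z"] kz f by simp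
 qed
 then obtain u where u: "u \<in> Ar D" "Dom D u = LO Q" "Cod D u = FO F A" "\<And>B z. B \<in> Ob C ==> z \<in> FO Q B ==> u \<cdot>[D] \<iota> Q B z = FA F (k B z)"
  by blast
 note i = \<iota>(2-4)[OF Q A ueQ]
 have "k A (ue A) = Idt C A" using k_res[of "Idt C A" A] A Q ueQ by simp
 hence "u \<cdot>[D] \<iota> Q A (ue A) = Idt D (FO F A)" using u(4)[OF A ueQ] A by (simp add: F.FA_Idt)
 moreover have "\<iota> Q A (ue A) \<cdot>[D] u = Idt D (LO Q)"
 proof (rule L_ext[OF Q])
  fix B z assume B: "B \<in> Ob C" "z \<in> FO Q B"
  note kz = k[OF B]
  have "\<iota> Q A (ue A) \<cdot>[D] u \<cdot>[D] \<iota> Q B z = \<iota> Q A (ue A) \<cdot>[D] FA F (k B z)"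
   using T.comp_assoc[of "\<iota> Q B z" u "\<iota> Q A (ue A)"] u(1-3) u(4)[OF B] \<iota>(2-4)[OF Q B] i by simp
  also have "\<dots> = \<iota> Q B z" using \<iota>_res[OF Q, of "k B z" "ue A"] kz ueQ by simp
  finally show "\<iota> Q A (ue A) \<cdot>[D] u \<cdot>[D] \<iota> Q B z = Idt D (LO Q) \<cdot>[D] \<iota> Q B z" using \<iota>(2-4)[OF Q B] by simp
 qed (use u i \<iota>(1)[OF Q] in simp_all)
 ultimately show "is_iso D (\<iota> (FO K A) A (ue A))"
  using u(1-3) i unfolding Q_def by (intro T.isoI[of _ u]) simp_all
qed

end

section \<open>Full faithfulness and essential surjectivity of restriction along
  \<open>ay\<close>\<close>

section \<open>The equivalence\<close>

lemma mcartesian_id: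
 assumes "cat_functor C D F" "\<And>m. m \<in> M ==> m \<in> Ar C"
 shows "mcartesian C M D (Idt (functor_cat C D) F)"
proof -
 interpret cat_functor C D F by (rule assms)
 show ?thesis unfolding mcartesian_def using assms(2) by (auto intro!: tgt.pullback_id_left)
qed

lemma mcartesian_comp:
 assumes s: "nat_trans C D s" "mcartesian C M D s" and t: "nat_trans C D t" "mcartesian C M D t" and st: "Tgt s = Src t"
  and M: "\<And>m. m \<in> M ==> m \<in> Ar C"
 shows "mcartesian C M D (t \<cdot>[functor_cat C D] s)"
proof -
 interpret cat_functor C D "Src s" by (rule nat_transD(1)[OF s(1)])
 show ?thesis
  unfolding mcartesian_def
 proof
  fix m assume m: "m \<in> M"
  have "pullback D (FA (Tgt t) m) (component t (Cod C m)) (component t (Dom C m)) (FA (Src t) m)"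
   "pullback D (FA (Src t) m) (component s (Cod C m)) (component s (Dom C m)) (FA (Src s) m)"
   using s(2) t(2) m st unfolding mcartesian_def by (metis tgt.pullback_sym)+
  from tgt.pullback_sym[OF tgt.pullback_paste[OF this]]
  show "pullback D (component (t \<cdot>[functor_cat C D] s) (Cod C m)) (FA (Tgt (t \<cdot>[functor_cat C D] s)) m)
    (FA (Src (t \<cdot>[functor_cat C D] s)) m) (component (t \<cdot>[functor_cat C D] s) (Dom C m))"
   using M[OF m] by simp
 qed
qed

lemma category_mcartesian:
 assumes "category D" "\<And>m. m \<in> M ==> m \<in> Ar C"
 shows "category (subcategory (functor_cat C D) P (mcartesian C M D))"
 by (rule category_subcategory[OF category_functor_cat[OF assms(1)]])
  (use mcartesian_id[OF _ assms(2)] mcartesian_comp[OF _ _ _ _ _ assms(2)] in simp_all)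

lemma inverse_nat_trans:
 assumes t: "nat_trans C D t" and iso: "\<And>A. A \<in> Ob C ==> is_iso D (component t A)"
 obtains s where "nat_trans C D s" "Src s = Tgt t" "Tgt s = Src t" "\<And>A. A \<in> Ob C ==> is_iso D (component s A)"
  "s \<cdot>[functor_cat C D] t = Idt (functor_cat C D) (Src t)" "t \<cdot>[functor_cat C D] s = Idt (functor_cat C D) (Tgt t)"
proof -
 interpret S: cat_functor C D "Src t" by (rule nat_transD(1)[OF t])
 interpret G: cat_functor C D "Tgt t" by (rule nat_transD(2)[OF t])
 note tD = nat_transD[OF t]
 have "\<exists>g. g \<in> Ar D \<and> Dom D g = FO (Tgt t) A \<and> Cod D g = FO (Src t) A \<and> is_iso D g \<and>
   g \<cdot>[D] component t A = Idt D (FO (Src t) A) \<and> component t A \<cdot>[D] g = Idt D (FO (Tgt t) A)" if A: "A \<in> Ob C" for A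
 proof (rule S.tgt.isoE[OF iso[OF A]])
  fix g assume "g \<in> Ar D" "Dom D g = Cod D (component t A)" "Cod D g = Dom D (component t A)" "is_iso D g"
   "g \<cdot>[D] component t A = Idt D (Dom D (component t A))" "component t A \<cdot>[D] g = Idt D (Cod D (component t A))"
  thus ?thesis using tD(5,6)[OF A] by (intro exI[of _ g]) simp
 qed
 then obtain g where g: "\<And>A. A \<in> Ob C ==> g A \<in> Ar D \<and> Dom D (g A) = FO (Tgt t) A \<and> Cod D (g A) = FO (Src t) A \<and> is_iso D (g A) \<and>
   g A \<cdot>[D] component t A = Idt D (FO (Src t) A) \<and> component t A \<cdot>[D] g A = Idt D (FO (Tgt t) A)" by metis
 define s where "s = \<lparr>Src = Tgt t, Tgt = Src t, component = restrict g (Ob C)\<rparr>"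
 have sc: "component s A = g A" if "A \<in> Ob C" for A using that by (simp add: s_def)
 have st: "Src s = Tgt t" "Tgt s = Src t" by (simp_all add: s_def)
 have s: "nat_trans C D s"
 proof (rule nat_transI)
  fix f assume f: "f \<in> Ar C"
  have O: "Dom C f \<in> Ob C" "Cod C f \<in> Ob C" using f by simp_all
  note gd = g[OF O(1)] and gc = g[OF O(2)] and td = tD(4-6)[OF O(1)] and tc = tD(4-6)[OF O(2)]
  have "g (Cod C f) \<cdot>[D] FA (Tgt t) f = g (Cod C f) \<cdot>[D] (FA (Tgt t) f \<cdot>[D] (component t (Dom C f) \<cdot>[D] g (Dom C f)))"
   using gd f by simp
  also have "\<dots> = g (Cod C f) \<cdot>[D] ((FA (Tgt t) f \<cdot>[D] component t (Dom C f)) \<cdot>[D] g (Dom C f))"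
   using gd td f by (subst S.tgt.comp_assoc) simp_all
  also have "\<dots> = g (Cod C f) \<cdot>[D] (component t (Cod C f) \<cdot>[D] (FA (Src t) f \<cdot>[D] g (Dom C f)))"
   unfolding tD(7)[OF f, symmetric] using gd tc f by (subst S.tgt.comp_assoc) simp_all
  also have "\<dots> = Idt D (FO (Src t) (Cod C f)) \<cdot>[D] (FA (Src t) f \<cdot>[D] g (Dom C f))"
   by (rule S.tgt.comp_reassoc) (use gc gd tc f in simp_all)
  also have "\<dots> = FA (Src t) f \<cdot>[D] g (Dom C f)" using gd f by simp
  finally show "component s (Cod C f) \<cdot>[D] FA (Src s) f = FA (Tgt s) f \<cdot>[D] component s (Dom C f)" using sc O st by simp
 qed (use g sc tD(1,2) in \<open>simp_all add: st\<close>, simp add: s_def)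
 show thesis
 proof (rule that[OF s st])
  show "is_iso D (component s A)" if "A \<in> Ob C" for A using g[OF that] sc[OF that] by simp
  interpret FC: category "functor_cat C D" by (rule category_functor_cat[OF S.tgt.category_axioms])
  have A: "t \<in> Ar (functor_cat C D)" "s \<in> Ar (functor_cat C D)" using s t by simp_all
  have O: "Src t \<in> Ob (functor_cat C D)" "Tgt t \<in> Ob (functor_cat C D)" using tD(1,2) by simp_all
  show "s \<cdot>[functor_cat C D] t = Idt (functor_cat C D) (Src t)"
   by (rule nat_trans_eqI[of C D]) (use FC.comp_simps(1)[OF A] FC.Idt_simps(1)[OF O(1)] g sc st in simp_all)
  show "t \<cdot>[functor_cat C D] s = Idt (functor_cat C D) (Tgt t)"
   by (rule nat_trans_eqI[of C D]) (use FC.comp_simps(1)[OF A(2,1)] FC.Idt_simps(1)[OF O(2)] g sc st in simp_all)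
 qed
qed

lemma mcartesian_iso:
 assumes t: "nat_trans C D t" and iso: "\<And>A. A \<in> Ob C ==> is_iso D (component t A)" and M: "\<And>m. m \<in> M ==> m \<in> Ar C"
 shows "mcartesian C M D t"
 unfolding mcartesian_def
proof
 interpret S: cat_functor C D "Src t" by (rule nat_transD(1)[OF t])
 interpret G: cat_functor C D "Tgt t" by (rule nat_transD(2)[OF t])
 fix m assume "m \<in> M"
 hence m: "m \<in> Ar C" by (rule M)
 show "pullback D (component t (Cod C m)) (FA (Tgt t) m) (FA (Src t) m) (component t (Dom C m))"
  by (rule S.tgt.pullback_isos) (use m iso nat_transD(4-7)[OF t] in simp_all)
qed

abbreviation whisker :: "('o, 'a) cat \<Rightarrow> ('o, 'a, 'p, 'b) ftor \<Rightarrow> ('p, 'b, 'q, 'c) ntrans \<Rightarrow> ('o, 'a, 'q, 'c) ntrans" where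
 "whisker C H t \<equiv> \<lparr>Src = comp_functor C (Src t) H, Tgt = comp_functor C (Tgt t) H, component = (\<lambda>A\<in>Ob C. component t (FO H A))\<rparr>"

lemma nat_trans_whisker:
 assumes H: "cat_functor C D H" and t: "nat_trans D E t"
 shows "nat_trans C E (whisker C H t)"
proof -
 interpret H: cat_functor C D H by (rule H)
 show ?thesis
 proof (rule nat_transI)
  fix f assume "f \<in> Ar C"
  thus "component (whisker C H t) (Cod C f) \<cdot>[E] FA (Src (whisker C H t)) f =
    FA (Tgt (whisker C H t)) f \<cdot>[E] component (whisker C H t) (Dom C f)"
   using nat_transD(7)[OF t, of "FA H f"] by simp
 qed (use cat_functor_comp[OF H nat_transD(1)[OF t]] cat_functor_comp[OF H nat_transD(2)[OF t]] nat_transD(4-6)[OF t] in simp_all)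
qed

lemma mcartesian_whisker:
 assumes "cat_functor C D H" "mcartesian D N E t" "\<And>m. m \<in> M ==> m \<in> Ar C \<and> FA H m \<in> N"
 shows "mcartesian C M E (whisker C H t)"
proof -
 interpret H: cat_functor C D H by (rule assms)
 show ?thesis
  unfolding mcartesian_def
 proof
  fix m assume m: "m \<in> M"
  thus "pullback E (component (whisker C H t) (Cod C m)) (FA (Tgt (whisker C H t)) m) (FA (Src (whisker C H t)) m)
    (component (whisker C H t) (Dom C m))"
   using assms(2)[unfolded mcartesian_def, rule_format, of "FA H m"] assms(3)[OF m] by simp
 qed
qed

context target
begin

context
 fixes F assumes F: "gMCocomp_1cell TYPE('u) E \<N> D N F"
begin

lemma cell_functor: "mfunctor E \<N> D N F" "cat_functor E D F" "preserves_colimits TYPE('u) E D F"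
 using F by (simp_all add: gMCocomp_1cell_def mfunctor_def)

lemma cell_colimit:
 assumes "Q \<in> Ob E"
 shows "El_colimit D (comp_functor C F K) (FO Q) (res Q) (FO F Q) (\<lambda>A x. FA F (pt Q A x))"
 using El_colimit_preserved[OF raw_presheaf[OF assms] small_presheaf[OF assms] cell_functor(3) K.cat_functor_axioms density_sheaf[OF assms]] .

lemma nat_trans_unique:
 assumes st: "nat_trans E D s" "nat_trans E D t" "Src s = F" "Src t = F" "Tgt s = Tgt t"
  and eq: "\<And>A. A \<in> Ob C ==> component s (FO K A) = component t (FO K A)"
 shows "s = t"
proof (rule nat_trans_eqI[OF st(1,2)])
 interpret F: cat_functor E D F by (rule cell_functor)
 fix Q assume Q: "Q \<in> Ob E"
 show "component s Q = component t Q"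
 proof (rule El_colimit_unique[OF raw_presheaf[OF Q] small_presheaf[OF Q] cat_functor_comp[OF K.cat_functor_axioms cell_functor(2)] cell_colimit[OF Q]])
  fix A x assume A: "A \<in> Ob C" "x \<in> FO Q A"
  show "component s Q \<cdot>[D] FA F (pt Q A x) = component t Q \<cdot>[D] FA F (pt Q A x)"
   using nat_transD(7)[OF st(1), of "pt Q A x"] nat_transD(7)[OF st(2), of "pt Q A x"] st(3-5) pt(1-3)[OF Q A] eq[OF A(1)] by simp
 qed (use nat_transD(4-6)[OF st(1) Q] nat_transD(4-6)[OF st(2) Q] st(3-5) in simp_all)
qed (use st in simp_all)

text \<open>The component at \<open>Q\<close> is induced on the colimit of the points of
  \<open>Q\<close> by transporting \<open>s\<close> along each of them. It remains to see that the
  squares at M-maps are pullbacks, which \<open>pullback_colimit\<close> reduces to points, where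
  \<open>s\<close> is M-cartesian.\<close>

lemma nat_trans_extends:
 assumes G: "gMCocomp_1cell TYPE('u) E \<N> D N G"
  and s: "nat_trans C D s" "Src s = comp_functor C F K" "Tgt s = comp_functor C G K" "mcartesian C M D s"
 obtains t where "nat_trans E D t" "Src t = F" "Tgt t = G" "mcartesian E \<N> D t"
  "\<And>A. A \<in> Ob C ==> component t (FO K A) = component s A"
proof -
 interpret F: cat_functor E D F by (rule cell_functor)
 interpret G: mfun E "TYPE('u)" \<N> D "TYPE('u)" N G
  using G by unfold_locales (simp add: gMCocomp_1cell_def)
 interpret MF: mfun E "TYPE('u)" \<N> D "TYPE('u)" N F
  using cell_functor(1) by unfold_locales
 have FK: "cat_functor C D (comp_functor C F K)" by (rule cat_functor_comp[OF K.cat_functor_axioms cell_functor(2)])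
 have sD: "component s A \<in> Ar D" "Dom D (component s A) = FO F (FO K A)" "Cod D (component s A) = FO G (FO K A)" if "A \<in> Ob C" for A
  using nat_transD(4-6)[OF s(1) that] s(2,3) that by simp_all
 have snat: "component s (cod f) \<cdot>[D] FA F (FA K f) = FA G (FA K f) \<cdot>[D] component s (dom f)" if "f \<in> Ar C" for f
  using nat_transD(7)[OF s(1) that] s(2,3) that by simp
 have "\<exists>u. u \<in> Ar D \<and> Dom D u = FO F Q \<and> Cod D u = FO G Q \<and>
   (\<forall>A\<in>Ob C. \<forall>x\<in>FO Q A. u \<cdot>[D] FA F (pt Q A x) = FA G (pt Q A x) \<cdot>[D] component s A)" if Q: "Q \<in> Ob E" for Q
 proof (rule El_colimit_lift[OF raw_presheaf[OF Q] small_presheaf[OF Q] cell_colimit[OF Q], of "FO G Q" "\<lambda>A x. FA G (pt Q A x) \<cdot>[D] component s A"])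
  show "FO G Q \<in> Ob D" using Q by simp
  show "FA G (pt Q A x) \<cdot>[D] component s A \<in> Ar D \<and> Dom D (FA G (pt Q A x) \<cdot>[D] component s A) = FO (comp_functor C F K) A \<and>
    Cod D (FA G (pt Q A x) \<cdot>[D] component s A) = FO G Q" if "A \<in> Ob C" "x \<in> FO Q A" for A x
   using pt(1-3)[OF Q that] sD[OF that(1)] that(1) by simp
  fix f x assume f: "f \<in> Ar C" "x \<in> FO Q (cod f)"
  have fO: "cod f \<in> Ob C" "dom f \<in> Ob C" using f by simp_all
  note p = pt(1-3)[OF Q fO(1) f(2)]
  have "(FA G (pt Q (cod f) x) \<cdot>[D] component s (cod f)) \<cdot>[D] FA F (FA K f) =
    FA G (pt Q (cod f) x) \<cdot>[D] (FA G (FA K f) \<cdot>[D] component s (dom f))"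
   using snat[OF f(1)] p f sD[OF fO(1)] by simp
  also have "\<dots> = FA G (pt Q (dom f) (res Q f x)) \<cdot>[D] component s (dom f)"
   using T.comp_assoc[of "component s (dom f)" "FA G (FA K f)" "FA G (pt Q (cod f) x)"] sD[OF fO(2)] p f
    G.FA_comp[of "FA K f" "pt Q (cod f) x"] pt_res[OF Q f] by simp
  finally show "FA G (pt Q (cod f) x) \<cdot>[D] component s (cod f) \<cdot>[D] FA (comp_functor C F K) f =
    FA G (pt Q (dom f) (res Q f x)) \<cdot>[D] component s (dom f)" using f by simp
 qed blast
 then obtain c where c: "\<And>Q. Q \<in> Ob E ==> c Q \<in> Ar D \<and> Dom D (c Q) = FO F Q \<and> Cod D (c Q) = FO G Q \<and>
   (\<forall>A\<in>Ob C. \<forall>x\<in>FO Q A. c Q \<cdot>[D] FA F (pt Q A x) = FA G (pt Q A x) \<cdot>[D] component s A)" by metis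
 hence cpt: "c Q \<cdot>[D] FA F (pt Q A x) = FA G (pt Q A x) \<cdot>[D] component s A" if "Q \<in> Ob E" "A \<in> Ob C" "x \<in> FO Q A" for Q A x
  using that by blast
 define t where "t = \<lparr>Src = F, Tgt = G, component = restrict c (Ob E)\<rparr>"
 have tc: "component t Q = c Q" if "Q \<in> Ob E" for Q using that by (simp add: t_def)
 have st: "Src t = F" "Tgt t = G" by (simp_all add: t_def)
 have t: "nat_trans E D t"
 proof (rule nat_transI)
  fix r assume r: "r \<in> Ar E"
  have O: "Dom E r \<in> Ob E" "Cod E r \<in> Ob E" using r by simp_all
  note cd = c[OF O(1)] and cc = c[OF O(2)]
  have "c (Cod E r) \<cdot>[D] FA F r = FA G r \<cdot>[D] c (Dom E r)"
  proof (rule El_colimit_unique[OF raw_presheaf[OF O(1)] small_presheaf[OF O(1)] FK cell_colimit[OF O(1)]])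
   fix A x assume A: "A \<in> Ob C" "x \<in> FO (Dom E r) A"
   note p = pt(1-3)[OF O(1) A]
   have x': "app r A x \<in> FO (Cod E r) A" using app_in[OF r A] .
   have "c (Cod E r) \<cdot>[D] FA F r \<cdot>[D] FA F (pt (Dom E r) A x) = c (Cod E r) \<cdot>[D] FA F (pt (Cod E r) A (app r A x))"
    using pt_comp[OF r A] F.FA_comp[of "pt (Dom E r) A x" r] p r cc by simp
   also have "\<dots> = FA G (pt (Cod E r) A (app r A x)) \<cdot>[D] component s A" by (rule cpt[OF O(2) A(1) x'])
   also have "\<dots> = (FA G r \<cdot>[D] FA G (pt (Dom E r) A x)) \<cdot>[D] component s A"
    using pt_comp[OF r A] G.FA_comp[of "pt (Dom E r) A x" r] p r by simp
   also have "\<dots> = FA G r \<cdot>[D] c (Dom E r) \<cdot>[D] FA F (pt (Dom E r) A x)"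
    using cpt[OF O(1) A] p r cd sD[OF A(1)] by simp
   finally show "c (Cod E r) \<cdot>[D] FA F r \<cdot>[D] FA F (pt (Dom E r) A x) = FA G r \<cdot>[D] c (Dom E r) \<cdot>[D] FA F (pt (Dom E r) A x)" .
  qed (use cd cc r in simp_all)
  thus "component t (Cod E r) \<cdot>[D] FA (Src t) r = FA (Tgt t) r \<cdot>[D] component t (Dom E r)" using tc O st by simp
 qed (use c tc cell_functor(2) G.cat_functor_axioms in \<open>simp_all add: st\<close>, simp add: t_def)
 have "mcartesian E \<N> D t"
  unfolding mcartesian_def
 proof
  fix \<mu> assume \<mu>: "\<mu> \<in> \<N>"
  have \<mu>A: "\<mu> \<in> Ar E" using \<mu> by simp
  have O: "Dom E \<mu> \<in> Ob E" "Cod E \<mu> \<in> Ob E" using \<mu>A by simp_all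
  note cd = c[OF O(1)] and cc = c[OF O(2)]
  have "pullback D (FA G \<mu>) (c (Cod E \<mu>)) (c (Dom E \<mu>)) (FA F \<mu>)"
  proof (rule pullback_colimit[OF raw_presheaf[OF O(2)] small_presheaf[OF O(2)] FK cell_colimit[OF O(2)]])
   show "FA G \<mu> \<cdot>[D] c (Dom E \<mu>) = c (Cod E \<mu>) \<cdot>[D] FA F \<mu>" using nat_transD(7)[OF t \<mu>A] tc O st by simp
   fix A x assume A: "A \<in> Ob C" "x \<in> FO (Cod E \<mu>) A"
   obtain m p where m: "M_point \<mu> A x m p" using M_point_exists[OF \<mu> A] by blast
   note mD = M_pointD[OF \<mu> A m]
   have "pullback D (component s (cod m)) (FA G (FA K m)) (FA F (FA K m)) (component s (dom m))"
    using s(2-4) mD(1,4) unfolding mcartesian_def by simp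
   \<comment> \<open>The image under \<open>G\<close> of the square over the point is pasted with
     the cartesian square of \<open>s\<close> at \<open>m\<close>. The outer pullback has the leg
     that \<open>F\<close> produces from the same square over the point.\<close>
   from T.pullback_paste[OF G.FA_pullback[OF mD(5) \<mu>] T.pullback_sym[OF this[unfolded mD(2)]]]
   show "\<exists>m q q'. pullback D (FA G \<mu>) (c (Cod E \<mu>) \<cdot>[D] FA F (pt (Cod E \<mu>) A x)) q' m \<and>
     pullback D (FA F \<mu>) (FA F (pt (Cod E \<mu>) A x)) q m"
    using MF.FA_pullback[OF mD(5) \<mu>] cpt[OF O(2) A] by metis
  qed (use cd cc \<mu> \<mu>A G.FA_M[OF \<mu>] MF.FA_M[OF \<mu>] in simp_all)
  thus "pullback D (component t (Cod E \<mu>)) (FA (Tgt t) \<mu>) (FA (Src t) \<mu>) (component t (Dom E \<mu>))"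
   using T.pullback_sym tc O st by simp
 qed
 moreover have "component t (FO K A) = component s A" if A: "A \<in> Ob C" for A
 proof -
  have "pt (FO K A) A (ue A) = Idt E (FO K A)" using pt_eta[of "Idt E (FO K A)" A] A by simp
  thus ?thesis using cpt[of "FO K A" A "ue A"] c[of "FO K A"] sD[OF A] tc[of "FO K A"] A by (simp add: F.FA_Idt G.FA_Idt)
 qed
 ultimately show thesis using that t st by blast
qed

end

abbreviation "\<X> \<equiv> gMCocomp_hom TYPE('u) E \<N> D N"
abbreviation "\<Y> \<equiv> gMCat_hom TYPE('u) C M D N"
abbreviation "\<R> \<equiv> precomposition C K \<X>"

lemma hom_simps:
 "F \<in> Ob \<X> \<longleftrightarrow> gMCocomp_1cell TYPE('u) E \<N> D N F"
 "t \<in> Ar \<X> \<longleftrightarrow> nat_trans E D t \<and> gMCocomp_1cell TYPE('u) E \<N> D N (Src t) \<and> gMCocomp_1cell TYPE('u) E \<N> D N (Tgt t) \<and> mcartesian E \<N> D t"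
 "G \<in> Ob \<Y> \<longleftrightarrow> gMCat_1cell TYPE('u) C M D N G"
 "s \<in> Ar \<Y> \<longleftrightarrow> nat_trans C D s \<and> gMCat_1cell TYPE('u) C M D N (Src s) \<and> gMCat_1cell TYPE('u) C M D N (Tgt s) \<and> mcartesian C M D s"
 "Dom \<X> = Src" "Cod \<X> = Tgt" "Idt \<X> = Idt (functor_cat E D)" "Cmp \<X> = Cmp (functor_cat E D)"
 "Dom \<Y> = Src" "Cod \<Y> = Tgt" "Idt \<Y> = Idt (functor_cat C D)" "Cmp \<Y> = Cmp (functor_cat C D)"
 by (auto simp: gMCocomp_hom_def gMCat_hom_def gMCocomp_1cell_def gMCat_1cell_def mfunctor_def)

lemma category_homs: "category \<X>" "category \<Y>"
 unfolding gMCocomp_hom_def gMCat_hom_def by (rule category_mcartesian[OF T.category_axioms]; simp)+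

lemma \<R>_simps:
 "F \<in> Ob \<X> ==> FO \<R> F = comp_functor C F K" "t \<in> Ar \<X> ==> FA \<R> t = whisker C K t"
 by (simp_all add: precomposition_def)

lemma cat_functor_\<R>: "cat_functor \<X> \<Y> \<R>"
proof (rule cat_functorI[OF category_homs])
 interpret X: category \<X> by (rule category_homs)
 interpret Y: category \<Y> by (rule category_homs)
 have KM: "m \<in> Ar C \<and> FA K m \<in> \<N>" if "m \<in> M" for m using mfunctor_K that by (simp add: mfunctor_def)
 show O: "FO \<R> F \<in> Ob \<Y>" if "F \<in> Ob \<X>" for F
  using restriction_1cell that \<R>_simps(1)[OF that] by (simp add: hom_simps)
 show "FO \<R> \<in> extensional (Ob \<X>)" "FA \<R> \<in> extensional (Ar \<X>)" by (simp_all add: precomposition_def)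
 show A: "FA \<R> t \<in> Ar \<Y>" if t: "t \<in> Ar \<X>" for t
  using t nat_trans_whisker[OF K.cat_functor_axioms, of D t] mcartesian_whisker[OF K.cat_functor_axioms _ KM, of D t]
   restriction_1cell[of "Src t"] restriction_1cell[of "Tgt t"] \<R>_simps(2)[OF t] by (simp add: hom_simps)
 show D: "Dom \<Y> (FA \<R> t) = FO \<R> (Dom \<X> t)" "Cod \<Y> (FA \<R> t) = FO \<R> (Cod \<X> t)" if t: "t \<in> Ar \<X>" for t
  using \<R>_simps(2)[OF t] \<R>_simps(1)[OF X.Dom_in[OF t]] \<R>_simps(1)[OF X.Cod_in[OF t]] by (simp_all add: hom_simps)
 show "FA \<R> (Idt \<X> F) = Idt \<Y> (FO \<R> F)" if F: "F \<in> Ob \<X>" for F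
 proof (rule nat_trans_eqI)
  show "nat_trans C D (FA \<R> (Idt \<X> F))" "nat_trans C D (Idt \<Y> (FO \<R> F))"
   using A[OF X.Idt_simps(1)[OF F]] Y.Idt_simps(1)[OF O[OF F]] by (simp_all add: hom_simps(4))
 qed (use \<R>_simps(1)[OF F] \<R>_simps(2)[OF X.Idt_simps(1)[OF F]] in \<open>simp_all add: hom_simps(5-12)\<close>)
 show "FA \<R> (t \<cdot>[\<X>] s) = FA \<R> t \<cdot>[\<Y>] FA \<R> s" if st: "s \<in> Ar \<X>" "t \<in> Ar \<X>" "Cod \<X> s = Dom \<X> t" for s t
 proof (rule nat_trans_eqI)
  have "FA \<R> t \<cdot>[\<Y>] FA \<R> s \<in> Ar \<Y>" using A D st by simp
  thus "nat_trans C D (FA \<R> (t \<cdot>[\<X>] s))" "nat_trans C D (FA \<R> t \<cdot>[\<Y>] FA \<R> s)"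
   using A[OF X.comp_simps(1)[OF st]] by (simp_all add: hom_simps(4))
 qed (use \<R>_simps(2)[OF X.comp_simps(1)[OF st]] \<R>_simps(2)[OF st(1)] \<R>_simps(2)[OF st(2)] in \<open>simp_all add: hom_simps(5-12)\<close>)
qed

lemma equivalence: "equivalence_of_categories \<X> \<Y> \<R>"
proof (rule equivalenceI[OF cat_functor_\<R>])
 fix F G s assume FG: "F \<in> Ob \<X>" "G \<in> Ob \<X>" and "s \<in> Hom \<Y> (FO \<R> F) (FO \<R> G)"
 hence s: "nat_trans C D s" "Src s = comp_functor C F K" "Tgt s = comp_functor C G K" "mcartesian C M D s"
  by (simp_all add: Hom_iff hom_simps \<R>_simps)
 have F: "gMCocomp_1cell TYPE('u) E \<N> D N F" and G: "gMCocomp_1cell TYPE('u) E \<N> D N G" using FG by (simp_all add: hom_simps)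
 obtain t where t: "nat_trans E D t" "Src t = F" "Tgt t = G" "mcartesian E \<N> D t"
  and ts: "\<And>A. A \<in> Ob C ==> component t (FO K A) = component s A"
  using nat_trans_extends[OF F G s] by blast
 have tA: "t \<in> Ar \<X>" using t F G by (simp add: hom_simps)
 have "FA \<R> t = s"
  by (rule nat_trans_eqI[of C D]) (use \<R>_simps(2)[OF tA] nat_trans_whisker[OF K.cat_functor_axioms t(1)] t s ts in simp_all)
 moreover have "t' = t" if t': "t' \<in> Hom \<X> F G" "FA \<R> t' = s" for t'
 proof (rule nat_trans_unique[OF F _ t(1) _ t(2)])
  have A: "t' \<in> Ar \<X>" using t' by (simp add: Hom_iff)
  show "nat_trans E D t'" "Src t' = F" "Tgt t' = Tgt t" using t' t(3) by (simp_all add: Hom_iff hom_simps)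
  have "s = whisker C K t'" using \<R>_simps(2)[OF A] t'(2) by simp
  thus "component t' (FO K B) = component t (FO K B)" if "B \<in> Ob C" for B using ts[OF that] that by simp
 qed
 ultimately show "\<exists>!t. t \<in> Hom \<X> F G \<and> FA \<R> t = s" using tA t(2,3) by (intro ex1I[of _ t]) (auto simp: Hom_iff hom_simps)
next
 fix G assume "G \<in> Ob \<Y>"
 hence G: "gMCat_1cell TYPE('u) C M D N G" by (simp add: hom_simps)
 interpret L: extension C M D N G by unfold_locales (rule G)
 have LX: "L.L \<in> Ob \<X>" using L.L_1cell by (simp add: hom_simps)
 let ?t = "\<lparr>Src = G, Tgt = comp_functor C L.L K, component = (\<lambda>A\<in>Ob C. L.\<iota> (FO K A) A (ue A))\<rparr>"
 have iso: "is_iso D (component ?t A)" if "A \<in> Ob C" for A using L.L_extends(2)[OF that] that by simp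
 \<comment> \<open>The injections at generic elements lead from \<open>G\<close> to the restriction
   of the extension; essential surjectivity asks for the opposite direction. Both are M-cartesian
   because their components are invertible.\<close>
 obtain s where s: "nat_trans C D s" "Src s = comp_functor C L.L K" "Tgt s = G" "\<And>A. A \<in> Ob C ==> is_iso D (component s A)"
  "s \<cdot>[functor_cat C D] ?t = Idt (functor_cat C D) G" "?t \<cdot>[functor_cat C D] s = Idt (functor_cat C D) (comp_functor C L.L K)"
  by (rule inverse_nat_trans[OF L.L_extends(1) iso]) (use that in simp_all)
 have 1: "gMCat_1cell TYPE('u) C M D N (comp_functor C L.L K)" by (rule restriction_1cell[OF L.L_1cell])
 have sY: "s \<in> Ar \<Y>" using s(1-3) mcartesian_iso[OF s(1,4), of M] G 1 by (simp add: hom_simps)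
 have tY: "?t \<in> Ar \<Y>" using L.L_extends(1) mcartesian_iso[OF L.L_extends(1) iso, of M] G 1 by (simp add: hom_simps)
 interpret Y: category \<Y> by (rule category_homs)
 have "is_iso \<Y> s" by (rule Y.isoI[OF sY tY]) (use s in \<open>simp_all add: hom_simps(5-12)\<close>)
 thus "\<exists>F\<in>Ob \<X>. \<exists>i\<in>Hom \<Y> (FO \<R> F) G. is_iso \<Y> i"
  using LX sY s(2,3) \<R>_simps(1)[OF LX] by (intro bexI[of _ L.L] bexI[of _ s]) (simp_all add: Hom_iff hom_simps(5-12))
qed

end

theorem theorem29:
  fixes C :: "('o, 'u) cat" and M\<^sub>C :: "'u set"
    and D :: "('p, 'd) cat" and M\<^sub>D :: "'d set"
  assumes "universe TYPE('u)"
    and "small_category TYPE('u) C" and "geometric TYPE('u) C M\<^sub>C"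
    and "cocomplete_mcategory TYPE('u) D M\<^sub>D" and "geometric TYPE('u) D M\<^sub>D"
  shows "equivalence_of_categories
           (gMCocomp_hom TYPE('u) (Sh C M\<^sub>C) (M_Sh C M\<^sub>C) D M\<^sub>D)
           (gMCat_hom TYPE('u) C M\<^sub>C D M\<^sub>D)
           (precomposition C (ay C M\<^sub>C)
              (gMCocomp_hom TYPE('u) (Sh C M\<^sub>C) (M_Sh C M\<^sub>C) D M\<^sub>D))"
proof -
  interpret target C M\<^sub>C D M\<^sub>D
  proof (intro target.intro site.intro gcat.intro mcat.intro gcat_axioms.intro mcat_axioms.intro site_axioms.intro target_axioms.intro)
    show "category C" using assms(2) by (simp add: small_category_def)
    show "category D" using assms(5) by (simp add: geometric_def mcategory_def)
  qed (use assms in \<open>simp_all add: geometric_def\<close>)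
  show ?thesis by (rule equivalence)
qed

end
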